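(* Let $\mathbf{D},\mathbf{C}\in\mathbb{R}^{d\times d}$ satisfy Conditions (A)-(C), and consider the Fokker-Planck equation $\partial_t f=\operatorname{div}(\mathbf{D}\nabla f+\mathbf{C}xf)$, $t>0$, $x\in\mathbb{R}^d$. Let $\mu:=\min\{\operatorname{Re}(\lambda)\mid \lambda \text{ is an eigenvalue of }\mathbf{C}\}$ and assume that one or more of the eigenvalues of $\mathbf{C}$ with real part $\mu$ are defective. Denote by $n>0$ the maximal defect of these eigenvalues. Then for every $1<p\le 2$ there is a constant $c_p>0$, not depending on $f_0$, such that for every $f_0\in L^1_+(\mathbb{R}^d)$ of unit mass with $e_p(f_0|f_\infty)<\infty$, the solution $f(t)$ of the equation with initial datum $f_0$ satisfies, for all $t\ge 0$, $$e_p(f(t)|f_\infty)\le \begin{cases} c_2\, e_2(f_0|f_\infty)\,(1+t^{2n})e^{-2\mu t}, & p=2,\\ c_p\,\big(p(p-1)e_p(f_0|f_\infty)+1\big)^{\frac2p}(1+t^{2n})e^{-2\mu t}, & 1<p<2,\end{cases}$$ where $f_\infty$ is the unique equilibrium of the equation with unit mass.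
   Context: Conditions: (A) $\mathbf{D}$ is (symmetric) positive semidefinite with $1\le \operatorname{rank}\mathbf{D}\le d$. (B) All eigenvalues of $\mathbf{C}$ have positive real part. (C) There is no non-trivial $\mathbf{C}^T$-invariant subspace of $\operatorname{Ker}\mathbf{D}$. $L^1_+(\mathbb{R}^d)$ is the set of non-negative functions in $L^1(\mathbb{R}^d)$. Under (A)-(C), for every $f_0\in L^1_+(\mathbb{R}^d)$ the equation has a unique classical solution $f\in C^\infty((0,\infty)\times\mathbb{R}^d)$ with initial datum $f_0$; it is non-negative and conserves mass. There is a unique stationary state of unit mass, $f_\infty(x)=c_{\mathbf{K}}e^{-\frac12x^T\mathbf{K}^{-1}x}$, where $\mathbf{K}$ is the unique symmetric positive definite solution of $2\mathbf{D}=\mathbf{C}\mathbf{K}+\mathbf{K}\mathbf{C}^T$ and $c_{\mathbf{K}}$ is the normalization constant. The defect of an eigenvalue is its algebraic multiplicity minus its geometric multiplicity; it is defective if its defect is positive. For $1<p\le2$, $\psi_p(y):=\frac{y^p-p(y-1)-1}{p(p-1)}$ and $e_p(f|f_\infty):=\int_{\mathbb{R}^d}\psi_p\big(\tfrac{f(x)}{f_\infty(x)}\big)f_\infty(x)\,dx$. The constants $c_p$ are "geometric": they depend only on the equation (i.e. $d,\mathbf{D},\mathbf{C}$) and $p$. *)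

theory Defs
  imports "HOL-Analysis.Analysis" "HOL-Computational_Algebra.Polynomial"
begin

section \<open>Spectral notions for a real square matrix\<close>

text \<open>Eigenvalues and their multiplicities are the complex ones: a real matrix is embedded
  entrywise into the complex matrices.\<close>

abbreviation complexify :: "real^'n^'n \<Rightarrow> complex^'n^'n" where
  "complexify A \<equiv> map_matrix complex_of_real A"

definition eigenspace :: "real^'n^'n \<Rightarrow> complex \<Rightarrow> (complex^'n) set" where
  "eigenspace A l = {v. complexify A *v v = l *s v}"

definition eigenvalues :: "real^'n^'n \<Rightarrow> complex set" where
  "eigenvalues A = {l. \<exists>v. v \<noteq> 0 \<and> v \<in> eigenspace A l}"

definition char_polynomial :: "real^'n^'n \<Rightarrow> complex poly" where
  "char_polynomial A = det (\<chi> i j. (if i = j then [:0, 1:] else 0) - [:complexify A $ i $ j:])"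

definition alg_multiplicity :: "real^'n^'n \<Rightarrow> complex \<Rightarrow> nat" where
  "alg_multiplicity A l = order l (char_polynomial A)"

definition geom_multiplicity :: "real^'n^'n \<Rightarrow> complex \<Rightarrow> nat" where
  "geom_multiplicity A l = vec.dim (eigenspace A l)"

text \<open>The subtraction does not truncate, as the geometric multiplicity is at most the
  algebraic one.\<close>

definition defect :: "real^'n^'n \<Rightarrow> complex \<Rightarrow> nat" where
  "defect A l = alg_multiplicity A l - geom_multiplicity A l"

definition defective :: "real^'n^'n \<Rightarrow> complex \<Rightarrow> bool" where
  "defective A l \<longleftrightarrow> defect A l > 0"

section \<open>Conditions on the coefficient matrices\<close>

definition condition_A :: "real^'d^'d \<Rightarrow> bool" where
  "condition_A D \<longleftrightarrow>
     transpose D = D \<and> (\<forall>x. 0 \<le> x \<bullet> (D *v x)) \<and> 1 \<le> rank D \<and> rank D \<le> CARD('d)"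

definition condition_B :: "real^'d^'d \<Rightarrow> bool" where
  "condition_B C \<longleftrightarrow> (\<forall>l\<in>eigenvalues C. 0 < Re l)"

definition condition_C :: "real^'d^'d \<Rightarrow> real^'d^'d \<Rightarrow> bool" where
  "condition_C D C \<longleftrightarrow>
     (\<forall>V. subspace V \<and> V \<subseteq> {x. D *v x = 0} \<and> (\<forall>x\<in>V. transpose C *v x \<in> V) \<longrightarrow> V = {0})"

section \<open>Differential operators and smoothness\<close>

definition partial_deriv :: "'d \<Rightarrow> (real^'d \<Rightarrow> real) \<Rightarrow> real^'d \<Rightarrow> real" where
  "partial_deriv i g x = deriv (\<lambda>h. g (x + h *\<^sub>R axis i 1)) 0"

definition grad :: "(real^'d \<Rightarrow> real) \<Rightarrow> real^'d \<Rightarrow> real^'d" where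
  "grad g x = (\<chi> i. partial_deriv i g x)"

definition divergence :: "(real^'d \<Rightarrow> real^'d) \<Rightarrow> real^'d \<Rightarrow> real" where
  "divergence F x = (\<Sum>i\<in>UNIV. partial_deriv i (\<lambda>y. F y $ i) x)"

text \<open>For open \<open>S\<close>, \<open>Ck_on k f S\<close> says that \<open>f\<close> is of class \<open>C\<^sup>k\<close> on \<open>S\<close>.\<close>

primrec Ck_on :: "nat \<Rightarrow> ('a::real_normed_vector \<Rightarrow> 'b::real_normed_vector) \<Rightarrow> 'a set \<Rightarrow> bool" where
  "Ck_on 0 f S \<longleftrightarrow> continuous_on S f"
| "Ck_on (Suc k) f S \<longleftrightarrow> (\<forall>x\<in>S. f differentiable (at x)) \<and>
     (\<forall>v. Ck_on k (\<lambda>x. frechet_derivative f (at x) v) S)"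

definition smooth_on :: "('a::real_normed_vector \<Rightarrow> 'b::real_normed_vector) \<Rightarrow> 'a set \<Rightarrow> bool" where
  "smooth_on f S \<longleftrightarrow> (\<forall>k. Ck_on k f S)"

section \<open>The Fokker-Planck equation\<close>

text \<open>Elements of \<open>L\<^sup>1\<close> are represented by Borel functions; statements about them hold up to
  null sets.\<close>

definition L1_plus :: "(real^'d \<Rightarrow> real) set" where
  "L1_plus = {g. integrable lborel g \<and> (AE x in lborel. 0 \<le> g x)}"

definition mass :: "(real^'d \<Rightarrow> real) \<Rightarrow> real" where
  "mass g = (\<integral>x. g x \<partial>lborel)"

text \<open>\<open>f t x\<close> is the value at time \<open>t\<close> and position \<open>x\<close>. A classical solution is smooth for positive
  times, solves the equation pointwise there, and attains its initial datum as a continuous curve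
  in \<open>L\<^sup>1\<close> on \<open>[0,\<infinity>)\<close>. Within this class the solution is unique, which is false for merely
  smooth functions (already for the heat equation).\<close>

definition fp_solution ::
    "real^'d^'d \<Rightarrow> real^'d^'d \<Rightarrow> (real^'d \<Rightarrow> real) \<Rightarrow> (real \<Rightarrow> real^'d \<Rightarrow> real) \<Rightarrow> bool" where
  "fp_solution D C f0 f \<longleftrightarrow>
     smooth_on (\<lambda>(t, x). f t x) ({0<..} \<times> UNIV) \<and>
     (\<forall>t>0. \<forall>x. ((\<lambda>s. f s x) has_real_derivative
        divergence (\<lambda>y. D *v grad (f t) y + f t y *\<^sub>R (C *v y)) x) (at t)) \<and>
     (\<forall>t\<ge>0. integrable lborel (f t)) \<and>
     (\<forall>t\<ge>0. ((\<lambda>s. \<integral>x. \<bar>f s x - f t x\<bar> \<partial>lborel) \<longlongrightarrow> 0) (at t within {0..})) \<and>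
     (AE x in lborel. f 0 x = f0 x)"

definition fp_equilibrium :: "real^'d^'d \<Rightarrow> real^'d^'d \<Rightarrow> (real^'d \<Rightarrow> real) \<Rightarrow> bool" where
  "fp_equilibrium D C g \<longleftrightarrow> fp_solution D C g (\<lambda>t. g)"

section \<open>Relative entropies\<close>

definition psi :: "real \<Rightarrow> real \<Rightarrow> real" where
  "psi p y = (y powr p - p * (y - 1) - 1) / (p * (p - 1))"

text \<open>The value may be infinite. For \<open>1 < p\<close> the integrand is non-negative wherever \<open>0 \<le> f x\<close> and
  \<open>0 < g x\<close>, so that passing to extended non-negative reals loses nothing.\<close>

definition rel_entropy :: "real \<Rightarrow> (real^'d \<Rightarrow> real) \<Rightarrow> (real^'d \<Rightarrow> real) \<Rightarrow> ennreal" where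
  "rel_entropy p f g = (\<integral>\<^sup>+x. ennreal (psi p (f x / g x) * g x) \<partial>lborel)"

end

theory Submission
  imports Defs "HOL-Computational_Algebra.Fundamental_Theorem_Algebra" "HOL-Probability.Probability"
begin

text \<open>A solution \<open>P = S S\<^sup>T\<close> of the Lyapunov equation \<open>C P + P C\<^sup>T = 2 D\<close> is the covariance of the equilibrium.
  Testing the equation against plane waves shows that \<open>u(t, z) = f(t, S z) / f\<^sub>\<infinity>(S z)\<close> evolves by duality
  through the Mehler operators \<open>G \<mapsto> (x \<mapsto> \<integral> G (A x + B y) d\<gamma>(y))\<close> on the standard Gaussian \<open>\<gamma>\<close>, where
  \<open>A = S\<^bsup>-1\<^esup> e\<^bsup>-Ct\<^esup> S\<close> and \<open>A A\<^sup>T + B B\<^sup>T = 1\<close>. Such an operator contracts the mean-zero part of \<open>L\<^sup>2(\<gamma>)\<close> by \<open>\<parallel>A\<parallel>\<close>,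
  and \<open>\<parallel>e\<^bsup>-Ct\<^esup>\<parallel> \<le> c (1 + t\<^sup>n) e\<^bsup>-\<mu>t\<^esup>\<close>, because the nilpotent part at an eigenvalue has index at most its defect plus one;
  this settles \<open>p = 2\<close>. For \<open>p < 2\<close> the dual operator maps \<open>L\<^sup>2\<close> to \<open>L\<^sup>q\<close> once \<open>\<parallel>A\<parallel>\<close> is small, by Cameron--Martin shifts and
  the resulting Harnack inequality. After a fixed time \<open>u\<close> therefore lies in \<open>L\<^sup>2\<close>, and the case \<open>p = 2\<close> takes over.\<close>

section \<open>Generalized eigenvectors and the defect\<close>

text \<open>A solution is only a continuous curve in L^1 up to time 0, and D may be degenerate. So
  there is neither an entropy production to differentiate nor a coercive form to compare it with;
  norms are instead recovered by duality from bounded Lipschitz test functions. The contraction by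
  the norm of A is valid also when the available bound for that norm exceeds 1. Its square turns c
  (1 + t^n) e^(-\<mu> t) into the factor (1 + t^(2n)) e^(-2\<mu> t). For a nonnegative u of unit
  mass, p(p-1) e_p + 1 is exactly the integral of u^p. Smoothing bounds the squared L^2 norm of u at
  a fixed time by a multiple of that moment to the power 2/p, which is the origin of the exponent.
  The fixed time depends only on the flow and on p; before it the p-th moment does not increase,
  which suffices because the moment is at least 1.\<close>

lemma poly_det:
  fixes M :: "'a::comm_ring_1 poly^'n^'n"
  shows "poly (det M) x = det (\<chi> i j. poly (M $ i $ j) x)"
  by (simp add: det_def poly_sum poly_prod)

text \<open>For a flag vector \<open>b = bs ! m\<close> the row \<open>x *s b - A *v b\<close> is
  \<open>(x - l) *s b\<close> minus a combination of earlier flag vectors. Those already stand as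
  rows up to the nonzero factor \<open>x - l\<close>, so a row operation removes the combination;
  the induction cleans the rows one at a time.\<close>

lemma det_triangular_rows:
  fixes A :: "complex^'n^'n" and f :: "'n \<Rightarrow> complex^'n"
  assumes f: "inj f" and bs: "distinct bs" "set bs \<subseteq> range f"
    and tri: "\<And>i. i < length bs \<Longrightarrow> A *v (bs ! i) - l *s (bs ! i) \<in> vec.span (set (take i bs))"
    and x: "x \<noteq> l" and m: "m \<le> length bs"
  shows "det (\<chi> i. if f i \<in> set (take m bs) then (x - l) *s f i else x *s f i - A *v f i)
       = det (\<chi> i. x *s f i - A *v f i)"
  using m
proof (induction m)
  case 0
  then show ?case by simp
next
  case (Suc m)
  let ?R = "\<lambda>m. \<chi> i. if f i \<in> set (take m bs) then (x - l) *s f i else x *s f i - A *v f i"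
  have m: "m < length bs" using Suc by simp
  obtain i0 where i0: "f i0 = bs ! m" using m bs(2) by (metis nth_mem rangeE subsetD)
  have nin: "bs ! m \<notin> set (take m bs)"
    using bs(1) m by (metis distinct_take id_take_nth_drop not_distinct_conv_prefix take_Suc_conv_app_nth)
  define N where "N = A *v (bs ! m) - l *s (bs ! m)"
  have "set (take m bs) \<subseteq> vec.span {row j (?R m) |j. j \<noteq> i0}"
  proof
    fix b assume b: "b \<in> set (take m bs)"
    then obtain j where j: "f j = b" using bs(2) by (metis in_set_takeD rangeE subsetD)
    have jn: "j \<noteq> i0" using j b i0 nin by auto
    have rj: "row j (?R m) = (x - l) *s b" using b unfolding row_def j[symmetric] by (simp add: vec_eq_iff)
    have "(x - l) *s b \<in> vec.span {row j (?R m) |j. j \<noteq> i0}"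
      by (intro vec.span_base CollectI exI[of _ j] conjI, rule rj[symmetric], rule jn)
    from vec.span_scale[OF this, of "1 / (x - l)"]
    show "b \<in> vec.span {row j (?R m) |j. j \<noteq> i0}"
      using x by (simp only: vec.scale_scale) (simp only: times_divide_eq_left mult_1_left divide_self right_minus_eq not_False_eq_True vec.scale_one)
  qed
  then have "N \<in> vec.span {row j (?R m) |j. j \<noteq> i0}"
    using tri[OF m] unfolding N_def by (meson subsetD vec.span_minimal vec.subspace_span)
  from det_row_span[OF this]
  have "det (\<chi> k. if k = i0 then row i0 (?R m) + N else row k (?R m)) = det (?R m)" .
  moreover have "(\<chi> k. if k = i0 then row i0 (?R m) + N else row k (?R m)) = ?R (Suc m)"
  proof -
    have "(if k = i0 then row i0 (?R m) + N else row k (?R m)) = ?R (Suc m) $ k" for k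
    proof (cases "k = i0")
      case True
      have "f i0 \<notin> set (take m bs)" "f i0 \<in> set (take (Suc m) bs)"
        using i0 nin m by (auto simp: take_Suc_conv_app_nth)
      then show ?thesis unfolding True N_def i0[symmetric]
        by (simp add: row_def vec_eq_iff algebra_simps)
    next
      case False
      then have "f k \<noteq> bs ! m" using f i0 by (metis injD)
      then have "f k \<in> set (take (Suc m) bs) \<longleftrightarrow> f k \<in> set (take m bs)"
        using m by (auto simp: take_Suc_conv_app_nth)
      then show ?thesis using False by (simp add: row_def vec_eq_iff)
    qed
    then show ?thesis by (simp add: vec_eq_iff)
  qed
  ultimately show ?case using Suc m by simp
qed

text \<open>In a basis that extends the flag, every flag vector contributes a row divisible by
  \<open>x - l\<close>. Pulling these factors out of the determinant leaves a quotient that is again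
  a polynomial, \<open>det Q\<close>.\<close>

lemma char_poly_dvd_of_triangular:
  fixes A :: "complex^'n^'n"
  assumes bs: "distinct bs" "vec.independent (set bs)"
    and tri: "\<And>i. i < length bs \<Longrightarrow> A *v (bs ! i) - l *s (bs ! i) \<in> vec.span (set (take i bs))"
  shows "[:-l, 1:] ^ length bs dvd det (\<chi> i j. (if i = j then [:0, 1:] else 0) - [:A $ i $ j:])"
    (is "_ dvd ?p")
proof -
  let ?B = "vec.extend_basis (set bs)"
  have ind: "vec.independent ?B" and sp: "vec.span ?B = UNIV" and sub: "set bs \<subseteq> ?B"
    using vec.independent_extend_basis[OF bs(2)] vec.span_extend_basis[OF bs(2)]
      vec.extend_basis_superset[OF bs(2)] by auto
  have finB: "finite ?B" using ind vec.finiteI_independent by blast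
  have "card ?B = CARD('n)"
    using vec.dim_eq_card[of ?B UNIV] ind sp by (simp add: vec.dim_UNIV card_cart_basis)
  then obtain f where f: "bij_betw f (UNIV :: 'n set) ?B"
    using finB by (metis finite_class.finite_UNIV finite_same_card_bij)
  have injf: "inj f" and ranf: "range f = ?B" using f by (auto simp: bij_betw_def)
  define P :: "complex^'n^'n" where "P = (\<chi> i. f i)"
  have "det P \<noteq> 0"
  proof
    assume "det P = 0"
    then have "\<not> invertible (transpose P)" using invertible_det_nz[of "transpose P"] by simp
    then obtain v where v: "v \<noteq> 0" "transpose P *v v = 0"
      using matrix_left_invertible_ker[of "transpose P"] invertible_left_inverse[of "transpose P"] by blast
    have "(\<Sum>i\<in>UNIV. v $ i *s f i) = 0"
      using v(2) by (simp add: vec_eq_iff vector_matrix_mult_def P_def mult.commute)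
    then have "(\<Sum>b\<in>?B. v $ (inv f b) *s b) = 0"
      using sum.reindex_bij_betw[OF f, of "\<lambda>b. v $ (inv f b) *s b"] injf by simp
    then have "\<forall>b\<in>?B. v $ (inv f b) = 0"
      using vec.independent_explicit[of ?B, THEN iffD1, OF ind, THEN conjunct2, rule_format, of "\<lambda>b. v $ inv f b"]
      by blast
    then have "\<forall>i. v $ i = 0" using injf ranf by (metis inv_f_f rangeI)
    then show False using v(1) by (simp add: vec_eq_iff)
  qed
  \<comment> \<open>The rows left after \<open>x - l\<close> is taken out of the flag rows: constant
    on the flag, still linear in x elsewhere.\<close>
  define Q :: "complex poly^'n^'n" where
    "Q = (\<chi> i j. if f i \<in> set bs then [:f i $ j:] else [:- (A *v f i) $ j, f i $ j:])"
  have polyp: "poly ?p x = det (\<chi> i j. (if i = j then x else 0) - A $ i $ j)" for x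
    by (simp add: poly_det if_distrib[of "\<lambda>q. poly q x"] if_distrib[of "\<lambda>a. a - b" for b] cong: if_cong)
  have key: "poly ?p x * det P = (x - l) ^ length bs * poly (det Q) x" if x: "x \<noteq> l" for x
  proof -
    let ?X = "\<chi> i j. (if i = j then x else 0) - A $ i $ j"
    have PX: "P ** transpose ?X = (\<chi> i. x *s f i - A *v f i)"
      by (simp add: vec_eq_iff matrix_matrix_mult_def P_def transpose_def matrix_vector_mult_def
          algebra_simps sum_subtractf if_distrib[of "\<lambda>a. a * b" for b] if_distrib[of "\<lambda>a. b * a" for b] sum.delta' cong: if_cong)
    have "det P * det ?X = det (P ** transpose ?X)" by (simp only: det_mul det_transpose)
    also have "\<dots> = det (\<chi> i. x *s f i - A *v f i)" by (simp only: PX)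
    also have "\<dots> = det (\<chi> i. if f i \<in> set (take (length bs) bs) then (x - l) *s f i else x *s f i - A *v f i)"
      using det_triangular_rows[OF injf bs(1) _ tri x order.refl] sub ranf by simp
    also have "\<dots> = det (\<chi> i. (if f i \<in> set bs then x - l else 1) *s
         (\<chi> j. poly (Q $ i $ j) x))"
      by (rule arg_cong[where f=det]) (simp add: Q_def vec_eq_iff algebra_simps)
    also have "\<dots> = (\<Prod>i\<in>UNIV. if f i \<in> set bs then x - l else 1) * poly (det Q) x"
      by (simp only: det_rows_mul poly_det)
    also have "(\<Prod>i\<in>UNIV. if f i \<in> set bs then x - l else 1) = (\<Prod>b\<in>?B. if b \<in> set bs then x - l else 1)"
      by (rule prod.reindex_bij_betw[OF f])
    also have "\<dots> = (x - l) ^ length bs"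
      using finB sub distinct_card[OF bs(1)] by (simp add: prod.If_cases Int_absorb1 inf_absorb2)
    finally show ?thesis by (simp add: polyp mult.commute)
  qed
  \<comment> \<open>The identity \<open>key\<close> is known only for x different from l. One extra
    factor \<open>x - l\<close> makes both sides vanish at l as well, so the polynomials agree, and
    it is cancelled afterwards.\<close>
  have "poly ([:-l, 1:] * (smult (det P) ?p)) = poly ([:-l, 1:] * ([:-l, 1:] ^ length bs * det Q))"
  proof
    fix x show "poly ([:-l, 1:] * (smult (det P) ?p)) x = poly ([:-l, 1:] * ([:-l, 1:] ^ length bs * det Q)) x"
      using key[of x] by (cases "x = l") (simp_all add: poly_power algebra_simps)
  qed
  then have "[:-l, 1:] * (smult (det P) ?p) = [:-l, 1:] * ([:-l, 1:] ^ length bs * det Q)"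
    by (simp only: poly_eq_poly_eq_iff)
  then have "smult (det P) ?p = [:-l, 1:] ^ length bs * det Q" by (simp only: mult_cancel_left pCons_eq_0_iff one_neq_zero simp_thms)
  then have "[:-l, 1:] ^ length bs dvd smult (det P) ?p" by (simp only: dvd_triv_left)
  then show ?thesis using \<open>det P \<noteq> 0\<close> by (rule dvd_smult_cancel)
qed

text \<open>A flag of maximal length exists because independence bounds the length by the dimension.
  If it missed some v in W, the last iterate of v outside its span could be appended, since N maps
  that iterate into the span.\<close>

lemma nilpotent_flag:
  fixes N :: "complex^'n \<Rightarrow> complex^'n"
  assumes nil: "\<And>v. v \<in> W \<Longrightarrow> \<exists>k. (N ^^ k) v = 0" and inv: "\<And>v. v \<in> W \<Longrightarrow> N v \<in> W"
  shows "\<exists>bs. distinct bs \<and> vec.independent (set bs) \<and> set bs \<subseteq> W \<and> W \<subseteq> vec.span (set bs) \<and>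
           (\<forall>i<length bs. N (bs ! i) \<in> vec.span (set (take i bs)))"
proof -
  define P where "P bs \<longleftrightarrow> distinct bs \<and> vec.independent (set bs) \<and> set bs \<subseteq> W \<and>
           (\<forall>i<length bs. N (bs ! i) \<in> vec.span (set (take i bs)))" for bs
  have "P []" by (simp add: P_def vec.independent_empty)
  moreover have "\<forall>bs. P bs \<longrightarrow> length bs < Suc (CARD('n))"
  proof (intro allI impI)
    fix bs assume "P bs"
    then have "distinct bs" "vec.independent (set bs)" by (auto simp: P_def)
    then have "length bs \<le> vec.dim (UNIV :: (complex^'n) set)"
      using vec.independent_card_le_dim[of "set bs" UNIV] by (simp add: distinct_card)
    then show "length bs < Suc (CARD('n))" by (simp add: vec.dim_UNIV card_cart_basis)
  qed
  ultimately obtain bs where bs: "P bs" and mx: "\<And>cs. P cs \<Longrightarrow> length cs \<le> length bs"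
    using ex_has_greatest_nat[of P "[]" length] by blast
  have "W \<subseteq> vec.span (set bs)"
  proof (rule ccontr)
    assume "\<not> W \<subseteq> vec.span (set bs)"
    then obtain v where v: "v \<in> W" "v \<notin> vec.span (set bs)" by blast
    obtain k0 where "(N ^^ k0) v = 0" using nil v by blast
    then have ex: "(N ^^ k0) v \<in> vec.span (set bs)" by (simp add: vec.span_zero)
    define k where "k = (LEAST k. (N ^^ k) v \<in> vec.span (set bs))"
    have k: "(N ^^ k) v \<in> vec.span (set bs)" unfolding k_def using ex by (rule LeastI)
    have "k \<noteq> 0" using k v by (metis funpow_0)
    then obtain j where j: "k = Suc j" by (cases k) auto
    define w where "w = (N ^^ j) v"
    have w: "w \<notin> vec.span (set bs)" using not_less_Least[of j "\<lambda>k. (N ^^ k) v \<in> vec.span (set bs)"] j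
      unfolding w_def k_def by simp
    have Nw: "N w \<in> vec.span (set bs)" using k j by (simp add: w_def)
    have wW: "w \<in> W" unfolding w_def using v(1) inv by (induction j) auto
    have wn: "w \<notin> set bs" using w vec.span_base by blast
    have "P (bs @ [w])" using bs w Nw wW wn
      by (auto simp: P_def nth_append less_Suc_eq vec.independent_insert)
    then show False using mx[of "bs @ [w]"] by simp
  qed
  then show ?thesis using bs unfolding P_def by blast
qed

text \<open>On the kernel of a power of A - l this map is nilpotent, so a flag of full dimension
  makes A triangular there, with l on the diagonal.\<close>

lemma dim_generalized_eigenspace_le_order:
  fixes A :: "complex^'n^'n"
  assumes nz: "det (\<chi> i j. (if i = j then [:0, 1:] else 0) - [:A $ i $ j:]) \<noteq> 0"
  shows "vec.dim {v. ((\<lambda>v. A *v v - l *s v) ^^ k) v = 0}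
     \<le> order l (det (\<chi> i j. (if i = j then [:0, 1:] else 0) - [:A $ i $ j:]))"
proof -
  define N where "N = (\<lambda>v. A *v v - l *s v)"
  let ?p = "det (\<chi> i j. (if i = j then [:0, 1:] else 0) - [:A $ i $ j:])"
  let ?W = "{v. (N ^^ k) v = 0}"
  have 0: "N 0 = 0" by (simp add: N_def)
  have inv: "N v \<in> ?W" if "v \<in> ?W" for v
  proof -
    have "(N ^^ k) (N v) = N ((N ^^ k) v)" by (rule funpow_swap1[symmetric])
    then show ?thesis using that 0 by (simp only: mem_Collect_eq)
  qed
  have nil: "\<exists>k. (N ^^ k) v = 0" if "v \<in> ?W" for v using that by blast
  obtain bs where bs: "distinct bs" "vec.independent (set bs)" "?W \<subseteq> vec.span (set bs)"
      "\<forall>i<length bs. N (bs ! i) \<in> vec.span (set (take i bs))"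
    using nilpotent_flag[of ?W N, OF nil inv] by blast
  have "vec.dim ?W \<le> length bs"
    using vec.dim_le_card[OF bs(3)] bs(1) by (simp only: distinct_card List.finite_set simp_thms)
  also have "[:-l, 1:] ^ length bs dvd ?p"
    using char_poly_dvd_of_triangular[OF bs(1,2)] bs(4) unfolding N_def by blast
  then have "length bs \<le> order l ?p" using nz order_divides by blast
  finally show ?thesis unfolding N_def .
qed

section \<open>Kernels of the powers of a nilpotent map\<close>

lemma linear_funpow:
  fixes N :: "complex^'n \<Rightarrow> complex^'n"
  assumes "Vector_Spaces.linear (*s) (*s) N"
  shows "Vector_Spaces.linear (*s) (*s) (N ^^ k)"
proof (induction k)
  case 0
  then show ?case using vec.linear_id by (simp add: id_def)
next
  case (Suc k)
  from Vector_Spaces.linear_compose[OF Suc assms] show ?case by (simp add: o_def)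
qed

text \<open>If m is the exact order of v, a suitable iterate of v lies in the kernel of N^(j+2) but
  not in that of N^(j+1). The kernels therefore grow strictly, by at least one dimension per step,
  up to exponent m.\<close>

lemma dim_kernel_chain:
  fixes N :: "complex^'n \<Rightarrow> complex^'n"
  assumes N: "Vector_Spaces.linear (*s) (*s) N"
    and m: "(N ^^ m) v = 0" and mless: "\<And>j. j < m \<Longrightarrow> (N ^^ j) v \<noteq> 0"
    and j: "Suc j \<le> m"
  shows "vec.dim {v. N v = 0} + j \<le> vec.dim {v. (N ^^ Suc j) v = 0}"
proof -
  define K where "K j = {v. (N ^^ j) v = 0}" for j
  note lin = linear_funpow[OF N]
  have "vec.subspace (K j)" for j
  proof (rule vec.subspaceI)
    show "0 \<in> K j" unfolding K_def mem_Collect_eq by (rule vec.linear_0[OF lin])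
    show "x + y \<in> K j" if "x \<in> K j" "y \<in> K j" for x y
      using that unfolding K_def mem_Collect_eq vec.linear_add[OF lin] by simp
    show "c *s x \<in> K j" if "x \<in> K j" for c x
      using that unfolding K_def mem_Collect_eq vec.linear_scale[OF lin] by simp
  qed
  then have spK: "vec.span (K j) = K j" for j using vec.span_eq_iff by blast
  have "vec.dim (K 1) + j \<le> vec.dim (K (Suc j))"
    using j
  proof (induction j)
    case 0
    then show ?case by simp
  next
    case (Suc j)
    define a where "a = m - Suc (Suc j)"
    have am: "m = Suc (Suc j) + a" "m - 1 = Suc j + a" using Suc.prems by (auto simp: a_def)
    let ?w = "(N ^^ a) v"
    have e1: "(N ^^ Suc (Suc j)) ?w = (N ^^ m) v" unfolding am(1) funpow_add o_apply ..
    have e2: "(N ^^ Suc j) ?w = (N ^^ (m - 1)) v" unfolding am(2) funpow_add o_apply ..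
    have w1: "?w \<in> K (Suc (Suc j))" unfolding K_def mem_Collect_eq e1 by (rule m)
    have "m - 1 < m" using Suc.prems by simp
    from mless[OF this] have w2: "?w \<notin> K (Suc j)" unfolding K_def mem_Collect_eq e2 .
    have "K (Suc j) \<subseteq> K (Suc (Suc j))"
    proof
      fix x assume "x \<in> K (Suc j)"
      then show "x \<in> K (Suc (Suc j))"
        using vec.linear_0[OF N] unfolding K_def mem_Collect_eq funpow.simps(2)[of "Suc j"] o_apply by simp
    qed
    then have "K (Suc j) \<subset> K (Suc (Suc j))" using w1 w2 by blast
    then have "vec.dim (K (Suc j)) < vec.dim (K (Suc (Suc j)))"
      using vec.dim_psubset[of "K (Suc j)" "K (Suc (Suc j))"] unfolding spK by blast
    moreover have "vec.dim (K 1) + j \<le> vec.dim (K (Suc j))" using Suc by linarith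
    ultimately show ?case by linarith
  qed
  then show ?thesis by (simp add: K_def)
qed

text \<open>With geometric multiplicity g, algebraic multiplicity a and exact order m of v, the
  chain of kernels gives g + (m - 1) \<le> a, so m is at most the defect plus one. This is how the
  defect becomes the exponent of t.\<close>

lemma nilpotency_index_le:
  fixes A :: "complex^'n^'n"
  assumes nz: "det (\<chi> i j. (if i = j then [:0, 1:] else 0) - [:A $ i $ j:]) \<noteq> 0"
    and v: "((\<lambda>v. A *v v - l *s v) ^^ k) v = 0"
  shows "((\<lambda>v. A *v v - l *s v) ^^ Suc (order l (det (\<chi> i j. (if i = j then [:0, 1:] else 0) - [:A $ i $ j:]))
            - vec.dim {v. A *v v = l *s v})) v = 0"
proof -
  define N where "N = (\<lambda>v. A *v v - l *s v)"
  define a where "a = order l (det (\<chi> i j. (if i = j then [:0, 1:] else 0) - [:A $ i $ j:]))"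
  have linN: "Vector_Spaces.linear (*s) (*s) N" 
  proof -
    have "N = (*v) (A - mat l)"
      by (simp add: N_def fun_eq_iff vec_eq_iff matrix_vector_mult_def mat_def algebra_simps sum_subtractf
          if_distrib[of "\<lambda>a. a * b" for b] if_distrib[of "\<lambda>a. b * a" for b] cong: if_cong)
    then show ?thesis using matrix_vector_mul_linear_gen[of "A - mat l"] by simp
  qed
  note lin0 = vec.linear_0[OF linear_funpow[OF linN]]
  have K1: "{v. N v = 0} = {v. A *v v = l *s v}" by (simp add: N_def)
  define g where "g = vec.dim {v. N v = 0}"
  define m where "m = (LEAST k. (N ^^ k) v = 0)"
  have m: "(N ^^ m) v = 0" unfolding m_def using v[folded N_def] by (rule LeastI)
  have mless: "(N ^^ j) v \<noteq> 0" if "j < m" for j using that not_less_Least unfolding m_def by blast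
  have le: "m \<le> Suc (a - g)"
  proof (cases m)
    case (Suc j)
    have "g + j \<le> vec.dim {v. (N ^^ m) v = 0}"
      using dim_kernel_chain[OF linN m mless, of j] Suc unfolding g_def by simp
    also have "\<dots> \<le> a"
      unfolding a_def N_def by (rule dim_generalized_eigenspace_le_order[OF nz])
    finally show ?thesis using Suc by linarith
  qed simp
  then obtain j where j: "Suc (a - g) = j + m"
    using le_iff_add add.commute by metis
  have "(N ^^ Suc (a - g)) v = 0" unfolding j funpow_add o_apply m by (rule lin0)
  then show ?thesis unfolding N_def[symmetric] a_def[symmetric] K1[symmetric] g_def[symmetric] .
qed

section \<open>Decomposition into generalized eigenvectors\<close>

definition mshift :: "complex^'n^'n \<Rightarrow> complex \<Rightarrow> complex^'n \<Rightarrow> complex^'n" where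
  "mshift A l v = A *v v - l *s v"

lemma mshift_add: "mshift A l (v + w) = mshift A l v + mshift A l w"
  by (simp add: mshift_def matrix_vector_right_distrib vec.scale_right_distrib)

lemma mshift_scale: "mshift A l (c *s v) = c *s mshift A l v"
  by (simp add: mshift_def vec.scale vec.scale_right_diff_distrib mult.commute)

lemma mshift_linear: "Vector_Spaces.linear (*s) (*s) (mshift A l)"
proof -
  have "mshift A l = (*v) (A - mat l)"
    by (simp add: mshift_def fun_eq_iff vec_eq_iff matrix_vector_mult_def mat_def algebra_simps sum_subtractf
        if_distrib[of "\<lambda>a. a * b" for b] if_distrib[of "\<lambda>a. b * a" for b] cong: if_cong)
  then show ?thesis using matrix_vector_mul_linear_gen[of "A - mat l"] by simp
qed

lemmas mshift_pow_0 = vec.linear_0[OF linear_funpow[OF mshift_linear]]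
lemmas mshift_pow_add = vec.linear_add[OF linear_funpow[OF mshift_linear]]
lemmas mshift_pow_diff = vec.linear_diff[OF linear_funpow[OF mshift_linear]]
lemmas mshift_pow_scale = vec.linear_scale[OF linear_funpow[OF mshift_linear]]
lemmas mshift_0 = vec.linear_0[OF mshift_linear]
lemmas mshift_diff = vec.linear_diff[OF mshift_linear]

lemma mshift_pow_mono:
  assumes "(mshift A l ^^ k) v = 0" shows "(mshift A l ^^ (j + k)) v = 0"
  unfolding funpow_add o_apply assms by (rule mshift_pow_0)

text \<open>On generalized eigenvectors for m one has A - l = (A - m) + (m - l), a nilpotent map
  plus a nonzero scalar, hence invertible there. Induction on the order replaces the finite Neumann
  series.\<close>

lemma mshift_solve:
  assumes "m \<noteq> l" and "(mshift A m ^^ k) w = 0"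
  shows "\<exists>u. (mshift A m ^^ k) u = 0 \<and> mshift A l u = w"
  using assms(2)
proof (induction k arbitrary: w)
  case 0
  then have "w = 0" by simp
  then show ?case using mshift_0[of A l] by auto
next
  case (Suc k)
  have "(mshift A m ^^ k) (mshift A m w) = 0" using Suc.prems by (simp add: funpow_swap1)
  from Suc.IH[OF this] obtain u where u: "(mshift A m ^^ k) u = 0" "mshift A l u = mshift A m w" by blast
  \<comment> \<open>Solves (A - l) z = w: here (A - l) w = (A - m) w + (m - l) w, and u already
    accounts for the first summand.\<close>
  define z where "z = (1 / (m - l)) *s (w - u)"
  have "(mshift A m ^^ Suc k) u = 0" using mshift_pow_mono[OF u(1), of 1] by simp
  then have 1: "(mshift A m ^^ Suc k) z = 0"
    unfolding z_def mshift_pow_scale mshift_pow_diff Suc.prems by simp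
  have "mshift A l w = mshift A m w + (m - l) *s w"
    by (simp add: mshift_def vec.scale_left_diff_distrib)
  then have e: "mshift A l (w - u) = (m - l) *s w"
    unfolding mshift_diff u(2) by simp
  have "1 / (m - l) * (m - l) = 1" using assms(1) by simp
  then have "mshift A l z = w"
    unfolding z_def mshift_scale e vec.scale_scale by (simp only: vec.scale_one)
  then show ?case using 1 by blast
qed

text \<open>The vector p(A) v.\<close>

definition poly_action :: "complex^'n^'n \<Rightarrow> complex poly \<Rightarrow> complex^'n \<Rightarrow> complex^'n" where
  "poly_action A p v = (\<Sum>i\<le>degree p. coeff p i *s (((*v) A ^^ i) v))"

lemma poly_action_upto:
  assumes "degree p \<le> n" shows "poly_action A p v = (\<Sum>i\<le>n. coeff p i *s (((*v) A ^^ i) v))"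
  unfolding poly_action_def
  by (rule sum.mono_neutral_left) (use assms in \<open>auto simp: coeff_eq_0\<close>)

text \<open>A root l of an annihilating polynomial is traded for one application of
  \<open>mshift A l\<close> to the vector, which lowers the degree.\<close>

lemma poly_action_factor:
  "poly_action A ([:-l, 1:] * q) v = poly_action A q (mshift A l v)"
proof -
  let ?n = "Suc (degree q)"
  have deg: "degree ([:-l, 1:] * q) \<le> ?n" using degree_mult_le[of "[:-l, 1:]" q] by simp
  have lin: "Vector_Spaces.linear (*s) (*s) (((*v) A) ^^ i)" for i
    by (rule linear_funpow) (rule matrix_vector_mul_linear_gen)
  have cf: "coeff ([:-l, 1:] * q) i = (if i = 0 then 0 else coeff q (i - 1)) - l * coeff q i" for i
    by (cases i) (auto simp: coeff_pCons split: nat.splits)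
  have "poly_action A ([:-l, 1:] * q) v
      = (\<Sum>i\<le>?n. ((if i = 0 then 0 else coeff q (i - 1)) - l * coeff q i) *s (((*v) A ^^ i) v))"
    unfolding poly_action_upto[OF deg] cf ..
  also have "\<dots> = (\<Sum>i\<le>?n. (if i = 0 then 0 else coeff q (i - 1)) *s (((*v) A ^^ i) v))
      - (\<Sum>i\<le>?n. (l * coeff q i) *s (((*v) A ^^ i) v))"
    by (simp only: vec.scale_left_diff_distrib sum_subtractf)
  also have "(\<Sum>i\<le>?n. (if i = 0 then 0 else coeff q (i - 1)) *s (((*v) A ^^ i) v))
     = (\<Sum>i\<le>degree q. coeff q i *s (((*v) A ^^ i) (A *v v)))"
    by (subst sum.atMost_Suc_shift) (simp add: funpow_swap1 del: sum.atMost_Suc)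
  also have "(\<Sum>i\<le>?n. (l * coeff q i) *s (((*v) A ^^ i) v))
     = (\<Sum>i\<le>degree q. (l * coeff q i) *s (((*v) A ^^ i) v))"
    by (simp add: coeff_eq_0)
  also have "\<dots> = (\<Sum>i\<le>degree q. coeff q i *s (((*v) A ^^ i) (l *s v)))"
    by (simp add: vec.linear_scale[OF lin] mult.commute)
  finally show ?thesis
    unfolding poly_action_def mshift_def vec.linear_diff[OF lin]
    by (simp add: vec.scale_right_diff_distrib sum_subtractf)
qed

text \<open>One more iterate of v than the dimension forces a linear relation. Independence speaks
  of sets, so coinciding iterates form a separate case, in which a difference of two monomials
  annihilates v.\<close>

lemma exists_annihilating_poly:
  fixes A :: "complex^'n^'n"
  shows "\<exists>p. p \<noteq> 0 \<and> poly_action A p v = 0"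
proof -
  let ?a = "\<lambda>i. ((*v) A ^^ i) v"
  have cs: "coeff (\<Sum>i\<le>d. monom (c i) i) j = (if j \<le> d then c j else 0)" for c :: "nat \<Rightarrow> complex" and d j
    by (simp add: coeff_sum)
  have rep: "poly_action A (\<Sum>i\<le>d. monom (c i) i) v = (\<Sum>i\<le>d. c i *s ?a i)" for c d
  proof -
    have "degree (\<Sum>i\<le>d. monom (c i) i) \<le> d"
      by (rule degree_le) (simp add: cs)
    from poly_action_upto[OF this] show ?thesis by (simp add: cs)
  qed
  have "\<exists>d c. (\<exists>i\<le>d. c i \<noteq> 0) \<and> (\<Sum>i\<le>d. c i *s ?a i) = 0"
  proof (cases "inj_on ?a {..CARD('n)}")
    case True
    let ?S = "?a ` {..CARD('n)}"
    have "card ?S = Suc (CARD('n))" using True by (simp add: card_image)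
    then have "vec.dim ?S < card ?S"
      using vec.dim_subset[of ?S UNIV] by (simp add: vec.dim_UNIV card_cart_basis)
    then have "\<not> vec.independent ?S" using vec.dependent_biggerset_general by blast
    moreover have "finite ?S" by simp
    ultimately obtain c where c: "(\<Sum>v\<in>?S. c v *s v) = 0" "\<exists>v\<in>?S. c v \<noteq> 0"
      unfolding vec.independent_explicit by blast
    have "(\<Sum>i\<le>CARD('n). c (?a i) *s ?a i) = 0"
      using c(1) sum.reindex[OF True, of "\<lambda>v. c v *s v"] by (simp only: o_def)
    moreover obtain i where "i \<le> CARD('n)" "c (?a i) \<noteq> 0" using c(2) by blast
    ultimately show ?thesis by (intro exI[of _ "CARD('n)"] exI[of _ "\<lambda>i. c (?a i)"]) blast
  next
    case False
    then obtain i j where ij: "i \<noteq> j" "?a i = ?a j" "i \<le> CARD('n)" "j \<le> CARD('n)"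
      unfolding inj_on_def by auto
    define c :: "nat \<Rightarrow> complex" where "c k = (if k = i then 1 else 0) - (if k = j then 1 else 0)" for k
    have "(\<Sum>k\<le>CARD('n). c k *s ?a k) = (\<Sum>k\<le>CARD('n). if k = i then ?a k else 0) - (\<Sum>k\<le>CARD('n). if k = j then ?a k else 0)"
      unfolding sum_subtractf[symmetric] by (rule sum.cong) (auto simp: c_def)
    also have "\<dots> = 0" using ij by simp
    finally show ?thesis using ij by (intro exI[of _ "CARD('n)"] exI[of _ c] conjI exI[of _ i]) (auto simp: c_def)
  qed
  then obtain d c where dc: "\<exists>i\<le>d. c i \<noteq> 0" "(\<Sum>i\<le>d. c i *s ?a i) = 0" by blast
  from dc(1) obtain i where "i \<le> d" "c i \<noteq> 0" by blast
  then have "coeff (\<Sum>i\<le>d. monom (c i) i) i \<noteq> 0" by (simp only: cs if_True simp_thms)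
  then have "(\<Sum>i\<le>d. monom (c i) i) \<noteq> 0" by (intro notI) (simp only: coeff_0 simp_thms)
  moreover have "poly_action A (\<Sum>i\<le>d. monom (c i) i) v = 0" unfolding rep by (rule dc(2))
  ultimately show ?thesis by blast
qed

text \<open>Induction on the degree of a polynomial annihilating v. It has a complex root l, and the
  span contains (A - l) v by the induction hypothesis; the claim \<open>pull\<close> lifts this back
  to v.\<close>

lemma span_generalized_eigenvectors:
  fixes A :: "complex^'n^'n"
  shows "v \<in> vec.span {v. \<exists>l k. (mshift A l ^^ k) v = 0}"
proof -
  define G where "G = {v. \<exists>l k. (mshift A l ^^ k) v = 0}"
  have pull: "v \<in> vec.span G" if "mshift A l v \<in> vec.span G" for v l
  proof -
    \<comment> \<open>Modulo A - l applied to the span, only generalized eigenvectors for l itself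
      survive: \<open>mshift_solve\<close> provides preimages for every other eigenvalue.\<close>
    have Q: "\<exists>u\<in>vec.span G. \<exists>k. (mshift A l ^^ k) (w - mshift A l u) = 0" if "w \<in> vec.span G" for w
      using that
    proof (induction rule: vec.span_induct_alt)
      case base
      then show ?case using vec.span_zero[of G] mshift_0[of A l]
        by (intro bexI[of _ 0] exI[of _ 0]) auto
    next
      case (step c x y)
      then obtain u k where u: "u \<in> vec.span G" "(mshift A l ^^ k) (y - mshift A l u) = 0" by blast
      obtain m j where x: "(mshift A m ^^ j) x = 0" using step by (auto simp: G_def)
      show ?case
      proof (cases "m = l")
        case True
        have "c *s x + y - mshift A l u = c *s x + (y - mshift A l u)" by simp
        moreover have "(mshift A l ^^ (k + j)) x = 0" "(mshift A l ^^ (k + j)) (y - mshift A l u) = 0"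
          using mshift_pow_mono[OF x, of k] mshift_pow_mono[OF u(2), of j] True by (simp_all add: add.commute)
        ultimately have "(mshift A l ^^ (k + j)) (c *s x + y - mshift A l u) = 0"
          by (simp only: mshift_pow_add mshift_pow_scale vec.scale_zero_right add_0)
        then show ?thesis using u(1) by blast
      next
        case False
        from mshift_solve[OF False x] obtain z where z: "(mshift A m ^^ j) z = 0" "mshift A l z = x" by blast
        have "z \<in> vec.span G" using z(1) by (intro vec.span_base) (auto simp: G_def)
        then have "c *s z + u \<in> vec.span G" using u(1) by (intro vec.span_add vec.span_scale)
        moreover have e: "c *s x + y - mshift A l (c *s z + u) = y - mshift A l u"
          by (simp add: mshift_add mshift_scale z)
        ultimately show ?thesis 
          by (intro bexI[of _ "c *s z + u"] exI[of _ k]) (simp_all only: e u(2))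
      qed
    qed
    from Q[OF that] obtain u k where u: "u \<in> vec.span G" "(mshift A l ^^ k) (mshift A l v - mshift A l u) = 0" by blast
    then have "(mshift A l ^^ Suc k) (v - u) = 0" by (simp add: mshift_diff funpow_swap1)
    then have "v - u \<in> vec.span G" by (intro vec.span_base) (auto simp: G_def simp del: funpow.simps)
    from vec.span_add[OF this u(1)] show ?thesis by simp
  qed
  have "\<lbrakk>p \<noteq> 0; poly_action A p v = 0\<rbrakk> \<Longrightarrow> v \<in> vec.span G" for p v
  proof (induction "degree p" arbitrary: p v)
    case 0
    then have "coeff p 0 *s v = 0" by (simp add: poly_action_def)
    moreover have "coeff p 0 \<noteq> 0" using 0 leading_coeff_0_iff[of p] by metis
    ultimately have "coeff p 0 *s v = 0" "coeff p 0 \<noteq> 0" by blast+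
    then have "v = 0" using vec.scale_eq_0_iff by blast
    then show ?case by (simp add: vec.span_zero)
  next
    case (Suc n)
    have "\<not> constant (poly p)" using Suc(2) by (simp add: constant_degree)
    then obtain l where "poly p l = 0" using fundamental_theorem_of_algebra by blast
    then obtain q where q: "p = [:-l, 1:] * q" by (metis dvdE poly_eq_0_iff_dvd)
    have q0: "q \<noteq> 0" using Suc.prems q by auto
    have "degree p = degree [:-l, 1:] + degree q" unfolding q using q0 by (intro degree_mult_eq) auto
    then have "n = degree q" using Suc(2) by simp
    moreover have "poly_action A q (mshift A l v) = 0" using Suc.prems(2) unfolding q poly_action_factor .
    ultimately have "mshift A l v \<in> vec.span G" using Suc(1) q0 by blast
    then show ?case by (rule pull)
  qed
  then show ?thesis using exists_annihilating_poly[of A v] unfolding G_def by blast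
qed

section \<open>Decay of the matrix flow\<close>

text \<open>A real number beyond the operator norm is not an eigenvalue, so the polynomial is not
  zero and its roots are finitely many. This gives \<open>Min\<close> and \<open>Max\<close> over
  eigenvalues their meaning.\<close>

lemma char_polynomial_nonzero_finite:
  fixes C :: "real^'n^'n"
  shows "char_polynomial C \<noteq> 0" and "finite (eigenvalues C)"
proof -
  let ?A = "complexify C"
  have ev: "poly (char_polynomial C) x = det (mat x - ?A)" for x
    unfolding char_polynomial_def poly_det
    by (rule arg_cong[where f = det]) (simp add: vec_eq_iff mat_def)
  have mv: "(mat x - ?A) *v v = x *s v - ?A *v v" for x v
    by (simp add: vec_eq_iff matrix_vector_mult_def mat_def algebra_simps sum_subtractf
          if_distrib[of "\<lambda>a. a * b" for b] if_distrib[of "\<lambda>a. b * a" for b] cong: if_cong)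
  have root: "poly (char_polynomial C) x = 0 \<longleftrightarrow> x \<in> eigenvalues C" for x
  proof -
    have "det (mat x - ?A) = 0 \<longleftrightarrow> \<not> invertible (mat x - ?A)" by (simp add: invertible_det_nz)
    also have "\<dots> \<longleftrightarrow> (\<exists>v. (mat x - ?A) *v v = 0 \<and> v \<noteq> 0)"
      unfolding invertible_left_inverse matrix_left_invertible_ker by blast
    also have "\<dots> \<longleftrightarrow> x \<in> eigenvalues C"
      unfolding mv eigenvalues_def eigenspace_def mem_Collect_eq right_minus_eq by metis
    finally show ?thesis unfolding ev .
  qed
  have "linear ((*v) ?A)"
    by (rule linearI)
      (auto simp: vec_eq_iff matrix_vector_mult_def algebra_simps sum.distrib scaleR_sum_right)
  then obtain B where B: "\<And>v. norm (?A *v v) \<le> B * norm v"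
    using linear_bounded by blast
  define x where "x = \<bar>B\<bar> + 1"
  have "complex_of_real x \<notin> eigenvalues C"
  proof
    assume "complex_of_real x \<in> eigenvalues C"
    then obtain v where v: "v \<noteq> 0" "?A *v v = complex_of_real x *s v"
      unfolding eigenvalues_def eigenspace_def by auto
    have "complex_of_real x *s v = x *\<^sub>R v" 
      unfolding vec_eq_iff vector_smult_component vector_scaleR_component by (simp add: scaleR_conv_of_real)
    then have "\<bar>x\<bar> * norm v \<le> B * norm v" using B[of v] v(2) by simp
    then have "\<bar>x\<bar> \<le> B" using v(1) by simp
    then show False unfolding x_def by linarith
  qed
  then show nz: "char_polynomial C \<noteq> 0" using root by (metis poly_0)
  have "eigenvalues C = {x. poly (char_polynomial C) x = 0}" using root by blast
  then show "finite (eigenvalues C)" using poly_roots_finite[OF nz] by simp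
qed

text \<open>Write t^j = (j/\<delta>)^j (\<delta> t/j)^j and use (1 + s/j)^j \<le> e^s with s =
  \<delta> t; this produces the constant.\<close>

lemma power_le_exp:
  fixes \<delta> :: real
  assumes "\<delta> > 0" shows "\<exists>K\<ge>0. \<forall>t\<ge>0. t ^ j \<le> K * exp (\<delta> * t)"
proof (cases "j = 0")
  case True
  then show ?thesis using assms by (intro exI[of _ 1]) simp
next
  case False
  show ?thesis
  proof (intro exI[of _ "(real j / \<delta>) ^ j"] conjI allI impI)
    fix t :: real assume t: "t \<ge> 0"
    have "(\<delta> * t / j) ^ j \<le> (1 + \<delta> * t / j) ^ j" using assms t by (intro power_mono) auto
    also have "\<dots> \<le> exp (\<delta> * t)"
    proof (rule exp_ge_one_plus_x_over_n_power_n)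
      have "0 \<le> \<delta> * t" using assms t by simp
      then show "- real j \<le> \<delta> * t" by linarith
    qed (use False in simp)
    finally have "(real j / \<delta>) ^ j * (\<delta> * t / j) ^ j \<le> (real j / \<delta>) ^ j * exp (\<delta> * t)"
      using assms by (intro mult_left_mono) auto
    then show "t ^ j \<le> (real j / \<delta>) ^ j * exp (\<delta> * t)"
      using assms False by (simp add: power_mult_distrib[symmetric])
  qed (use assms in auto)
qed

text \<open>Stands for decay of e^(-At) v without a matrix exponential. Since K may depend on v,
  these vectors form a subspace, and the estimate has to be checked only on generalized
  eigenvectors.\<close>

definition has_decaying_orbit :: "complex^'n^'n \<Rightarrow> real \<Rightarrow> nat \<Rightarrow> complex^'n \<Rightarrow> bool" where
  "has_decaying_orbit A \<mu> n v \<longleftrightarrow> (\<exists>u K. u 0 = v \<and>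
     (\<forall>t::real. (u has_vector_derivative - (A *v u t)) (at t)) \<and>
     (\<forall>t\<ge>0. norm (u t) \<le> K * ((1 + t ^ n) * exp (- \<mu> * t))))"

lemma bounded_linear_smult_left: "bounded_linear (\<lambda>c::complex. c *s (w::complex^'n))"
  by (simp add: linear_conv_bounded_linear[symmetric])
    (rule linearI; simp add: vec_eq_iff algebra_simps)

lemma bounded_linear_smult_right: "bounded_linear (\<lambda>w::complex^'n. c *s w)"
  by (simp add: linear_conv_bounded_linear[symmetric])
    (rule linearI; simp add: vec_eq_iff algebra_simps)

lemma has_decaying_orbit_add:
  assumes "has_decaying_orbit A \<mu> n v" "has_decaying_orbit A \<mu> n w"
  shows "has_decaying_orbit A \<mu> n (v + w)"
proof -
  from assms obtain u K u' K' where u: "u 0 = v" "\<And>t. (u has_vector_derivative - (A *v u t)) (at t)"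
      "\<And>t. t \<ge> 0 \<Longrightarrow> norm (u t) \<le> K * ((1 + t ^ n) * exp (- \<mu> * t))"
    and u': "u' 0 = w" "\<And>t. (u' has_vector_derivative - (A *v u' t)) (at t)"
      "\<And>t. t \<ge> 0 \<Longrightarrow> norm (u' t) \<le> K' * ((1 + t ^ n) * exp (- \<mu> * t))"
    unfolding has_decaying_orbit_def by blast
  show ?thesis unfolding has_decaying_orbit_def
  proof (intro exI[of _ "\<lambda>t. u t + u' t"] exI[of _ "K + K'"] conjI allI impI)
    show "((\<lambda>t. u t + u' t) has_vector_derivative - (A *v (u t + u' t))) (at t)" for t
      using has_vector_derivative_add[OF u(2) u'(2), of t] by (simp add: matrix_vector_right_distrib)
    show "norm (u t + u' t) \<le> (K + K') * ((1 + t ^ n) * exp (- \<mu> * t))" if "t \<ge> 0" for t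
      using norm_triangle_mono[OF u(3)[OF that] u'(3)[OF that]] by (simp only: distrib_right[of K K'])
  qed (simp add: u(1) u'(1))
qed

lemma has_decaying_orbit_scale:
  fixes A :: "complex^'n^'n"
  assumes "has_decaying_orbit A \<mu> n v"
  shows "has_decaying_orbit A \<mu> n (c *s v)"
proof -
  from assms obtain u K where u: "u 0 = v" "\<And>t. (u has_vector_derivative - (A *v u t)) (at t)"
      "\<And>t. t \<ge> 0 \<Longrightarrow> norm (u t) \<le> K * ((1 + t ^ n) * exp (- \<mu> * t))"
    unfolding has_decaying_orbit_def by blast
  obtain M where M: "M \<ge> 0" "\<And>w::complex^'n. norm (c *s w) \<le> norm w * M"
    using bounded_linear.nonneg_bounded[OF bounded_linear_smult_right] by blast
  show ?thesis unfolding has_decaying_orbit_def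
  proof (intro exI[of _ "\<lambda>t. c *s u t"] exI[of _ "M * K"] conjI allI impI)
    show "((\<lambda>t. c *s u t) has_vector_derivative - (A *v (c *s u t))) (at t)" for t
      using bounded_linear.has_vector_derivative[OF bounded_linear_smult_right u(2), of c t]
      by (simp add: vec.scale vec_eq_iff)
    show "norm (c *s u t) \<le> (M * K) * ((1 + t ^ n) * exp (- \<mu> * t))" if "t \<ge> 0" for t
      using mult_right_mono[OF u(3)[OF that] M(1)] M(2)[of "u t"] by (simp add: mult_ac)
  qed (simp add: u(1))
qed

lemma has_decaying_orbit_0: "has_decaying_orbit A \<mu> n 0"
  unfolding has_decaying_orbit_def by (intro exI[of _ "\<lambda>t. 0"] exI[of _ 0]) simp

text \<open>On a generalized eigenvector the orbit is the finite exponential series of the nilpotent part.\<close>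

lemma has_decaying_orbit_generalized_eigenvector:
  fixes A :: "complex^'n^'n"
  assumes v: "(mshift A l ^^ k) v = 0"
    and rate: "\<mu> < Re l \<or> (\<mu> = Re l \<and> k \<le> Suc n)"
  shows "has_decaying_orbit A \<mu> n v"
proof -
  \<comment> \<open>\<open>\<phi> j t\<close> multiplies N^j in the series of e^(-(l + N) t), where
    N = A - l.\<close>
  define \<phi> where "\<phi> j t = exp (- l * complex_of_real t) * (- complex_of_real t) ^ j / fact j" for j and t :: real
  have d\<phi>0: "(\<phi> 0 has_vector_derivative - l * \<phi> 0 t) (at t)" for t
    unfolding \<phi>_def has_real_derivative_iff_has_vector_derivative[symmetric]
    by (auto intro!: derivative_eq_intros has_vector_derivative_real_field simp: algebra_simps)
  have d\<phi>: "(\<phi> (Suc j) has_vector_derivative - l * \<phi> (Suc j) t - \<phi> j t) (at t)" for j t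
  proof -
    have "((\<lambda>z. exp (- l * z) * (- z) ^ Suc j / fact (Suc j)) has_field_derivative
        - l * (exp (- l * z) * (- z) ^ Suc j / fact (Suc j)) - exp (- l * z) * (- z) ^ j / fact j) (at z)" for z
    proof -
      have "((\<lambda>z. (- z) ^ Suc j) has_field_derivative of_nat (Suc j) * (- 1 * (- z) ^ j)) (at z)"
        by (rule derivative_eq_intros refl)+ simp
      from DERIV_cdivide[OF this, of "fact (Suc j)"]
      have "((\<lambda>z. (- z) ^ Suc j / fact (Suc j)) has_field_derivative - ((- z) ^ j / fact j)) (at z)"
        by (simp add: fact_Suc del: of_nat_Suc power_Suc)
      moreover have "((\<lambda>z. exp (- l * z)) has_field_derivative - l * exp (- l * z)) (at z)"
        by (rule derivative_eq_intros refl)+ simp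
      ultimately have "((\<lambda>z. exp (- l * z) * ((- z) ^ Suc j / fact (Suc j))) has_field_derivative
          (- l * exp (- l * z)) * ((- z) ^ Suc j / fact (Suc j)) + (- ((- z) ^ j / fact j)) * exp (- l * z)) (at z)"
        by (rule DERIV_mult[rotated])
      then show ?thesis by (simp add: mult_ac del: power_Suc fact_Suc)
    qed
    from has_vector_derivative_real_field[OF this] show ?thesis
      unfolding \<phi>_def .
  qed
  define u where "u t = (\<Sum>j<k. \<phi> j t *s ((mshift A l ^^ j) v))" for t
  have lin: "bounded_linear (\<lambda>c::complex. c *s (w::complex^'n))" for w by (rule bounded_linear_smult_left)
  \<comment> \<open>The index shifted by one, with value 0 at j = 0, so that one derivative formula
    covers all j.\<close>
  define \<psi> where "\<psi> j t = (case j of 0 \<Rightarrow> 0 | Suc i \<Rightarrow> \<phi> i t)" for j t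
  have "(\<phi> j has_vector_derivative - l * \<phi> j t - \<psi> j t) (at t)" for j t
    using d\<phi>0 d\<phi> by (cases j) (simp_all add: \<psi>_def)
  then have "((\<lambda>t. \<phi> j t *s ((mshift A l ^^ j) v)) has_vector_derivative
      (- l * \<phi> j t - \<psi> j t) *s ((mshift A l ^^ j) v)) (at t)" for j t
    using bounded_linear.has_vector_derivative[OF lin] by blast
  then have du: "(u has_vector_derivative (\<Sum>j<k. (- l * \<phi> j t - \<psi> j t) *s ((mshift A l ^^ j) v))) (at t)" for t
    unfolding u_def by (intro has_vector_derivative_sum)
  have shift: "(\<Sum>j<k. \<psi> j t *s ((mshift A l ^^ j) v)) = mshift A l (u t)" for t
  proof (cases k)
    case 0
    then show ?thesis by (simp add: u_def mshift_0)
  next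
    case (Suc i)
    have "(\<Sum>j<k. \<psi> j t *s ((mshift A l ^^ j) v)) = (\<Sum>j<i. \<phi> j t *s ((mshift A l ^^ Suc j) v))"
      unfolding Suc sum.lessThan_Suc_shift by (simp add: \<psi>_def)
    moreover have "mshift A l (u t) = (\<Sum>j<k. \<phi> j t *s ((mshift A l ^^ Suc j) v))"
      unfolding u_def by (simp add: vec.linear_sum[OF mshift_linear] mshift_scale)
    moreover have "(\<Sum>j<k. \<phi> j t *s ((mshift A l ^^ Suc j) v)) = (\<Sum>j<i. \<phi> j t *s ((mshift A l ^^ Suc j) v))"
      using v unfolding Suc by simp
    ultimately show ?thesis by simp
  qed
  have der: "(u has_vector_derivative - (A *v u t)) (at t)" for t
  proof -
    have "(\<Sum>j<k. (- l * \<phi> j t - \<psi> j t) *s ((mshift A l ^^ j) v))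
       = - (l *s u t) - (\<Sum>j<k. \<psi> j t *s ((mshift A l ^^ j) v))"
      by (simp add: u_def vec.scale_left_diff_distrib sum_subtractf vec.scale_sum_right sum_negf)
    also have "\<dots> = - (A *v u t)" unfolding shift by (simp add: mshift_def)
    finally show ?thesis using du[of t] by simp
  qed
  have ex: "\<exists>K. \<forall>t\<ge>0. norm (\<phi> j t) \<le> K * ((1 + t ^ n) * exp (- \<mu> * t))" if "j < k" for j
  proof -
    have nphi: "norm (\<phi> j t) \<le> exp (- Re l * t) * t ^ j" if "t \<ge> 0" for t
    proof -
      have "norm (\<phi> j t) = exp (- Re l * t) * t ^ j / fact j"
        using that by (simp add: \<phi>_def norm_mult norm_divide norm_power)
      also have "\<dots> \<le> exp (- Re l * t) * t ^ j" 
        using that mult_left_mono[OF fact_ge_1[of j], of "t ^ j"] by (simp add: divide_le_eq)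
      finally show ?thesis .
    qed
    show ?thesis
    \<comment> \<open>A strictly larger real part leaves an exponential margin that absorbs every
      power of t. Without margin only powers j \<le> n occur.\<close>
    proof (cases "\<mu> < Re l")
      case True
      then obtain K where K: "K \<ge> 0" "\<And>t. t \<ge> 0 \<Longrightarrow> t ^ j \<le> K * exp ((Re l - \<mu>) * t)"
        using power_le_exp[of "Re l - \<mu>" j] by auto
      show ?thesis
      proof (intro exI[of _ K] allI impI)
        fix t :: real assume t: "t \<ge> 0"
        have "norm (\<phi> j t) \<le> exp (- Re l * t) * (K * exp ((Re l - \<mu>) * t))"
          by (rule order_trans[OF nphi[OF t] mult_left_mono[OF K(2)[OF t]]]) simp
        also have "\<dots> = K * exp (- \<mu> * t)" by (simp add: exp_add[symmetric] algebra_simps)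
        also have "\<dots> \<le> K * ((1 + t ^ n) * exp (- \<mu> * t))"
          using K(1) t by (intro mult_left_mono) (auto simp: mult_le_cancel_right1)
        finally show "norm (\<phi> j t) \<le> K * ((1 + t ^ n) * exp (- \<mu> * t))" .
      qed
    next
      case False
      then have m: "\<mu> = Re l" "j \<le> n" using rate \<open>j < k\<close> by auto
      show ?thesis
      proof (intro exI[of _ 1] allI impI)
        fix t :: real assume t: "t \<ge> 0"
        have "t ^ j \<le> 1 + t ^ n"
        proof (cases "t \<le> 1")
          case True
          then have "t ^ j \<le> 1" using t by (simp add: power_le_one)
          then show ?thesis using t by (simp add: add_increasing2)
        next
          case False
          then have "t ^ j \<le> t ^ n" using m(2) by (intro power_increasing) auto
          then show ?thesis by linarith
        qed
        then have "exp (- Re l * t) * t ^ j \<le> exp (- Re l * t) * (1 + t ^ n)" by (intro mult_left_mono) auto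
        from order_trans[OF nphi[OF t] this] show "norm (\<phi> j t) \<le> 1 * ((1 + t ^ n) * exp (- \<mu> * t))"
          using m(1) by (simp add: mult.commute)
      qed
    qed
  qed
  then obtain K where K: "\<And>j t. j < k \<Longrightarrow> t \<ge> 0 \<Longrightarrow> norm (\<phi> j t) \<le> K j * ((1 + t ^ n) * exp (- \<mu> * t))"
    by metis
  have "\<exists>M. \<forall>j. M j \<ge> 0 \<and> (\<forall>c. norm (c *s ((mshift A l ^^ j) v)) \<le> norm c * M j)"
    using bounded_linear.nonneg_bounded[OF lin] by (intro choice) blast
  then obtain M where M: "\<And>j. M j \<ge> 0" "\<And>j c. norm (c *s ((mshift A l ^^ j) v)) \<le> norm c * M j"
    by blast
  have bound: "norm (u t) \<le> (\<Sum>j<k. K j * M j) * ((1 + t ^ n) * exp (- \<mu> * t))" if t: "t \<ge> 0" for t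
  proof -
    have "norm (u t) \<le> (\<Sum>j<k. norm (\<phi> j t) * M j)"
      unfolding u_def by (rule order_trans[OF norm_sum sum_mono]) (rule M(2))
    also have "\<dots> \<le> (\<Sum>j<k. K j * ((1 + t ^ n) * exp (- \<mu> * t)) * M j)"
      using K t M(1) by (intro sum_mono mult_right_mono) auto
    also have "\<dots> = (\<Sum>j<k. K j * M j) * ((1 + t ^ n) * exp (- \<mu> * t))"
      by (simp only: sum_distrib_right) (simp add: mult_ac)
    finally show ?thesis .
  qed
  have u0: "u 0 = v"
  proof (cases k)
    case 0
    then show ?thesis using v by (simp add: u_def)
  next
    case (Suc i)
    show ?thesis unfolding u_def Suc sum.lessThan_Suc_shift by (simp add: \<phi>_def)
  qed
  show ?thesis unfolding has_decaying_orbit_def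
    using u0 der bound by blast
qed

text \<open>At an eigenvalue of real part \<mu> the nilpotency index is at most its defect plus one,
  hence at most n + 1; every other eigenvalue has larger real part. Each case meets one alternative
  of the rate condition on generalized eigenvectors.\<close>

lemma has_decaying_orbit_complexify:
  fixes C :: "real^'n^'n"
  assumes \<mu>: "\<mu> = Min {Re l | l. l \<in> eigenvalues C}"
    and n: "n = Max {defect C l | l. l \<in> eigenvalues C \<and> Re l = \<mu>}"
  shows "has_decaying_orbit (complexify C) \<mu> n v"
proof -
  let ?A = "complexify C"
  note fin = char_polynomial_nonzero_finite(2)[of C]
  have gen: "has_decaying_orbit ?A \<mu> n v" if v: "(mshift ?A l ^^ k) v = 0" for v l k
  proof (cases "v = 0")
    case True
    then show ?thesis by (simp add: has_decaying_orbit_0)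
  next
    case False
    \<comment> \<open>The last nonzero iterate of v is a genuine eigenvector, so l belongs to
      \<open>eigenvalues C\<close>, and the definitions of \<mu> and n apply to it.\<close>
    define m where "m = (LEAST k. (mshift ?A l ^^ k) v = 0)"
    have m: "(mshift ?A l ^^ m) v = 0" unfolding m_def using v by (rule LeastI)
    obtain i where i: "m = Suc i" using m False by (cases m) auto
    have wn: "(mshift ?A l ^^ i) v \<noteq> 0" using not_less_Least[of i "\<lambda>k. (mshift ?A l ^^ k) v = 0"] i
      unfolding m_def by simp
    have "mshift ?A l ((mshift ?A l ^^ i) v) = 0" using m i by simp
    then have ev: "l \<in> eigenvalues C"
      unfolding eigenvalues_def eigenspace_def mshift_def[of _ _ "(mshift ?A l ^^ i) v"] using wn
      by (intro CollectI exI[of _ "(mshift ?A l ^^ i) v"] conjI) simp_all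
    have le: "\<mu> \<le> Re l" unfolding \<mu> using fin ev by (intro Min_le) auto
    show ?thesis
    proof (cases "\<mu> = Re l")
      case True
      have "defect C l \<le> n" unfolding n using fin ev True
        by (intro Max_ge) auto
      moreover have "(mshift ?A l ^^ Suc (defect C l)) v = 0"
        using nilpotency_index_le[where A = ?A and l = l and k = k and v = v] char_polynomial_nonzero_finite(1)[of C] v
        unfolding defect_def alg_multiplicity_def geom_multiplicity_def char_polynomial_def eigenspace_def
          mshift_def[abs_def] .
      ultimately show ?thesis
        using True by (intro has_decaying_orbit_generalized_eigenvector[where l = l and k = "Suc (defect C l)"]) auto
    next
      case False
      then show ?thesis using le v by (intro has_decaying_orbit_generalized_eigenvector[where l = l and k = k]) auto
    qed
  qed
  show ?thesis
    using span_generalized_eigenvectors[of v ?A]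
  proof (induction rule: vec.span_induct_alt)
    case base
    then show ?case by (rule has_decaying_orbit_0)
  next
    case (step c x y)
    then show ?case using gen by (auto intro!: has_decaying_orbit_add has_decaying_orbit_scale)
  qed
qed

section \<open>The Lyapunov equation\<close>

text \<open>Energy argument: if B bounds the operator norm of C, the weight e^(-2Bs) makes the
  square of the norm of y nonincreasing.\<close>

lemma linear_ode_zero:
  fixes C :: "real^'n^'n" and y :: "real \<Rightarrow> real^'n"
  assumes y: "\<And>t. (y has_vector_derivative - (C *v y t)) (at t)" and y0: "y 0 = 0" and t: "t \<ge> 0"
  shows "y t = 0"
proof -
  obtain B where B: "\<And>v. norm (C *v v) \<le> norm v * B"
    using bounded_linear.bounded[OF matrix_vector_mul_bounded_linear[of C]] by blast
  define g where "g s = exp (- (2 * B) * s) * (y s \<bullet> y s)" for s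
  have dg: "(g has_real_derivative exp (- (2 * B) * s) * (- 2 * (y s \<bullet> (C *v y s)) - 2 * B * (y s \<bullet> y s))) (at s)" for s
  proof -
    have "((\<lambda>s. y s \<bullet> y s) has_vector_derivative (y s \<bullet> (- (C *v y s)) + (- (C *v y s)) \<bullet> y s)) (at s)"
      by (rule bounded_bilinear.has_vector_derivative[OF bounded_bilinear_inner y y])
    then have "((\<lambda>s. y s \<bullet> y s) has_real_derivative - 2 * (y s \<bullet> (C *v y s))) (at s)"
      by (simp add: has_real_derivative_iff_has_vector_derivative inner_commute)
    then show ?thesis unfolding g_def
      by (auto intro!: derivative_eq_intros simp: algebra_simps)
  qed
  have "exp (- (2 * B) * s) * (- 2 * (y s \<bullet> (C *v y s)) - 2 * B * (y s \<bullet> y s)) \<le> 0" for s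
  proof -
    have "\<bar>y s \<bullet> (C *v y s)\<bar> \<le> norm (y s) * (norm (y s) * B)"
      using Cauchy_Schwarz_ineq2[of "y s" "C *v y s"] mult_left_mono[OF B[of "y s"] norm_ge_zero[of "y s"]] by linarith
    also have "\<dots> = B * (y s \<bullet> y s)" by (simp add: power2_norm_eq_inner[symmetric] power2_eq_square)
    finally have "- 2 * (y s \<bullet> (C *v y s)) - 2 * B * (y s \<bullet> y s) \<le> 0" by (simp add: abs_le_iff)
    then show ?thesis by (intro mult_nonneg_nonpos) auto
  qed
  then have "g t \<le> g 0" using dg t by (intro DERIV_nonpos_imp_nonincreasing[of 0 t g]) blast+
  then have "y t \<bullet> y t \<le> 0" by (simp add: g_def y0 mult_le_0_iff)
  then have "y t \<bullet> y t = 0" using inner_ge_zero[of "y t"] by linarith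
  then show ?thesis by (simp only: inner_eq_zero_iff)
qed

text \<open>Cholesky elimination, with J the columns still to be eliminated. A positive pivot s is
  removed by subtracting w w^T with w = S e_j / sqrt s, which keeps the form nonnegative and kills
  column j; a zero pivot forces S e_j = 0.\<close>

lemma psd_sum_of_rank_ones:
  fixes S :: "real^'n^'n"
  assumes "finite J" and "transpose S = S" and "\<And>x. 0 \<le> x \<bullet> (S *v x)"
    and "\<And>j. j \<notin> J \<Longrightarrow> S *v axis j 1 = 0"
  shows "\<exists>B :: real^'n^'n. S = B ** transpose B \<and> (\<forall>j. j \<notin> J \<longrightarrow> column j B = 0)"
  using assms
proof (induction J arbitrary: S rule: finite_induct)
  case empty
  then have "S = 0" by (simp add: vec_eq_iff matrix_vector_mul_component inner_axis)
  then show ?case by (intro exI[of _ 0]) (simp add: vec_eq_iff column_def matrix_matrix_mult_def)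
next
  case (insert j J)
  let ?e = "axis j 1 :: real^'n"
  have sym: "x \<bullet> (S *v y) = y \<bullet> (S *v x)" for x y
    by (metis dot_lmul_matrix inner_commute insert.prems(1) transpose_matrix_vector)
  have exp: "(x + t *\<^sub>R ?e) \<bullet> (S *v (x + t *\<^sub>R ?e)) = x \<bullet> (S *v x) + 2 * t * (x \<bullet> (S *v ?e)) + t\<^sup>2 * (?e \<bullet> (S *v ?e))" for x t
    by (simp add: matrix_vector_right_distrib matrix_vector_mult_scaleR inner_add_left inner_add_right sym[of ?e x]
        power2_eq_square algebra_simps)
  define s where "s = ?e \<bullet> (S *v ?e)"
  have s0: "s \<ge> 0" unfolding s_def by (rule insert.prems)
  show ?case
  proof (cases "s = 0")
    case True
    have "x \<bullet> (S *v ?e) = 0" for x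
    proof (rule ccontr)
      assume b: "x \<bullet> (S *v ?e) \<noteq> 0"
      \<comment> \<open>With a zero pivot the form is affine in t along e_j; this t brings it to
        -1.\<close>
      define t where "t = - (x \<bullet> (S *v x) + 1) / (2 * (x \<bullet> (S *v ?e)))"
      have "x \<bullet> (S *v x) + 2 * t * (x \<bullet> (S *v ?e)) = -1" using b by (simp add: t_def field_simps)
      then show False using exp[of x t] insert.prems(2)[of "x + t *\<^sub>R ?e"] True unfolding s_def[symmetric] by simp
    qed
    then have "S *v ?e = 0" by (metis inner_eq_zero_iff)
    then have "\<And>i. i \<notin> J \<Longrightarrow> S *v axis i 1 = 0" using insert.prems(3) by (metis insertE)
    from insert.IH[OF insert.prems(1,2) this] show ?thesis by auto
  next
    case False
    then have spos: "s > 0" using s0 by simp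
    define w where "w = (1 / sqrt s) *\<^sub>R (S *v ?e)"
    define S' where "S' = S - (\<chi> i k. w $ i * w $ k)"
    have S'v: "S' *v x = S *v x - (w \<bullet> x) *\<^sub>R w" for x
      by (simp add: S'_def vec_eq_iff matrix_vector_mult_def inner_vec_def algebra_simps sum_subtractf sum_distrib_left)
    have wi: "w \<bullet> x = (x \<bullet> (S *v ?e)) / sqrt s" for x by (simp add: w_def inner_commute)
    have 1: "transpose S' = S'" using insert.prems(1)
      by (simp add: S'_def vec_eq_iff transpose_def mult.commute)
    have 2: "0 \<le> x \<bullet> (S' *v x)" for x
    proof -
      \<comment> \<open>The minimiser of the form on the line x + t e_j. The minimum is the form of
        S' at x.\<close>
      define t where "t = - (x \<bullet> (S *v ?e)) / s"
      have "x \<bullet> (S *v x) + 2 * t * (x \<bullet> (S *v ?e)) + t\<^sup>2 * s = x \<bullet> (S *v x) - (x \<bullet> (S *v ?e))\<^sup>2 / s"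
        using spos by (simp add: t_def field_simps power2_eq_square)
      then have "0 \<le> x \<bullet> (S *v x) - (x \<bullet> (S *v ?e))\<^sup>2 / s"
        using exp[of x t] insert.prems(2)[of "x + t *\<^sub>R ?e"] unfolding s_def[symmetric] by linarith
      also have "\<dots> = x \<bullet> (S' *v x)"
        using spos by (simp add: S'v inner_diff_right wi inner_commute[of x w] power2_eq_square)
      finally show ?thesis .
    qed
    have 3: "S' *v axis i 1 = 0" if "i \<notin> J" for i
    proof (cases "i = j")
      case True
      have "w \<bullet> ?e = sqrt s" unfolding wi s_def[symmetric] using spos by (simp add: real_div_sqrt)
      then show ?thesis unfolding True S'v using spos by (simp add: w_def)
    next
      case False
      then have 0: "S *v axis i 1 = 0" using insert.prems(3) that by blast
      then have "w \<bullet> axis i 1 = 0" unfolding wi sym[of _ ?e] by simp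
      then show ?thesis unfolding S'v 0 by simp
    qed
    from insert.IH[OF 1 2 3] obtain B :: "real^'n^'n" where B: "S' = B ** transpose B" "\<And>i. i \<notin> J \<Longrightarrow> column i B = 0" by blast
    have Bj: "B $ i $ j = 0" for i using B(2)[OF insert.hyps(2)] by (simp add: column_def vec_eq_iff)
    \<comment> \<open>Column j of B is zero by the induction hypothesis, so w can take its place and
      contributes exactly w w^T.\<close>
    define B' where "B' = (\<chi> i k. if k = j then w $ i else B $ i $ k)"
    have "(\<Sum>k\<in>UNIV. B' $ a $ k * B' $ b $ k) = (\<Sum>k\<in>UNIV. B $ a $ k * B $ b $ k) + w $ a * w $ b" for a b
    proof -
      have "(\<Sum>k\<in>UNIV. B' $ a $ k * B' $ b $ k) = (\<Sum>k\<in>UNIV. B $ a $ k * B $ b $ k + (if k = j then w $ a * w $ b else 0))"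
        by (rule sum.cong) (auto simp: B'_def Bj)
      then show ?thesis by (simp add: sum.distrib)
    qed
    moreover have "(\<Sum>k\<in>UNIV. B $ a $ k * B $ b $ k) = S $ a $ b - w $ a * w $ b" for a b
      using arg_cong[OF B(1), of "\<lambda>M. M $ a $ b"] by (simp add: S'_def matrix_matrix_mult_def transpose_def)
    ultimately have "S = B' ** transpose B'"
      by (simp add: vec_eq_iff matrix_matrix_mult_def transpose_def)
    moreover have "column i B' = 0" if "i \<notin> insert j J" for i
      using B(2)[of i] that by (simp add: column_def vec_eq_iff B'_def)
    ultimately show ?thesis by blast
  qed
qed

lemma psd_factor:
  fixes S :: "real^'n^'n"
  assumes "transpose S = S" and "\<And>x. 0 \<le> x \<bullet> (S *v x)"
  obtains B :: "real^'n^'n" where "S = B ** transpose B"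
  using psd_sum_of_rank_ones[of UNIV S] assms by auto

text \<open>E(t) is e^(-Ct), with the real parts of the orbits of the unit vectors as columns. It
  acts on row vectors because the frequencies of plane waves are moved by its transpose.\<close>

lemma exists_flow:
  fixes C :: "real^'n^'n"
  assumes decay: "\<And>v. has_decaying_orbit (complexify C) \<mu> n v"
  obtains E :: "real \<Rightarrow> real^'n^'n" and K :: real where "E 0 = mat 1"
    and "\<And>t x. t \<ge> 0 \<Longrightarrow> ((\<lambda>t. x v* E t) has_vector_derivative - ((x v* E t) v* C)) (at t)"
    and "K > 0" and "\<And>t x. t \<ge> 0 \<Longrightarrow> norm (x v* E t) \<le> K * (1 + t ^ n) * exp (- \<mu> * t) * norm x"
proof -
  let ?A = "complexify C"
  have "\<forall>i. \<exists>u K. u 0 = axis i 1 \<and> (\<forall>t::real. (u has_vector_derivative - (?A *v u t)) (at t)) \<and>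
     (\<forall>t\<ge>0. norm (u t) \<le> K * ((1 + t ^ n) * exp (- \<mu> * t)))"
    using decay unfolding has_decaying_orbit_def by blast
  then obtain u K where u: "\<And>i. u i 0 = (axis i 1 :: complex^'n)" "\<And>i t. (u i has_vector_derivative - (?A *v u i t)) (at t)"
     "\<And>i t. t \<ge> 0 \<Longrightarrow> norm (u i t) \<le> K i * ((1 + t ^ n) * exp (- \<mu> * t))"
    by metis
  define re :: "complex^'n \<Rightarrow> real^'n" where "re z = (\<chi> k. Re (z $ k))" for z
  have re: "bounded_linear re"
    by (simp add: linear_conv_bounded_linear[symmetric]) (rule linearI; simp add: re_def vec_eq_iff)
  have reA: "re (?A *v z) = C *v re z" for z
    by (simp add: re_def vec_eq_iff matrix_vector_mult_def map_matrix_def)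
  define y where "y i t = re (u i t)" for i t
  have dy: "(y i has_vector_derivative - (C *v y i t)) (at t)" for i t
    using bounded_linear.has_vector_derivative[OF re u(2), of i t]
    unfolding y_def linear_neg[OF bounded_linear.linear[OF re]] reA .
  have y0: "y i 0 = axis i 1" for i
    by (simp add: y_def u re_def vec_eq_iff axis_def)
  define E :: "real \<Rightarrow> real^'n^'n" where "E t = (\<chi> k i. y i t $ k)" for t
  have Ex: "E t *v x = (\<Sum>i\<in>UNIV. (x $ i) *\<^sub>R y i t)" for t x
    by (simp add: vec_eq_iff E_def matrix_vector_mult_def mult.commute)
  have Ea: "E t *v axis i 1 = y i t" for t i
    by (simp add: vec_eq_iff E_def matrix_vector_mult_def axis_def if_distrib cong: if_cong)
  have E0: "E 0 = mat 1" by (simp add: vec_eq_iff E_def y0 mat_def axis_def)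
  have dEx: "((\<lambda>t. E t *v x) has_vector_derivative - (C *v (E t *v x))) (at t)" for x t
  proof -
    have "((\<lambda>t. \<Sum>i\<in>UNIV. (x $ i) *\<^sub>R y i t) has_vector_derivative (\<Sum>i\<in>UNIV. (x $ i) *\<^sub>R (- (C *v y i t)))) (at t)"
      by (intro has_vector_derivative_sum bounded_linear.has_vector_derivative[OF bounded_linear_scaleR_right dy])
    moreover have "(\<Sum>i\<in>UNIV. (x $ i) *\<^sub>R (- (C *v y i t))) = - (C *v (\<Sum>i\<in>UNIV. (x $ i) *\<^sub>R y i t))"
      using matrix_vector_mul_linear[of C]
      by (simp add: linear_sum linear_cmul sum_negf)
    ultimately show ?thesis unfolding Ex by simp
  qed
  \<comment> \<open>The columns satisfy E' = - C E, while the claim on row vectors needs E' = - E C.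
    The commutator applied to x solves the same linear equation with zero datum.\<close>
  have comm: "E t *v (C *v x) = C *v (E t *v x)" if "t \<ge> 0" for t x
  proof -
    define d where "d t = E t *v (C *v x) - C *v (E t *v x)" for t
    have "((\<lambda>t. C *v (E t *v x)) has_vector_derivative C *v (- (C *v (E t *v x)))) (at t)" for t
      by (rule bounded_linear.has_vector_derivative[OF matrix_vector_mul_bounded_linear dEx])
    then have "(d has_vector_derivative - (C *v d t)) (at t)" for t
      unfolding d_def using has_vector_derivative_diff[OF dEx, of _ _ t]
      by (fastforce simp: matrix_vector_mult_diff_distrib linear_neg[OF matrix_vector_mul_linear])
    from linear_ode_zero[OF this _ that] show ?thesis by (simp add: d_def E0)
  qed
  have comp: "(x v* E t) = (\<Sum>i\<in>UNIV. (x \<bullet> y i t) *\<^sub>R axis i 1)" for x t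
    by (simp add: vec_eq_iff vector_matrix_mult_def E_def inner_vec_def axis_def mult.commute if_distrib cong: if_cong)
  have dE: "((\<lambda>t. x v* E t) has_vector_derivative - ((x v* E t) v* C)) (at t)" if t: "t \<ge> 0" for t x
  proof -
    have "((\<lambda>t. \<Sum>i\<in>UNIV. (x \<bullet> y i t) *\<^sub>R axis i 1) has_vector_derivative
        (\<Sum>i\<in>UNIV. (x \<bullet> (- (C *v y i t))) *\<^sub>R (axis i 1 :: real^'n))) (at t)"
      by (intro has_vector_derivative_sum bounded_linear.has_vector_derivative[OF bounded_linear_scaleR_left]
          bounded_linear.has_vector_derivative[OF bounded_linear_inner_right dy])
    moreover have "x \<bullet> (C *v y i t) = ((x v* E t) v* C) $ i" for i
    proof -
      have "x \<bullet> (C *v y i t) = x \<bullet> (E t *v (C *v axis i 1))" using comm[OF t, of "axis i 1"] Ea by simp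
      also have "\<dots> = ((x v* E t) v* C) \<bullet> axis i 1" by (simp add: dot_lmul_matrix)
      finally show ?thesis by (simp add: inner_axis)
    qed
    then have "(\<Sum>i\<in>UNIV. (x \<bullet> (- (C *v y i t))) *\<^sub>R (axis i 1 :: real^'n)) = - ((x v* E t) v* C)"
      by (simp add: vec_eq_iff axis_def if_distrib cong: if_cong)
    ultimately show ?thesis unfolding comp by simp
  qed
  obtain M where M: "\<And>z. norm (re z) \<le> norm z * M" "M > 0"
    using bounded_linear.pos_bounded[OF re] by blast
  define L where "L = (\<Sum>i\<in>UNIV. \<bar>K i\<bar> * M) + 1"
  have yb: "norm (y i t) \<le> \<bar>K i\<bar> * M * ((1 + t ^ n) * exp (- \<mu> * t))" if "t \<ge> 0" for i t
  proof -
    have nn: "0 \<le> (1 + t ^ n) * exp (- \<mu> * t)" using that by simp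
    have "norm (y i t) \<le> norm (u i t) * M" unfolding y_def by (rule M)
    also have "\<dots> \<le> (\<bar>K i\<bar> * ((1 + t ^ n) * exp (- \<mu> * t))) * M"
      using u(3)[OF that, of i] M(2) mult_right_mono[OF abs_ge_self[of "K i"] nn] by (intro mult_right_mono) auto
    finally show ?thesis by (simp add: mult_ac)
  qed
  have "norm (x v* E t) \<le> L * (1 + t ^ n) * exp (- \<mu> * t) * norm x" if t: "t \<ge> 0" for t x
  proof -
    have nn: "0 \<le> (1 + t ^ n) * exp (- \<mu> * t)" using t by simp
    have "norm (x v* E t) \<le> (\<Sum>i\<in>UNIV. norm ((x \<bullet> y i t) *\<^sub>R (axis i 1 :: real^'n)))"
      unfolding comp by (rule norm_sum)
    also have "\<dots> = (\<Sum>i\<in>UNIV. \<bar>x \<bullet> y i t\<bar>)" by (simp add: norm_axis_1)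
    also have "\<dots> \<le> (\<Sum>i\<in>UNIV. norm x * (\<bar>K i\<bar> * M * ((1 + t ^ n) * exp (- \<mu> * t))))"
      by (rule sum_mono) (rule order_trans[OF Cauchy_Schwarz_ineq2 mult_left_mono[OF yb[OF t] norm_ge_zero]])
    also have "\<dots> = (\<Sum>i\<in>UNIV. \<bar>K i\<bar> * M) * (((1 + t ^ n) * exp (- \<mu> * t)) * norm x)"
      by (simp only: sum_distrib_right) (simp add: mult_ac)
    also have "\<dots> \<le> L * (((1 + t ^ n) * exp (- \<mu> * t)) * norm x)"
      unfolding L_def using nn by (intro mult_right_mono) auto
    finally show ?thesis by (simp add: mult_ac)
  qed
  moreover have "L > 0" unfolding L_def using M(2) by (intro add_nonneg_pos sum_nonneg) auto
  ultimately show thesis using that[OF E0 dE] by blast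
qed

lemma poly_mult_exp_tendsto_0:
  fixes \<mu> :: real assumes "\<mu> > 0"
  shows "((\<lambda>t. (1 + t ^ n) * exp (- \<mu> * t)) \<longlongrightarrow> 0) at_top"
proof -
  obtain K where K: "K \<ge> 0" "\<And>t. t \<ge> 0 \<Longrightarrow> t ^ n \<le> K * exp (\<mu> / 2 * t)"
    using power_le_exp[of "\<mu> / 2" n] assms by auto
  have lim: "((\<lambda>t. exp (- \<mu> * t) + K * exp (- (\<mu> / 2) * t)) \<longlongrightarrow> 0 + K * 0) at_top"
  proof (intro tendsto_intros)
    have e: "((\<lambda>t. exp (c * t)) \<longlongrightarrow> 0) at_top" if "c < 0" for c :: real
      by (rule filterlim_compose[OF exp_at_bot])
        (rule filterlim_tendsto_neg_mult_at_bot[OF tendsto_const that filterlim_ident])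
    show "((\<lambda>t. exp (- \<mu> * t)) \<longlongrightarrow> 0) at_top" "((\<lambda>t. exp (- (\<mu> / 2) * t)) \<longlongrightarrow> 0) at_top"
      by (rule e, use assms in simp)+
  qed
  show ?thesis
  proof (rule tendsto_sandwich[OF _ _ tendsto_const lim[simplified]])
    show "\<forall>\<^sub>F t in at_top. 0 \<le> (1 + t ^ n) * exp (- \<mu> * t)"
      using eventually_ge_at_top[of "0::real"] by eventually_elim simp
    show "\<forall>\<^sub>F t in at_top. (1 + t ^ n) * exp (- \<mu> * t) \<le> exp (- (\<mu> * t)) + K * exp (- (\<mu> * t / 2))"
      using eventually_ge_at_top[of "0::real"]
    proof eventually_elim
      case (elim t)
      have "t ^ n * exp (- \<mu> * t) \<le> K * exp (\<mu> / 2 * t) * exp (- \<mu> * t)"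
        using K(2)[OF elim] by (intro mult_right_mono) auto
      also have "\<dots> = K * exp (- (\<mu> * t / 2))" by (simp add: mult.assoc exp_add[symmetric] algebra_simps)
      finally show ?case by (simp add: algebra_simps)
    qed
  qed
qed

text \<open>For a solution of the Lyapunov equation the derivative is minus twice the form of D, so
  the form of P decreases along the flow; for a solution of the homogeneous equation it is constant.
  \<open>lyapunov_solution\<close> uses both cases.\<close>

lemma quadratic_form_along_flow:
  fixes C P :: "real^'n^'n"
  assumes dE: "\<And>x. ((\<lambda>t. x v* E t) has_vector_derivative - ((x v* E t) v* C)) (at t)"
  shows "((\<lambda>t. (x v* E t) \<bullet> (P *v (y v* E t))) has_real_derivative
     - ((x v* E t) \<bullet> ((C ** P + P ** transpose C) *v (y v* E t)))) (at t)"
proof -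
  have "((\<lambda>t. (x v* E t) \<bullet> (P *v (y v* E t))) has_vector_derivative
     ((x v* E t) \<bullet> (P *v (- ((y v* E t) v* C))) + (- ((x v* E t) v* C)) \<bullet> (P *v (y v* E t)))) (at t)"
    by (rule bounded_bilinear.has_vector_derivative[OF bounded_bilinear_inner dE
          bounded_linear.has_vector_derivative[OF matrix_vector_mul_bounded_linear dE]])
  moreover have "((x v* E t) \<bullet> (P *v (- ((y v* E t) v* C))) + (- ((x v* E t) v* C)) \<bullet> (P *v (y v* E t)))
     = - ((x v* E t) \<bullet> ((C ** P + P ** transpose C) *v (y v* E t)))"
    by (simp add: linear_neg[OF matrix_vector_mul_linear] matrix_vector_mult_add_rdistrib inner_add_right
        dot_lmul_matrix matrix_vector_mul_assoc[symmetric])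
  ultimately show ?thesis by (simp add: has_real_derivative_iff_has_vector_derivative)
qed

text \<open>The map Q to C Q + Q C^T is injective, because a form in its kernel is constant along
  the flow and tends to 0; in finite dimension it is then surjective. Injectivity makes P symmetric,
  decay along the flow makes it nonnegative, and Condition (C) makes it definite.\<close>

lemma lyapunov_solution:
  fixes C D :: "real^'n^'n"
  assumes decay: "\<And>v. has_decaying_orbit (complexify C) \<mu> n v" and \<mu>: "\<mu> > 0"
    and A: "condition_A D" and CC: "condition_C D C"
  obtains E :: "real \<Rightarrow> real^'n^'n" and P S T :: "real^'n^'n" and K :: real
  where "E 0 = mat 1"
    and "\<And>t x. t \<ge> 0 \<Longrightarrow> ((\<lambda>t. x v* E t) has_vector_derivative - ((x v* E t) v* C)) (at t)"
    and "K > 0" and "\<And>t x. t \<ge> 0 \<Longrightarrow> norm (x v* E t) \<le> K * (1 + t ^ n) * exp (- \<mu> * t) * norm x"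
    and "C ** P + P ** transpose C = 2 *\<^sub>R D"
    and "P = S ** transpose S" and "S ** T = mat 1" and "T ** S = mat 1"
    and "\<And>t x. t \<ge> 0 \<Longrightarrow> (x v* E t) \<bullet> (P *v (x v* E t)) \<le> x \<bullet> (P *v x)"
proof -
  obtain E K where E: "E 0 = mat 1"
    "\<And>t x. t \<ge> 0 \<Longrightarrow> ((\<lambda>t. x v* E t) has_vector_derivative - ((x v* E t) v* C)) (at t)"
    "K > 0" "\<And>t x. t \<ge> 0 \<Longrightarrow> norm (x v* E t) \<le> K * (1 + t ^ n) * exp (- \<mu> * t) * norm x"
    using exists_flow[OF decay] by blast
  have x0: "x v* E 0 = x" for x by (simp add: E(1) vec_eq_iff vector_matrix_mult_def mat_def if_distrib if_distribR cong: if_cong)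
  have lim0: "((\<lambda>t. x v* E t) \<longlongrightarrow> 0) at_top" for x
  proof (rule Lim_null_comparison)
    show "\<forall>\<^sub>F t in at_top. norm (x v* E t) \<le> K * ((1 + t ^ n) * exp (- \<mu> * t)) * norm x"
      using eventually_ge_at_top[of "0::real"] by eventually_elim (use E(4) in \<open>simp add: mult.assoc\<close>)
    show "((\<lambda>t. K * ((1 + t ^ n) * exp (- \<mu> * t)) * norm x) \<longlongrightarrow> 0) at_top"
      by (rule tendsto_eq_intros poly_mult_exp_tendsto_0[OF \<mu>] refl | simp)+
  qed
  have limP: "((\<lambda>t. (x v* E t) \<bullet> (Q *v (y v* E t))) \<longlongrightarrow> 0) at_top" for x y and Q :: "real^'n^'n"
    using tendsto_inner[OF lim0 bounded_linear.tendsto[OF matrix_vector_mul_bounded_linear[of Q] lim0], of x y]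
    by simp
  define L where "L Q = C ** Q + Q ** transpose C" for Q
  have linL: "linear L"
    by (rule linearI)
      (auto simp: L_def vec_eq_iff matrix_matrix_mult_def algebra_simps sum.distrib sum_distrib_left)
  have "inj L"
    unfolding linear_injective_0[OF linL]
  proof (intro allI impI)
    fix Q assume Q: "L Q = 0"
    have z: "x \<bullet> (Q *v y) = 0" for x y
    proof -
      define g where "g t = (x v* E t) \<bullet> (Q *v (y v* E t))" for t
      have dg: "(g has_real_derivative 0) (at t)" if "t \<ge> 0" for t
        using quadratic_form_along_flow[OF E(2)[OF that], where x = x and y = y and P = Q] Q
        unfolding g_def L_def by simp
      have "g t = g 0" if "t \<ge> 0" for t
      proof -
        have "g t \<le> g 0" using dg by (intro DERIV_nonpos_imp_nonincreasing[OF that]) blast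
        moreover have "g 0 \<le> g t" using dg by (intro DERIV_nonneg_imp_nondecreasing[OF that]) blast
        ultimately show ?thesis by simp
      qed
      then have "(g \<longlongrightarrow> g 0) at_top"
        by (intro tendsto_eventually) (use eventually_ge_at_top[of "0::real"] in eventually_elim, blast)
      moreover have "(g \<longlongrightarrow> 0) at_top" unfolding g_def by (rule limP)
      ultimately have "g 0 = 0" using tendsto_unique trivial_limit_at_top_linorder by blast
      then show ?thesis by (simp add: g_def x0)
    qed
    have "Q *v y = 0" for y using z[of "Q *v y" y] by simp
    then show "Q = 0" by (simp add: matrix_eq)
  qed
  then have "surj L" by (rule linear_injective_imp_surjective[OF linL], simp_all only:)
  then obtain P where P: "L P = 2 *\<^sub>R D" by (metis surjD)
  have Dsym: "transpose D = D" and Dpsd: "\<And>x. 0 \<le> x \<bullet> (D *v x)"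
    using A unfolding condition_A_def by auto
  have "L (transpose P) = transpose (L P)"
    by (simp add: L_def vec_eq_iff matrix_matrix_mult_def transpose_def mult.commute add.commute)
  then have "L (transpose P) = L P" using P Dsym by (simp add: transpose_scalar)
  then have Psym: "transpose P = P" using \<open>inj L\<close> by (simp add: inj_eq)
  have mono: "(x v* E t) \<bullet> (P *v (x v* E t)) \<le> x \<bullet> (P *v x)" if t: "t \<ge> 0" for t x
  proof -
    define g where "g t = (x v* E t) \<bullet> (P *v (x v* E t))" for t
    have dg: "(g has_real_derivative - 2 * ((x v* E t) \<bullet> (D *v (x v* E t)))) (at t)" if "t \<ge> 0" for t
      using quadratic_form_along_flow[OF E(2)[OF that], where x = x and y = x and P = P] P
      unfolding g_def L_def by (simp add: scaleR_matrix_vector_assoc[symmetric])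
    have "g t \<le> g 0" using dg Dpsd by (intro DERIV_nonpos_imp_nonincreasing[OF t]) fastforce
    then show ?thesis by (simp add: g_def x0)
  qed
  have Ppsd: "0 \<le> x \<bullet> (P *v x)" for x
    using mono by (intro tendsto_upperbound[OF limP[of x P x]])
      (use eventually_ge_at_top[of "0::real"] in eventually_elim, auto)
  obtain S :: "real^'n^'n" where S: "P = S ** transpose S" using psd_factor[OF Psym Ppsd] by blast
  \<comment> \<open>If P x = 0, the Lyapunov equation tested with x gives D x = 0, and applied to x
    it then gives P (C^T x) = 0. So the kernel is a C^T-invariant subspace of the kernel of
    D.\<close>
  have ker: "{x. P *v x = 0} = {0}"
  proof -
    have "D *v x = 0 \<and> P *v (transpose C *v x) = 0" if x: "P *v x = 0" for x
    proof -
      have LP: "C *v (P *v y) + P *v (transpose C *v y) = 2 *\<^sub>R (D *v y)" for y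
        using arg_cong[OF P, of "\<lambda>M. M *v y"]
        by (simp add: L_def matrix_vector_mult_add_rdistrib matrix_vector_mul_assoc scaleR_matrix_vector_assoc del: transpose_matrix_vector)
      have "x \<bullet> (P *v y) = 0" for y
        using x Psym by (metis dot_lmul_matrix inner_zero_left transpose_matrix_vector)
      then have "2 * (x \<bullet> (D *v x)) = 0"
        using arg_cong[OF LP[of x], of "\<lambda>v. x \<bullet> v"] x by (simp add: inner_add_right)
      moreover obtain R :: "real^'n^'n" where R: "D = R ** transpose R" using psd_factor[OF Dsym Dpsd] by blast
      ultimately have "(x v* R) \<bullet> (x v* R) = 0"
        by (simp add: dot_lmul_matrix matrix_vector_mul_assoc[symmetric])
      then have "D *v x = 0" unfolding R by (simp add: matrix_vector_mul_assoc[symmetric])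
      then show ?thesis using LP[of x] x by simp
    qed
    moreover have "subspace {x. P *v x = 0}"
      by (rule subspaceI) (auto simp: matrix_vector_right_distrib matrix_vector_mult_scaleR)
    ultimately show ?thesis using CC unfolding condition_C_def by (simp add: subset_eq)
  qed
  have "x = 0" if "transpose S *v x = 0" for x
  proof -
    have "P *v x = S *v (transpose S *v x)" unfolding S by (rule matrix_vector_mul_assoc[symmetric])
    then show ?thesis using ker that by auto
  qed
  then obtain B :: "real^'n^'n" where "B ** transpose S = mat 1"
    using matrix_left_invertible_ker[of "transpose S"] by blast
  then have "S ** transpose B = mat 1"
    using arg_cong[of _ _ transpose] by (simp add: matrix_transpose_mul[of B "transpose S", simplified, symmetric])
  moreover from this have "transpose B ** S = mat 1" using matrix_left_right_inverse by blast
  ultimately show thesis using that[OF E _ S _ _ mono] P unfolding L_def by blast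
qed

section \<open>The Gaussian measure\<close>

text \<open>Defined on every Euclidean space because \<open>mehler_square\<close> smooths functions
  of pairs. The product form matches the product structure of \<open>lborel\<close>.\<close>

definition gauss_density :: "'a::euclidean_space \<Rightarrow> real" where
  "gauss_density x = (\<Prod>b\<in>Basis. std_normal_density (x \<bullet> b))"

definition gauss :: "'a::euclidean_space measure" where
  "gauss = density lborel (\<lambda>x. ennreal (gauss_density x))"

lemma gauss_density_pos: "gauss_density x > 0"
  unfolding gauss_density_def by (intro prod_pos) (simp add: normal_density_pos)

lemma gauss_density_nonneg [simp]: "gauss_density x \<ge> 0"
  using gauss_density_pos[of x] by linarith

lemma gauss_density_measurable [measurable]: "gauss_density \<in> borel_measurable borel"
  unfolding gauss_density_def by measurable

lemma gauss_density_altdef: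
  fixes x :: "'a::euclidean_space"
  shows "gauss_density x = (1 / sqrt (2 * pi)) ^ DIM('a) * exp (- (norm x)\<^sup>2 / 2)"
proof -
  have "(norm x)\<^sup>2 = (\<Sum>b\<in>Basis. (x \<bullet> b)\<^sup>2)"
    unfolding power2_norm_eq_inner euclidean_inner[of x x] by (simp add: power2_eq_square)
  then show ?thesis
    by (simp add: gauss_density_def std_normal_density_def prod.distrib exp_sum[symmetric]
        sum_divide_distrib sum_negf power_divide prod_dividef)
qed

lemma sets_gauss [simp, measurable_cong]: "sets gauss = sets borel"
  by (simp add: gauss_def)

lemma space_gauss [simp]: "space gauss = UNIV"
  by (simp add: gauss_def)

text \<open>In each coordinate the weight e^(\<kappa> y^2) turns the standard normal density into
  \<sigma> times the centred normal density of variance \<sigma>^2 = 1/(1 - 2\<kappa>).\<close>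

lemma nn_integral_gauss_exp_square_finite:
  assumes "\<kappa> < 1 / 2"
  shows "(\<integral>\<^sup>+x. ennreal (exp (\<kappa> * (norm x)\<^sup>2)) \<partial>(gauss :: 'a::euclidean_space measure)) < \<infinity>"
proof -
  define \<sigma> where "\<sigma> = 1 / sqrt (1 - 2 * \<kappa>)"
  have s: "\<sigma> > 0" "\<sigma>\<^sup>2 = 1 / (1 - 2 * \<kappa>)" using assms by (auto simp: \<sigma>_def power_divide)
  have one: "std_normal_density y * exp (\<kappa> * y\<^sup>2) = \<sigma> * normal_density 0 \<sigma> y" for y
  proof -
    have "- y\<^sup>2 / 2 + \<kappa> * y\<^sup>2 = - (y - 0)\<^sup>2 / (2 * \<sigma>\<^sup>2)" using assms unfolding s(2) by (simp add: field_simps)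
    then have "exp (- y\<^sup>2 / 2) * exp (\<kappa> * y\<^sup>2) = exp (- (y - 0)\<^sup>2 / (2 * \<sigma>\<^sup>2))"
      by (simp only: exp_add[symmetric])
    moreover have "1 / sqrt (2 * pi) = \<sigma> * (1 / sqrt (2 * pi * \<sigma>\<^sup>2))" using s(1) by (simp add: real_sqrt_mult)
    ultimately show ?thesis unfolding std_normal_density_def normal_density_def by simp
  qed
  have int: "integrable lborel (\<lambda>y. std_normal_density y * exp (\<kappa> * y\<^sup>2))"
    unfolding one using integrable_normal_density[OF s(1), of 0] by simp
  have sq: "(norm x)\<^sup>2 = (\<Sum>b\<in>Basis. (x \<bullet> b)\<^sup>2)" for x :: 'a
    unfolding power2_norm_eq_inner euclidean_inner[of x x] by (simp add: power2_eq_square)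
  have "(\<integral>\<^sup>+x. ennreal (exp (\<kappa> * (norm x)\<^sup>2)) \<partial>(gauss :: 'a measure))
    = (\<integral>\<^sup>+x. ennreal (gauss_density x * exp (\<kappa> * (norm x)\<^sup>2)) \<partial>(lborel :: 'a measure))"
    unfolding gauss_def by (subst nn_integral_density) (auto simp: ennreal_mult)
  also have "\<dots> = (\<integral>\<^sup>+x. (\<Prod>b\<in>Basis. ennreal (std_normal_density (x \<bullet> b) * exp (\<kappa> * (x \<bullet> b)\<^sup>2))) \<partial>(lborel :: 'a measure))"
    by (intro nn_integral_cong)
      (simp add: gauss_density_def sq sum_distrib_left exp_sum prod.distrib[symmetric] prod_ennreal)
  also have "\<dots> = (\<Prod>b\<in>(Basis :: 'a set). \<integral>\<^sup>+y. ennreal (std_normal_density y * exp (\<kappa> * y\<^sup>2)) \<partial>lborel)"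
    by (rule nn_integral_lborel_prod) auto
  also have "\<dots> < \<infinity>"
  proof -
    have "(\<integral>\<^sup>+y. ennreal (std_normal_density y * exp (\<kappa> * y\<^sup>2)) \<partial>lborel) < \<infinity>"
      using int unfolding integrable_iff_bounded by (auto simp: abs_mult)
    then show ?thesis by (simp add: power_less_top_ennreal)
  qed
  finally show ?thesis .
qed

lemma prob_space_gauss: "prob_space (gauss :: 'a::euclidean_space measure)"
proof
  have "emeasure (gauss :: 'a measure) (space gauss) = (\<integral>\<^sup>+x. (\<Prod>b\<in>Basis. ennreal (std_normal_density (x \<bullet> b))) \<partial>(lborel :: 'a measure))"
    by (simp add: gauss_def emeasure_density gauss_density_def prod_ennreal)
  also have "\<dots> = (\<Prod>b\<in>(Basis :: 'a set). \<integral>\<^sup>+y. ennreal (std_normal_density y) \<partial>lborel)"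
    by (rule nn_integral_lborel_prod) auto
  also have "(\<integral>\<^sup>+y. ennreal (std_normal_density y) \<partial>lborel) = 1"
    by (subst nn_integral_eq_integral) (auto simp: integrable_normal_density integral_normal_density)
  finally show "emeasure (gauss :: 'a measure) (space gauss) = 1" by simp
qed

interpretation gauss: prob_space gauss by (rule prob_space_gauss)

lemma integrable_gauss_bounded:
  fixes g :: "'a::euclidean_space \<Rightarrow> real"
  assumes "g \<in> borel_measurable borel" "\<And>x. \<bar>g x\<bar> \<le> b"
  shows "integrable gauss g"
  by (rule gauss.integrable_const_bound[where B = b]) (use assms in auto)

lemma integral_gauss:
  fixes F :: "'a::euclidean_space \<Rightarrow> real"
  assumes [measurable]: "F \<in> borel_measurable borel"
  shows "(\<integral>z. F z \<partial>gauss) = (\<integral>z. gauss_density z * F z \<partial>lborel)"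
  unfolding gauss_def by (subst integral_density) auto

text \<open>The characteristic function of the Gaussian in real form. The phase \<theta> encodes
  cosine and sine at once, so that the later Fourier arguments run with real integrals.\<close>

lemma gauss_cos:
  fixes \<xi> :: "'a::euclidean_space"
  shows "(\<integral>z. cos (\<xi> \<bullet> z + \<theta>) \<partial>gauss) = exp (- (norm \<xi>)\<^sup>2 / 2) * cos \<theta>"
proof -
  have nn: "(norm \<xi>)\<^sup>2 = (\<Sum>b\<in>Basis. (\<xi> \<bullet> b)\<^sup>2)"
    unfolding power2_norm_eq_inner euclidean_inner[of \<xi> \<xi>] by (simp add: power2_eq_square)
  define f where "f b y = complex_of_real (std_normal_density y) * iexp ((\<xi> \<bullet> b) * y)" for b y
  have f_int: "integrable lborel (f b)" for b
    unfolding f_def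
    by (rule Bochner_Integration.integrable_bound[OF integrable_normal_density[of 1 0]])
      (auto simp: norm_mult)
  have f1: "(\<integral>y. f b y \<partial>lborel) = complex_of_real (exp (- (\<xi> \<bullet> b)\<^sup>2 / 2))" for b
  proof -
    have "char std_normal_distribution (\<xi> \<bullet> b) = (\<integral>y. f b y \<partial>lborel)"
      unfolding char_def f_def by (subst integral_density) (auto simp: scaleR_conv_of_real)
    then show ?thesis by (simp add: char_std_normal_distribution)
  qed
  interpret product_sigma_finite "\<lambda>_::'a. lborel :: real measure" ..
  have prodf: "(\<Prod>b\<in>Basis. f b (z \<bullet> b)) = complex_of_real (gauss_density z) * iexp (\<xi> \<bullet> z)" for z
  proof -
    have "(\<Prod>b\<in>Basis. iexp ((\<xi> \<bullet> b) * (z \<bullet> b))) = iexp (\<xi> \<bullet> z)"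
      by (simp add: exp_sum[symmetric] euclidean_inner[of \<xi> z] sum_distrib_left)
    then show ?thesis by (simp add: f_def prod.distrib gauss_density_def)
  qed
  have fm [measurable]: "f b \<in> borel_measurable borel" for b unfolding f_def by measurable
  have "(\<integral>z. (\<Prod>b\<in>Basis. f b (z \<bullet> b)) \<partial>(lborel :: 'a measure))
     = (\<integral>x. (\<Prod>b\<in>Basis. f b (x b)) \<partial>(Pi\<^sub>M Basis (\<lambda>b::'a. lborel)))"
  proof -
    have "(\<integral>z. (\<Prod>b\<in>Basis. f b (z \<bullet> b)) \<partial>(lborel :: 'a measure))
      = (\<integral>x. (\<Prod>b\<in>Basis. f b ((\<Sum>c\<in>Basis. x c *\<^sub>R c) \<bullet> b)) \<partial>(Pi\<^sub>M Basis (\<lambda>b::'a. lborel)))"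
      by (subst lborel_eq) (rule integral_distr; measurable)
    also have "\<dots> = (\<integral>x. (\<Prod>b\<in>Basis. f b (x b)) \<partial>(Pi\<^sub>M Basis (\<lambda>b::'a. lborel)))"
      by (intro Bochner_Integration.integral_cong refl prod.cong) auto
    finally show ?thesis .
  qed
  also have "\<dots> = (\<Prod>b\<in>Basis. \<integral>y. f b y \<partial>lborel)"
    by (rule product_integral_prod) (auto simp: f_int)
  also have "\<dots> = complex_of_real (exp (- (norm \<xi>)\<^sup>2 / 2))"
    unfolding f1 nn by (simp add: exp_sum[symmetric] sum_divide_distrib sum_negf of_real_prod[symmetric] del: of_real_prod)
  finally have ch: "(\<integral>z. complex_of_real (gauss_density z) * iexp (\<xi> \<bullet> z) \<partial>lborel) = complex_of_real (exp (- (norm \<xi>)\<^sup>2 / 2))"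
    unfolding prodf .
  have gi: "integrable lborel (gauss_density :: 'a \<Rightarrow> real)"
  proof (rule integrableI_nonneg)
    have "emeasure (gauss :: 'a measure) (space gauss) = 1" by (rule gauss.emeasure_space_1)
    then show "(\<integral>\<^sup>+x. ennreal (gauss_density x) \<partial>(lborel :: 'a measure)) < \<infinity>"
      by (simp add: gauss_def emeasure_density)
  qed auto
  have ci: "integrable lborel (\<lambda>z. complex_of_real (gauss_density z) * iexp (\<xi> \<bullet> z) * cis \<theta>)"
    by (rule Bochner_Integration.integrable_bound[OF gi]) (auto simp: norm_mult)
  have "(\<integral>z. complex_of_real (gauss_density z) * iexp (\<xi> \<bullet> z) * cis \<theta> \<partial>lborel) = complex_of_real (exp (- (norm \<xi>)\<^sup>2 / 2)) * cis \<theta>"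
    using ch by simp
  from arg_cong[OF this, of Re]
  have "(\<integral>z. Re (complex_of_real (gauss_density z) * iexp (\<xi> \<bullet> z) * cis \<theta>) \<partial>lborel) = exp (- (norm \<xi>)\<^sup>2 / 2) * cos \<theta>"
    by (subst integral_Re[OF ci]) simp
  moreover have "Re (complex_of_real (gauss_density z) * iexp (\<xi> \<bullet> z) * cis \<theta>) = gauss_density z * cos (\<xi> \<bullet> z + \<theta>)" for z
  proof -
    have e: "complex_of_real (gauss_density z) * iexp (\<xi> \<bullet> z) * cis \<theta> = complex_of_real (gauss_density z) * cis (\<xi> \<bullet> z + \<theta>)"
      by (simp add: cis_conv_exp exp_add[symmetric] distrib_left)
    show ?thesis unfolding e by simp
  qed
  ultimately show ?thesis by (subst integral_gauss) simp_all
qed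

text \<open>The Cameron-Martin formula: the exponential is the ratio of the shifted Gaussian density
  to the original one.\<close>

lemma gauss_shift:
  fixes F :: "'a::euclidean_space \<Rightarrow> real"
  assumes [measurable]: "F \<in> borel_measurable borel"
  shows "(\<integral>z. F (z + k) \<partial>gauss) = (\<integral>z. F z * exp (z \<bullet> k - (norm k)\<^sup>2 / 2) \<partial>gauss)"
proof -
  have "(\<integral>z. F z * exp (z \<bullet> k - (norm k)\<^sup>2 / 2) \<partial>gauss)
      = (\<integral>z. gauss_density z * (F z * exp (z \<bullet> k - (norm k)\<^sup>2 / 2)) \<partial>lborel)"
    by (rule integral_gauss) measurable
  also have "\<dots> = (\<integral>z. gauss_density z * (F z * exp (z \<bullet> k - (norm k)\<^sup>2 / 2)) \<partial>distr lborel borel ((+) k))"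
    by (simp only: lborel_distr_plus)
  also have "\<dots> = (\<integral>z. gauss_density (k + z) * (F (k + z) * exp ((k + z) \<bullet> k - (norm k)\<^sup>2 / 2)) \<partial>lborel)"
    by (subst integral_distr) auto
  also have "\<dots> = (\<integral>z. gauss_density z * F (z + k) \<partial>lborel)"
  proof (rule Bochner_Integration.integral_cong[OF refl])
    fix z :: 'a
    have "(norm (k + z))\<^sup>2 = (norm k)\<^sup>2 + 2 * (k \<bullet> z) + (norm z)\<^sup>2"
      by (simp add: power2_norm_eq_inner inner_add_left inner_add_right inner_commute)
    then have "- (norm (k + z))\<^sup>2 / 2 + ((k + z) \<bullet> k - (norm k)\<^sup>2 / 2) = - (norm z)\<^sup>2 / 2"
      by (simp add: inner_add_left inner_add_right power2_norm_eq_inner[symmetric] inner_commute) (simp add: field_simps)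
    then have "exp (- (norm (k + z))\<^sup>2 / 2) * exp ((k + z) \<bullet> k - (norm k)\<^sup>2 / 2) = exp (- (norm z)\<^sup>2 / 2)"
      by (simp only: exp_add[symmetric])
    then have "gauss_density (k + z) * exp ((k + z) \<bullet> k - (norm k)\<^sup>2 / 2) = gauss_density z"
      unfolding gauss_density_altdef mult.assoc by simp
    then show "gauss_density (k + z) * (F (k + z) * exp ((k + z) \<bullet> k - (norm k)\<^sup>2 / 2)) = gauss_density z * F (z + k)"
      by (simp add: add.commute mult_ac)
  qed
  also have "\<dots> = (\<integral>z. F (z + k) \<partial>gauss)" by (rule integral_gauss[symmetric]) measurable
  finally show ?thesis by simp
qed

section \<open>Gaussian smoothing and uniqueness of Fourier transforms\<close>

lemma gauss_affine:
  fixes g :: "'a::euclidean_space \<Rightarrow> real"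
  assumes [measurable]: "g \<in> borel_measurable borel" and \<epsilon>: "\<epsilon> > 0"
  shows "(\<integral>z. g (x + \<epsilon> *\<^sub>R z) \<partial>gauss)
       = (\<integral>y. g y * (gauss_density ((x - y) /\<^sub>R \<epsilon>) / \<epsilon> ^ DIM('a)) \<partial>lborel)"
proof -
  let ?h = "\<lambda>y. g y * (gauss_density ((x - y) /\<^sub>R \<epsilon>) / \<epsilon> ^ DIM('a))"
  have sym: "gauss_density (- z) = gauss_density z" for z :: 'a by (simp add: gauss_density_altdef)
  have "(\<integral>y. ?h y \<partial>lborel) = (\<integral>y. ?h y \<partial>density (distr lborel borel (\<lambda>z. x + \<epsilon> *\<^sub>R z)) (\<lambda>_. ennreal (\<bar>\<epsilon>\<bar> ^ DIM('a))))"
    using lborel_affine[of \<epsilon> x] \<epsilon> by simp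
  also have "\<dots> = (\<integral>y. \<epsilon> ^ DIM('a) * ?h y \<partial>distr lborel borel (\<lambda>z. x + \<epsilon> *\<^sub>R z))"
    using \<epsilon> by (subst integral_density) auto
  also have "\<dots> = (\<integral>z. \<epsilon> ^ DIM('a) * ?h (x + \<epsilon> *\<^sub>R z) \<partial>lborel)"
    by (subst integral_distr) auto
  also have "\<dots> = (\<integral>z. gauss_density z * g (x + \<epsilon> *\<^sub>R z) \<partial>lborel)"
    using \<epsilon> by (intro Bochner_Integration.integral_cong refl) (simp add: sym scaleR_minus_right[symmetric] del: scaleR_minus_right)
  also have "\<dots> = (\<integral>z. g (x + \<epsilon> *\<^sub>R z) \<partial>gauss)" by (rule integral_gauss[symmetric]) measurable
  finally show ?thesis by simp
qed

lemma integrable_pair_dominated: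
  fixes f :: "'a \<times> 'b \<Rightarrow> real"
  assumes M: "sigma_finite_measure M" and N: "sigma_finite_measure N"
    and f [measurable]: "f \<in> borel_measurable (M \<Otimes>\<^sub>M N)" and w: "integrable M w"
    and int: "\<And>x. x \<in> space M \<Longrightarrow> integrable N (\<lambda>y. f (x, y))"
    and le: "\<And>x. x \<in> space M \<Longrightarrow> (\<integral>y. \<bar>f (x, y)\<bar> \<partial>N) \<le> b * \<bar>w x\<bar>"
  shows "integrable (M \<Otimes>\<^sub>M N) f"
proof -
  interpret pair_sigma_finite M N using M N by (rule pair_sigma_finite.intro)
  show ?thesis
  proof (rule Fubini_integrable[OF f])
    show "integrable M (\<lambda>x. \<integral>y. norm (f (x, y)) \<partial>N)"
    proof (rule Bochner_Integration.integrable_bound)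
      show "integrable M (\<lambda>x. b * \<bar>w x\<bar>)" using w by simp
      show "AE x in M. norm (\<integral>y. norm (f (x, y)) \<partial>N) \<le> norm (b * \<bar>w x\<bar>)"
      proof (rule AE_I2)
        fix x assume "x \<in> space M"
        then have "(\<integral>y. norm (f (x, y)) \<partial>N) \<le> b * \<bar>w x\<bar>" using le by simp
        moreover have "0 \<le> (\<integral>y. norm (f (x, y)) \<partial>N)" by simp
        ultimately show "norm (\<integral>y. norm (f (x, y)) \<partial>N) \<le> norm (b * \<bar>w x\<bar>)" by simp
      qed
    qed measurable
    show "AE x in M. integrable N (\<lambda>y. f (x, y))" using int by auto
  qed
qed

text \<open>Up to constants the Gaussian is its own Fourier transform, so the smoothing kernel is
  itself a Gaussian average of cosines. After Fubini the weighted measure enters only through its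
  cosine integrals.\<close>

lemma gauss_smoothing_via_cos:
  fixes X :: "'m \<Rightarrow> 'a::euclidean_space" and g :: "'a \<Rightarrow> real"
  assumes M: "sigma_finite_measure M" and X [measurable]: "X \<in> measurable M borel"
    and w: "integrable M w" and g [measurable]: "g \<in> borel_measurable borel" and gb: "\<And>x. \<bar>g x\<bar> \<le> b"
    and \<epsilon>: "\<epsilon> > 0"
  shows "(\<integral>m. w m * (\<integral>z. g (X m + \<epsilon> *\<^sub>R z) \<partial>gauss) \<partial>M)
    = (\<integral>y. g y * ((1 / sqrt (2 * pi) / \<epsilon>) ^ DIM('a) *
         (\<integral>\<zeta>. (\<integral>m. w m * cos ((\<zeta> /\<^sub>R \<epsilon>) \<bullet> X m + (- (\<zeta> /\<^sub>R \<epsilon>) \<bullet> y)) \<partial>M) \<partial>gauss)) \<partial>lborel)"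
proof -
  have wm [measurable]: "w \<in> borel_measurable M" using w by simp
  interpret P: pair_sigma_finite M "gauss :: 'a measure"
    by (rule pair_sigma_finite.intro[OF M]) (rule gauss.sigma_finite_measure_axioms)
  interpret L: pair_sigma_finite M "lborel :: 'a measure"
    by (rule pair_sigma_finite.intro[OF M]) (rule sigma_finite_lborel)
  let ?c = "(1 / sqrt (2 * pi) / \<epsilon>) ^ DIM('a)"
  \<comment> \<open>\<open>gauss_cos\<close> read from right to left, with frequency (x -
    y)/\<epsilon> and integration variable \<zeta>.\<close>
  have dens: "gauss_density ((x - y) /\<^sub>R \<epsilon>) / \<epsilon> ^ DIM('a)
     = ?c * (\<integral>\<zeta>. cos ((\<zeta> /\<^sub>R \<epsilon>) \<bullet> x + (- (\<zeta> /\<^sub>R \<epsilon>) \<bullet> y)) \<partial>gauss)" for x y :: 'a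
  proof -
    have "(\<integral>\<zeta>. cos ((\<zeta> /\<^sub>R \<epsilon>) \<bullet> x + (- (\<zeta> /\<^sub>R \<epsilon>) \<bullet> y)) \<partial>gauss) = (\<integral>\<zeta>. cos (((x - y) /\<^sub>R \<epsilon>) \<bullet> \<zeta> + 0) \<partial>gauss)"
      by (intro Bochner_Integration.integral_cong refl arg_cong[where f = cos])
        (simp add: inner_diff_left inner_diff_right inner_commute algebra_simps)
    also have "\<dots> = exp (- (norm ((x - y) /\<^sub>R \<epsilon>))\<^sup>2 / 2)" by (subst gauss_cos) simp
    finally show ?thesis by (simp add: gauss_density_altdef power_divide power_mult_distrib)
  qed
  have one: "(\<integral>m. w m * (\<integral>\<zeta>. cos ((\<zeta> /\<^sub>R \<epsilon>) \<bullet> X m + (- (\<zeta> /\<^sub>R \<epsilon>) \<bullet> y)) \<partial>gauss) \<partial>M)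
      = (\<integral>\<zeta>. (\<integral>m. w m * cos ((\<zeta> /\<^sub>R \<epsilon>) \<bullet> X m + (- (\<zeta> /\<^sub>R \<epsilon>) \<bullet> y)) \<partial>M) \<partial>gauss)" for y
  proof -
    let ?f = "\<lambda>m \<zeta>. w m * cos ((\<zeta> /\<^sub>R \<epsilon>) \<bullet> X m + (- (\<zeta> /\<^sub>R \<epsilon>) \<bullet> y))"
    have "integrable (M \<Otimes>\<^sub>M gauss) (case_prod ?f)"
    proof (rule integrable_pair_dominated[OF M gauss.sigma_finite_measure_axioms _ w, where b = 1])
      show i: "integrable gauss (\<lambda>\<zeta>. case_prod ?f (m, \<zeta>))" for m
        by (rule integrable_gauss_bounded[where b = "\<bar>w m\<bar>"]) (auto simp: abs_mult mult_left_le)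
      show "(\<integral>\<zeta>. \<bar>case_prod ?f (m, \<zeta>)\<bar> \<partial>gauss) \<le> 1 * \<bar>w m\<bar>" for m
      proof -
        have "(\<integral>\<zeta>. \<bar>case_prod ?f (m, \<zeta>)\<bar> \<partial>gauss) \<le> (\<integral>\<zeta>. \<bar>w m\<bar> \<partial>(gauss :: 'a measure))"
          using i[of m] by (intro integral_mono) (auto simp: abs_mult mult_left_le)
        then show ?thesis by (simp add: gauss.prob_space[simplified])
      qed
    qed measurable
    from P.Fubini_integral[OF this] show ?thesis by simp
  qed
  have "(\<integral>m. w m * (\<integral>z. g (X m + \<epsilon> *\<^sub>R z) \<partial>gauss) \<partial>M)
     = (\<integral>m. (\<integral>y. w m * (g y * (gauss_density ((X m - y) /\<^sub>R \<epsilon>) / \<epsilon> ^ DIM('a))) \<partial>lborel) \<partial>M)"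
    using \<epsilon> by (simp add: gauss_affine)
  also have "\<dots> = (\<integral>y. (\<integral>m. w m * (g y * (gauss_density ((X m - y) /\<^sub>R \<epsilon>) / \<epsilon> ^ DIM('a))) \<partial>M) \<partial>lborel)"
  proof -
    let ?f = "\<lambda>m y. w m * (g y * (gauss_density ((X m - y) /\<^sub>R \<epsilon>) / \<epsilon> ^ DIM('a)))"
    let ?k = "\<lambda>x y :: 'a. gauss_density ((x - y) /\<^sub>R \<epsilon>) / \<epsilon> ^ DIM('a)"
    have k1: "(\<integral>y. ?k x y \<partial>lborel) = 1" for x
    proof -
      have "(\<integral>z. 1 \<partial>(gauss :: 'a measure)) = (\<integral>y. 1 * ?k x y \<partial>lborel)"
        by (rule gauss_affine) (use \<epsilon> in auto)
      moreover have "(\<integral>z. (1 :: real) \<partial>(gauss :: 'a measure)) = 1"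
        by (simp add: gauss.prob_space[simplified])
      ultimately show ?thesis by (simp only: mult_1_left)
    qed
    \<comment> \<open>A nonintegrable function would have integral 0 by default, so the value 1 in
      \<open>k1\<close> already yields integrability.\<close>
    have ki: "integrable lborel (?k x)" for x
    proof (rule ccontr)
      assume "\<not> ?thesis"
      then have "(\<integral>y. ?k x y \<partial>lborel) = 0" by (rule not_integrable_integral_eq)
      then show False using k1[of x] by simp
    qed
    have bd: "\<bar>?f m y\<bar> \<le> \<bar>w m\<bar> * b * ?k (X m) y" for m y
      using gb[of y] \<epsilon> by (simp add: abs_mult mult.assoc) (intro mult_left_mono divide_right_mono mult_right_mono; simp)
    have "integrable (M \<Otimes>\<^sub>M lborel) (case_prod ?f)"
    proof (rule integrable_pair_dominated[OF M sigma_finite_lborel _ w, where b = b])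
      show i: "integrable lborel (\<lambda>y. case_prod ?f (m, y))" if "m \<in> space M" for m
      proof (rule Bochner_Integration.integrable_bound)
        show "integrable lborel (\<lambda>y. \<bar>w m\<bar> * b * ?k (X m) y)" by (rule integrable_mult_right, rule ki)
        show "AE y in lborel. norm (case_prod ?f (m, y)) \<le> norm (\<bar>w m\<bar> * b * ?k (X m) y)"
          using bd[of m] order_trans[OF _ abs_ge_self] by (intro AE_I2) (simp only: real_norm_def prod.case, blast)
      qed (use that in measurable)
      show "(\<integral>y. \<bar>case_prod ?f (m, y)\<bar> \<partial>lborel) \<le> b * \<bar>w m\<bar>" if "m \<in> space M" for m
      proof -
        have "(\<integral>y. \<bar>case_prod ?f (m, y)\<bar> \<partial>lborel) \<le> (\<integral>y. \<bar>w m\<bar> * b * ?k (X m) y \<partial>lborel)"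
          using i[OF that] ki[of "X m"] bd[of m] by (intro integral_mono integrable_abs) (simp_all only: prod.case integrable_mult_right)
        also have "\<dots> = b * \<bar>w m\<bar>" using k1[of "X m"] by (simp only: Bochner_Integration.integral_mult_right_zero mult_1_right mult.commute)
        finally show ?thesis .
      qed
    qed measurable
    from L.Fubini_integral[OF this] show ?thesis by (rule sym)
  qed
  also have "\<dots> = (\<integral>y. g y * (?c *
         (\<integral>\<zeta>. (\<integral>m. w m * cos ((\<zeta> /\<^sub>R \<epsilon>) \<bullet> X m + (- (\<zeta> /\<^sub>R \<epsilon>) \<bullet> y)) \<partial>M) \<partial>gauss)) \<partial>lborel)"
  proof (rule Bochner_Integration.integral_cong[OF refl])
    fix y :: 'a
    have "(\<integral>m. w m * (g y * (gauss_density ((X m - y) /\<^sub>R \<epsilon>) / \<epsilon> ^ DIM('a))) \<partial>M)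
       = (\<integral>m. (g y * ?c) * (w m * (\<integral>\<zeta>. cos ((\<zeta> /\<^sub>R \<epsilon>) \<bullet> X m + (- (\<zeta> /\<^sub>R \<epsilon>) \<bullet> y)) \<partial>gauss)) \<partial>M)"
      unfolding dens by (intro Bochner_Integration.integral_cong refl) (simp only: mult_ac)
    also have "\<dots> = (g y * ?c) * (\<integral>m. w m * (\<integral>\<zeta>. cos ((\<zeta> /\<^sub>R \<epsilon>) \<bullet> X m + (- (\<zeta> /\<^sub>R \<epsilon>) \<bullet> y)) \<partial>gauss) \<partial>M)"
      by (rule integral_mult_right_zero)
    finally show "(\<integral>m. w m * (g y * (gauss_density ((X m - y) /\<^sub>R \<epsilon>) / \<epsilon> ^ DIM('a))) \<partial>M)
      = g y * (?c * (\<integral>\<zeta>. (\<integral>m. w m * cos ((\<zeta> /\<^sub>R \<epsilon>) \<bullet> X m + (- (\<zeta> /\<^sub>R \<epsilon>) \<bullet> y)) \<partial>M) \<partial>gauss))"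
      unfolding one by (simp only: mult.assoc)
  qed
  finally show ?thesis .
qed

lemma continuous_on_borel_measurable:
  fixes g :: "'a::euclidean_space \<Rightarrow> real"
  assumes "continuous_on UNIV g" shows "g \<in> borel_measurable borel"
  using assms by (rule borel_measurable_continuous_onI)

lemma gauss_smoothing_limit:
  fixes X :: "'m \<Rightarrow> 'a::euclidean_space" and g :: "'a \<Rightarrow> real"
  assumes X [measurable]: "X \<in> measurable M borel"
    and w: "integrable M w" and g: "continuous_on UNIV g" and gb: "\<And>x. \<bar>g x\<bar> \<le> b"
  shows "(\<lambda>n. \<integral>m. w m * (\<integral>z. g (X m + (1 / real (Suc n)) *\<^sub>R z) \<partial>gauss) \<partial>M) \<longlonglongrightarrow> (\<integral>m. w m * g (X m) \<partial>M)"
proof -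
  have [measurable]: "g \<in> borel_measurable borel" using g by (rule continuous_on_borel_measurable)
  have [measurable]: "w \<in> borel_measurable M" using w by simp
  have inner: "(\<lambda>n. \<integral>z. g (x + (1 / real (Suc n)) *\<^sub>R z) \<partial>gauss) \<longlonglongrightarrow> g x" for x
  proof -
    have "(\<lambda>n. \<integral>z. g (x + (1 / real (Suc n)) *\<^sub>R z) \<partial>gauss) \<longlonglongrightarrow> (\<integral>z. g x \<partial>(gauss :: 'a measure))"
    proof (rule integral_dominated_convergence[where w = "\<lambda>_. b"])
      show "AE z in gauss. (\<lambda>n. g (x + (1 / real (Suc n)) *\<^sub>R z)) \<longlonglongrightarrow> g x"
      proof (rule AE_I2)
        fix z :: 'a
        have "(\<lambda>n. x + (1 / real (Suc n)) *\<^sub>R z) \<longlonglongrightarrow> x + 0 *\<^sub>R z"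
          by (intro tendsto_intros LIMSEQ_inverse_real_of_nat[unfolded inverse_eq_divide])
        then show "(\<lambda>n. g (x + (1 / real (Suc n)) *\<^sub>R z)) \<longlonglongrightarrow> g x"
          using g by (intro continuous_on_tendsto_compose[OF g]) auto
      qed
    qed (use gb in auto)
    then show ?thesis by (simp add: gauss.prob_space[simplified])
  qed
  have bnd: "\<bar>\<integral>z. g (x + c *\<^sub>R z) \<partial>gauss\<bar> \<le> b" for x c
  proof -
    have "\<bar>\<integral>z. g (x + c *\<^sub>R z) \<partial>gauss\<bar> \<le> (\<integral>z. \<bar>g (x + c *\<^sub>R z)\<bar> \<partial>gauss)" by (rule integral_abs_bound)
    also have "\<dots> \<le> (\<integral>z. b \<partial>(gauss :: 'a measure))"
      by (intro integral_mono integrable_abs integrable_gauss_bounded[where b = b]) (use gb order_trans[OF abs_ge_zero gb] in auto)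
    finally show ?thesis by (simp add: gauss.prob_space[simplified])
  qed
  show ?thesis
  proof (rule integral_dominated_convergence[where w = "\<lambda>m. \<bar>w m\<bar> * b"])
    show "AE m in M. (\<lambda>n. w m * (\<integral>z. g (X m + (1 / real (Suc n)) *\<^sub>R z) \<partial>gauss)) \<longlonglongrightarrow> w m * g (X m)"
      by (intro AE_I2 tendsto_intros inner)
    show "AE m in M. norm (w m * (\<integral>z. g (X m + (1 / real (Suc n)) *\<^sub>R z) \<partial>gauss)) \<le> \<bar>w m\<bar> * b" for n
      using bnd by (intro AE_I2) (simp add: abs_mult mult_left_mono)
    show "(\<lambda>m. w m * (\<integral>z. g (X m + (1 / real (Suc n)) *\<^sub>R z) \<partial>gauss)) \<in> borel_measurable M" for n
      by measurable
  qed (use w in auto)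
qed

text \<open>Uniqueness of characteristic functions. The weights are signed, since no sign of a
  solution is known at this stage, and the two sides may live on different spaces, so that laws of
  random vectors on products can be compared. The smoothed integrals agree for every width
  \<epsilon>, which then tends to 0.\<close>

theorem cos_integrals_determine_integrals:
  fixes X1 :: "'m1 \<Rightarrow> 'a::euclidean_space" and X2 :: "'m2 \<Rightarrow> 'a" and g :: "'a \<Rightarrow> real"
  assumes M1: "sigma_finite_measure M1" and X1: "X1 \<in> measurable M1 borel" and w1: "integrable M1 w1"
    and M2: "sigma_finite_measure M2" and X2: "X2 \<in> measurable M2 borel" and w2: "integrable M2 w2"
    and eq: "\<And>\<xi> \<theta>. (\<integral>m. w1 m * cos (\<xi> \<bullet> X1 m + \<theta>) \<partial>M1) = (\<integral>m. w2 m * cos (\<xi> \<bullet> X2 m + \<theta>) \<partial>M2)"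
    and g: "continuous_on UNIV g" and gb: "\<And>x. \<bar>g x\<bar> \<le> b"
  shows "(\<integral>m. w1 m * g (X1 m) \<partial>M1) = (\<integral>m. w2 m * g (X2 m) \<partial>M2)"
proof -
  have gm: "g \<in> borel_measurable borel" using g by (rule continuous_on_borel_measurable)
  have "(\<integral>m. w1 m * (\<integral>z. g (X1 m + \<epsilon> *\<^sub>R z) \<partial>gauss) \<partial>M1) = (\<integral>m. w2 m * (\<integral>z. g (X2 m + \<epsilon> *\<^sub>R z) \<partial>gauss) \<partial>M2)"
    if "\<epsilon> > 0" for \<epsilon>
    unfolding gauss_smoothing_via_cos[OF M1 X1 w1 gm gb that] gauss_smoothing_via_cos[OF M2 X2 w2 gm gb that] eq ..
  then have "(\<lambda>n. \<integral>m. w1 m * (\<integral>z. g (X1 m + (1 / real (Suc n)) *\<^sub>R z) \<partial>gauss) \<partial>M1) \<longlonglongrightarrow> (\<integral>m. w2 m * g (X2 m) \<partial>M2)"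
    using gauss_smoothing_limit[OF X2 w2 g gb] by simp
  then show ?thesis using gauss_smoothing_limit[OF X1 w1 g gb] LIMSEQ_unique by blast
qed

section \<open>Mehler operators\<close>

lemma Holder_inequality:
  fixes f g :: "'a \<Rightarrow> real"
  assumes p: "p > 1" "q > 1" "1 / p + 1 / q = 1"
    and [measurable]: "f \<in> borel_measurable M" "g \<in> borel_measurable M"
    and f: "integrable M (\<lambda>x. \<bar>f x\<bar> powr p)" and g: "integrable M (\<lambda>x. \<bar>g x\<bar> powr q)"
  shows "integrable M (\<lambda>x. f x * g x)"
    and "\<bar>\<integral>x. f x * g x \<partial>M\<bar> \<le> (\<integral>x. \<bar>f x\<bar> powr p \<partial>M) powr (1 / p) * (\<integral>x. \<bar>g x\<bar> powr q \<partial>M) powr (1 / q)"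
proof -
  have y: "\<bar>f x * g x\<bar> \<le> \<bar>f x\<bar> powr p / p + \<bar>g x\<bar> powr q / q" for x
    using Youngs_inequality[OF p, of "\<bar>f x\<bar>" "\<bar>g x\<bar>"] by (simp add: abs_mult)
  show fg: "integrable M (\<lambda>x. f x * g x)"
  proof (rule Bochner_Integration.integrable_bound)
    show "integrable M (\<lambda>x. \<bar>f x\<bar> powr p / p + \<bar>g x\<bar> powr q / q)" using f g by simp
    show "AE x in M. norm (f x * g x) \<le> norm (\<bar>f x\<bar> powr p / p + \<bar>g x\<bar> powr q / q)"
      using y order_trans[OF _ abs_ge_self] by (intro AE_I2) (simp only: real_norm_def, blast)
  qed measurable
  define F where "F = (\<integral>x. \<bar>f x\<bar> powr p \<partial>M) powr (1 / p)"
  define G where "G = (\<integral>x. \<bar>g x\<bar> powr q \<partial>M) powr (1 / q)"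
  have nf: "0 \<le> (\<integral>x. \<bar>f x\<bar> powr p \<partial>M)" "0 \<le> (\<integral>x. \<bar>g x\<bar> powr q \<partial>M)" by auto
  show "\<bar>\<integral>x. f x * g x \<partial>M\<bar> \<le> (\<integral>x. \<bar>f x\<bar> powr p \<partial>M) powr (1 / p) * (\<integral>x. \<bar>g x\<bar> powr q \<partial>M) powr (1 / q)"
  \<comment> \<open>Normalising f and g requires both norms to be positive; otherwise the product
    vanishes almost everywhere.\<close>
  proof (cases "(\<integral>x. \<bar>f x\<bar> powr p \<partial>M) = 0 \<or> (\<integral>x. \<bar>g x\<bar> powr q \<partial>M) = 0")
    case True
    then have "AE x in M. f x * g x = 0"
    proof
      assume "(\<integral>x. \<bar>f x\<bar> powr p \<partial>M) = 0"
      then have "AE x in M. \<bar>f x\<bar> powr p = 0" using f by (subst (asm) integral_nonneg_eq_0_iff_AE) auto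
      then show ?thesis by eventually_elim simp
    next
      assume "(\<integral>x. \<bar>g x\<bar> powr q \<partial>M) = 0"
      then have "AE x in M. \<bar>g x\<bar> powr q = 0" using g by (subst (asm) integral_nonneg_eq_0_iff_AE) auto
      then show ?thesis by eventually_elim simp
    qed
    then have "(\<integral>x. f x * g x \<partial>M) = 0" by (rule integral_eq_zero_AE)
    then show ?thesis by simp
  next
    case False
    then have pos: "(\<integral>x. \<bar>f x\<bar> powr p \<partial>M) > 0" "(\<integral>x. \<bar>g x\<bar> powr q \<partial>M) > 0" using nf by linarith+
    then have FG: "F > 0" "G > 0" unfolding F_def G_def by auto
    have Fp: "F powr p = (\<integral>x. \<bar>f x\<bar> powr p \<partial>M)" "G powr q = (\<integral>x. \<bar>g x\<bar> powr q \<partial>M)"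
      using pos p unfolding F_def G_def by (simp_all add: powr_powr)
    have "\<bar>\<integral>x. f x * g x \<partial>M\<bar> \<le> (\<integral>x. \<bar>f x * g x\<bar> \<partial>M)" by (rule integral_abs_bound)
    also have "\<dots> \<le> (\<integral>x. F * G * (\<bar>f x\<bar> powr p / F powr p / p + \<bar>g x\<bar> powr q / G powr q / q) \<partial>M)"
    proof (rule integral_mono)
      fix x
      have "\<bar>f x\<bar> / F * (\<bar>g x\<bar> / G) \<le> (\<bar>f x\<bar> / F) powr p / p + (\<bar>g x\<bar> / G) powr q / q"
        using FG by (intro Youngs_inequality p) auto
      then have "F * G * (\<bar>f x\<bar> / F * (\<bar>g x\<bar> / G)) \<le> F * G * ((\<bar>f x\<bar> / F) powr p / p + (\<bar>g x\<bar> / G) powr q / q)"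
        using FG by (intro mult_left_mono) auto
      then show "\<bar>f x * g x\<bar> \<le> F * G * (\<bar>f x\<bar> powr p / F powr p / p + \<bar>g x\<bar> powr q / G powr q / q)"
        using FG by (simp add: abs_mult powr_divide)
    qed (use fg f g in auto)
    also have "\<dots> = F * G * ((\<integral>x. \<bar>f x\<bar> powr p \<partial>M) / F powr p / p + (\<integral>x. \<bar>g x\<bar> powr q \<partial>M) / G powr q / q)"
      using f g by simp
    also have "\<dots> = F * G * (1 / p + 1 / q)" using pos unfolding Fp by simp
    finally show ?thesis using p(3) unfolding F_def G_def by simp
  qed
qed

lemma Cauchy_Schwarz_integral:
  fixes f g :: "'a \<Rightarrow> real"
  assumes [measurable]: "f \<in> borel_measurable M" "g \<in> borel_measurable M"
    and f: "integrable M (\<lambda>x. (f x)\<^sup>2)" and g: "integrable M (\<lambda>x. (g x)\<^sup>2)"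
  shows "\<bar>\<integral>x. f x * g x \<partial>M\<bar> \<le> sqrt (\<integral>x. (f x)\<^sup>2 \<partial>M) * sqrt (\<integral>x. (g x)\<^sup>2 \<partial>M)"
proof -
  have p2: "\<bar>y\<bar> powr 2 = y\<^sup>2" for y :: real by (simp add: powr_numeral)
  have "\<bar>\<integral>x. f x * g x \<partial>M\<bar> \<le> (\<integral>x. \<bar>f x\<bar> powr 2 \<partial>M) powr (1 / 2) * (\<integral>x. \<bar>g x\<bar> powr 2 \<partial>M) powr (1 / 2)"
    by (rule Holder_inequality) (use f g in \<open>auto simp: p2\<close>)
  then show ?thesis unfolding p2 by (simp add: powr_half_sqrt)
qed

lemma integral_pair_prob:
  fixes f :: "'a \<times> 'b \<Rightarrow> real"
  assumes M: "prob_space M" and N: "prob_space N"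
    and f [measurable]: "f \<in> borel_measurable (M \<Otimes>\<^sub>M N)" and b: "\<And>x. \<bar>f x\<bar> \<le> b"
  shows "(\<integral>p. f p \<partial>(M \<Otimes>\<^sub>M N)) = (\<integral>x. (\<integral>y. f (x, y) \<partial>N) \<partial>M)"
proof -
  interpret M: prob_space M by (rule M)
  interpret N: prob_space N by (rule N)
  interpret P: pair_prob_space M N ..
  have "integrable (M \<Otimes>\<^sub>M N) f" by (rule P.integrable_const_bound[where B = b]) (use b in auto)
  from P.integral_fst'[OF this] show ?thesis by simp
qed

definition mehler :: "real^'d^'d \<Rightarrow> real^'d^'d \<Rightarrow> (real^'d \<Rightarrow> real) \<Rightarrow> real^'d \<Rightarrow> real" where
  "mehler A B G x = (\<integral>z. G (A *v x + B *v z) \<partial>gauss)"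

lemma measurable_matrix_vector_mult [measurable]:
  "f \<in> borel_measurable M \<Longrightarrow> (\<lambda>x. (A :: real^'d^'e) *v f x) \<in> borel_measurable M"
  by (rule borel_measurable_continuous_on[where f = "(*v) A"])
    (intro matrix_vector_mult_linear_continuous_on)

lemma gauss_product_sigma:
  "prob_space ((gauss :: 'a::euclidean_space measure) \<Otimes>\<^sub>M (gauss :: 'b::euclidean_space measure))"
proof -
  interpret pair_prob_space "gauss :: 'a measure" "gauss :: 'b measure" ..
  show ?thesis by unfold_locales
qed

lemma mehler_measurable [measurable]:
  assumes [measurable]: "G \<in> borel_measurable borel"
  shows "mehler A B G \<in> borel_measurable borel"
  unfolding mehler_def[abs_def] by measurable

lemma mehler_bound:
  fixes G :: "real^'d \<Rightarrow> real"
  assumes [measurable]: "G \<in> borel_measurable borel" and b: "\<And>x. \<bar>G x\<bar> \<le> b"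
  shows "\<bar>mehler A B G x\<bar> \<le> b"
proof -
  have "\<bar>mehler A B G x\<bar> \<le> (\<integral>z. \<bar>G (A *v x + B *v z)\<bar> \<partial>gauss)" unfolding mehler_def by (rule integral_abs_bound)
  also have "\<dots> \<le> (\<integral>z. b \<partial>(gauss :: (real^'d) measure))"
    by (intro integral_mono integrable_abs integrable_gauss_bounded[where b = b])
      (use b order_trans[OF abs_ge_zero b] in auto)
  finally show ?thesis by (simp add: gauss.prob_space[simplified])
qed

lemma gauss_cos_pair:
  fixes A B :: "real^'d^'d"
  shows "(\<integral>p. 1 * cos (\<xi> \<bullet> (A *v fst p + B *v snd p) + \<theta>) \<partial>(gauss \<Otimes>\<^sub>M gauss))
     = exp (- ((norm (\<xi> v* A))\<^sup>2 + (norm (\<xi> v* B))\<^sup>2) / 2) * cos \<theta>"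
proof -
  have "(\<integral>p. 1 * cos (\<xi> \<bullet> (A *v fst p + B *v snd p) + \<theta>) \<partial>(gauss \<Otimes>\<^sub>M gauss))
     = (\<integral>x. (\<integral>z. 1 * cos (\<xi> \<bullet> (A *v fst (x, z) + B *v snd (x, z)) + \<theta>) \<partial>gauss) \<partial>gauss)"
    by (rule integral_pair_prob[where b = 1]) (auto intro: prob_space_gauss)
  also have "\<dots> = (\<integral>x. (\<integral>z. cos ((\<xi> v* B) \<bullet> z + ((\<xi> v* A) \<bullet> x + \<theta>)) \<partial>gauss) \<partial>gauss)"
    by (simp add: dot_lmul_matrix inner_add_right add_ac)
  also have "\<dots> = exp (- (norm (\<xi> v* B))\<^sup>2 / 2) * (exp (- (norm (\<xi> v* A))\<^sup>2 / 2) * cos \<theta>)"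
    unfolding gauss_cos integral_mult_right_zero ..
  finally show ?thesis by (simp add: mult.assoc[symmetric] exp_add[symmetric] add_divide_distrib diff_divide_distrib)
qed

lemma norm_vector_matrix_split:
  fixes A B :: "real^'d^'d"
  assumes "A ** transpose A + B ** transpose B = mat 1"
  shows "(\<xi> v* A) \<bullet> (\<eta> v* A) + (\<xi> v* B) \<bullet> (\<eta> v* B) = \<xi> \<bullet> \<eta>"
proof -
  have "(\<xi> v* A) \<bullet> (\<eta> v* A) = \<xi> \<bullet> ((A ** transpose A) *v \<eta>)" for A :: "real^'d^'d"
    by (simp add: dot_lmul_matrix matrix_vector_mul_assoc[symmetric])
  then have "(\<xi> v* A) \<bullet> (\<eta> v* A) + (\<xi> v* B) \<bullet> (\<eta> v* B) = \<xi> \<bullet> ((A ** transpose A + B ** transpose B) *v \<eta>)"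
    by (simp add: matrix_vector_mult_add_rdistrib inner_add_right)
  then show ?thesis using assms by simp
qed

text \<open>For independent standard Gaussians X and Y the vector A X + B Y has covariance A A^T + B
  B^T = 1, so it is again standard Gaussian.\<close>

lemma mehler_invariant:
  fixes A B :: "real^'d^'d"
  assumes AB: "A ** transpose A + B ** transpose B = mat 1"
    and G: "continuous_on UNIV G" and b: "\<And>x. \<bar>G x\<bar> \<le> b"
  shows "(\<integral>x. mehler A B G x \<partial>gauss) = (\<integral>x. G x \<partial>gauss)"
proof -
  have [measurable]: "G \<in> borel_measurable borel" using G by (rule continuous_on_borel_measurable)
  have s: "(norm (\<xi> v* A))\<^sup>2 + (norm (\<xi> v* B))\<^sup>2 = (norm \<xi>)\<^sup>2" for \<xi>
    using norm_vector_matrix_split[OF AB, of \<xi> \<xi>] by (simp add: power2_norm_eq_inner)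
  interpret PP: prob_space "(gauss :: (real^'d) measure) \<Otimes>\<^sub>M (gauss :: (real^'d) measure)"
    by (rule gauss_product_sigma)
  have "(\<integral>p. 1 * G (A *v fst p + B *v snd p) \<partial>(gauss \<Otimes>\<^sub>M gauss)) = (\<integral>x. 1 * G x \<partial>gauss)"
  proof (rule cos_integrals_determine_integrals[OF PP.sigma_finite_measure_axioms _ _ gauss.sigma_finite_measure_axioms _ _ _ G b])
    show "(\<integral>p. 1 * cos (\<xi> \<bullet> (A *v fst p + B *v snd p) + \<theta>) \<partial>(gauss \<Otimes>\<^sub>M gauss)) = (\<integral>x. 1 * cos (\<xi> \<bullet> x + \<theta>) \<partial>gauss)" for \<xi> \<theta>
      unfolding gauss_cos_pair s using gauss_cos[of \<xi> \<theta>] by simp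
  qed auto
  moreover have "(\<integral>p. 1 * G (A *v fst p + B *v snd p) \<partial>(gauss \<Otimes>\<^sub>M gauss))
    = (\<integral>x. (\<integral>z. 1 * G (A *v fst (x, z) + B *v snd (x, z)) \<partial>gauss) \<partial>gauss)"
    by (rule integral_pair_prob[where b = b]) (auto intro: prob_space_gauss b)
  ultimately show ?thesis by (simp add: mehler_def)
qed

text \<open>Take independent standard Gaussians X, Y, Z. The pair (A X + B Y, A X + B Z) has
  standard marginals and cross covariance A A^T = M, hence the same law as (X, M X + N Z). Test both
  with G(first) G(second); conditioning on X produces the square on the left.\<close>

lemma mehler_square:
  fixes A B N :: "real^'d^'d"
  assumes AB: "A ** transpose A + B ** transpose B = mat 1"
    and M: "M = A ** transpose A" and MN: "M ** transpose M + N ** transpose N = mat 1"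
    and G: "continuous_on UNIV G" and b: "\<And>x. \<bar>G x\<bar> \<le> b"
  shows "(\<integral>x. (mehler A B G x)\<^sup>2 \<partial>gauss) = (\<integral>x. G x * mehler M N G x \<partial>gauss)"
proof -
  have [measurable]: "G \<in> borel_measurable borel" using G by (rule continuous_on_borel_measurable)
  have b0: "b \<ge> 0" using order_trans[OF abs_ge_zero b] .
  let ?g = "gauss :: (real^'d) measure"
  let ?H = "\<lambda>q :: (real^'d) \<times> (real^'d). G (fst q) * G (snd q)"
  interpret PP: prob_space "?g \<Otimes>\<^sub>M ?g" by (rule gauss_product_sigma)
  interpret P3: pair_prob_space ?g "?g \<Otimes>\<^sub>M ?g" ..
  let ?X1 = "\<lambda>p. (A *v fst p + B *v fst (snd p), A *v fst p + B *v snd (snd p))"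
  let ?X2 = "\<lambda>p. (fst p, M *v fst p + N *v snd p)"
  have H: "continuous_on UNIV ?H"
    by (intro continuous_intros continuous_on_compose2[OF G]) auto
  have Hb: "\<bar>?H q\<bar> \<le> b * b" for q using b b0 by (simp add: abs_mult mult_mono)
  have Hm [measurable]: "?H \<in> borel_measurable borel" using H by (rule continuous_on_borel_measurable)
  have "(\<integral>p. 1 * ?H (?X1 p) \<partial>(?g \<Otimes>\<^sub>M (?g \<Otimes>\<^sub>M ?g))) = (\<integral>p. 1 * ?H (?X2 p) \<partial>(?g \<Otimes>\<^sub>M ?g))"
  proof (rule cos_integrals_determine_integrals[OF P3.P.sigma_finite_measure_axioms _ _ PP.sigma_finite_measure_axioms _ _ _ H Hb])
    fix \<zeta> :: "(real^'d) \<times> (real^'d)" and \<theta> :: real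
    obtain \<xi> \<eta> where z: "\<zeta> = (\<xi>, \<eta>)" by (cases \<zeta>)
    have "(\<integral>p. 1 * cos (\<zeta> \<bullet> ?X1 p + \<theta>) \<partial>(?g \<Otimes>\<^sub>M (?g \<Otimes>\<^sub>M ?g)))
       = (\<integral>x. (\<integral>q. 1 * cos (\<zeta> \<bullet> ?X1 (x, q) + \<theta>) \<partial>(?g \<Otimes>\<^sub>M ?g)) \<partial>?g)"
      by (rule integral_pair_prob[where b = 1]) (auto intro: prob_space_gauss gauss_product_sigma)
    also have "\<dots> = (\<integral>x. (\<integral>y. (\<integral>z. 1 * cos (\<zeta> \<bullet> ?X1 (x, y, z) + \<theta>) \<partial>?g) \<partial>?g) \<partial>?g)"
      by (intro Bochner_Integration.integral_cong refl integral_pair_prob[where b = 1]) (auto intro: prob_space_gauss)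
    also have "\<dots> = (\<integral>x. (\<integral>y. (\<integral>z. cos ((\<eta> v* B) \<bullet> z + ((\<xi> v* B) \<bullet> y + ((\<xi> v* A + \<eta> v* A) \<bullet> x + \<theta>))) \<partial>?g) \<partial>?g) \<partial>?g)"
      by (simp add: z dot_lmul_matrix inner_add_right inner_add_left add_ac)
    also have "\<dots> = exp (- (norm (\<eta> v* B))\<^sup>2 / 2) * (exp (- (norm (\<xi> v* B))\<^sup>2 / 2) * (exp (- (norm (\<xi> v* A + \<eta> v* A))\<^sup>2 / 2) * cos \<theta>))"
      unfolding gauss_cos integral_mult_right_zero ..
    also have "\<dots> = exp (- ((norm (\<eta> v* B))\<^sup>2 + (norm (\<xi> v* B))\<^sup>2 + (norm (\<xi> v* A + \<eta> v* A))\<^sup>2) / 2) * cos \<theta>"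
      by (simp add: mult.assoc[symmetric] exp_add[symmetric] add_divide_distrib diff_divide_distrib)
    also have "(norm (\<eta> v* B))\<^sup>2 + (norm (\<xi> v* B))\<^sup>2 + (norm (\<xi> v* A + \<eta> v* A))\<^sup>2
       = \<eta> \<bullet> \<eta> + \<xi> \<bullet> \<xi> + 2 * ((\<xi> v* A) \<bullet> (\<eta> v* A))"
      using norm_vector_matrix_split[OF AB, of \<xi> \<xi>] norm_vector_matrix_split[OF AB, of \<eta> \<eta>]
      by (simp add: power2_norm_eq_inner inner_add_left inner_add_right inner_commute)
    also have "(\<xi> v* A) \<bullet> (\<eta> v* A) = \<xi> \<bullet> (\<eta> v* M)"
      by (simp add: M dot_lmul_matrix vector_matrix_mul_assoc[symmetric])
    also have "\<eta> \<bullet> \<eta> + \<xi> \<bullet> \<xi> + 2 * (\<xi> \<bullet> (\<eta> v* M)) = (norm (\<eta> v* N))\<^sup>2 + (norm (\<xi> + \<eta> v* M))\<^sup>2"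
      using norm_vector_matrix_split[OF MN, of \<eta> \<eta>]
      by (simp add: power2_norm_eq_inner inner_add_left inner_add_right inner_commute)
    also have "exp (- ((norm (\<eta> v* N))\<^sup>2 + (norm (\<xi> + \<eta> v* M))\<^sup>2) / 2) * cos \<theta>
       = exp (- (norm (\<eta> v* N))\<^sup>2 / 2) * (exp (- (norm (\<xi> + \<eta> v* M))\<^sup>2 / 2) * cos \<theta>)"
      by (simp add: mult.assoc[symmetric] exp_add[symmetric] add_divide_distrib diff_divide_distrib)
    also have "\<dots> = (\<integral>x. (\<integral>z. cos ((\<eta> v* N) \<bullet> z + ((\<xi> + \<eta> v* M) \<bullet> x + \<theta>)) \<partial>?g) \<partial>?g)"
      unfolding gauss_cos integral_mult_right_zero ..
    also have "\<dots> = (\<integral>x. (\<integral>z. 1 * cos (\<zeta> \<bullet> ?X2 (x, z) + \<theta>) \<partial>?g) \<partial>?g)"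
      by (simp add: z dot_lmul_matrix inner_add_right inner_add_left add_ac)
    also have "\<dots> = (\<integral>p. 1 * cos (\<zeta> \<bullet> ?X2 p + \<theta>) \<partial>(?g \<Otimes>\<^sub>M ?g))"
      by (rule integral_pair_prob[where b = 1, symmetric]) (auto intro: prob_space_gauss)
    finally show "(\<integral>p. 1 * cos (\<zeta> \<bullet> ?X1 p + \<theta>) \<partial>(?g \<Otimes>\<^sub>M (?g \<Otimes>\<^sub>M ?g))) = (\<integral>p. 1 * cos (\<zeta> \<bullet> ?X2 p + \<theta>) \<partial>(?g \<Otimes>\<^sub>M ?g))" .
  qed auto
  moreover have "(\<integral>p. 1 * ?H (?X1 p) \<partial>(?g \<Otimes>\<^sub>M (?g \<Otimes>\<^sub>M ?g))) = (\<integral>x. (\<integral>q. 1 * ?H (?X1 (x, q)) \<partial>(?g \<Otimes>\<^sub>M ?g)) \<partial>?g)"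
    by (rule integral_pair_prob[where b = "b * b"]) (use Hb in \<open>auto intro: prob_space_gauss gauss_product_sigma\<close>)
  moreover have "(\<integral>q. 1 * ?H (?X1 (x, q)) \<partial>(?g \<Otimes>\<^sub>M ?g)) = (mehler A B G x)\<^sup>2" for x
  proof -
    have "(\<integral>q. 1 * ?H (?X1 (x, q)) \<partial>(?g \<Otimes>\<^sub>M ?g)) = (\<integral>y. (\<integral>z. 1 * ?H (?X1 (x, (y, z))) \<partial>?g) \<partial>?g)"
      by (rule integral_pair_prob[where b = "b * b"]) (use Hb in \<open>auto intro: prob_space_gauss\<close>)
    then show ?thesis by (simp add: mehler_def power2_eq_square)
  qed
  moreover have "(\<integral>p. 1 * ?H (?X2 p) \<partial>(?g \<Otimes>\<^sub>M ?g)) = (\<integral>x. (\<integral>z. 1 * ?H (?X2 (x, z)) \<partial>?g) \<partial>?g)"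
    by (rule integral_pair_prob[where b = "b * b"]) (use Hb in \<open>auto intro: prob_space_gauss\<close>)
  ultimately show ?thesis by (simp add: mehler_def)
qed

section \<open>Contraction on mean-zero functions\<close>

lemma norm_matrix_vector_le_of_transpose:
  fixes A :: "real^'d^'e"
  assumes "\<And>\<xi>. norm (\<xi> v* A) \<le> c * norm \<xi>"
  shows "norm (A *v y) \<le> c * norm y"
proof (cases "A *v y = 0")
  case True
  have "0 \<le> c * norm y" if "y \<noteq> 0"
  proof -
    have "0 \<le> c * norm (1 :: real^'e)" using assms[of 1] norm_ge_zero order_trans by blast
    then have "0 \<le> c" by (simp add: zero_le_mult_iff)
    then show ?thesis by simp
  qed
  then show ?thesis using True by (cases "y = 0") auto
next
  case False
  have "norm (A *v y) * norm (A *v y) = ((A *v y) v* A) \<bullet> y"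
    by (simp add: dot_lmul_matrix power2_norm_eq_inner[symmetric] power2_eq_square)
  also have "\<dots> \<le> norm ((A *v y) v* A) * norm y" by (rule norm_cauchy_schwarz)
  also have "\<dots> \<le> c * norm (A *v y) * norm y" using assms by (intro mult_right_mono) auto
  finally have "norm (A *v y) * norm (A *v y) \<le> norm (A *v y) * (c * norm y)" by (simp add: mult_ac)
  then show ?thesis using False by simp
qed

lemma integrable_gauss_exp_square:
  assumes "\<kappa> < 1 / 2"
  shows "integrable (gauss :: 'a::euclidean_space measure) (\<lambda>x. exp (\<kappa> * (norm x)\<^sup>2))"
  by (rule integrableI_nonneg) (use nn_integral_gauss_exp_square_finite[OF assms, where ?'a = 'a] in auto)

lemma integrable_gauss_norm: "integrable (gauss :: 'a::euclidean_space measure) norm"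
proof (rule Bochner_Integration.integrable_bound)
  show "integrable (gauss :: 'a measure) (\<lambda>x. exp (1 / 4 * (norm x)\<^sup>2))"
    by (rule integrable_gauss_exp_square) simp
  show "AE x :: 'a in gauss. norm (norm x) \<le> norm (exp (1 / 4 * (norm x)\<^sup>2))"
  proof (rule AE_I2)
    fix x :: 'a
    have "0 \<le> (norm x / 2 - 1)\<^sup>2" by simp
    then have "norm x \<le> 1 + 1 / 4 * (norm x)\<^sup>2" by (simp add: power2_eq_square algebra_simps)
    also have "\<dots> \<le> exp (1 / 4 * (norm x)\<^sup>2)" by (rule exp_ge_add_one_self)
    finally show "norm (norm x) \<le> norm (exp (1 / 4 * (norm x)\<^sup>2))" by simp
  qed
qed auto

text \<open>For mean zero, the value at x is the average over y of the difference between the values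
  at x and at y. The noise is common to both, so the arguments differ only by M (x - y).\<close>

lemma mehler_lipschitz_centered:
  fixes M N :: "real^'d^'d"
  assumes MN: "M ** transpose M + N ** transpose N = mat 1"
    and \<delta>: "\<And>x. norm (M *v x) \<le> \<delta> * norm x"
    and L: "\<And>x y. \<bar>G x - G y\<bar> \<le> L * norm (x - y)" "L \<ge> 0"
    and b: "\<And>x. \<bar>G x\<bar> \<le> b" and G0: "(\<integral>x. G x \<partial>gauss) = 0"
  shows "\<bar>mehler M N G x\<bar> \<le> L * \<delta> * (norm x + (\<integral>y. norm y \<partial>(gauss :: (real^'d) measure)))"
proof -
  have G: "continuous_on UNIV G"
    by (rule lipschitz_on_continuous_on[where L = L]) (use L in \<open>auto simp: lipschitz_on_def dist_norm\<close>)
  have [measurable]: "G \<in> borel_measurable borel" using G by (rule continuous_on_borel_measurable)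
  have diff: "\<bar>mehler M N G x - mehler M N G y\<bar> \<le> L * \<delta> * (norm x + norm y)" for y
  proof -
    have i: "integrable gauss (\<lambda>z. G (M *v x + N *v z))" for x
      by (rule integrable_gauss_bounded[where b = b]) (auto simp: b)
    have "norm (x - y) \<le> norm x + norm y" by (rule norm_triangle_ineq4)
    moreover have "0 \<le> \<delta>"
    proof -
      have "0 \<le> \<delta> * norm (1 :: real^'d)" using \<delta>[of 1] norm_ge_zero order_trans by blast
      then show ?thesis by (simp add: zero_le_mult_iff)
    qed
    ultimately have "norm (M *v (x - y)) \<le> \<delta> * (norm x + norm y)"
      using order_trans[OF \<delta>[of "x - y"] mult_left_mono] by blast
    then have le: "L * norm (M *v (x - y)) \<le> L * \<delta> * (norm x + norm y)"
      using L(2) by (simp add: mult.assoc mult_left_mono)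
    have "\<bar>mehler M N G x - mehler M N G y\<bar> = \<bar>\<integral>z. G (M *v x + N *v z) - G (M *v y + N *v z) \<partial>gauss\<bar>"
      unfolding mehler_def by (simp add: i)
    also have "\<dots> \<le> (\<integral>z. \<bar>G (M *v x + N *v z) - G (M *v y + N *v z)\<bar> \<partial>gauss)" by (rule integral_abs_bound)
    also have "\<dots> \<le> (\<integral>z. L * \<delta> * (norm x + norm y) \<partial>(gauss :: (real^'d) measure))"
    proof (rule integral_mono)
      fix z
      have "\<bar>G (M *v x + N *v z) - G (M *v y + N *v z)\<bar> \<le> L * norm (M *v (x - y))"
        using L(1)[of "M *v x + N *v z" "M *v y + N *v z"] by (simp add: matrix_vector_mult_diff_distrib)
      then show "\<bar>G (M *v x + N *v z) - G (M *v y + N *v z)\<bar> \<le> L * \<delta> * (norm x + norm y)" using le by simp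
    qed (auto simp: i)
    finally show ?thesis by (simp add: gauss.prob_space[simplified])
  qed
  have im: "integrable gauss (mehler M N G)"
    by (rule integrable_gauss_bounded[where b = b]) (auto intro: mehler_bound b)
  have "mehler M N G x = (\<integral>y. mehler M N G x - mehler M N G y \<partial>gauss)"
    using mehler_invariant[OF MN G b] G0 im by (simp add: gauss.prob_space[simplified])
  also have "\<bar>\<dots>\<bar> \<le> (\<integral>y. \<bar>mehler M N G x - mehler M N G y\<bar> \<partial>gauss)" by (rule integral_abs_bound)
  also have "\<dots> \<le> (\<integral>y. L * \<delta> * (norm x + norm y) \<partial>(gauss :: (real^'d) measure))"
    using diff im integrable_gauss_norm by (intro integral_mono) auto
  also have "\<dots> = L * \<delta> * (norm x + (\<integral>y. norm y \<partial>(gauss :: (real^'d) measure)))"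
    using integrable_gauss_norm[where ?'a = "real^'d"] by (simp add: gauss.prob_space[simplified])
  finally show ?thesis .
qed

text \<open>With \<open>M\<^sub>0 = A A\<^sup>T\<close> and \<open>M\<^sub>k\<^sub>+\<^sub>1 = M\<^sub>k\<^sup>2\<close>, the numbers \<open>b\<^sub>k = \<integral> G (T\<^sub>k G)\<close>, with \<open>T\<^sub>k\<close> the Mehler
  operator of \<open>M\<^sub>k\<close>, satisfy \<open>b\<^sub>k\<^sup>2 \<le> \<parallel>G\<parallel>\<^sup>2 b\<^sub>k\<^sub>+\<^sub>1\<close>, while the Lipschitz bound gives
  \<open>b\<^sub>k = O(a\<^bsup>2^(k+1)\<^esup>)\<close>. Iterating removes the constant in the latter.\<close>

theorem mehler_contraction:
  fixes A B :: "real^'d^'d"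
  assumes AB: "A ** transpose A + B ** transpose B = mat 1"
    and a: "\<And>\<xi>. norm (\<xi> v* A) \<le> a * norm \<xi>" "a > 0"
    and L: "\<And>x y. \<bar>G x - G y\<bar> \<le> L * norm (x - y)" "L \<ge> 0"
    and b: "\<And>x. \<bar>G x\<bar> \<le> b" and G0: "(\<integral>x. G x \<partial>gauss) = 0"
  shows "(\<integral>x. (mehler A B G x)\<^sup>2 \<partial>gauss) \<le> a\<^sup>2 * (\<integral>x. (G x)\<^sup>2 \<partial>gauss)"
proof -
  have G: "continuous_on UNIV G"
    by (rule lipschitz_on_continuous_on[where L = L]) (use L in \<open>auto simp: lipschitz_on_def dist_norm\<close>)
  have [measurable]: "G \<in> borel_measurable borel" using G by (rule continuous_on_borel_measurable)
  have b0: "b \<ge> 0" using order_trans[OF abs_ge_zero b] .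
  define M where "M k = ((\<lambda>X. X ** X) ^^ k) (A ** transpose A)" for k
  have MSuc: "M (Suc k) = M k ** M k" for k by (simp add: M_def)
  have M0: "M 0 = A ** transpose A" by (simp add: M_def)
  have sym: "transpose (M k) = M k" for k
    by (induction k) (simp_all add: M0 MSuc matrix_transpose_mul)
  have step: "norm (\<xi> v* (X ** X)) \<le> c\<^sup>2 * norm \<xi>" if X: "\<And>\<xi>. norm (\<xi> v* X) \<le> c * norm \<xi>" "c \<ge> 0" for X :: "real^'d^'d" and c \<xi>
  proof -
    have "norm (\<xi> v* (X ** X)) = norm ((\<xi> v* X) v* X)" by (simp add: vector_matrix_mul_assoc)
    also have "\<dots> \<le> c * norm (\<xi> v* X)" by (rule X)
    also have "\<dots> \<le> c * (c * norm \<xi>)" using X by (intro mult_left_mono) auto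
    finally show ?thesis by (simp add: power2_eq_square mult.assoc)
  qed
  have base: "norm (\<xi> v* (A ** transpose A)) \<le> c\<^sup>2 * norm \<xi>" if c: "\<And>\<xi>. norm (\<xi> v* A) \<le> c * norm \<xi>" "c \<ge> 0" for c \<xi>
  proof -
    have "norm (\<xi> v* (A ** transpose A)) = norm (A *v (\<xi> v* A))" by (simp add: vector_matrix_mul_assoc[symmetric])
    also have "\<dots> \<le> c * norm (\<xi> v* A)" by (rule norm_matrix_vector_le_of_transpose[OF c(1)])
    also have "\<dots> \<le> c * (c * norm \<xi>)" using c by (intro mult_left_mono) auto
    finally show ?thesis by (simp add: power2_eq_square mult.assoc)
  qed
  \<comment> \<open>The constant 1 is available besides a, which may exceed 1. It makes
    \<open>mat 1 - M k ** transpose (M k)\<close> nonnegative, so that every \<open>M k\<close> has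
    a partner \<open>N k\<close>.\<close>
  have A1: "norm (\<xi> v* A) \<le> 1 * norm \<xi>" for \<xi>
  proof -
    have "(norm (\<xi> v* A))\<^sup>2 \<le> (norm \<xi>)\<^sup>2"
      using norm_vector_matrix_split[OF AB, of \<xi> \<xi>] inner_ge_zero[of "\<xi> v* B"]
      unfolding power2_norm_eq_inner by linarith
    from power2_le_imp_le[OF this norm_ge_zero] show ?thesis by simp
  qed
  have M1: "norm (\<xi> v* M k) \<le> 1 * norm \<xi>" for k \<xi>
  proof (induction k arbitrary: \<xi>)
    case 0
    then show ?case using base[OF A1] by (simp add: M0)
  next
    case (Suc k)
    then show ?case using step[of "M k" 1] by (simp add: MSuc)
  qed
  have Ma: "norm (\<xi> v* M k) \<le> (a\<^sup>2) ^ (2 ^ k) * norm \<xi>" for k \<xi>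
  proof (induction k arbitrary: \<xi>)
    case 0
    then show ?case using base[OF a(1)] a(2) by (simp add: M0)
  next
    case (Suc k)
    then show ?case using step[of "M k" "(a\<^sup>2) ^ (2 ^ k)"] by (simp add: MSuc power_mult[symmetric] mult.commute)
  qed
  have "\<exists>N :: real^'d^'d. M k ** transpose (M k) + N ** transpose N = mat 1" for k
  proof -
    have 1: "transpose (mat 1 - M k ** transpose (M k)) = mat 1 - M k ** transpose (M k)"
    proof -
      have "transpose (X - Y) = transpose X - transpose Y" for X Y :: "real^'d^'d" by (simp add: transpose_def vec_eq_iff)
      then show ?thesis by (simp add: matrix_transpose_mul)
    qed
    have 2: "0 \<le> x \<bullet> ((mat 1 - M k ** transpose (M k)) *v x)" for x
    proof -
      have "x \<bullet> ((mat 1 - M k ** transpose (M k)) *v x) = x \<bullet> x - (x v* M k) \<bullet> (x v* M k)"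
        by (simp add: matrix_vector_mult_diff_rdistrib inner_diff_right dot_lmul_matrix matrix_vector_mul_assoc[symmetric])
      moreover have "(norm (x v* M k))\<^sup>2 \<le> (norm x)\<^sup>2" using M1[of x k] by (intro power_mono) auto
      ultimately show ?thesis by (simp add: power2_norm_eq_inner)
    qed
    obtain N :: "real^'d^'d" where "mat 1 - M k ** transpose (M k) = N ** transpose N" using psd_factor[OF 1 2] .
    then have "mat 1 = N ** transpose N + M k ** transpose (M k)" by (simp only: diff_eq_eq)
    then have "M k ** transpose (M k) + N ** transpose N = mat 1" by (simp only: add.commute)
    then show ?thesis ..
  qed
  then obtain N :: "nat \<Rightarrow> real^'d^'d" where N: "\<And>k. M k ** transpose (M k) + N k ** transpose (N k) = mat 1" by metis
  define \<beta> where "\<beta> k = (\<integral>x. G x * mehler (M k) (N k) G x \<partial>gauss)" for k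
  define c where "c = (\<integral>x. (G x)\<^sup>2 \<partial>gauss)"
  have c0: "c \<ge> 0" unfolding c_def by simp
  have bd2: "\<bar>y\<^sup>2\<bar> \<le> b\<^sup>2" if "\<bar>y\<bar> \<le> b" for y
    using power_mono[OF that, of 2] by simp
  have iG2: "integrable gauss (\<lambda>x. (G x)\<^sup>2)"
    by (rule integrable_gauss_bounded[where b = "b\<^sup>2"], measurable, rule bd2, rule b)
  have start: "(\<integral>x. (mehler A B G x)\<^sup>2 \<partial>gauss) = \<beta> 0"
    unfolding \<beta>_def by (rule mehler_square[OF AB M0 N G b])
  have nxt: "(\<beta> k)\<^sup>2 \<le> c * \<beta> (Suc k)" for k
  proof -
    have im2: "integrable gauss (\<lambda>x. (mehler (M k) (N k) G x)\<^sup>2)"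
      by (rule integrable_gauss_bounded[where b = "b\<^sup>2"], measurable, rule bd2, rule mehler_bound, measurable, rule b)
    have "(\<integral>x. (mehler (M k) (N k) G x)\<^sup>2 \<partial>gauss) = \<beta> (Suc k)"
      unfolding \<beta>_def by (rule mehler_square[OF N _ N G b]) (simp add: MSuc sym)
    then have "\<bar>\<beta> k\<bar> \<le> sqrt c * sqrt (\<beta> (Suc k))"
      using Cauchy_Schwarz_integral[OF _ _ iG2 im2] unfolding \<beta>_def c_def by simp
    then have "\<bar>\<beta> k\<bar>\<^sup>2 \<le> (sqrt c * sqrt (\<beta> (Suc k)))\<^sup>2" by (intro power_mono) auto
    moreover have "\<beta> (Suc k) \<ge> 0" using \<open>_ = \<beta> (Suc k)\<close>[symmetric] by simp
    ultimately show ?thesis using c0 by (simp add: power_mult_distrib)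
  qed
  define m where "m = (\<integral>y. norm y \<partial>(gauss :: (real^'d) measure))"
  have upper: "\<beta> k \<le> b * L * 2 * m * (a\<^sup>2) ^ (2 ^ k)" for k
  proof -
    let ?\<delta> = "(a\<^sup>2) ^ (2 ^ k)"
    have "norm (M k *v x) \<le> ?\<delta> * norm x" for x by (rule norm_matrix_vector_le_of_transpose[OF Ma])
    from mehler_lipschitz_centered[OF N this L b G0]
    have le: "\<bar>mehler (M k) (N k) G x\<bar> \<le> L * ?\<delta> * (norm x + m)" for x unfolding m_def .
    have "\<beta> k \<le> (\<integral>x. b * (L * ?\<delta> * (norm x + m)) \<partial>(gauss :: (real^'d) measure))"
      unfolding \<beta>_def
    proof (rule integral_mono)
      show "integrable gauss (\<lambda>x. G x * mehler (M k) (N k) G x)"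
        by (rule integrable_gauss_bounded[where b = "b * b"])
          (measurable, unfold abs_mult, intro mult_mono mehler_bound b b0, auto)
      show "integrable (gauss :: (real^'d) measure) (\<lambda>x. b * (L * ?\<delta> * (norm x + m)))" 
        by (intro integrable_mult_right Bochner_Integration.integrable_add integrable_gauss_norm gauss.integrable_const)
      fix x
      have "\<bar>G x\<bar> * \<bar>mehler (M k) (N k) G x\<bar> \<le> b * (L * ?\<delta> * (norm x + m))"
        using b le b0 by (intro mult_mono) auto
      then show "G x * mehler (M k) (N k) G x \<le> b * (L * ?\<delta> * (norm x + m))"
        unfolding abs_mult[symmetric] using abs_ge_self order_trans by blast
    qed
    also have "\<dots> = b * L * 2 * m * ?\<delta>"
      using integrable_gauss_norm[where ?'a = "real^'d"] by (simp add: gauss.prob_space[simplified] m_def)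
    finally show ?thesis .
  qed
  have "\<beta> 0 \<le> a\<^sup>2 * c"
  proof (cases "c = 0")
    case True
    then have "(\<beta> 0)\<^sup>2 \<le> 0" using nxt[of 0] by simp
    then show ?thesis using True by simp
  next
    case False
    then have cp: "c > 0" using c0 by simp
    have b00: "\<beta> 0 \<ge> 0" unfolding start[symmetric] by simp
    define r where "r k = \<beta> k / c" for k
    have rr: "(r k)\<^sup>2 \<le> r (Suc k)" for k
      using nxt[of k] cp by (simp add: r_def power_divide power2_eq_square field_simps)
    have r0: "r 0 \<ge> 0" using b00 cp by (simp add: r_def)
    have pw: "r 0 ^ (2 ^ k) \<le> r k" for k
    proof (induction k)
      case (Suc k)
      have "r 0 ^ (2 ^ Suc k) = (r 0 ^ (2 ^ k))\<^sup>2" by (simp add: power_mult[symmetric] mult.commute)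
      also have "\<dots> \<le> (r k)\<^sup>2" using Suc r0 by (intro power_mono) auto
      finally show ?case using rr[of k] by simp
    qed simp
    have "r 0 \<le> a\<^sup>2"
    proof (rule ccontr)
      assume "\<not> r 0 \<le> a\<^sup>2"
      then have gt: "r 0 / a\<^sup>2 > 1" using a(2) by simp
      \<comment> \<open>A ratio above 1 would let its powers outgrow the constant of
        \<open>upper\<close>, which does not depend on k.\<close>
      obtain n where n: "(r 0 / a\<^sup>2) ^ n > b * L * 2 * m / c" using real_arch_pow[OF gt] by blast
      have "n \<le> 2 ^ n" using less_exp[of n] by simp
      then have "(r 0 / a\<^sup>2) ^ n \<le> (r 0 / a\<^sup>2) ^ (2 ^ n)" using gt by (intro power_increasing) auto
      also have "\<dots> = r 0 ^ (2 ^ n) / (a\<^sup>2) ^ (2 ^ n)" by (simp add: power_divide)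
      also have "\<dots> \<le> r n / (a\<^sup>2) ^ (2 ^ n)" using pw a(2) by (intro divide_right_mono) auto
      also have "\<dots> \<le> (b * L * 2 * m * (a\<^sup>2) ^ (2 ^ n) / c) / (a\<^sup>2) ^ (2 ^ n)"
        unfolding r_def using upper[of n] cp a(2) by (intro divide_right_mono) auto
      also have "\<dots> = b * L * 2 * m / c" using a(2) by simp
      finally show False using n by simp
    qed
    then show ?thesis using cp by (simp add: r_def divide_le_eq)
  qed
  then show ?thesis unfolding start c_def .
qed

text \<open>Here B B^T = 1 - A A^T is at least 1 - a^2 > 0. With w = A h the shift is the least-norm
  solution k = B^T y, where B B^T y = w, and its squared norm is the inner product of y and
  w.\<close>

lemma cameron_martin_shift:
  fixes A B :: "real^'d^'d"
  assumes AB: "A ** transpose A + B ** transpose B = mat 1"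
    and a: "\<And>\<xi>. norm (\<xi> v* A) \<le> a * norm \<xi>" "0 \<le> a" "a < 1"
  shows "\<exists>k. B *v k = A *v h \<and> (norm k)\<^sup>2 \<le> a\<^sup>2 / (1 - a\<^sup>2) * (norm h)\<^sup>2"
proof -
  have a2: "a\<^sup>2 < 1" using a by (simp add: abs_square_less_1)
  have coer: "(1 - a\<^sup>2) * (norm y)\<^sup>2 \<le> (norm (y v* B))\<^sup>2" for y
  proof -
    have "(norm (y v* A))\<^sup>2 \<le> (a * norm y)\<^sup>2" using a by (intro power_mono) auto
    moreover have "(norm (y v* A))\<^sup>2 + (norm (y v* B))\<^sup>2 = (norm y)\<^sup>2"
      using norm_vector_matrix_split[OF AB, of y y] unfolding power2_norm_eq_inner .
    ultimately show ?thesis by (simp add: power_mult_distrib algebra_simps)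
  qed
  have BB: "y \<bullet> (B *v (y v* B)) = (norm (y v* B))\<^sup>2" for y
    by (simp add: power2_norm_eq_inner dot_lmul_matrix)
  have "y = 0" if "(B ** transpose B) *v y = 0" for y
  proof -
    have "B *v (y v* B) = 0" using that by (simp add: matrix_vector_mul_assoc[symmetric])
    then have "(norm (y v* B))\<^sup>2 = 0" using BB[of y] by simp
    then have "(1 - a\<^sup>2) * (norm y)\<^sup>2 \<le> 0" using coer[of y] by simp
    then show ?thesis using a2 by (simp add: mult_le_0_iff)
  qed
  then obtain X :: "real^'d^'d" where "X ** (B ** transpose B) = mat 1"
    using matrix_left_invertible_ker[of "B ** transpose B"] by blast
  then have X: "(B ** transpose B) ** X = mat 1" using matrix_left_right_inverse by blast
  define w where "w = A *v h"
  define y where "y = X *v w"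
  define k where "k = y v* B"
  have Bk: "B *v k = w"
  proof -
    have "B *v k = (B ** transpose B) *v y" unfolding k_def by (simp add: matrix_vector_mul_assoc[symmetric])
    also have "\<dots> = w" unfolding y_def matrix_vector_mul_assoc X by simp
    finally show ?thesis .
  qed
  have "(norm k)\<^sup>2 = y \<bullet> w" using BB[of y] Bk unfolding k_def by simp
  also have "\<dots> \<le> norm y * norm w" by (rule norm_cauchy_schwarz)
  finally have k1: "(norm k)\<^sup>2 \<le> norm y * norm w" .
  have k2: "(1 - a\<^sup>2) * (norm y)\<^sup>2 \<le> (norm k)\<^sup>2" using coer[of y] unfolding k_def .
  have w: "norm w \<le> a * norm h" unfolding w_def by (rule norm_matrix_vector_le_of_transpose[OF a(1)])
  have "(norm k)\<^sup>2 * (1 - a\<^sup>2) \<le> (norm w)\<^sup>2"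
  proof (cases "norm k = 0")
    case False
    have "((norm k)\<^sup>2)\<^sup>2 \<le> (norm y * norm w)\<^sup>2" using k1 by (intro power_mono) auto
    then have "(1 - a\<^sup>2) * ((norm k)\<^sup>2)\<^sup>2 \<le> ((1 - a\<^sup>2) * (norm y)\<^sup>2) * (norm w)\<^sup>2"
      using a2 by (simp add: power_mult_distrib mult_left_mono mult.assoc)
    also have "\<dots> \<le> (norm k)\<^sup>2 * (norm w)\<^sup>2" using k2 by (intro mult_right_mono) auto
    finally have "(norm k)\<^sup>2 * ((norm k)\<^sup>2 * (1 - a\<^sup>2)) \<le> (norm k)\<^sup>2 * (norm w)\<^sup>2"
      by (simp add: power2_eq_square mult_ac)
    then show ?thesis by (rule mult_left_le_imp_le) (use False in simp)
  qed simp
  also have "\<dots> \<le> (a * norm h)\<^sup>2" using w by (intro power_mono) auto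
  finally have "(norm k)\<^sup>2 * (1 - a\<^sup>2) \<le> a\<^sup>2 * (norm h)\<^sup>2" by (simp add: power_mult_distrib)
  then have "(norm k)\<^sup>2 \<le> a\<^sup>2 / (1 - a\<^sup>2) * (norm h)\<^sup>2" using a2 by (simp add: field_simps)
  then show ?thesis using Bk unfolding w_def by blast
qed

text \<open>The square of the Cameron-Martin density of k is e^(|k|^2) times the Cameron-Martin
  density of 2k, which has integral 1.\<close>

lemma gauss_exp_linear:
  fixes k :: "'a::euclidean_space"
  shows "integrable gauss (\<lambda>z. (exp (z \<bullet> k - (norm k)\<^sup>2 / 2))\<^sup>2)"
    and "(\<integral>z. (exp (z \<bullet> k - (norm k)\<^sup>2 / 2))\<^sup>2 \<partial>gauss) = exp ((norm k)\<^sup>2)"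
proof -
  have e: "(exp (z \<bullet> k - (norm k)\<^sup>2 / 2))\<^sup>2 = exp ((norm k)\<^sup>2) * (1 * exp (z \<bullet> (2 *\<^sub>R k) - (norm (2 *\<^sub>R k))\<^sup>2 / 2))" for z
    by (simp add: power2_eq_square exp_add[symmetric])
  have one: "(\<integral>z. 1 * exp (z \<bullet> (2 *\<^sub>R k) - (norm (2 *\<^sub>R k))\<^sup>2 / 2) \<partial>gauss) = 1"
  proof -
    have "(\<integral>z. 1 \<partial>(gauss :: 'a measure)) = (\<integral>z. 1 * exp (z \<bullet> (2 *\<^sub>R k) - (norm (2 *\<^sub>R k))\<^sup>2 / 2) \<partial>gauss)"
      by (rule gauss_shift) auto
    moreover have "(\<integral>z. (1 :: real) \<partial>(gauss :: 'a measure)) = 1" by (simp add: gauss.prob_space[simplified])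
    ultimately show ?thesis by (simp only:)
  qed
  have i: "integrable gauss (\<lambda>z. 1 * exp (z \<bullet> (2 *\<^sub>R k) - (norm (2 *\<^sub>R k))\<^sup>2 / 2))"
  proof (rule ccontr)
    assume "\<not> ?thesis"
    from not_integrable_integral_eq[OF this] one show False by linarith
  qed
  show "integrable gauss (\<lambda>z. (exp (z \<bullet> k - (norm k)\<^sup>2 / 2))\<^sup>2)"
    unfolding e by (rule integrable_mult_right, rule i)
  show "(\<integral>z. (exp (z \<bullet> k - (norm k)\<^sup>2 / 2))\<^sup>2 \<partial>gauss) = exp ((norm k)\<^sup>2)"
  proof -
    have "(\<integral>z. (exp (z \<bullet> k - (norm k)\<^sup>2 / 2))\<^sup>2 \<partial>gauss)
       = exp ((norm k)\<^sup>2) * (\<integral>z. 1 * exp (z \<bullet> (2 *\<^sub>R k) - (norm (2 *\<^sub>R k))\<^sup>2 / 2) \<partial>gauss)"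
      unfolding e by (rule integral_mult_right_zero)
    then show ?thesis by (simp only: one mult_1_right)
  qed
qed

text \<open>Moving the starting point from y to x amounts to shifting the noise by k with B k = A (x
  - y). Cauchy-Schwarz separates G from the shift density, whose second moment is e^(|k|^2).\<close>

lemma mehler_harnack:
  fixes A B :: "real^'d^'d"
  assumes AB: "A ** transpose A + B ** transpose B = mat 1"
    and a: "\<And>\<xi>. norm (\<xi> v* A) \<le> a * norm \<xi>" "0 \<le> a" "a < 1"
    and G: "continuous_on UNIV G" and b: "\<And>x. \<bar>G x\<bar> \<le> b"
  shows "(mehler A B G x)\<^sup>2 \<le> mehler A B (\<lambda>x. (G x)\<^sup>2) y * exp (a\<^sup>2 / (1 - a\<^sup>2) * (norm (x - y))\<^sup>2)"
proof -
  have [measurable]: "G \<in> borel_measurable borel" using G by (rule continuous_on_borel_measurable)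
  obtain k where k: "B *v k = A *v (x - y)" "(norm k)\<^sup>2 \<le> a\<^sup>2 / (1 - a\<^sup>2) * (norm (x - y))\<^sup>2"
    using cameron_martin_shift[OF AB a] by blast
  have eq: "A *v x + B *v z = A *v y + B *v (z + k)" for z
    using k(1) by (simp add: matrix_vector_mult_diff_distrib matrix_vector_right_distrib)
  have "mehler A B G x = (\<integral>z. G (A *v y + B *v z) * exp (z \<bullet> k - (norm k)\<^sup>2 / 2) \<partial>gauss)"
    unfolding mehler_def eq by (rule gauss_shift[where F = "\<lambda>z. G (A *v y + B *v z)"]) measurable
  moreover have "integrable gauss (\<lambda>z. (G (A *v y + B *v z))\<^sup>2)"
    by (rule integrable_gauss_bounded[where b = "b\<^sup>2"]) (use power_mono[OF b abs_ge_zero, of _ 2] in auto)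
  from Cauchy_Schwarz_integral[OF _ _ this gauss_exp_linear(1)[of k]]
  have "\<bar>\<integral>z. G (A *v y + B *v z) * exp (z \<bullet> k - (norm k)\<^sup>2 / 2) \<partial>gauss\<bar>
      \<le> sqrt (mehler A B (\<lambda>x. (G x)\<^sup>2) y) * sqrt (exp ((norm k)\<^sup>2))"
    unfolding gauss_exp_linear(2) mehler_def by simp
  ultimately have "\<bar>mehler A B G x\<bar> \<le> sqrt (mehler A B (\<lambda>x. (G x)\<^sup>2) y) * sqrt (exp ((norm k)\<^sup>2))"
    by (simp only:)
  then have "\<bar>mehler A B G x\<bar>\<^sup>2 \<le> (sqrt (mehler A B (\<lambda>x. (G x)\<^sup>2) y) * sqrt (exp ((norm k)\<^sup>2)))\<^sup>2"
    by (intro power_mono) auto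
  also have "\<dots> = mehler A B (\<lambda>x. (G x)\<^sup>2) y * exp ((norm k)\<^sup>2)"
    by (simp add: power_mult_distrib mehler_def)
  also have "\<dots> \<le> mehler A B (\<lambda>x. (G x)\<^sup>2) y * exp (a\<^sup>2 / (1 - a\<^sup>2) * (norm (x - y))\<^sup>2)"
    using k(2) by (intro mult_left_mono) (auto simp: mehler_def)
  finally show ?thesis by simp
qed

text \<open>Integrate the Harnack inequality over y against e^(-2\<kappa> |y|^2), with \<kappa> =
  a^2/(1 - a^2). By invariance this bounds the square of the Mehler average at x by e^(2\<kappa>
  |x|^2) times the integral of G^2, up to a constant. The power q/2 of the bound is Gaussian
  integrable because q \<kappa> < 1/2.\<close>

lemma mehler_hypercontractive:
  assumes a: "0 \<le> a" "a < 1" and q: "q > 0" "q * (a\<^sup>2 / (1 - a\<^sup>2)) < 1 / 2"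
  shows "\<exists>K>0. \<forall>(A :: real^'d^'d) B G. A ** transpose A + B ** transpose B = mat 1 \<longrightarrow>
     (\<forall>\<xi>. norm (\<xi> v* A) \<le> a * norm \<xi>) \<longrightarrow> continuous_on UNIV G \<longrightarrow> (\<exists>b. \<forall>x. \<bar>G x\<bar> \<le> b) \<longrightarrow>
     (\<integral>x. \<bar>mehler A B G x\<bar> powr q \<partial>gauss) powr (1 / q) \<le> K * sqrt (\<integral>x. (G x)\<^sup>2 \<partial>gauss)"
proof -
  define \<kappa> where "\<kappa> = a\<^sup>2 / (1 - a\<^sup>2)"
  have a2: "a\<^sup>2 < 1" using a by (simp add: abs_square_less_1)
  have k0: "\<kappa> \<ge> 0" unfolding \<kappa>_def using a2 by simp
  let ?g = "gauss :: (real^'d) measure"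
  have i1: "integrable ?g (\<lambda>x. exp (- (2 * \<kappa>) * (norm x)\<^sup>2))" using k0 by (intro integrable_gauss_exp_square) simp
  have i2: "integrable ?g (\<lambda>x. exp (q * \<kappa> * (norm x)\<^sup>2))" using q(2) by (intro integrable_gauss_exp_square) (simp add: \<kappa>_def)
  have posint: "0 < (\<integral>x. exp (f x) \<partial>?g)" if "integrable ?g (\<lambda>x. exp (f x))" for f :: "real^'d \<Rightarrow> real"
  proof -
    have "(\<integral>x. exp (f x) \<partial>?g) \<noteq> 0"
    proof
      assume "(\<integral>x. exp (f x) \<partial>?g) = 0"
      then have "AE x in ?g. exp (f x) = 0" using that by (subst (asm) integral_nonneg_eq_0_iff_AE) auto
      then have "AE x in ?g. False" by simp
      then show False by simp
    qed
    moreover have "0 \<le> (\<integral>x. exp (f x) \<partial>?g)" by simp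
    ultimately show ?thesis by linarith
  qed
  define c0 where "c0 = (\<integral>x. exp (- (2 * \<kappa>) * (norm x)\<^sup>2) \<partial>?g)"
  define c1 where "c1 = (\<integral>x. exp (q * \<kappa> * (norm x)\<^sup>2) \<partial>?g)"
  have c: "c0 > 0" "c1 > 0" unfolding c0_def c1_def by (intro posint i1 i2)+
  \<comment> \<open>\<open>c1 powr (1 / q)\<close> is the L^q norm of e^(\<kappa> |x|^2), and
    \<open>sqrt c0\<close> comes from averaging over y.\<close>
  define K where "K = c1 powr (1 / q) / sqrt c0"
  show ?thesis
  proof (intro exI[of _ K] conjI allI impI)
    show "K > 0" unfolding K_def using c by simp
    fix A B :: "real^'d^'d" and G :: "real^'d \<Rightarrow> real"
    assume AB: "A ** transpose A + B ** transpose B = mat 1"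
      and A: "\<forall>\<xi>. norm (\<xi> v* A) \<le> a * norm \<xi>" and G: "continuous_on UNIV G" and "\<exists>b. \<forall>x. \<bar>G x\<bar> \<le> b"
    then obtain b where b: "\<And>x. \<bar>G x\<bar> \<le> b" by blast
    have b2: "\<bar>(G x)\<^sup>2\<bar> \<le> b\<^sup>2" for x using power_mono[OF b abs_ge_zero, of x 2] by simp
    have [measurable]: "G \<in> borel_measurable borel" using G by (rule continuous_on_borel_measurable)
    have G2: "continuous_on UNIV (\<lambda>x. (G x)\<^sup>2)" using G by (intro continuous_intros)
    define S where "S = (\<integral>x. (G x)\<^sup>2 \<partial>?g)"
    have S0: "S \<ge> 0" unfolding S_def by simp
    have ptw: "(mehler A B G x)\<^sup>2 * c0 \<le> exp (2 * \<kappa> * (norm x)\<^sup>2) * S" for x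
    proof -
      have "(mehler A B G x)\<^sup>2 * exp (- (2 * \<kappa>) * (norm y)\<^sup>2) \<le> exp (2 * \<kappa> * (norm x)\<^sup>2) * mehler A B (\<lambda>x. (G x)\<^sup>2) y" for y
      proof -
        have m0: "mehler A B (\<lambda>x. (G x)\<^sup>2) y \<ge> 0" by (simp add: mehler_def)
        \<comment> \<open>By the parallelogram identity; it separates the Gaussian weights in x and
          y.\<close>
        have n2: "(norm (x - y))\<^sup>2 \<le> 2 * (norm x)\<^sup>2 + 2 * (norm y)\<^sup>2"
        proof -
          have "0 \<le> (norm (x + y))\<^sup>2" by simp
          then show ?thesis by (simp add: power2_norm_eq_inner inner_diff_left inner_diff_right inner_add_left inner_add_right inner_commute)
        qed
        have "(mehler A B G x)\<^sup>2 \<le> mehler A B (\<lambda>x. (G x)\<^sup>2) y * exp (\<kappa> * (norm (x - y))\<^sup>2)"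
          unfolding \<kappa>_def by (rule mehler_harnack[OF AB _ a G b]) (use A in blast)
        also have "\<dots> \<le> mehler A B (\<lambda>x. (G x)\<^sup>2) y * exp (\<kappa> * (2 * (norm x)\<^sup>2 + 2 * (norm y)\<^sup>2))"
          using n2 k0 m0 by (intro mult_left_mono) (auto intro: mult_left_mono)
        finally have "(mehler A B G x)\<^sup>2 * exp (- (2 * \<kappa>) * (norm y)\<^sup>2)
          \<le> mehler A B (\<lambda>x. (G x)\<^sup>2) y * exp (\<kappa> * (2 * (norm x)\<^sup>2 + 2 * (norm y)\<^sup>2)) * exp (- (2 * \<kappa>) * (norm y)\<^sup>2)"
          by (intro mult_right_mono) auto
        also have "\<dots> = exp (2 * \<kappa> * (norm x)\<^sup>2) * mehler A B (\<lambda>x. (G x)\<^sup>2) y"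
          by (simp add: mult.assoc exp_add[symmetric] algebra_simps)
        finally show ?thesis .
      qed
      then have "(\<integral>y. (mehler A B G x)\<^sup>2 * exp (- (2 * \<kappa>) * (norm y)\<^sup>2) \<partial>?g) \<le> (\<integral>y. exp (2 * \<kappa> * (norm x)\<^sup>2) * mehler A B (\<lambda>x. (G x)\<^sup>2) y \<partial>?g)"
      proof (intro integral_mono)
        show "integrable ?g (\<lambda>y. (mehler A B G x)\<^sup>2 * exp (- (2 * \<kappa>) * (norm y)\<^sup>2))"
          by (rule integrable_mult_right, rule i1)
        show "integrable ?g (\<lambda>y. exp (2 * \<kappa> * (norm x)\<^sup>2) * mehler A B (\<lambda>x. (G x)\<^sup>2) y)"
          by (rule integrable_mult_right, rule integrable_gauss_bounded[where b = "b\<^sup>2"]) (auto intro!: mehler_bound b2)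
      qed
      then show ?thesis
        unfolding integral_mult_right_zero mehler_invariant[OF AB G2 b2] c0_def S_def .
    qed
    have ptq: "\<bar>mehler A B G x\<bar> powr q \<le> (S / c0) powr (q / 2) * exp (q * \<kappa> * (norm x)\<^sup>2)" for x
    proof -
      have "(mehler A B G x)\<^sup>2 \<le> S / c0 * exp (2 * \<kappa> * (norm x)\<^sup>2)" using ptw[of x] c(1) by (simp add: field_simps)
      then have "((mehler A B G x)\<^sup>2) powr (q / 2) \<le> (S / c0 * exp (2 * \<kappa> * (norm x)\<^sup>2)) powr (q / 2)"
        using q(1) by (intro powr_mono2) auto
      also have "\<dots> = (S / c0) powr (q / 2) * exp (q * \<kappa> * (norm x)\<^sup>2)"
        using S0 c(1) by (subst powr_mult) (auto simp: exp_powr_real algebra_simps)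
      also have "((mehler A B G x)\<^sup>2) powr (q / 2) = \<bar>mehler A B G x\<bar> powr q"
      proof -
        have e: "((mehler A B G x)\<^sup>2) = \<bar>mehler A B G x\<bar> powr 2" by (simp add: powr_numeral)
        show ?thesis unfolding e powr_powr by simp
      qed
      finally show ?thesis .
    qed
    have "(\<integral>x. \<bar>mehler A B G x\<bar> powr q \<partial>?g) \<le> (\<integral>x. (S / c0) powr (q / 2) * exp (q * \<kappa> * (norm x)\<^sup>2) \<partial>?g)"
    proof (rule integral_mono)
      show "integrable ?g (\<lambda>x. \<bar>mehler A B G x\<bar> powr q)"
        by (rule integrable_gauss_bounded[where b = "b powr q"]) (use q(1) in \<open>auto intro!: powr_mono2 mehler_bound b\<close>)
    qed (use i2 ptq in auto)
    then have "(\<integral>x. \<bar>mehler A B G x\<bar> powr q \<partial>?g) \<le> (S / c0) powr (q / 2) * c1" unfolding c1_def by simp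
    then have "(\<integral>x. \<bar>mehler A B G x\<bar> powr q \<partial>?g) powr (1 / q) \<le> ((S / c0) powr (q / 2) * c1) powr (1 / q)"
      using q(1) by (intro powr_mono2) auto
    also have "\<dots> = (S / c0) powr (1 / 2) * c1 powr (1 / q)"
      using c q(1) by (subst powr_mult) (auto simp: powr_powr)
    also have "\<dots> = K * sqrt S" using S0 c by (simp add: powr_half_sqrt K_def real_sqrt_divide)
    finally show "(\<integral>x. \<bar>mehler A B G x\<bar> powr q \<partial>?g) powr (1 / q) \<le> K * sqrt (\<integral>x. (G x)\<^sup>2 \<partial>?g)" unfolding S_def .
  qed
qed

text \<open>Jensen's inequality at each point, obtained from Holder with the constant function 1,
  followed by invariance.\<close>

lemma mehler_Lq_contraction:
  fixes A B :: "real^'d^'d"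
  assumes AB: "A ** transpose A + B ** transpose B = mat 1" and q: "q > 1"
    and G: "continuous_on UNIV G" and b: "\<And>x. \<bar>G x\<bar> \<le> b"
  shows "(\<integral>x. \<bar>mehler A B G x\<bar> powr q \<partial>gauss) \<le> (\<integral>x. \<bar>G x\<bar> powr q \<partial>gauss)"
proof -
  have [measurable]: "G \<in> borel_measurable borel" using G by (rule continuous_on_borel_measurable)
  let ?g = "gauss :: (real^'d) measure"
  have Gq: "continuous_on UNIV (\<lambda>x. \<bar>G x\<bar> powr q)" 
    by (rule continuous_on_powr') (use q in \<open>auto intro!: continuous_intros G\<close>)
  have bq: "\<bar>\<bar>G x\<bar> powr q\<bar> \<le> b powr q" for x using q b[of x] by (auto intro: powr_mono2)
  define p where "p = q / (q - 1)"
  have p: "p > 1" "1 / q + 1 / p = 1" using q by (auto simp: p_def field_simps)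
  have pt: "\<bar>mehler A B G x\<bar> powr q \<le> mehler A B (\<lambda>x. \<bar>G x\<bar> powr q) x" for x
  proof -
    let ?f = "\<lambda>z. G (A *v x + B *v z)"
    have i: "integrable ?g (\<lambda>z. \<bar>?f z\<bar> powr q)" by (rule integrable_gauss_bounded[where b = "b powr q"]) (use bq in auto)
    have i1: "integrable ?g (\<lambda>z. \<bar>1::real\<bar> powr p)" by simp
    have "\<bar>\<integral>z. ?f z * 1 \<partial>?g\<bar> \<le> (\<integral>z. \<bar>?f z\<bar> powr q \<partial>?g) powr (1 / q) * (\<integral>z. \<bar>1::real\<bar> powr p \<partial>?g) powr (1 / p)"
      by (rule Holder_inequality(2)[OF q p(1) p(2) _ _ i i1]) auto
    then have "\<bar>mehler A B G x\<bar> \<le> (mehler A B (\<lambda>x. \<bar>G x\<bar> powr q) x) powr (1 / q)"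
      by (simp add: mehler_def gauss.prob_space[simplified])
    then have "\<bar>mehler A B G x\<bar> powr q \<le> ((mehler A B (\<lambda>x. \<bar>G x\<bar> powr q) x) powr (1 / q)) powr q"
      using q by (intro powr_mono2) auto
    then show ?thesis using q by (simp add: powr_powr mehler_def)
  qed
  have "(\<integral>x. \<bar>mehler A B G x\<bar> powr q \<partial>?g) \<le> (\<integral>x. mehler A B (\<lambda>x. \<bar>G x\<bar> powr q) x \<partial>?g)"
  proof (rule integral_mono)
    show "integrable ?g (\<lambda>x. \<bar>mehler A B G x\<bar> powr q)"
      by (rule integrable_gauss_bounded[where b = "b powr q"]) (use q in \<open>auto intro!: powr_mono2 mehler_bound b\<close>)
    show "integrable ?g (mehler A B (\<lambda>x. \<bar>G x\<bar> powr q))"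
      by (rule integrable_gauss_bounded[where b = "b powr q"]) (auto intro!: mehler_bound bq)
  qed (rule pt)
  also have "\<dots> = (\<integral>x. \<bar>G x\<bar> powr q \<partial>?g)" by (rule mehler_invariant[OF AB Gq bq])
  finally show ?thesis .
qed

section \<open>Duality\<close>

lemma bounded_measurable_approx:
  fixes g :: "'a::euclidean_space \<Rightarrow> real"
  assumes g: "g \<in> borel_measurable borel" and b: "\<And>x. \<bar>g x\<bar> \<le> b"
  shows "\<exists>h. (\<forall>n. continuous_on UNIV (h n)) \<and> (\<forall>n x. \<bar>h n x\<bar> \<le> b) \<and> (AE x in lborel. (\<lambda>n. h n x) \<longlonglongrightarrow> g x)"
proof -
  have b0: "0 \<le> b" using order_trans[OF abs_ge_zero b] .
  have "g \<in> borel_measurable lebesgue" using g by (rule measurable_completion[of g lborel borel, simplified])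
  then have "g measurable_on UNIV" by (rule lebesgue_measurable_imp_measurable_on) simp
  then obtain N h where N: "negligible N" and h: "\<And>n. continuous_on UNIV (h n)"
      and lim: "\<And>x. x \<notin> N \<Longrightarrow> (\<lambda>n. h n x) \<longlonglongrightarrow> g x"
    unfolding measurable_on_def by auto
  \<comment> \<open>Clipping to [-b, b] makes the approximants uniformly bounded without moving the
    limit, since g takes its values there.\<close>
  define k where "k n x = max (- b) (min b (h n x))" for n :: nat and x
  have "AE x in completion lborel. x \<notin> N"
    using N by (intro AE_not_in) (simp add: negligible_iff_null_sets)
  then have "AE x in lborel. x \<notin> N" by (simp add: AE_completion_iff)
  then have "AE x in lborel. (\<lambda>n. k n x) \<longlonglongrightarrow> g x"
  proof eventually_elim
    case (elim x)
    have "(\<lambda>n. k n x) \<longlonglongrightarrow> max (- b) (min b (g x))"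
      unfolding k_def by (intro tendsto_intros lim elim)
    moreover have "max (- b) (min b (g x)) = g x" using b[of x] by (auto simp: abs_le_iff)
    ultimately show ?case by simp
  qed
  moreover have "continuous_on UNIV (k n)" for n unfolding k_def by (intro continuous_intros h)
  moreover have "\<bar>k n x\<bar> \<le> b" for n x unfolding k_def using b0 by (auto simp: abs_le_iff)
  ultimately show ?thesis by blast
qed

text \<open>The infimal convolutions \<open>h\<^sub>n(x) = inf\<^sub>y (g(y) + n |x - y|)\<close>.\<close>

lemma continuous_lipschitz_approx:
  fixes g :: "'a::euclidean_space \<Rightarrow> real"
  assumes g: "continuous_on UNIV g" and b: "\<And>x. \<bar>g x\<bar> \<le> b"
  shows "\<exists>h. (\<forall>n x y. \<bar>h n x - h n y\<bar> \<le> real n * norm (x - y)) \<and> (\<forall>n x. \<bar>h n x\<bar> \<le> b) \<and> (\<forall>x. (\<lambda>n. h n x) \<longlonglongrightarrow> g x)"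
proof -
  define F where "F n x y = g y + real n * norm (x - y)" for n and x y :: 'a
  define h where "h n x = Inf (range (F n x))" for n x
  have lowF: "- b \<le> F n x y" for n x y
  proof -
    have "- b \<le> g y" using b[of y] by linarith
    then show ?thesis unfolding F_def by (simp add: add_increasing2)
  qed
  then have bdd: "bdd_below (range (F n x))" for n x by (auto intro!: bdd_belowI)
  have le: "h n x \<le> F n x y" for n x y unfolding h_def by (rule cInf_lower[OF _ bdd]) simp
  have ge: "c \<le> h n x" if "\<And>y. c \<le> F n x y" for c n x
    unfolding h_def by (rule cInf_greatest) (use that in auto)
  have hg: "h n x \<le> g x" for n x using le[of n x x] by (simp add: F_def)
  have "h n x - real n * norm (x - y) \<le> h n y" for n x y
  proof (rule ge)
    fix z
    have "norm (x - z) \<le> norm (x - y) + norm (y - z)" using norm_triangle_ineq[of "x - y" "y - z"] by simp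
    then have "real n * norm (x - z) \<le> real n * norm (x - y) + real n * norm (y - z)"
      by (simp add: distrib_left[symmetric] mult_left_mono)
    then show "h n x - real n * norm (x - y) \<le> F n y z" using le[of n x z] unfolding F_def by linarith
  qed
  then have lip: "\<bar>h n x - h n y\<bar> \<le> real n * norm (x - y)" for n x y
    by (smt (verit) norm_minus_commute)
  have bd: "\<bar>h n x\<bar> \<le> b" for n x using hg[of n x] ge[OF lowF, of n x] b[of x] by linarith
  have "(\<lambda>n. h n x) \<longlonglongrightarrow> g x" for x
  proof (rule LIMSEQ_I)
    fix e :: real assume e: "0 < e"
    obtain \<delta> where \<delta>: "\<delta> > 0" "\<And>y. dist y x < \<delta> \<Longrightarrow> dist (g y) (g x) < e / 2"
      using g e unfolding continuous_on_iff by (metis UNIV_I half_gt_zero)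
    \<comment> \<open>Beyond distance \<delta> the penalty is at least 2b and outweighs any drop of
      g; within \<delta> continuity applies.\<close>
    obtain n0 :: nat where n0: "real n0 \<ge> 2 * b / \<delta>" using real_arch_simple by blast
    have "norm (h n x - g x) < e" if n: "n \<ge> n0" for n
    proof -
      have "g x - e / 2 \<le> h n x"
      proof (rule ge)
        fix y
        show "g x - e / 2 \<le> F n x y"
        proof (cases "dist y x < \<delta>")
          case True
          then have "g x - e / 2 < g y" using \<delta>(2)[of y] unfolding dist_real_def abs_less_iff by linarith
          then show ?thesis unfolding F_def by (simp add: add_increasing2)
        next
          case False
          have "2 * b \<le> real n0 * \<delta>" using n0 \<delta>(1) by (simp add: divide_le_eq)
          also have "\<dots> \<le> real n * norm (x - y)"
            using n False \<delta>(1) by (intro mult_mono) (auto simp: dist_norm norm_minus_commute)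
          finally show ?thesis unfolding F_def using b[of x] b[of y] e by linarith
        qed
      qed
      then show ?thesis using hg[of n x] e by simp
    qed
    then show "\<exists>n0. \<forall>n\<ge>n0. norm (h n x - g x) < e" by blast
  qed
  then show ?thesis using lip bd by blast
qed

text \<open>Dominated convergence on both sides. It is applied twice below, passing from Lipschitz
  to continuous and from continuous to measurable test functions.\<close>

lemma Lq_pairing_bound_limit:
  fixes u :: "'a::euclidean_space \<Rightarrow> real"
  assumes u: "integrable gauss u" and q: "q > 1"
    and h: "\<And>n. h n \<in> borel_measurable borel" "\<And>n x. \<bar>h n x\<bar> \<le> b" and g: "g \<in> borel_measurable borel"
    and lim: "AE x in gauss. (\<lambda>n. h n x) \<longlonglongrightarrow> g x"
    and bound: "\<And>n. (\<integral>x. u x * h n x \<partial>gauss) \<le> N * (\<integral>x. \<bar>h n x\<bar> powr q \<partial>gauss) powr (1 / q)"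
  shows "(\<integral>x. u x * g x \<partial>gauss) \<le> N * (\<integral>x. \<bar>g x\<bar> powr q \<partial>gauss) powr (1 / q)"
proof (rule LIMSEQ_le)
  note [measurable] = h(1) g
  have [measurable]: "u \<in> borel_measurable borel" using u by (auto dest: borel_measurable_integrable)
  show "(\<lambda>n. \<integral>x. u x * h n x \<partial>gauss) \<longlonglongrightarrow> (\<integral>x. u x * g x \<partial>gauss)"
  proof (rule integral_dominated_convergence[where w = "\<lambda>x. \<bar>u x\<bar> * b"])
    show "AE x in gauss. (\<lambda>n. u x * h n x) \<longlonglongrightarrow> u x * g x"
      using lim by eventually_elim (intro tendsto_intros)
    show "AE x in gauss. norm (u x * h n x) \<le> \<bar>u x\<bar> * b" for n
      using h(2) by (intro AE_I2) (simp add: abs_mult mult_left_mono)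
  qed (use u in auto)
  have "(\<lambda>n. \<integral>x. \<bar>h n x\<bar> powr q \<partial>gauss) \<longlonglongrightarrow> (\<integral>x. \<bar>g x\<bar> powr q \<partial>gauss)"
  proof (rule integral_dominated_convergence[where w = "\<lambda>_. b powr q"])
    show "AE x in gauss. (\<lambda>n. \<bar>h n x\<bar> powr q) \<longlonglongrightarrow> \<bar>g x\<bar> powr q"
      using lim by eventually_elim (intro tendsto_powr' tendsto_intros; use q in auto)
    show "AE x in gauss. norm (\<bar>h n x\<bar> powr q) \<le> b powr q" for n
      using h(2)[of n] q by (intro AE_I2) (auto intro: powr_mono2)
  qed auto
  then show "(\<lambda>n. N * (\<integral>x. \<bar>h n x\<bar> powr q \<partial>gauss) powr (1 / q)) \<longlonglongrightarrow> N * (\<integral>x. \<bar>g x\<bar> powr q \<partial>gauss) powr (1 / q)"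
    by (intro tendsto_mult tendsto_const tendsto_powr') (use q in auto)
  show "\<exists>N'. \<forall>n\<ge>N'. (\<integral>x. u x * h n x \<partial>gauss) \<le> N * (\<integral>x. \<bar>h n x\<bar> powr q \<partial>gauss) powr (1 / q)"
    using bound by blast
qed

text \<open>The converse Holder inequality, from Lipschitz test functions only, the class that
  \<open>mehler_contraction\<close> treats. The extremal test function sgn u |u|^(p-1) is truncated
  at level k to keep it bounded, and Fatou's lemma removes k.\<close>

theorem Lp_bound_by_duality:
  fixes u :: "'a::euclidean_space \<Rightarrow> real"
  assumes u: "integrable gauss u" and p: "p > 1" "q > 1" "1 / p + 1 / q = 1" and N: "N \<ge> 0"
    and bound: "\<And>G b L. \<lbrakk>\<And>x. \<bar>G x\<bar> \<le> b; \<And>x y. \<bar>G x - G y\<bar> \<le> L * norm (x - y); L \<ge> 0\<rbrakk> \<Longrightarrow>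
        (\<integral>x. u x * G x \<partial>gauss) \<le> N * (\<integral>x. \<bar>G x\<bar> powr q \<partial>gauss) powr (1 / q)"
  shows "integrable gauss (\<lambda>x. \<bar>u x\<bar> powr p)" and "(\<integral>x. \<bar>u x\<bar> powr p \<partial>gauss) \<le> N powr p"
proof -
  have um [measurable]: "u \<in> borel_measurable borel" using u by (auto dest: borel_measurable_integrable)
  have cont: "(\<integral>x. u x * g x \<partial>gauss) \<le> N * (\<integral>x. \<bar>g x\<bar> powr q \<partial>gauss) powr (1 / q)"
    if g: "continuous_on UNIV g" and b: "\<And>x. \<bar>g x\<bar> \<le> b" for g b
  proof -
    obtain h where h: "\<And>n x y. \<bar>h n x - h n y\<bar> \<le> real n * norm (x - y)" "\<And>n x. \<bar>h n x\<bar> \<le> b" "\<And>x. (\<lambda>n. h n x) \<longlonglongrightarrow> g x"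
      using continuous_lipschitz_approx[OF g b] by blast
    have hc: "continuous_on UNIV (h n)" for n
      by (rule lipschitz_on_continuous_on[where L = "real n"]) (use h(1) in \<open>auto simp: lipschitz_on_def dist_norm\<close>)
    show ?thesis
    proof (rule Lq_pairing_bound_limit[OF u p(2) _ h(2)])
      show "h n \<in> borel_measurable borel" for n by (rule continuous_on_borel_measurable[OF hc])
      show "g \<in> borel_measurable borel" by (rule continuous_on_borel_measurable[OF g])
      show "AE x in gauss. (\<lambda>n. h n x) \<longlonglongrightarrow> g x" using h(3) by simp
      show "(\<integral>x. u x * h n x \<partial>gauss) \<le> N * (\<integral>x. \<bar>h n x\<bar> powr q \<partial>gauss) powr (1 / q)" for n
        by (rule bound[OF h(2) h(1)]) simp
    qed
  qed
  have meas: "(\<integral>x. u x * g x \<partial>gauss) \<le> N * (\<integral>x. \<bar>g x\<bar> powr q \<partial>gauss) powr (1 / q)"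
    if g: "g \<in> borel_measurable borel" and b: "\<And>x. \<bar>g x\<bar> \<le> b" for g b
  proof -
    obtain h where h: "\<And>n. continuous_on UNIV (h n)" "\<And>n x. \<bar>h n x\<bar> \<le> b" and lim: "AE x in lborel. (\<lambda>n. h n x) \<longlonglongrightarrow> g x"
      using bounded_measurable_approx[OF g b] by blast
    have "AE x in gauss. (\<lambda>n. h n x) \<longlonglongrightarrow> g x"
      unfolding gauss_def using lim by (subst AE_density) (auto elim: eventually_mono)
    then show ?thesis
      by (rule Lq_pairing_bound_limit[OF u p(2) continuous_on_borel_measurable[OF h(1)] h(2) g _ cont[OF h]])
  qed
  have qp: "(p - 1) * q = p" using p by (simp add: field_simps)
  define m where "m k x = min \<bar>u x\<bar> (real k)" for k :: nat and x
  have m0: "0 \<le> m k x" and mk: "m k x \<le> real k" and mu: "m k x \<le> \<bar>u x\<bar>" for k x by (auto simp: m_def)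
  have [measurable]: "m k \<in> borel_measurable borel" for k unfolding m_def by measurable
  have I: "integrable gauss (\<lambda>x. m k x powr p)" for k
    by (rule integrable_gauss_bounded[where b = "real k powr p"]) (use m0 mk p in \<open>auto intro!: powr_mono2\<close>)
  have trunc: "(\<integral>x. m k x powr p \<partial>gauss) \<le> N powr p" for k
  proof -
    define g where "g x = sgn (u x) * m k x powr (p - 1)" for x
    have gm [measurable]: "g \<in> borel_measurable borel" unfolding g_def by measurable
    have gb: "\<bar>g x\<bar> \<le> real k powr (p - 1)" for x
    proof -
      have "\<bar>g x\<bar> \<le> m k x powr (p - 1)" by (auto simp: g_def abs_mult sgn_real_def)
      also have "\<dots> \<le> real k powr (p - 1)" using m0 mk p by (intro powr_mono2) auto
      finally show ?thesis .
    qed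
    have gq: "\<bar>g x\<bar> powr q = m k x powr p" for x
    proof (cases "u x = 0")
      case True
      then show ?thesis by (simp add: g_def m_def)
    next
      case False
      then have "\<bar>g x\<bar> = m k x powr (p - 1)" by (simp add: g_def abs_mult)
      then show ?thesis by (simp add: powr_powr qp)
    qed
    have ug: "m k x powr p \<le> u x * g x" for x
    proof -
      have "m k x powr p = m k x * m k x powr (p - 1)"
        using m0[of k x] by (cases "m k x = 0") (auto simp: powr_mult_base)
      also have "\<dots> \<le> \<bar>u x\<bar> * m k x powr (p - 1)" using mu by (intro mult_right_mono) auto
      also have "\<dots> = u x * g x" by (simp add: g_def sgn_mult_abs abs_sgn mult.assoc[symmetric])
      finally show ?thesis .
    qed
    have iug: "integrable gauss (\<lambda>x. u x * g x)"
    proof (rule Bochner_Integration.integrable_bound)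
      show "integrable gauss (\<lambda>x. \<bar>u x\<bar> * real k powr (p - 1))" using u by simp
      show "AE x in gauss. norm (u x * g x) \<le> norm (\<bar>u x\<bar> * real k powr (p - 1))"
        using gb by (intro AE_I2) (simp add: abs_mult mult_left_mono)
    qed measurable
    define J where "J = (\<integral>x. m k x powr p \<partial>gauss)"
    have J0: "J \<ge> 0" unfolding J_def by simp
    have "J \<le> (\<integral>x. u x * g x \<partial>gauss)" unfolding J_def by (rule integral_mono[OF I iug ug])
    also have "\<dots> \<le> N * J powr (1 / q)" using meas[OF gm gb] unfolding gq J_def .
    finally have J: "J \<le> N * J powr (1 / q)" .
    show "J \<le> N powr p" unfolding J_def[symmetric]
    proof (cases "J = 0")
      case False
      then have Jp: "J > 0" using J0 by simp
      \<comment> \<open>Truncation keeps J finite, so the factor J^(1/q) may be cancelled; J^(1/p)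
        \<le> N remains.\<close>
      have "J = J powr (1 / p) * J powr (1 / q)" using Jp p(3) by (simp add: powr_add[symmetric])
      then have "J powr (1 / p) * J powr (1 / q) \<le> N * J powr (1 / q)" using J by simp
      then have "J powr (1 / p) \<le> N" using Jp by simp
      then have "(J powr (1 / p)) powr p \<le> N powr p" using p by (intro powr_mono2) auto
      then show ?thesis using Jp p by (simp add: powr_powr)
    qed simp
  qed
  have "(\<integral>\<^sup>+x. ennreal (\<bar>u x\<bar> powr p) \<partial>gauss) \<le> (\<integral>\<^sup>+x. liminf (\<lambda>k. ennreal (m k x powr p)) \<partial>gauss)"
  proof (rule nn_integral_mono)
    fix x
    obtain k0 :: nat where k0: "\<bar>u x\<bar> \<le> real k0" using real_arch_simple by blast
    have "m k x = \<bar>u x\<bar>" if "k \<ge> k0" for k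
      unfolding m_def using that k0 by (simp add: min_def)
    then have "eventually (\<lambda>k. ennreal (\<bar>u x\<bar> powr p) \<le> ennreal (m k x powr p)) sequentially"
      unfolding eventually_sequentially by (intro exI[of _ k0]) simp
    then show "ennreal (\<bar>u x\<bar> powr p) \<le> liminf (\<lambda>k. ennreal (m k x powr p))" by (rule Liminf_bounded)
  qed
  also have "\<dots> \<le> liminf (\<lambda>k. \<integral>\<^sup>+x. ennreal (m k x powr p) \<partial>gauss)"
    by (rule nn_integral_liminf) measurable
  also have "\<dots> \<le> ennreal (N powr p)"
  proof (rule Liminf_le)
    show "\<forall>\<^sub>F k in sequentially. (\<integral>\<^sup>+x. ennreal (m k x powr p) \<partial>gauss) \<le> ennreal (N powr p)"
      using trunc by (intro always_eventually allI) (subst nn_integral_eq_integral[OF I]; auto intro: ennreal_leI)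
  qed simp
  finally have fin: "(\<integral>\<^sup>+x. ennreal (\<bar>u x\<bar> powr p) \<partial>gauss) \<le> ennreal (N powr p)" .
  show i: "integrable gauss (\<lambda>x. \<bar>u x\<bar> powr p)"
    by (rule integrableI_nonneg) (use fin le_less_trans[OF fin ennreal_less_top] in auto)
  show "(\<integral>x. \<bar>u x\<bar> powr p \<partial>gauss) \<le> N powr p"
    using fin by (subst (asm) nn_integral_eq_integral[OF i]) (auto simp: ennreal_le_iff)
qed

section \<open>Weak form of the equation\<close>

lemma integrable_compact_support:
  fixes f :: "'a::euclidean_space \<Rightarrow> real"
  assumes f: "continuous_on UNIV f" and z: "\<And>x. norm x \<ge> R \<Longrightarrow> f x = 0"
  shows "integrable lborel f"
proof -
  have "integrable lborel (\<lambda>x. indicator (cball 0 R) x *\<^sub>R f x)"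
    by (rule borel_integrable_compact) (auto intro: continuous_on_subset[OF f])
  moreover have "indicator (cball 0 R) x *\<^sub>R f x = f x" for x
    using z[of x] by (auto simp: indicator_def)
  ultimately show ?thesis by (simp only:)
qed

lemma lborel_integral_eq_cbox:
  fixes f :: "'a::euclidean_space \<Rightarrow> real"
  assumes f: "continuous_on UNIV f" and z: "\<And>x. norm x \<ge> R \<Longrightarrow> f x = 0" and sub: "cball 0 R \<subseteq> cbox a b"
  shows "(\<integral>x. f x \<partial>lborel) = integral (cbox a b) f"
proof -
  have "(f has_integral (\<integral>x. f x \<partial>lborel)) UNIV"
    by (rule has_integral_integral_lborel[OF integrable_compact_support[OF f z]])
  then have "integral UNIV f = (\<integral>x. f x \<partial>lborel)" by (rule integral_unique)
  moreover have "integral UNIV f = integral (cbox a b) f"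
  proof -
    have "f x = 0" if "x \<notin> cbox a b" for x using sub that z[of x] by (auto simp: subset_iff not_le) (meson linorder_le_cases)
    then have "integral UNIV f = integral UNIV (\<lambda>x. if x \<in> cbox a b then f x else 0)"
      by (intro arg_cong[where f = "integral UNIV"]) auto
    then show ?thesis by (simp add: integral_restrict_UNIV)
  qed
  ultimately show ?thesis by simp
qed

text \<open>A common compact support turns the integrals into integrals over one fixed box, where
  the Leibniz rule applies to a jointly continuous derivative.\<close>

lemma integral_deriv_compact_support:
  fixes f f' :: "real \<Rightarrow> 'a::euclidean_space \<Rightarrow> real"
  assumes U: "open U" "convex U" "s \<in> U"
    and d: "\<And>s x. s \<in> U \<Longrightarrow> ((\<lambda>s. f s x) has_real_derivative f' s x) (at s)"
    and cf: "\<And>s. s \<in> U \<Longrightarrow> continuous_on UNIV (f s)"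
    and cf': "continuous_on (U \<times> UNIV) (\<lambda>(s, x). f' s x)"
    and z: "\<And>s x. s \<in> U \<Longrightarrow> norm x \<ge> R \<Longrightarrow> f s x = 0" "\<And>s x. s \<in> U \<Longrightarrow> norm x \<ge> R \<Longrightarrow> f' s x = 0"
  shows "((\<lambda>s. \<integral>x. f s x \<partial>lborel) has_real_derivative (\<integral>x. f' s x \<partial>lborel)) (at s)"
proof -
  obtain b :: 'a where "cball 0 R \<subseteq> cbox (- b) b"
    using bounded_subset_cbox_symmetric[OF bounded_cball] by blast
  then obtain a b :: 'a where ab: "cball 0 R \<subseteq> cbox a b" by blast
  have "((\<lambda>s. integral (cbox a b) (f s)) has_field_derivative integral (cbox a b) (f' s)) (at s within U)"
  proof (rule leibniz_rule_field_derivative)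
    show "((\<lambda>s. f s x) has_real_derivative f' s x) (at s within U)" if "s \<in> U" for s x
      using d[OF that] by (rule has_field_derivative_at_within)
    show "f s integrable_on cbox a b" if "s \<in> U" for s
      by (rule integrable_continuous) (rule continuous_on_subset[OF cf[OF that]], simp)
    show "continuous_on (U \<times> cbox a b) (\<lambda>(s, x). f' s x)"
      by (rule continuous_on_subset[OF cf']) auto
  qed (use U in auto)
  then have D: "((\<lambda>s. integral (cbox a b) (f s)) has_field_derivative integral (cbox a b) (f' s)) (at s)"
    using U at_within_open by metis
  have "continuous_on UNIV (f' s)"
    by (rule continuous_on_compose2[OF cf', of UNIV "\<lambda>x. (s, x)", simplified]) (use U in \<open>auto intro!: continuous_intros\<close>)
  then have e': "(\<integral>x. f' s x \<partial>lborel) = integral (cbox a b) (f' s)"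
    by (rule lborel_integral_eq_cbox) (use U z ab in auto)
  have e: "(\<integral>x. f s x \<partial>lborel) = integral (cbox a b) (f s)" if "s \<in> U" for s
    by (rule lborel_integral_eq_cbox) (use that cf z ab in auto)
  show ?thesis unfolding e'
    by (rule has_field_derivative_transform_within_open[OF D U(1,3)]) (use e in simp)
qed

text \<open>Differentiate the translation-invariant integral \<open>\<integral> f(x + h e) dx\<close> at \<open>h = 0\<close>.\<close>

lemma integral_directional_derivative_zero:
  fixes f f' :: "'a::euclidean_space \<Rightarrow> real"
  assumes d: "\<And>x. ((\<lambda>h. f (x + h *\<^sub>R e)) has_real_derivative f' x) (at 0)"
    and c: "continuous_on UNIV f" "continuous_on UNIV f'"
    and z: "\<And>x. norm x \<ge> R \<Longrightarrow> f x = 0" "\<And>x. norm x \<ge> R \<Longrightarrow> f' x = 0"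
  shows "(\<integral>x. f' x \<partial>lborel) = 0"
proof -
  have [measurable]: "f \<in> borel_measurable borel" using c(1) by (rule continuous_on_borel_measurable)
  have D: "((\<lambda>h. \<integral>x. f (x + h *\<^sub>R e) \<partial>lborel) has_real_derivative (\<integral>x. f' (x + 0 *\<^sub>R e) \<partial>lborel)) (at 0)"
  \<comment> \<open>Shifts by s e with |s| < 1 enlarge the support by at most
    \<open>norm e\<close>.\<close>
  proof (rule integral_deriv_compact_support[where U = "{-1<..<1}" and R = "R + norm e"])
    show "((\<lambda>h. f (x + h *\<^sub>R e)) has_real_derivative f' (x + s *\<^sub>R e)) (at s)" for s x
    proof -
      have "((\<lambda>h. f ((x + s *\<^sub>R e) + h *\<^sub>R e)) has_real_derivative f' (x + s *\<^sub>R e)) (at (s - s))"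
        using d[of "x + s *\<^sub>R e"] by simp
      then have "((\<lambda>h. f ((x + s *\<^sub>R e) + (h - s) *\<^sub>R e)) has_real_derivative f' (x + s *\<^sub>R e) * 1) (at s)"
        by (rule DERIV_chain2) (auto intro!: derivative_eq_intros)
      then show ?thesis by (simp add: algebra_simps)
    qed
    show "continuous_on UNIV (\<lambda>x. f (x + s *\<^sub>R e))" for s
      by (rule continuous_on_compose2[OF c(1)]) (auto intro!: continuous_intros)
    show "continuous_on ({-1<..<1} \<times> UNIV) (\<lambda>(s, x). f' (x + s *\<^sub>R e))"
      unfolding case_prod_beta
      by (rule continuous_on_compose2[OF c(2)]) (auto intro!: continuous_intros)
    have big: "R \<le> norm (x + s *\<^sub>R e)" if "s \<in> {-1<..<1}" "R + norm e \<le> norm x" for s x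
    proof -
      have "\<bar>s\<bar> * norm e \<le> 1 * norm e" using that(1) by (intro mult_right_mono) auto
      moreover have "norm x \<le> norm (x + s *\<^sub>R e) + norm (s *\<^sub>R e)"
        using norm_triangle_ineq4[of "x + s *\<^sub>R e" "s *\<^sub>R e"] by simp
      ultimately show ?thesis using that(2) by simp
    qed
    show "f (x + s *\<^sub>R e) = 0" "f' (x + s *\<^sub>R e) = 0" if "s \<in> {-1<..<1}" "R + norm e \<le> norm x" for s x
      using z big[OF that] by auto
  qed auto
  have "(\<integral>x. f (x + h *\<^sub>R e) \<partial>lborel) = (\<integral>x. f x \<partial>lborel)" for h
  proof -
    have "(\<integral>x. f x \<partial>lborel) = (\<integral>x. f x \<partial>distr lborel borel ((+) (h *\<^sub>R e)))" by (simp only: lborel_distr_plus)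
    also have "\<dots> = (\<integral>x. f (h *\<^sub>R e + x) \<partial>lborel)" by (rule integral_distr) auto
    finally show ?thesis by (simp add: add.commute)
  qed
  then have "((\<lambda>h::real. \<integral>x. f x \<partial>lborel) has_real_derivative (\<integral>x. f' x \<partial>lborel)) (at 0)" using D by simp
  moreover have "((\<lambda>h::real. \<integral>x. f x \<partial>lborel) has_real_derivative 0) (at 0)" by simp
  ultimately show ?thesis by (rule DERIV_unique)
qed

text \<open>Only g is compactly supported, f may grow; the product still falls under
  \<open>integral_directional_derivative_zero\<close>.\<close>

lemma integral_by_parts:
  fixes f f' g g' :: "'a::euclidean_space \<Rightarrow> real"
  assumes df: "\<And>x. ((\<lambda>h. f (x + h *\<^sub>R e)) has_real_derivative f' x) (at 0)"
    and dg: "\<And>x. ((\<lambda>h. g (x + h *\<^sub>R e)) has_real_derivative g' x) (at 0)"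
    and c: "continuous_on UNIV f" "continuous_on UNIV f'" "continuous_on UNIV g" "continuous_on UNIV g'"
    and z: "\<And>x. norm x \<ge> R \<Longrightarrow> g x = 0" "\<And>x. norm x \<ge> R \<Longrightarrow> g' x = 0"
  shows "(\<integral>x. f' x * g x \<partial>lborel) = - (\<integral>x. f x * g' x \<partial>lborel)"
proof -
  have "(\<integral>x. f' x * g x + f x * g' x \<partial>lborel) = 0"
  proof (rule integral_directional_derivative_zero[where f = "\<lambda>x. f x * g x" and e = e and R = R])
    show "((\<lambda>h. f (x + h *\<^sub>R e) * g (x + h *\<^sub>R e)) has_real_derivative f' x * g x + f x * g' x) (at 0)" for x
      using DERIV_mult[OF df[of x] dg[of x]] by (simp add: mult.commute add.commute)
  qed (use z in \<open>auto intro!: continuous_intros c\<close>)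
  moreover have "integrable lborel (\<lambda>x. f' x * g x)"
    by (rule integrable_compact_support[where R = R]) (use z in \<open>auto intro!: continuous_intros c\<close>)
  moreover have "integrable lborel (\<lambda>x. f x * g' x)"
    by (rule integrable_compact_support[where R = R]) (use z in \<open>auto intro!: continuous_intros c\<close>)
  ultimately show ?thesis by simp
qed

section \<open>Weak formulation against compactly supported functions\<close>

lemma Ck_on_continuous: "Ck_on k f S \<Longrightarrow> continuous_on S f"
proof (cases k)
  case (Suc m)
  assume "Ck_on k f S"
  then have "\<forall>x\<in>S. f differentiable (at x)" using Suc by simp
  then show ?thesis
    by (meson continuous_at_imp_continuous_on differentiable_imp_continuous_within)
qed simp

lemma Ck_on_Suc_line_derivative:
  fixes f :: "'a::real_normed_vector \<Rightarrow> real"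
  assumes "Ck_on (Suc k) f S" "p \<in> S"
  shows "((\<lambda>h. f (p + h *\<^sub>R v)) has_real_derivative frechet_derivative f (at p) v) (at 0)"
proof -
  have "(f has_derivative frechet_derivative f (at p)) (at p)"
    using assms by (simp add: frechet_derivative_works)
  then have D: "(f has_derivative frechet_derivative f (at p)) (at (p + 0 *\<^sub>R v))" by simp
  have "((\<lambda>h. p + h *\<^sub>R v) has_derivative (\<lambda>h. h *\<^sub>R v)) (at (0::real))"
    by (auto intro!: derivative_eq_intros)
  from has_derivative_compose[OF this D]
  have "((\<lambda>h. f (p + h *\<^sub>R v)) has_derivative (\<lambda>h. frechet_derivative f (at p) (h *\<^sub>R v))) (at 0)" .
  moreover have "frechet_derivative f (at p) (h *\<^sub>R v) = frechet_derivative f (at p) v * h" for h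
    using linear_cmul[OF has_derivative_linear[OF D], of h v] by simp
  ultimately show ?thesis by (simp add: has_field_derivative_def)
qed

text \<open>The partial derivatives are read off the Frechet derivative in the directions (1, 0) and
  (0, e_i), so their continuity comes from the smoothness of the uncurried function.\<close>

lemma smooth_on_partial_derivs:
  fixes f :: "real \<Rightarrow> real^'d \<Rightarrow> real"
  assumes sm: "smooth_on (\<lambda>(t, x). f t x) ({0<..} \<times> UNIV)"
  obtains ft :: "real \<Rightarrow> real^'d \<Rightarrow> real" and f1 :: "'d \<Rightarrow> real \<Rightarrow> real^'d \<Rightarrow> real"
    and f2 :: "'d \<Rightarrow> 'd \<Rightarrow> real \<Rightarrow> real^'d \<Rightarrow> real"
  where "continuous_on ({0<..} \<times> UNIV) (\<lambda>(t, x). f t x)"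
    and "\<And>t x. t > 0 \<Longrightarrow> ((\<lambda>s. f s x) has_real_derivative ft t x) (at t)"
    and "continuous_on ({0<..} \<times> UNIV) (\<lambda>(t, x). ft t x)"
    and "\<And>i t x. t > 0 \<Longrightarrow> ((\<lambda>h. f t (x + h *\<^sub>R axis i 1)) has_real_derivative f1 i t x) (at 0)"
    and "\<And>i j t x. t > 0 \<Longrightarrow> ((\<lambda>h. f1 i t (x + h *\<^sub>R axis j 1)) has_real_derivative f2 i j t x) (at 0)"
    and "\<And>t. t > 0 \<Longrightarrow> continuous_on UNIV (f t)"
    and "\<And>i t. t > 0 \<Longrightarrow> continuous_on UNIV (f1 i t)"
    and "\<And>i j t. t > 0 \<Longrightarrow> continuous_on UNIV (f2 i j t)"
proof -
  let ?S = "{0<..} \<times> UNIV :: (real \<times> (real^'d)) set"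
  define F where "F = (\<lambda>(t, x). f t x)"
  define D where "D G v = (\<lambda>p. frechet_derivative G (at p) v)" for G :: "real \<times> (real^'d) \<Rightarrow> real" and v
  have CF: "Ck_on k F ?S" for k using sm unfolding smooth_on_def F_def by blast
  have C1: "Ck_on k (D F v) ?S" for k v 
    using conjunct2[OF CF[of "Suc k", unfolded Ck_on.simps]] unfolding D_def by (rule spec)
  have C2: "Ck_on k (D (D F v) w) ?S" for k v w 
    using conjunct2[OF C1[of "Suc k" v, unfolded Ck_on.simps]] unfolding D_def[of "D F v"] by (rule spec)
  have line: "((\<lambda>h. G (t + h * \<tau>, x + h *\<^sub>R e)) has_real_derivative D G (\<tau>, e) (t, x)) (at 0)"
    if "\<And>k. Ck_on k G ?S" "t > 0" for G t x \<tau> e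
    using Ck_on_Suc_line_derivative[OF that(1), where p = "(t, x)" and v = "(\<tau>, e)"] that(2) unfolding D_def by simp
  have slice: "continuous_on UNIV (\<lambda>x. G (t, x))" if "Ck_on 0 G ?S" "t > 0" for G :: "real \<times> (real^'d) \<Rightarrow> real" and t
    by (rule continuous_on_compose2[OF Ck_on_continuous[OF that(1)]]) (use that(2) in \<open>auto intro!: continuous_intros\<close>)
  show thesis
  proof (rule that[of "\<lambda>t x. D F (1, 0) (t, x)" "\<lambda>i t x. D F (0, axis i 1) (t, x)" "\<lambda>i j t x. D (D F (0, axis i 1)) (0, axis j 1) (t, x)"])
    show "continuous_on ?S (\<lambda>(t, x). f t x)" using Ck_on_continuous[OF CF] unfolding F_def .
    show "continuous_on ?S (\<lambda>(t, x). D F (1, 0) (t, x))" using Ck_on_continuous[OF C1] by simp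
    show "((\<lambda>s. f s x) has_real_derivative D F (1, 0) (t, x)) (at t)" if "t > 0" for t x
    proof -
      have "((\<lambda>h. f (t + h) x) has_real_derivative D F (1, 0) (t, x)) (at 0)"
        using line[OF CF that, where x = x and \<tau> = 1 and e = 0] by (simp add: F_def)
      then have "((\<lambda>h. f (h + t) x) has_real_derivative D F (1, 0) (t, x)) (at 0)" by (simp add: add.commute)
      then show ?thesis using DERIV_shift[of "\<lambda>s. f s x" _ 0 t] by simp
    qed
    show "((\<lambda>h. f t (x + h *\<^sub>R axis i 1)) has_real_derivative D F (0, axis i 1) (t, x)) (at 0)" if "t > 0" for i t x
      using line[OF CF that, where x = x and \<tau> = 0 and e = "axis i 1"] by (simp add: F_def)
    show "((\<lambda>h. D F (0, axis i 1) (t, x + h *\<^sub>R axis j 1)) has_real_derivative D (D F (0, axis i 1)) (0, axis j 1) (t, x)) (at 0)"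
      if "t > 0" for i j t x
      using line[OF C1 that, where x = x and \<tau> = 0 and e = "axis j 1"] by simp
    show "continuous_on UNIV (f t)" if "t > 0" for t using slice[OF CF that] by (simp add: F_def)
  qed (rule slice[OF C1] slice[OF C2], assumption)+
qed

text \<open>Two integrations by parts produce the formal adjoint, whose drift term is - C x . grad
  \<psi>. The derivatives of \<psi> are supplied as explicit functions because the cutoff below is
  of class C^2 and not smooth.\<close>

lemma fp_weak_form:
  fixes f :: "real^'d \<Rightarrow> real" and f1 :: "'d \<Rightarrow> real^'d \<Rightarrow> real" and f2 :: "'d \<Rightarrow> 'd \<Rightarrow> real^'d \<Rightarrow> real"
    and D C :: "real^'d^'d"
  assumes d1: "\<And>i x. ((\<lambda>h. f (x + h *\<^sub>R axis i 1)) has_real_derivative f1 i x) (at 0)"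
    and d2: "\<And>i j x. ((\<lambda>h. f1 i (x + h *\<^sub>R axis j 1)) has_real_derivative f2 i j x) (at 0)"
    and c: "continuous_on UNIV f" "\<And>i. continuous_on UNIV (f1 i)" "\<And>i j. continuous_on UNIV (f2 i j)"
    and e1: "\<And>i x. ((\<lambda>h. \<psi> (x + h *\<^sub>R axis i 1)) has_real_derivative \<psi>1 i x) (at 0)"
    and e2: "\<And>i j x. ((\<lambda>h. \<psi>1 i (x + h *\<^sub>R axis j 1)) has_real_derivative \<psi>2 i j x) (at 0)"
    and ce: "continuous_on UNIV \<psi>" "\<And>i. continuous_on UNIV (\<psi>1 i)" "\<And>i j. continuous_on UNIV (\<psi>2 i j)"
    and z: "\<And>x. norm x \<ge> R \<Longrightarrow> \<psi> x = 0" "\<And>i x. norm x \<ge> R \<Longrightarrow> \<psi>1 i x = 0" "\<And>i j x. norm x \<ge> R \<Longrightarrow> \<psi>2 i j x = 0"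
  shows "(\<integral>x. divergence (\<lambda>y. D *v grad f y + f y *\<^sub>R (C *v y)) x * \<psi> x \<partial>lborel)
    = (\<integral>x. f x * ((\<Sum>i\<in>UNIV. \<Sum>j\<in>UNIV. D $ i $ j * \<psi>2 i j x) - (\<Sum>i\<in>UNIV. (C *v x) $ i * \<psi>1 i x)) \<partial>lborel)"
proof -
  have pd: "partial_deriv i f x = f1 i x" for i x
    unfolding partial_deriv_def using d1[of x i] by (rule DERIV_imp_deriv)
  define G where "G i y = (\<Sum>j\<in>UNIV. D $ i $ j * f1 j y) + f y * (C *v y) $ i" for i y
  define G' where "G' i y = (\<Sum>j\<in>UNIV. D $ i $ j * f2 j i y) + (f1 i y * (C *v y) $ i + f y * C $ i $ i)" for i y
  have comp: "(D *v grad f y + f y *\<^sub>R (C *v y)) $ i = G i y" for i y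
    by (simp add: G_def grad_def pd matrix_vector_mult_def)
  have dG: "((\<lambda>h. G i (x + h *\<^sub>R axis i 1)) has_real_derivative G' i x) (at 0)" for i x
  proof -
    have lin: "((\<lambda>h. (C *v (x + h *\<^sub>R axis i 1)) $ i) has_real_derivative C $ i $ i) (at 0)"
    proof -
      have "(C *v (x + h *\<^sub>R axis i 1)) $ i = (C *v x) $ i + h * C $ i $ i" for h
        by (simp add: matrix_vector_right_distrib matrix_vector_mult_scaleR matrix_vector_mul_component inner_axis)
      then show ?thesis by (auto intro!: derivative_eq_intros)
    qed
    have 1: "((\<lambda>h. f (x + h *\<^sub>R axis i 1) * (C *v (x + h *\<^sub>R axis i 1)) $ i) has_real_derivative
        f1 i x * (C *v x) $ i + f x * C $ i $ i) (at 0)"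
      using DERIV_mult[OF d1[of x i] lin] by (simp add: mult.commute)
    have 2: "((\<lambda>h. \<Sum>j\<in>UNIV. D $ i $ j * f1 j (x + h *\<^sub>R axis i 1)) has_real_derivative
        (\<Sum>j\<in>UNIV. D $ i $ j * f2 j i x)) (at 0)"
      by (intro DERIV_sum DERIV_cmult d2)
    show ?thesis unfolding G_def G'_def by (rule DERIV_add[OF 2 1])
  qed
  have div: "divergence (\<lambda>y. D *v grad f y + f y *\<^sub>R (C *v y)) x = (\<Sum>i\<in>UNIV. G' i x)" for x
    unfolding divergence_def partial_deriv_def comp by (intro sum.cong refl DERIV_imp_deriv dG)
  have cC: "continuous_on UNIV (\<lambda>x. (C *v x) $ i)" for i by (intro continuous_intros)
  have cG: "continuous_on UNIV (G i)" "continuous_on UNIV (G' i)" for i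
    unfolding G_def G'_def by (intro continuous_intros c cC)+
  have int1: "integrable lborel (\<lambda>x. G' i x * \<psi> x)" for i
    by (rule integrable_compact_support[where R = R]) (use z in \<open>auto intro!: continuous_intros cG ce\<close>)
  have int2: "integrable lborel (\<lambda>x. f1 j x * \<psi>1 i x)" for i j
    by (rule integrable_compact_support[where R = R]) (use z in \<open>auto intro!: continuous_intros c ce\<close>)
  have int3: "integrable lborel (\<lambda>x. f x * \<psi>2 i j x)" for i j
    by (rule integrable_compact_support[where R = R]) (use z in \<open>auto intro!: continuous_intros c ce\<close>)
  have int4: "integrable lborel (\<lambda>x. f x * ((C *v x) $ i * \<psi>1 i x))" for i
    by (rule integrable_compact_support[where R = R]) (use z in \<open>auto intro!: continuous_intros c ce cC\<close>)
  have ibp1: "(\<integral>x. G' i x * \<psi> x \<partial>lborel) = - (\<integral>x. G i x * \<psi>1 i x \<partial>lborel)" for i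
    by (rule integral_by_parts[where e = "axis i 1" and R = R]) (auto intro: dG e1 cG ce z)
  have ibp2: "(\<integral>x. f1 j x * \<psi>1 i x \<partial>lborel) = - (\<integral>x. f x * \<psi>2 i j x \<partial>lborel)" for i j
    by (rule integral_by_parts[where e = "axis j 1" and R = R]) (auto intro: d1 e2 c ce z)
  have step: "(\<integral>x. G i x * \<psi>1 i x \<partial>lborel) = (\<Sum>j\<in>UNIV. D $ i $ j * (\<integral>x. f1 j x * \<psi>1 i x \<partial>lborel)) + (\<integral>x. f x * ((C *v x) $ i * \<psi>1 i x) \<partial>lborel)" for i
  proof -
    have "G i x * \<psi>1 i x = (\<Sum>j\<in>UNIV. D $ i $ j * (f1 j x * \<psi>1 i x)) + f x * ((C *v x) $ i * \<psi>1 i x)" for x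
      by (simp add: G_def distrib_right sum_distrib_right mult.assoc)
    then show ?thesis using int2 int4 by simp
  qed
  have "(\<integral>x. divergence (\<lambda>y. D *v grad f y + f y *\<^sub>R (C *v y)) x * \<psi> x \<partial>lborel) = (\<Sum>i\<in>UNIV. (\<integral>x. G' i x * \<psi> x \<partial>lborel))"
    unfolding div sum_distrib_right using int1 by simp
  also have "\<dots> = (\<Sum>i\<in>UNIV. (\<Sum>j\<in>UNIV. D $ i $ j * (\<integral>x. f x * \<psi>2 i j x \<partial>lborel)) - (\<integral>x. f x * ((C *v x) $ i * \<psi>1 i x) \<partial>lborel))"
    unfolding ibp1 step ibp2 by (simp add: sum_negf)
  also have "\<dots> = (\<integral>x. (\<Sum>i\<in>UNIV. (\<Sum>j\<in>UNIV. D $ i $ j * (f x * \<psi>2 i j x)) - f x * ((C *v x) $ i * \<psi>1 i x)) \<partial>lborel)"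
    using int3 int4 by simp
  also have "\<dots> = (\<integral>x. f x * ((\<Sum>i\<in>UNIV. \<Sum>j\<in>UNIV. D $ i $ j * \<psi>2 i j x) - (\<Sum>i\<in>UNIV. (C *v x) $ i * \<psi>1 i x)) \<partial>lborel)"
    by (intro Bochner_Integration.integral_cong refl)
      (simp add: sum_subtractf right_diff_distrib sum_distrib_left mult_ac)
  finally show ?thesis .
qed

section \<open>Plane wave test functions\<close>

text \<open>An exponent of at least 2 flattens the kink at 0. The exponents 3 and 2 are the ones
  that occur, for the cutoff and its first derivatives.\<close>

lemma max_0_power_deriv:
  fixes y :: real
  shows "((\<lambda>y. max 0 y ^ Suc (Suc k)) has_real_derivative real (Suc (Suc k)) * max 0 y ^ Suc k) (at y)"
proof -
  consider "y > 0" | "y < 0" | "y = 0" by linarith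
  then show ?thesis
  proof cases
    case 1
    have "((\<lambda>y. y ^ Suc (Suc k)) has_real_derivative real (Suc (Suc k)) * y ^ Suc k) (at y)"
      using DERIV_pow[of "Suc (Suc k)" y] by simp
    then have "((\<lambda>y. max 0 y ^ Suc (Suc k)) has_real_derivative real (Suc (Suc k)) * y ^ Suc k) (at y)"
      by (rule has_field_derivative_transform_within_open[of _ _ _ "{0<..}"]) (use 1 in auto)
    then show ?thesis using 1 by simp
  next
    case 2
    have "((\<lambda>y::real. 0 :: real) has_real_derivative 0) (at y)" by simp
    then have "((\<lambda>y. max 0 y ^ Suc (Suc k)) has_real_derivative 0) (at y)"
      by (rule has_field_derivative_transform_within_open[of _ _ _ "{..<0}"]) (use 2 in auto)
    then show ?thesis using 2 by simp
  next
    case 3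
    have "((\<lambda>h::real. \<bar>h\<bar> ^ Suc k) \<longlongrightarrow> \<bar>0\<bar> ^ Suc k) (at 0)" by (intro tendsto_intros)
    then have lim: "((\<lambda>h::real. \<bar>h\<bar> ^ Suc k) \<longlongrightarrow> 0) (at 0)" by simp
    have "((\<lambda>h::real. max 0 h ^ Suc (Suc k) / h) \<longlongrightarrow> 0) (at 0)"
    proof (rule Lim_null_comparison[OF _ lim])
      have "norm (max 0 h ^ Suc (Suc k) / h) \<le> \<bar>h\<bar> ^ Suc k" for h :: real
      proof (cases "h > 0")
        case False
        then have "max 0 h = 0" by simp
        then show ?thesis by (simp add: power_0_Suc del: power_Suc)
      qed auto
      then show "\<forall>\<^sub>F h :: real in at 0. norm (max 0 h ^ Suc (Suc k) / h) \<le> \<bar>h\<bar> ^ Suc k" by simp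
    qed
    then show ?thesis unfolding 3 DERIV_def by simp
  qed
qed

text \<open>The profile is logarithmic because the drift C x grows linearly: the gradient of the
  logarithm is of size 1/(1 + |x|), so drift times gradient stays bounded, and division by R makes
  it O(1/R).\<close>

definition cutoff_base :: "real \<Rightarrow> real^'d \<Rightarrow> real" where
  "cutoff_base R x = 1 - ln (1 + (norm x)\<^sup>2) / R"

text \<open>The cube makes the cutoff of class C^2 across the boundary of its support;
  \<open>cutoff1\<close> and \<open>cutoff2\<close> are its partial derivatives, as verified
  below.\<close>

definition cutoff :: "real \<Rightarrow> real^'d \<Rightarrow> real" where
  "cutoff R x = max 0 (cutoff_base R x) ^ 3"

definition cutoff1 :: "real \<Rightarrow> 'd \<Rightarrow> real^'d \<Rightarrow> real" where
  "cutoff1 R i x = 3 * max 0 (cutoff_base R x) ^ 2 * (- (2 * x $ i / (1 + (norm x)\<^sup>2)) / R)"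

definition cutoff2 :: "real \<Rightarrow> 'd \<Rightarrow> 'd \<Rightarrow> real^'d \<Rightarrow> real" where
  "cutoff2 R i j x = 6 * max 0 (cutoff_base R x) * ((2 * x $ i / (1 + (norm x)\<^sup>2)) * (2 * x $ j / (1 + (norm x)\<^sup>2)) / R\<^sup>2)
     - 3 * max 0 (cutoff_base R x) ^ 2 * (((if i = j then 2 else 0) / (1 + (norm x)\<^sup>2)
          - 4 * x $ i * x $ j / (1 + (norm x)\<^sup>2)\<^sup>2) / R)"

lemma one_plus_norm_square_pos: "1 + (norm x)\<^sup>2 > 0" for x :: "'a::real_normed_vector"
  by (simp add: add_pos_nonneg)

lemma one_plus_norm_square_nz [simp]: "1 + (norm x)\<^sup>2 \<noteq> 0" for x :: "'a::real_normed_vector"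
  using one_plus_norm_square_pos[of x] by linarith

lemma norm_square_line_deriv:
  fixes x :: "real^'d"
  shows "((\<lambda>h. 1 + (norm (x + h *\<^sub>R axis i 1))\<^sup>2) has_real_derivative 2 * x $ i) (at 0)"
proof -
  have "1 + (norm (x + h *\<^sub>R axis i 1))\<^sup>2 = 1 + (norm x)\<^sup>2 + 2 * h * x $ i + h\<^sup>2" for h
  proof -
    have "x \<bullet> axis i 1 = x $ i" "axis i 1 \<bullet> x = x $ i" "axis i 1 \<bullet> axis i (1 :: real) = 1"
      by (simp_all add: inner_axis inner_commute[of "axis i 1" x])
    then show ?thesis
      by (simp add: power2_norm_eq_inner inner_add_left inner_add_right) (simp add: power2_eq_square algebra_simps)
  qed
  then show ?thesis by (auto intro!: derivative_eq_intros)
qed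

lemma component_line_deriv:
  fixes x :: "real^'d"
  shows "((\<lambda>h. (x + h *\<^sub>R axis j 1) $ i) has_real_derivative (if i = j then 1 else 0)) (at 0)"
  by (auto intro!: derivative_eq_intros simp: axis_def)

lemma cutoff_base_deriv:
  fixes x :: "real^'d"
  shows "((\<lambda>h. cutoff_base R (x + h *\<^sub>R axis i 1)) has_real_derivative - (2 * x $ i / (1 + (norm x)\<^sup>2)) / R) (at 0)"
proof -
  have "((\<lambda>h. ln (1 + (norm (x + h *\<^sub>R axis i 1))\<^sup>2)) has_real_derivative 1 / (1 + (norm (x + 0 *\<^sub>R axis i 1))\<^sup>2) * (2 * x $ i)) (at 0)"
    by (rule DERIV_chain2[OF DERIV_ln_divide norm_square_line_deriv]) (simp add: one_plus_norm_square_pos)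
  from DERIV_diff[OF DERIV_const DERIV_cdivide[OF this, of R], of 1]
  show ?thesis unfolding cutoff_base_def by simp
qed

lemma cutoff_deriv:
  fixes x :: "real^'d"
  shows "((\<lambda>h. cutoff R (x + h *\<^sub>R axis i 1)) has_real_derivative cutoff1 R i x) (at 0)"
proof -
  have "((\<lambda>h. max 0 (cutoff_base R (x + h *\<^sub>R axis i 1)) ^ Suc (Suc 1)) has_real_derivative
     real (Suc (Suc 1)) * max 0 (cutoff_base R (x + 0 *\<^sub>R axis i 1)) ^ Suc 1 * (- (2 * x $ i / (1 + (norm x)\<^sup>2)) / R)) (at 0)"
    by (rule DERIV_chain2[OF max_0_power_deriv cutoff_base_deriv])
  then show ?thesis unfolding cutoff_def cutoff1_def by (simp add: eval_nat_numeral)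
qed

lemma cutoff1_deriv:
  fixes x :: "real^'d"
  shows "((\<lambda>h. cutoff1 R i (x + h *\<^sub>R axis j 1)) has_real_derivative cutoff2 R i j x) (at 0)"
proof -
  let ?q = "1 + (norm x)\<^sup>2"
  have 1: "((\<lambda>h. max 0 (cutoff_base R (x + h *\<^sub>R axis j 1)) ^ Suc (Suc 0)) has_real_derivative
     real (Suc (Suc 0)) * max 0 (cutoff_base R (x + 0 *\<^sub>R axis j 1)) ^ Suc 0 * (- (2 * x $ j / ?q) / R)) (at 0)"
    by (rule DERIV_chain2[OF max_0_power_deriv cutoff_base_deriv])
  have 2: "((\<lambda>h. (x + h *\<^sub>R axis j 1) $ i / (1 + (norm (x + h *\<^sub>R axis j 1))\<^sup>2)) has_real_derivative
      ((if i = j then 1 else 0) * (1 + (norm (x + 0 *\<^sub>R axis j 1))\<^sup>2) - (x + 0 *\<^sub>R axis j 1) $ i * (2 * x $ j))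
       / ((1 + (norm (x + 0 *\<^sub>R axis j 1))\<^sup>2) * (1 + (norm (x + 0 *\<^sub>R axis j 1))\<^sup>2))) (at 0)"
    by (rule DERIV_divide[OF component_line_deriv norm_square_line_deriv]) simp
  have "((\<lambda>h. (3 * (- 2 / R)) * (max 0 (cutoff_base R (x + h *\<^sub>R axis j 1)) ^ Suc (Suc 0) *
       ((x + h *\<^sub>R axis j 1) $ i / (1 + (norm (x + h *\<^sub>R axis j 1))\<^sup>2)))) has_real_derivative
     (3 * (- 2 / R)) * ((real (Suc (Suc 0)) * max 0 (cutoff_base R (x + 0 *\<^sub>R axis j 1)) ^ Suc 0 * (- (2 * x $ j / ?q) / R))
         * ((x + 0 *\<^sub>R axis j 1) $ i / (1 + (norm (x + 0 *\<^sub>R axis j 1))\<^sup>2))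
       + (((if i = j then 1 else 0) * (1 + (norm (x + 0 *\<^sub>R axis j 1))\<^sup>2) - (x + 0 *\<^sub>R axis j 1) $ i * (2 * x $ j))
       / ((1 + (norm (x + 0 *\<^sub>R axis j 1))\<^sup>2) * (1 + (norm (x + 0 *\<^sub>R axis j 1))\<^sup>2)))
        * max 0 (cutoff_base R (x + 0 *\<^sub>R axis j 1)) ^ Suc (Suc 0))) (at 0)"
    by (rule DERIV_cmult[OF DERIV_mult[OF 1 2]])
  moreover have "(\<lambda>h. cutoff1 R i (x + h *\<^sub>R axis j 1)) = (\<lambda>h. (3 * (- 2 / R)) * (max 0 (cutoff_base R (x + h *\<^sub>R axis j 1)) ^ Suc (Suc 0) *
       ((x + h *\<^sub>R axis j 1) $ i / (1 + (norm (x + h *\<^sub>R axis j 1))\<^sup>2))))"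
  proof -
    have "3 * m ^ 2 * (- (2 * y / q) / R) = (3 * (- 2 / R)) * (m ^ Suc (Suc 0) * (y / q))" for m y q :: real
      by (cases "R = 0"; cases "q = 0") (auto simp: field_simps power2_eq_square)
    then show ?thesis unfolding cutoff1_def by blast
  qed
  moreover have "cutoff2 R i j x = (3 * (- 2 / R)) * ((real (Suc (Suc 0)) * max 0 (cutoff_base R (x + 0 *\<^sub>R axis j 1)) ^ Suc 0 * (- (2 * x $ j / ?q) / R))
         * ((x + 0 *\<^sub>R axis j 1) $ i / (1 + (norm (x + 0 *\<^sub>R axis j 1))\<^sup>2))
       + (((if i = j then 1 else 0) * (1 + (norm (x + 0 *\<^sub>R axis j 1))\<^sup>2) - (x + 0 *\<^sub>R axis j 1) $ i * (2 * x $ j))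
       / ((1 + (norm (x + 0 *\<^sub>R axis j 1))\<^sup>2) * (1 + (norm (x + 0 *\<^sub>R axis j 1))\<^sup>2)))
        * max 0 (cutoff_base R (x + 0 *\<^sub>R axis j 1)) ^ Suc (Suc 0))"
  proof -
    define q where "q = 1 + (norm x)\<^sup>2"
    have q: "q \<noteq> 0" unfolding q_def by simp
    have split: "((if i = j then 1 else 0) * q - x $ i * (2 * x $ j)) / (q * q) = (if i = j then 1 else 0) / q - 2 * x $ i * x $ j / q\<^sup>2"
      using q by (simp add: diff_divide_distrib power2_eq_square)
    show ?thesis
      unfolding cutoff2_def q_def[symmetric] scaleR_zero_left add_0_right split
      by (cases "i = j") (simp_all add: power2_eq_square diff_divide_distrib algebra_simps)
  qed
  ultimately show ?thesis by simp
qed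

lemma continuous_on_cutoff_base: "continuous_on UNIV (cutoff_base R)"
proof -
  have "0 < 1 + (norm x)\<^sup>2" for x :: "real^'d" by (rule one_plus_norm_square_pos)
  then show ?thesis unfolding cutoff_base_def[abs_def] divide_inverse
    by (intro continuous_intros) (auto simp: less_imp_neq[symmetric])
qed

lemma continuous_on_cutoff:
  "continuous_on UNIV (cutoff R)" "continuous_on UNIV (cutoff1 R i)" "continuous_on UNIV (cutoff2 R i j)"
  unfolding cutoff_def[abs_def] cutoff1_def[abs_def] cutoff2_def[abs_def] divide_inverse[of _ R] divide_inverse[of _ "R\<^sup>2"]
  by (intro continuous_intros continuous_on_cutoff_base ballI; simp)+

lemma cutoff_base_nonpos:
  fixes x :: "real^'d"
  assumes "R \<ge> 1" "norm x \<ge> exp R"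
  shows "max 0 (cutoff_base R x) = 0"
proof -
  have "1 \<le> exp R" using assms(1) by simp
  then have "exp R \<le> exp R * exp R" by simp
  also have "\<dots> \<le> norm x * norm x" using assms(2) by (intro mult_mono) auto
  also have "\<dots> \<le> 1 + (norm x)\<^sup>2" by (simp add: power2_eq_square)
  finally have "R \<le> ln (1 + (norm x)\<^sup>2)" using ln_ge_iff[OF one_plus_norm_square_pos[of x]] by blast
  then show ?thesis using assms(1) by (simp add: cutoff_base_def)
qed

lemma cutoff_vanish:
  fixes x :: "real^'d"
  assumes "R \<ge> 1" "norm x \<ge> exp R"
  shows "cutoff R x = 0" "cutoff1 R i x = 0" "cutoff2 R i j x = 0"
  using cutoff_base_nonpos[OF assms] by (simp_all add: cutoff_def cutoff1_def cutoff2_def)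

lemma cutoff_base_le_1:
  assumes "R \<ge> 1"
  shows "max 0 (cutoff_base R x) \<le> 1"
  using assms by (simp add: cutoff_base_def)

text \<open>Each derivative carries a factor 1/R. From 2 |x_i| \<le> 1 + |x|^2 the basic quotient is
  at most 1, and after multiplication by \<open>norm x\<close> at most 2, which gives 3 and 6. In
  the second derivative the two groups of terms contribute 6 and 3 (2 + 1), together 15.\<close>

lemma cutoff_bounds:
  fixes x :: "real^'d"
  assumes R: "R \<ge> 1"
  shows "\<bar>cutoff R x\<bar> \<le> 1" and "\<bar>cutoff1 R i x\<bar> \<le> 3 / R" and "\<bar>cutoff1 R i x\<bar> * norm x \<le> 6 / R"
    and "\<bar>cutoff2 R i j x\<bar> \<le> 15 / R"
proof -
  define m where "m = max 0 (cutoff_base R x)"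
  have m: "0 \<le> m" "m \<le> 1" unfolding m_def using cutoff_base_le_1[OF R] by auto
  have m2: "0 \<le> m\<^sup>2" "m\<^sup>2 \<le> 1" using m by (auto simp: power_le_one)
  define q where "q = 1 + (norm x)\<^sup>2"
  have q: "q > 0" unfolding q_def by (rule one_plus_norm_square_pos)
  have xi: "\<bar>x $ i\<bar> \<le> norm x" for i by (rule component_le_norm_cart)
  have n2q: "2 * norm x \<le> q"
  proof -
    have "0 \<le> (norm x - 1)\<^sup>2" by simp
    then show ?thesis by (simp add: q_def power2_eq_square algebra_simps)
  qed
  have a: "\<bar>2 * x $ i / q\<bar> \<le> 1" for i using xi[of i] n2q q by (simp add: abs_mult)
  show "\<bar>cutoff R x\<bar> \<le> 1" unfolding cutoff_def m_def[symmetric] using m by (simp add: power_le_one)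
  have c1: "\<bar>cutoff1 R i x\<bar> = 3 * m\<^sup>2 * \<bar>2 * x $ i / q\<bar> / R" for i
    unfolding cutoff1_def m_def[symmetric] q_def[symmetric] using R by (simp add: abs_mult)
  have "m\<^sup>2 * \<bar>2 * x $ i / q\<bar> \<le> 1 * 1" using m2 a by (intro mult_mono) auto
  then have "3 * (m\<^sup>2 * \<bar>2 * x $ i / q\<bar>) / R \<le> 3 / R" using R by (intro divide_right_mono) auto
  then show "\<bar>cutoff1 R i x\<bar> \<le> 3 / R" unfolding c1 by (simp only: mult.assoc)
  have "\<bar>2 * x $ i / q\<bar> * norm x \<le> 2"
  proof -
    have "\<bar>x $ i\<bar> * norm x \<le> norm x * norm x" using xi by (intro mult_right_mono) auto
    also have "\<dots> \<le> q" by (simp add: q_def power2_eq_square)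
    finally show ?thesis using q by (simp add: abs_mult field_simps)
  qed
  then have "m\<^sup>2 * (\<bar>2 * x $ i / q\<bar> * norm x) \<le> 1 * 2" using m2 by (intro mult_mono) auto
  then have "3 * (m\<^sup>2 * (\<bar>2 * x $ i / q\<bar> * norm x)) / R \<le> 6 / R" using R by (intro divide_right_mono) auto
  then show "\<bar>cutoff1 R i x\<bar> * norm x \<le> 6 / R" unfolding c1 by (simp add: mult.assoc)
  have t1: "\<bar>6 * m * ((2 * x $ i / q) * (2 * x $ j / q) / R\<^sup>2)\<bar> \<le> 6 / R"
  proof -
    have "\<bar>2 * x $ i / q\<bar> * \<bar>2 * x $ j / q\<bar> \<le> 1 * 1" using a by (intro mult_mono) auto
    then have "m * (\<bar>2 * x $ i / q\<bar> * \<bar>2 * x $ j / q\<bar>) \<le> 1 * 1" using m by (intro mult_mono) auto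
    then have "6 * (m * (\<bar>2 * x $ i / q\<bar> * \<bar>2 * x $ j / q\<bar>)) / R\<^sup>2 \<le> 6 / R\<^sup>2" using R by (intro divide_right_mono) auto
    also have "\<dots> \<le> 6 / R" using R by (intro divide_left_mono) (auto simp: power2_eq_square)
    also have "6 * (m * (\<bar>2 * x $ i / q\<bar> * \<bar>2 * x $ j / q\<bar>)) / R\<^sup>2 = \<bar>6 * m * ((2 * x $ i / q) * (2 * x $ j / q) / R\<^sup>2)\<bar>"
      using m(1) by (simp add: abs_mult)
    finally show ?thesis .
  qed
  have t2: "\<bar>3 * m\<^sup>2 * (((if i = j then 2 else 0) / q - 4 * x $ i * x $ j / q\<^sup>2) / R)\<bar> \<le> 9 / R"
  proof -
    have "q \<ge> 1" unfolding q_def by simp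
    then have "\<bar>(if i = j then 2 else 0) / q\<bar> \<le> 2" by (simp add: divide_le_eq)
    moreover have "\<bar>4 * x $ i * x $ j / q\<^sup>2\<bar> \<le> 1"
    proof -
      have "\<bar>2 * x $ i / q\<bar> * \<bar>2 * x $ j / q\<bar> \<le> 1 * 1" using a by (intro mult_mono) auto
      then show ?thesis using q by (simp add: abs_mult power2_eq_square)
    qed
    ultimately have "\<bar>(if i = j then 2 else 0) / q - 4 * x $ i * x $ j / q\<^sup>2\<bar> \<le> 3" by linarith
    then have "m\<^sup>2 * \<bar>(if i = j then 2 else 0) / q - 4 * x $ i * x $ j / q\<^sup>2\<bar> \<le> 1 * 3" using m2 by (intro mult_mono) auto
    then have "3 * (m\<^sup>2 * \<bar>(if i = j then 2 else 0) / q - 4 * x $ i * x $ j / q\<^sup>2\<bar>) / R \<le> 9 / R" using R by (intro divide_right_mono) auto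
    moreover have "3 * (m\<^sup>2 * \<bar>(if i = j then 2 else 0) / q - 4 * x $ i * x $ j / q\<^sup>2\<bar>) / R
        = \<bar>3 * m\<^sup>2 * (((if i = j then 2 else 0) / q - 4 * x $ i * x $ j / q\<^sup>2) / R)\<bar>"
      using R by (simp only: abs_mult abs_divide) simp
    ultimately show ?thesis by simp
  qed
  have "\<bar>cutoff2 R i j x\<bar> \<le> 6 / R + 9 / R"
    unfolding cutoff2_def m_def[symmetric] q_def[symmetric]
    by (rule order_trans[OF abs_triangle_ineq4 add_mono[OF t1 t2]])
  then show "\<bar>cutoff2 R i j x\<bar> \<le> 15 / R" by (simp add: add_divide_distrib[symmetric])
qed

lemma cutoff_tendsto_1: "(\<lambda>n. cutoff (real (Suc n)) x) \<longlonglongrightarrow> 1"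
proof -
  have "(\<lambda>n. 1 - ln (1 + (norm x)\<^sup>2) * (1 / real (Suc n))) \<longlonglongrightarrow> 1 - ln (1 + (norm x)\<^sup>2) * 0"
    by (intro tendsto_intros LIMSEQ_inverse_real_of_nat[unfolded inverse_eq_divide])
  then have "(\<lambda>n. cutoff_base (real (Suc n)) x) \<longlonglongrightarrow> 1" unfolding cutoff_base_def by simp
  then have "(\<lambda>n. max 0 (cutoff_base (real (Suc n)) x) ^ 3) \<longlonglongrightarrow> max 0 1 ^ 3" by (intro tendsto_intros)
  then show ?thesis unfolding cutoff_def by simp
qed

lemma cos_line_deriv:
  fixes x \<zeta> :: "real^'d"
  shows "((\<lambda>h. \<alpha> * cos (\<zeta> \<bullet> (x + h *\<^sub>R axis i 1) + \<theta>)) has_real_derivative - (\<alpha> * \<zeta> $ i * sin (\<zeta> \<bullet> x + \<theta>))) (at 0)"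
    and "((\<lambda>h. - (\<alpha> * \<zeta> $ k * sin (\<zeta> \<bullet> (x + h *\<^sub>R axis i 1) + \<theta>))) has_real_derivative - (\<alpha> * \<zeta> $ k * \<zeta> $ i * cos (\<zeta> \<bullet> x + \<theta>))) (at 0)"
proof -
  have e: "\<zeta> \<bullet> (x + h *\<^sub>R axis i 1) + \<theta> = \<zeta> \<bullet> x + \<theta> + h * \<zeta> $ i" for h
    by (simp add: inner_add_right inner_axis)
  show "((\<lambda>h. \<alpha> * cos (\<zeta> \<bullet> (x + h *\<^sub>R axis i 1) + \<theta>)) has_real_derivative - (\<alpha> * \<zeta> $ i * sin (\<zeta> \<bullet> x + \<theta>))) (at 0)"
    unfolding e by (auto intro!: derivative_eq_intros)
  show "((\<lambda>h. - (\<alpha> * \<zeta> $ k * sin (\<zeta> \<bullet> (x + h *\<^sub>R axis i 1) + \<theta>))) has_real_derivative - (\<alpha> * \<zeta> $ k * \<zeta> $ i * cos (\<zeta> \<bullet> x + \<theta>))) (at 0)"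
    unfolding e by (auto intro!: derivative_eq_intros)
qed

text \<open>The part of the adjoint operator, applied to cutoff times wave, in which the cutoff is
  differentiated at least once.\<close>

definition cutoff_error :: "real^'d^'d \<Rightarrow> real^'d^'d \<Rightarrow> real \<Rightarrow> real \<Rightarrow> real^'d \<Rightarrow> real \<Rightarrow> real^'d \<Rightarrow> real" where
  "cutoff_error D C R \<alpha> \<zeta> \<theta> x =
    (\<Sum>i\<in>UNIV. \<Sum>j\<in>UNIV. D $ i $ j * (cutoff2 R i j x * (\<alpha> * cos (\<zeta> \<bullet> x + \<theta>))
        + cutoff1 R i x * - (\<alpha> * \<zeta> $ j * sin (\<zeta> \<bullet> x + \<theta>)) + cutoff1 R j x * - (\<alpha> * \<zeta> $ i * sin (\<zeta> \<bullet> x + \<theta>))))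
    - (\<Sum>i\<in>UNIV. (C *v x) $ i * (cutoff1 R i x * (\<alpha> * cos (\<zeta> \<bullet> x + \<theta>))))"

text \<open>Z controls the derivatives of the wave, and the linear growth of C x is paid for by the
  bound on \<open>\<bar>cutoff1 R i x\<bar> * norm x\<close>. The constant c depends on D, C and Z
  only.\<close>

lemma cutoff_error_bound:
  fixes D C :: "real^'d^'d"
  shows "\<exists>c\<ge>0. \<forall>R \<alpha> \<zeta> \<theta> x. R \<ge> 1 \<longrightarrow> \<bar>\<alpha>\<bar> \<le> 1 \<longrightarrow> norm \<zeta> \<le> Z \<longrightarrow> \<bar>cutoff_error D C R \<alpha> \<zeta> \<theta> x\<bar> \<le> c / R"
proof -
  obtain K where K: "K > 0" "\<And>x. norm (C *v x) \<le> norm x * K"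
    using bounded_linear.pos_bounded[OF matrix_vector_mul_bounded_linear[of C]] by blast
  define c where "c = (\<Sum>i\<in>UNIV. \<Sum>j\<in>UNIV. \<bar>D $ i $ j\<bar> * (15 + 3 * \<bar>Z\<bar> + 3 * \<bar>Z\<bar>)) + (\<Sum>i\<in>(UNIV :: 'd set). 6 * K)"
  have c0: "c \<ge> 0" unfolding c_def using K(1) by (intro add_nonneg_nonneg sum_nonneg) auto
  show ?thesis
  proof (intro exI[of _ c] conjI c0 allI impI)
    fix R \<alpha> \<theta> :: real and \<zeta> x :: "real^'d" assume R: "R \<ge> 1" and \<alpha>: "\<bar>\<alpha>\<bar> \<le> 1" and \<zeta>: "norm \<zeta> \<le> Z"
    have ph: "\<bar>\<alpha> * cos (\<zeta> \<bullet> x + \<theta>)\<bar> \<le> 1"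
      unfolding abs_mult using mult_mono[OF \<alpha> abs_cos_le_one] by simp
    have ph1: "\<bar>- (\<alpha> * \<zeta> $ i * sin (\<zeta> \<bullet> x + \<theta>))\<bar> \<le> \<bar>Z\<bar>" for i
    proof -
      have "\<bar>\<zeta> $ i\<bar> \<le> \<bar>Z\<bar>" using component_le_norm_cart[of \<zeta> i] \<zeta> by linarith
      then have "\<bar>\<alpha>\<bar> * \<bar>\<zeta> $ i\<bar> * \<bar>sin (\<zeta> \<bullet> x + \<theta>)\<bar> \<le> 1 * \<bar>Z\<bar> * 1"
        using \<alpha> by (intro mult_mono abs_sin_le_one) auto
      then show ?thesis by (simp add: abs_mult)
    qed
    have R0: "3 / R \<ge> 0" "15 / R \<ge> 0" using R by auto
    have t1: "\<bar>D $ i $ j * (cutoff2 R i j x * (\<alpha> * cos (\<zeta> \<bullet> x + \<theta>))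
        + cutoff1 R i x * - (\<alpha> * \<zeta> $ j * sin (\<zeta> \<bullet> x + \<theta>)) + cutoff1 R j x * - (\<alpha> * \<zeta> $ i * sin (\<zeta> \<bullet> x + \<theta>)))\<bar>
        \<le> \<bar>D $ i $ j\<bar> * (15 / R * 1 + 3 / R * \<bar>Z\<bar> + 3 / R * \<bar>Z\<bar>)" for i j
    proof -
      have a: "\<bar>cutoff2 R i j x * (\<alpha> * cos (\<zeta> \<bullet> x + \<theta>))\<bar> \<le> 15 / R * 1"
        unfolding abs_mult[of "cutoff2 R i j x"] by (rule mult_mono[OF cutoff_bounds(4)[OF R] ph R0(2)]) simp
      have b: "\<bar>cutoff1 R i x * - (\<alpha> * \<zeta> $ j * sin (\<zeta> \<bullet> x + \<theta>))\<bar> \<le> 3 / R * \<bar>Z\<bar>" for i j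
        unfolding abs_mult[of "cutoff1 R i x"] by (rule mult_mono[OF cutoff_bounds(2)[OF R] ph1 R0(1)]) simp
      have "\<bar>cutoff2 R i j x * (\<alpha> * cos (\<zeta> \<bullet> x + \<theta>))
        + cutoff1 R i x * - (\<alpha> * \<zeta> $ j * sin (\<zeta> \<bullet> x + \<theta>)) + cutoff1 R j x * - (\<alpha> * \<zeta> $ i * sin (\<zeta> \<bullet> x + \<theta>))\<bar>
        \<le> 15 / R * 1 + 3 / R * \<bar>Z\<bar> + 3 / R * \<bar>Z\<bar>"
        using a b[of i j] b[of j i] by linarith
      then show ?thesis unfolding abs_mult[of "D $ i $ j"] by (intro mult_left_mono) auto
    qed
    have t2: "\<bar>(C *v x) $ i * (cutoff1 R i x * (\<alpha> * cos (\<zeta> \<bullet> x + \<theta>)))\<bar> \<le> 6 * K / R" for i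
    proof -
      have "\<bar>(C *v x) $ i\<bar> \<le> norm x * K" using component_le_norm_cart[of "C *v x" i] K(2)[of x] by linarith
      then have "\<bar>(C *v x) $ i\<bar> * \<bar>cutoff1 R i x\<bar> \<le> norm x * K * \<bar>cutoff1 R i x\<bar>" by (intro mult_right_mono) auto
      also have "\<dots> = K * (\<bar>cutoff1 R i x\<bar> * norm x)" by simp
      also have "\<dots> \<le> K * (6 / R)" using K(1) cutoff_bounds(3)[OF R] by (intro mult_left_mono) auto
      finally have fin: "\<bar>(C *v x) $ i\<bar> * \<bar>cutoff1 R i x\<bar> \<le> K * (6 / R)" .
      have "(\<bar>(C *v x) $ i\<bar> * \<bar>cutoff1 R i x\<bar>) * \<bar>\<alpha> * cos (\<zeta> \<bullet> x + \<theta>)\<bar> \<le> (K * (6 / R)) * 1"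
        by (rule mult_mono[OF fin ph]) (use K(1) R in auto)
      then show ?thesis by (simp add: abs_mult mult_ac)
    qed
    have "\<bar>cutoff_error D C R \<alpha> \<zeta> \<theta> x\<bar> \<le> (\<Sum>i\<in>UNIV. \<Sum>j\<in>UNIV. \<bar>D $ i $ j\<bar> * (15 / R * 1 + 3 / R * \<bar>Z\<bar> + 3 / R * \<bar>Z\<bar>)) + (\<Sum>i\<in>(UNIV :: 'd set). 6 * K / R)"
      unfolding cutoff_error_def
      by (rule order_trans[OF abs_triangle_ineq4 add_mono])
        (rule order_trans[OF sum_abs sum_mono] t1 t2 order_trans[OF sum_abs sum_mono[OF t1]])+
    also have "\<dots> = c / R"
    proof -
      have "\<bar>D $ i $ j\<bar> * (15 / R * 1 + 3 / R * \<bar>Z\<bar> + 3 / R * \<bar>Z\<bar>) = \<bar>D $ i $ j\<bar> * (15 + 3 * \<bar>Z\<bar> + 3 * \<bar>Z\<bar>) / R" for i j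
        by (simp add: add_divide_distrib distrib_left)
      then show ?thesis unfolding c_def by (simp add: add_divide_distrib sum_divide_distrib)
    qed
    finally show "\<bar>cutoff_error D C R \<alpha> \<zeta> \<theta> x\<bar> \<le> c / R" .
  qed
qed

lemma fp_weak_form_cos:
  fixes f :: "real^'d \<Rightarrow> real" and f1 :: "'d \<Rightarrow> real^'d \<Rightarrow> real" and f2 :: "'d \<Rightarrow> 'd \<Rightarrow> real^'d \<Rightarrow> real"
    and D C :: "real^'d^'d"
  assumes d1: "\<And>i x. ((\<lambda>h. f (x + h *\<^sub>R axis i 1)) has_real_derivative f1 i x) (at 0)"
    and d2: "\<And>i j x. ((\<lambda>h. f1 i (x + h *\<^sub>R axis j 1)) has_real_derivative f2 i j x) (at 0)"
    and c: "continuous_on UNIV f" "\<And>i. continuous_on UNIV (f1 i)" "\<And>i j. continuous_on UNIV (f2 i j)"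
    and R: "R \<ge> 1"
  shows "(\<integral>x. divergence (\<lambda>y. D *v grad f y + f y *\<^sub>R (C *v y)) x * (cutoff R x * (\<alpha> * cos (\<zeta> \<bullet> x + \<theta>))) \<partial>lborel)
    = (\<integral>x. f x * (cutoff R x * (\<alpha> * (- (\<zeta> \<bullet> (D *v \<zeta>)) * cos (\<zeta> \<bullet> x + \<theta>) + (\<zeta> \<bullet> (C *v x)) * sin (\<zeta> \<bullet> x + \<theta>)))
          + cutoff_error D C R \<alpha> \<zeta> \<theta> x) \<partial>lborel)"
proof -
  define \<phi> where "\<phi> x = \<alpha> * cos (\<zeta> \<bullet> x + \<theta>)" for x
  define \<phi>1 where "\<phi>1 i x = - (\<alpha> * \<zeta> $ i * sin (\<zeta> \<bullet> x + \<theta>))" for i x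
  define \<phi>2 where "\<phi>2 i j x = - (\<alpha> * \<zeta> $ i * \<zeta> $ j * cos (\<zeta> \<bullet> x + \<theta>))" for i j x
  have d\<phi>: "((\<lambda>h. \<phi> (x + h *\<^sub>R axis i 1)) has_real_derivative \<phi>1 i x) (at 0)"
    "((\<lambda>h. \<phi>1 i (x + h *\<^sub>R axis j 1)) has_real_derivative \<phi>2 i j x) (at 0)" for i j x
    unfolding \<phi>_def \<phi>1_def \<phi>2_def by (rule cos_line_deriv)+
  have c\<phi>: "continuous_on UNIV \<phi>" "continuous_on UNIV (\<phi>1 i)" "continuous_on UNIV (\<phi>2 i j)" for i j
    unfolding \<phi>_def \<phi>1_def \<phi>2_def by (intro continuous_intros)+
  have eq: "(\<integral>x. divergence (\<lambda>y. D *v grad f y + f y *\<^sub>R (C *v y)) x * (cutoff R x * \<phi> x) \<partial>lborel)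
    = (\<integral>x. f x * ((\<Sum>i\<in>UNIV. \<Sum>j\<in>UNIV. D $ i $ j * (cutoff2 R i j x * \<phi> x + cutoff1 R i x * \<phi>1 j x + cutoff1 R j x * \<phi>1 i x + cutoff R x * \<phi>2 i j x))
       - (\<Sum>i\<in>UNIV. (C *v x) $ i * (cutoff1 R i x * \<phi> x + cutoff R x * \<phi>1 i x))) \<partial>lborel)"
  proof (rule fp_weak_form[OF d1 d2 c, where R = "exp R"])
    show "((\<lambda>h. cutoff R (x + h *\<^sub>R axis i 1) * \<phi> (x + h *\<^sub>R axis i 1)) has_real_derivative
        cutoff1 R i x * \<phi> x + cutoff R x * \<phi>1 i x) (at 0)" for i x
      using DERIV_mult[OF cutoff_deriv d\<phi>(1), of R x i x i] by (simp add: mult.commute)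
    show "((\<lambda>h. cutoff1 R i (x + h *\<^sub>R axis j 1) * \<phi> (x + h *\<^sub>R axis j 1) + cutoff R (x + h *\<^sub>R axis j 1) * \<phi>1 i (x + h *\<^sub>R axis j 1)) has_real_derivative
        cutoff2 R i j x * \<phi> x + cutoff1 R i x * \<phi>1 j x + cutoff1 R j x * \<phi>1 i x + cutoff R x * \<phi>2 i j x) (at 0)" for i j x
      using DERIV_add[OF DERIV_mult[OF cutoff1_deriv d\<phi>(1)] DERIV_mult[OF cutoff_deriv d\<phi>(2)], of R i x j x j R x j i x j]
      by (simp add: algebra_simps)
  qed (auto intro!: continuous_intros continuous_on_cutoff c\<phi> simp: cutoff_vanish[OF R])
  have alg: "(\<Sum>i\<in>UNIV. \<Sum>j\<in>UNIV. D $ i $ j * (cutoff2 R i j x * \<phi> x + cutoff1 R i x * \<phi>1 j x + cutoff1 R j x * \<phi>1 i x + cutoff R x * \<phi>2 i j x))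
       - (\<Sum>i\<in>UNIV. (C *v x) $ i * (cutoff1 R i x * \<phi> x + cutoff R x * \<phi>1 i x))
     = cutoff R x * (\<alpha> * (- (\<zeta> \<bullet> (D *v \<zeta>)) * cos (\<zeta> \<bullet> x + \<theta>) + (\<zeta> \<bullet> (C *v x)) * sin (\<zeta> \<bullet> x + \<theta>)))
          + cutoff_error D C R \<alpha> \<zeta> \<theta> x" for x
  proof -
    have 1: "(\<Sum>i\<in>UNIV. \<Sum>j\<in>UNIV. D $ i $ j * (cutoff R x * \<phi>2 i j x)) = cutoff R x * (\<alpha> * (- (\<zeta> \<bullet> (D *v \<zeta>)) * cos (\<zeta> \<bullet> x + \<theta>)))"
      by (simp add: \<phi>2_def inner_vec_def matrix_vector_mult_def sum_distrib_left sum_distrib_right sum_negf mult_ac)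
    have 2: "(\<Sum>i\<in>UNIV. (C *v x) $ i * (cutoff R x * \<phi>1 i x)) = - (cutoff R x * (\<alpha> * ((\<zeta> \<bullet> (C *v x)) * sin (\<zeta> \<bullet> x + \<theta>))))"
      by (simp add: \<phi>1_def inner_vec_def sum_distrib_left sum_distrib_right sum_negf mult_ac)
    have e: "cutoff_error D C R \<alpha> \<zeta> \<theta> x = (\<Sum>i\<in>UNIV. \<Sum>j\<in>UNIV. D $ i $ j * (cutoff2 R i j x * \<phi> x + cutoff1 R i x * \<phi>1 j x + cutoff1 R j x * \<phi>1 i x))
       - (\<Sum>i\<in>UNIV. (C *v x) $ i * (cutoff1 R i x * \<phi> x))"
      unfolding cutoff_error_def \<phi>_def \<phi>1_def ..
    have "(\<Sum>i\<in>UNIV. \<Sum>j\<in>UNIV. D $ i $ j * (cutoff2 R i j x * \<phi> x + cutoff1 R i x * \<phi>1 j x + cutoff1 R j x * \<phi>1 i x + cutoff R x * \<phi>2 i j x))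
       = (\<Sum>i\<in>UNIV. \<Sum>j\<in>UNIV. D $ i $ j * (cutoff2 R i j x * \<phi> x + cutoff1 R i x * \<phi>1 j x + cutoff1 R j x * \<phi>1 i x))
        + (\<Sum>i\<in>UNIV. \<Sum>j\<in>UNIV. D $ i $ j * (cutoff R x * \<phi>2 i j x))"
      by (simp only: distrib_left[of "D $ _ $ _" "_ + _ + _" "cutoff R x * _"] sum.distrib)
    moreover have "(\<Sum>i\<in>UNIV. (C *v x) $ i * (cutoff1 R i x * \<phi> x + cutoff R x * \<phi>1 i x))
       = (\<Sum>i\<in>UNIV. (C *v x) $ i * (cutoff1 R i x * \<phi> x)) + (\<Sum>i\<in>UNIV. (C *v x) $ i * (cutoff R x * \<phi>1 i x))"
      by (simp only: distrib_left sum.distrib)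
    ultimately show ?thesis unfolding e 1 2 by (simp only: distrib_left)
  qed
  show ?thesis using eq unfolding alg unfolding \<phi>_def .
qed

section \<open>Evolution of plane waves along a solution\<close>

lemma L1_norm_continuous:
  fixes f :: "real \<Rightarrow> 'a::euclidean_space \<Rightarrow> real"
  assumes int: "\<And>t. t \<ge> 0 \<Longrightarrow> integrable lborel (f t)"
    and L1: "\<And>t. t \<ge> 0 \<Longrightarrow> ((\<lambda>s. \<integral>x. \<bar>f s x - f t x\<bar> \<partial>lborel) \<longlongrightarrow> 0) (at t within {0..})"
  shows "continuous_on {0..} (\<lambda>s. \<integral>x. \<bar>f s x\<bar> \<partial>lborel)"
  unfolding continuous_on_def
proof
  fix t :: real assume t: "t \<in> {0..}"
  have "((\<lambda>s. (\<integral>x. \<bar>f s x\<bar> \<partial>lborel) - (\<integral>x. \<bar>f t x\<bar> \<partial>lborel)) \<longlongrightarrow> 0) (at t within {0..})"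
  proof (rule Lim_null_comparison[OF _ L1])
    show "\<forall>\<^sub>F s in at t within {0..}. norm ((\<integral>x. \<bar>f s x\<bar> \<partial>lborel) - (\<integral>x. \<bar>f t x\<bar> \<partial>lborel)) \<le> (\<integral>x. \<bar>f s x - f t x\<bar> \<partial>lborel)"
      unfolding eventually_at_filter
    proof (intro always_eventually allI impI)
      fix s :: real assume s: "s \<noteq> t" "s \<in> {0..}"
      have i: "integrable lborel (f s)" "integrable lborel (f t)" using int s t by auto
      have "norm ((\<integral>x. \<bar>f s x\<bar> \<partial>lborel) - (\<integral>x. \<bar>f t x\<bar> \<partial>lborel)) = \<bar>\<integral>x. \<bar>f s x\<bar> - \<bar>f t x\<bar> \<partial>lborel\<bar>" using i by simp
      also have "\<dots> \<le> (\<integral>x. \<bar>\<bar>f s x\<bar> - \<bar>f t x\<bar>\<bar> \<partial>lborel)" by (rule integral_abs_bound)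
      also have "\<dots> \<le> (\<integral>x. \<bar>f s x - f t x\<bar> \<partial>lborel)" using i by (intro integral_mono) auto
      finally show "norm ((\<integral>x. \<bar>f s x\<bar> \<partial>lborel) - (\<integral>x. \<bar>f t x\<bar> \<partial>lborel)) \<le> (\<integral>x. \<bar>f s x - f t x\<bar> \<partial>lborel)" .
    qed
  qed (use t in auto)
  then show "((\<lambda>s. \<integral>x. \<bar>f s x\<bar> \<partial>lborel) \<longlongrightarrow> (\<integral>x. \<bar>f t x\<bar> \<partial>lborel)) (at t within {0..})"
    by (rule LIM_zero_cancel)
qed

text \<open>The increment splits in two: moving f costs at most its L^1 increment because |g| \<le>
  1, and moving g with f fixed is dominated by |f|. So g has to be continuous in s only at each
  fixed x.\<close>

lemma L1_pairing_continuous: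
  fixes f :: "real \<Rightarrow> 'a::euclidean_space \<Rightarrow> real"
  assumes int: "\<And>t. t \<ge> 0 \<Longrightarrow> integrable lborel (f t)"
    and L1: "\<And>t. t \<ge> 0 \<Longrightarrow> ((\<lambda>s. \<integral>x. \<bar>f s x - f t x\<bar> \<partial>lborel) \<longlongrightarrow> 0) (at t within {0..})"
    and r: "0 \<le> r"
    and gm: "\<And>s. s \<in> {r..t} \<Longrightarrow> g s \<in> borel_measurable borel"
    and gb: "\<And>s x. s \<in> {r..t} \<Longrightarrow> \<bar>g s x\<bar> \<le> 1"
    and gc: "\<And>x. continuous_on {r..t} (\<lambda>s. g s x)"
  shows "continuous_on {r..t} (\<lambda>s. \<integral>x. f s x * g s x \<partial>lborel)"
  unfolding continuous_on_sequentially comp_def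
proof (intro allI ballI impI, elim conjE)
  fix \<sigma> :: "nat \<Rightarrow> real" and a assume a: "a \<in> {r..t}" and \<sigma>: "\<forall>n. \<sigma> n \<in> {r..t}" "\<sigma> \<longlonglongrightarrow> a"
  have a0: "a \<ge> 0" and \<sigma>0: "\<And>n. \<sigma> n \<ge> 0" using a \<sigma>(1) r by (auto intro: order_trans)
  have prod_int: "integrable lborel (\<lambda>x. h x * g s x)" if "integrable lborel h" "s \<in> {r..t}" for h s
  proof (rule Bochner_Integration.integrable_bound[OF that(1)])
    show "AE x in lborel. norm (h x * g s x) \<le> norm (h x)"
      using gb[OF that(2)] by (intro AE_I2) (simp add: abs_mult mult_left_le)
    show "(\<lambda>x. h x * g s x) \<in> borel_measurable lborel" using that(1) gm[OF that(2)] by simp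
  qed
  have one: "(\<lambda>n. (\<integral>x. f a x * g (\<sigma> n) x \<partial>lborel)) \<longlonglongrightarrow> (\<integral>x. f a x * g a x \<partial>lborel)"
  proof (rule integral_dominated_convergence[where w = "\<lambda>x. \<bar>f a x\<bar>"])
    show "AE x in lborel. (\<lambda>n. f a x * g (\<sigma> n) x) \<longlonglongrightarrow> f a x * g a x"
      using a \<sigma> by (intro AE_I2 tendsto_intros continuous_on_tendsto_compose[OF gc]) auto
    show "AE x in lborel. norm (f a x * g (\<sigma> n) x) \<le> \<bar>f a x\<bar>" for n
      using gb \<sigma>(1) by (intro AE_I2) (simp add: abs_mult mult_left_le)
  qed (use int[OF a0] prod_int[OF int[OF a0]] a \<sigma>(1) in auto)
  have two: "(\<lambda>n. (\<integral>x. f (\<sigma> n) x * g (\<sigma> n) x \<partial>lborel) - (\<integral>x. f a x * g (\<sigma> n) x \<partial>lborel)) \<longlonglongrightarrow> 0"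
  proof (rule Lim_null_comparison)
    have "continuous (at a within {0..}) (\<lambda>s. \<integral>x. \<bar>f s x - f a x\<bar> \<partial>lborel)"
      unfolding continuous_within using L1[OF a0] by simp
    then show "(\<lambda>n. \<integral>x. \<bar>f (\<sigma> n) x - f a x\<bar> \<partial>lborel) \<longlonglongrightarrow> 0"
      unfolding continuous_within_sequentially comp_def using \<sigma> \<sigma>0 by auto
    show "\<forall>\<^sub>F n in sequentially. norm ((\<integral>x. f (\<sigma> n) x * g (\<sigma> n) x \<partial>lborel) - (\<integral>x. f a x * g (\<sigma> n) x \<partial>lborel)) \<le> (\<integral>x. \<bar>f (\<sigma> n) x - f a x\<bar> \<partial>lborel)"
    proof (intro always_eventually allI)
      fix n
      have s: "\<sigma> n \<in> {r..t}" using \<sigma>(1) by blast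
      have i: "integrable lborel (\<lambda>x. (f (\<sigma> n) x - f a x) * g (\<sigma> n) x)"
        by (rule prod_int[OF _ s]) (use int[OF a0] int[OF \<sigma>0] in auto)
      have "(\<integral>x. f (\<sigma> n) x * g (\<sigma> n) x \<partial>lborel) - (\<integral>x. f a x * g (\<sigma> n) x \<partial>lborel) = (\<integral>x. (f (\<sigma> n) x - f a x) * g (\<sigma> n) x \<partial>lborel)"
        using prod_int[OF int[OF a0] s] prod_int[OF int[OF \<sigma>0] s] by (simp add: left_diff_distrib)
      also have "norm \<dots> \<le> (\<integral>x. norm ((f (\<sigma> n) x - f a x) * g (\<sigma> n) x) \<partial>lborel)" by (rule integral_norm_bound)
      also have "\<dots> \<le> (\<integral>x. \<bar>f (\<sigma> n) x - f a x\<bar> \<partial>lborel)"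
        using i int[OF a0] int[OF \<sigma>0] gb[OF s] by (intro integral_mono integrable_norm) (auto simp: abs_mult mult_left_le)
      finally show "norm ((\<integral>x. f (\<sigma> n) x * g (\<sigma> n) x \<partial>lborel) - (\<integral>x. f a x * g (\<sigma> n) x \<partial>lborel)) \<le> (\<integral>x. \<bar>f (\<sigma> n) x - f a x\<bar> \<partial>lborel)" .
    qed
  qed
  show "(\<lambda>n. \<integral>x. f (\<sigma> n) x * g (\<sigma> n) x \<partial>lborel) \<longlonglongrightarrow> (\<integral>x. f a x * g a x \<partial>lborel)"
    using tendsto_add[OF two one] by simp
qed

text \<open>The plane wave \<open>exp(-q(t - s)) cos(\<zeta>(t - s) \<bullet> x + \<theta>)\<close> solves the backward equation, so its
  integral against the solution is constant in time, up to the cutoff error \<open>O(1/R)\<close>.\<close>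

lemma fp_cos_evolution:
  fixes D C P :: "real^'d^'d" and f :: "real \<Rightarrow> real^'d \<Rightarrow> real"
  assumes sol: "fp_solution D C f0 f"
    and E0: "E 0 = mat 1"
    and dE: "\<And>t x. t \<ge> 0 \<Longrightarrow> ((\<lambda>t. x v* E t) has_vector_derivative - ((x v* E t) v* C)) (at t)"
    and lyap: "C ** P + P ** transpose C = 2 *\<^sub>R D"
    and mono: "\<And>t x. t \<ge> 0 \<Longrightarrow> (x v* E t) \<bullet> (P *v (x v* E t)) \<le> x \<bullet> (P *v x)"
    and r: "0 \<le> r" and rt: "r < t"
  shows "(\<integral>x. f t x * cos (\<xi> \<bullet> x + \<theta>) \<partial>lborel)
    = exp (- (\<xi> \<bullet> (P *v \<xi>) - (\<xi> v* E (t - r)) \<bullet> (P *v (\<xi> v* E (t - r)))) / 2)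
      * (\<integral>x. f r x * cos ((\<xi> v* E (t - r)) \<bullet> x + \<theta>) \<partial>lborel)"
proof -
  have sm: "smooth_on (\<lambda>(t, x). f t x) ({0<..} \<times> UNIV)"
    and pde: "\<And>t x. t > 0 \<Longrightarrow> ((\<lambda>s. f s x) has_real_derivative
        divergence (\<lambda>y. D *v grad (f t) y + f t y *\<^sub>R (C *v y)) x) (at t)"
    and int: "\<And>t. t \<ge> 0 \<Longrightarrow> integrable lborel (f t)"
    and L1: "\<And>t. t \<ge> 0 \<Longrightarrow> ((\<lambda>s. \<integral>x. \<bar>f s x - f t x\<bar> \<partial>lborel) \<longlongrightarrow> 0) (at t within {0..})"
    using sol unfolding fp_solution_def by blast+
  obtain ft f1 f2 where cf: "continuous_on ({0<..} \<times> UNIV) (\<lambda>(t, x). f t x)"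
    and dft: "\<And>t x. t > 0 \<Longrightarrow> ((\<lambda>s. f s x) has_real_derivative ft t x) (at t)"
    and cft: "continuous_on ({0<..} \<times> UNIV) (\<lambda>(t, x). ft t x)"
    and df1: "\<And>i t x. t > 0 \<Longrightarrow> ((\<lambda>h. f t (x + h *\<^sub>R axis i 1)) has_real_derivative f1 i t x) (at 0)"
    and df2: "\<And>i j t x. t > 0 \<Longrightarrow> ((\<lambda>h. f1 i t (x + h *\<^sub>R axis j 1)) has_real_derivative f2 i j t x) (at 0)"
    and cs: "\<And>t. t > 0 \<Longrightarrow> continuous_on UNIV (f t)" "\<And>i t. t > 0 \<Longrightarrow> continuous_on UNIV (f1 i t)"
       "\<And>i j t. t > 0 \<Longrightarrow> continuous_on UNIV (f2 i j t)"
    using smooth_on_partial_derivs[OF sm] by blast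
  have ft_eq: "ft s x = divergence (\<lambda>y. D *v grad (f s) y + f s y *\<^sub>R (C *v y)) x" if "s > 0" for s x
    using DERIV_unique[OF dft pde] that by blast
  \<comment> \<open>The frequency is followed backwards from \<xi> at the final time t, so that
    \<zeta>' = C^T \<zeta>.\<close>
  define \<zeta> where "\<zeta> s = \<xi> v* E (t - s)" for s
  have d\<zeta>: "(\<zeta> has_vector_derivative (\<zeta> s v* C)) (at s)" if "s \<le> t" for s
  proof -
    have "((\<lambda>s. t - s) has_vector_derivative -1) (at s)"
      by (auto intro!: derivative_eq_intros simp: has_real_derivative_iff_has_vector_derivative[symmetric])
    moreover have "((\<lambda>t. \<xi> v* E t) has_vector_derivative - (\<zeta> s v* C)) (at (t - s))"
      unfolding \<zeta>_def by (rule dE) (use that in simp)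
    ultimately have "((\<lambda>t. \<xi> v* E t) \<circ> (\<lambda>s. t - s) has_vector_derivative -1 *\<^sub>R (- (\<zeta> s v* C))) (at s)"
      by (rule vector_diff_chain_at)
    then show ?thesis unfolding \<zeta>_def comp_def by (simp only: scaleR_minus1_left minus_minus)
  qed
  define q where "q s = \<zeta> s \<bullet> (P *v \<zeta> s)" for s
  have dq: "(q has_real_derivative 2 * (\<zeta> s \<bullet> (D *v \<zeta> s))) (at s)" if "s \<le> t" for s
  proof -
    have "((\<lambda>t. (\<xi> v* E t) \<bullet> (P *v (\<xi> v* E t))) has_real_derivative - (2 * (\<zeta> s \<bullet> (D *v \<zeta> s)))) (at (t - s))"
      using quadratic_form_along_flow[OF dE, of "t - s" \<xi> P \<xi>] that unfolding lyap \<zeta>_def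
      by (simp add: scaleR_matrix_vector_assoc[symmetric])
    moreover have "((\<lambda>s. t - s) has_real_derivative -1) (at s)" by (auto intro!: derivative_eq_intros)
    ultimately have "((\<lambda>s. (\<xi> v* E (t - s)) \<bullet> (P *v (\<xi> v* E (t - s)))) has_real_derivative - (2 * (\<zeta> s \<bullet> (D *v \<zeta> s))) * -1) (at s)"
      by (rule DERIV_chain2)
    then show ?thesis unfolding q_def \<zeta>_def by simp
  qed
  \<comment> \<open>Normalised to 1 at the final time. By the Lyapunov equation its logarithmic
    derivative is the form of D at \<zeta>, and \<open>mono\<close> keeps it at most 1.\<close>
  define \<alpha> where "\<alpha> s = exp (- (\<xi> \<bullet> (P *v \<xi>) - q s) / 2)" for s
  have d\<alpha>: "(\<alpha> has_real_derivative \<alpha> s * (\<zeta> s \<bullet> (D *v \<zeta> s))) (at s)" if "s \<le> t" for s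
    unfolding \<alpha>_def using dq[OF that] by (auto intro!: derivative_eq_intros)
  have \<alpha>1: "\<bar>\<alpha> s\<bar> \<le> 1" if "s \<le> t" for s
    using mono[of "t - s" \<xi>] that unfolding \<alpha>_def q_def \<zeta>_def by simp
  have c\<zeta>: "continuous_on {..t} \<zeta>"
    by (rule continuous_at_imp_continuous_on) (use d\<zeta> has_vector_derivative_continuous in blast)
  have c\<alpha>: "continuous_on {..t} \<alpha>"
    by (rule continuous_at_imp_continuous_on) (use d\<alpha> DERIV_isCont in blast)
  have c\<zeta>r: "continuous_on {r..t} \<zeta>" by (rule continuous_on_subset[OF c\<zeta>]) auto
  have c\<alpha>r: "continuous_on {r..t} \<alpha>" by (rule continuous_on_subset[OF c\<alpha>]) auto
  obtain Z where "\<forall>y\<in>\<zeta> ` {r..t}. norm y \<le> Z"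
    using compact_imp_bounded[OF compact_continuous_image[OF c\<zeta>r compact_Icc]] unfolding bounded_iff by blast
  then have Z: "\<And>s. s \<in> {r..t} \<Longrightarrow> norm (\<zeta> s) \<le> Z" by blast
  obtain M where M: "\<And>s. s \<in> {r..t} \<Longrightarrow> (\<integral>x. \<bar>f s x\<bar> \<partial>lborel) \<le> M"
  proof -
    have "continuous_on {r..t} (\<lambda>s. \<integral>x. \<bar>f s x\<bar> \<partial>lborel)"
      by (rule continuous_on_subset[OF L1_norm_continuous[OF int L1]]) (use r in auto)
    from compact_imp_bounded[OF compact_continuous_image[OF this compact_Icc]]
    obtain M where "\<forall>y\<in>(\<lambda>s. \<integral>x. \<bar>f s x\<bar> \<partial>lborel) ` {r..t}. norm y \<le> M" unfolding bounded_iff by blast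
    then have "\<And>s. s \<in> {r..t} \<Longrightarrow> norm (\<integral>x. \<bar>f s x\<bar> \<partial>lborel) \<le> M" by blast
    then have "(\<integral>x. \<bar>f s x\<bar> \<partial>lborel) \<le> M" if "s \<in> {r..t}" for s
      using that abs_ge_self order_trans unfolding real_norm_def by blast
    then show thesis by (rule that)
  qed
  obtain c where c0: "c \<ge> 0"
    and c: "\<And>R \<alpha> \<zeta> \<theta> x. R \<ge> 1 \<Longrightarrow> \<bar>\<alpha>\<bar> \<le> 1 \<Longrightarrow> norm \<zeta> \<le> Z \<Longrightarrow> \<bar>cutoff_error D C R \<alpha> \<zeta> \<theta> x\<bar> \<le> c / R"
    using cutoff_error_bound[of Z D C] by blast
  define \<phi> where "\<phi> s x = \<alpha> s * cos (\<zeta> s \<bullet> x + \<theta>)" for s x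
  define \<phi>' where "\<phi>' s x = \<alpha> s * ((\<zeta> s \<bullet> (D *v \<zeta> s)) * cos (\<zeta> s \<bullet> x + \<theta>) - (\<zeta> s \<bullet> (C *v x)) * sin (\<zeta> s \<bullet> x + \<theta>))" for s x
  have \<phi>1: "\<bar>\<phi> s x\<bar> \<le> 1" if "s \<le> t" for s x
    unfolding \<phi>_def abs_mult using mult_mono[OF \<alpha>1[OF that] abs_cos_le_one] by simp
  have d\<phi>: "((\<lambda>s. \<phi> s x) has_real_derivative \<phi>' s x) (at s)" if "s \<le> t" for s x
  proof -
    have "((\<lambda>s. \<zeta> s \<bullet> x) has_vector_derivative (\<zeta> s v* C) \<bullet> x) (at s)"
      by (rule bounded_linear.has_vector_derivative[OF bounded_linear_inner_left d\<zeta>[OF that]])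
    then have z: "((\<lambda>s. \<zeta> s \<bullet> x) has_real_derivative \<zeta> s \<bullet> (C *v x)) (at s)"
      by (simp add: has_real_derivative_iff_has_vector_derivative dot_lmul_matrix)
    have "((\<lambda>s. cos (\<zeta> s \<bullet> x + \<theta>)) has_real_derivative - sin (\<zeta> s \<bullet> x + \<theta>) * (\<zeta> s \<bullet> (C *v x))) (at s)"
      using z by (auto intro!: derivative_eq_intros)
    from DERIV_mult[OF d\<alpha>[OF that] this] show ?thesis
      unfolding \<phi>_def \<phi>'_def by (simp add: algebra_simps)
  qed
  define J where "J R s = (\<integral>x. f s x * (cutoff R x * \<phi> s x) \<partial>lborel)" for R s
  have c\<phi>x: "continuous_on UNIV (\<phi> s)" for s unfolding \<phi>_def by (intro continuous_intros)
  \<comment> \<open>The time derivative of the wave cancels the adjoint operator applied to it, so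
    only f times the cutoff error is left; M bounds the L^1 norm of f on the whole time
    interval.\<close>
  have dJ: "\<exists>J'. (J R has_real_derivative J') (at s) \<and> \<bar>J'\<bar> \<le> c * M / R" if R: "R \<ge> 1" and s: "s \<in> {r<..<t}" for R s
  proof -
    have s0: "s > 0" using s r by auto
    have st: "s \<le> t" using s by auto
    let ?U = "{r<..<t}"
    have Usub: "?U \<times> UNIV \<subseteq> {0<..} \<times> (UNIV :: (real^'d) set)" using r by auto
    have cU: "continuous_on (?U \<times> UNIV) (\<lambda>p. \<zeta> (fst p))" "continuous_on (?U \<times> UNIV) (\<lambda>p. \<alpha> (fst p))"
      by (rule continuous_on_compose2[OF c\<zeta>] continuous_on_compose2[OF c\<alpha>]; auto intro!: continuous_intros)+
    have cxU: "continuous_on (?U \<times> UNIV) (\<lambda>p :: real \<times> (real^'d). cutoff R (snd p))"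
      by (rule continuous_on_compose2[OF continuous_on_cutoff(1)]) (auto intro!: continuous_intros)
    have cfU: "continuous_on (?U \<times> UNIV) (\<lambda>p. f (fst p) (snd p))" "continuous_on (?U \<times> UNIV) (\<lambda>p. ft (fst p) (snd p))"
      using continuous_on_subset[OF cf Usub] continuous_on_subset[OF cft Usub] by (simp_all add: case_prod_beta)
    have c\<phi>U: "continuous_on (?U \<times> UNIV) (\<lambda>p. \<phi> (fst p) (snd p))"
      unfolding \<phi>_def by (intro continuous_intros cU)
    have lin: "continuous_on S (\<lambda>p. A *v g p)" if "continuous_on S g" for A :: "real^'d^'d" and g :: "real \<times> (real^'d) \<Rightarrow> real^'d" and S
      by (rule bounded_linear.continuous_on[OF matrix_vector_mul_bounded_linear that])
    have c\<phi>'U: "continuous_on (?U \<times> UNIV) (\<lambda>p. \<phi>' (fst p) (snd p))"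
      unfolding \<phi>'_def by (intro continuous_intros cU lin)
    let ?g' = "\<lambda>s x. ft s x * (cutoff R x * \<phi> s x) + f s x * (cutoff R x * \<phi>' s x)"
    have D1: "(J R has_real_derivative (\<integral>x. ?g' s x \<partial>lborel)) (at s)"
      unfolding J_def
    proof (rule integral_deriv_compact_support[where U = ?U and R = "exp R"])
      show "((\<lambda>s. f s x * (cutoff R x * \<phi> s x)) has_real_derivative ?g' s x) (at s)" if "s \<in> ?U" for s x
      proof -
        have "s > 0" "s \<le> t" using that r by auto
        from DERIV_mult[OF dft[OF this(1), of x] DERIV_cmult[OF d\<phi>[OF this(2), of x], of "cutoff R x"]]
        show ?thesis by (simp add: algebra_simps)
      qed
      show "continuous_on UNIV (\<lambda>x. f s x * (cutoff R x * \<phi> s x))" if "s \<in> ?U" for s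
        using that r by (intro continuous_intros cs continuous_on_cutoff c\<phi>x) auto
      show "continuous_on (?U \<times> UNIV) (\<lambda>(s, x). ?g' s x)"
        unfolding case_prod_beta by (intro continuous_intros cfU cxU c\<phi>U c\<phi>'U)
    qed (use s in \<open>auto simp: cutoff_vanish[OF R]\<close>)
    have c\<phi>'x: "continuous_on UNIV (\<phi>' s)"
      unfolding \<phi>'_def by (intro continuous_intros)
    have ceqs: "continuous_on UNIV (ft s)"
      by (rule continuous_on_compose2[OF cft, of UNIV "\<lambda>x. (s, x)", simplified]) (use s0 in \<open>auto intro!: continuous_intros\<close>)
    have i1: "integrable lborel (\<lambda>x. ft s x * (cutoff R x * \<phi> s x))"
      by (rule integrable_compact_support[where R = "exp R"])
        (auto intro!: continuous_intros ceqs continuous_on_cutoff c\<phi>x simp: cutoff_vanish[OF R])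
    have i2: "integrable lborel (\<lambda>x. f s x * (cutoff R x * \<phi>' s x))"
      by (rule integrable_compact_support[where R = "exp R"])
        (auto intro!: continuous_intros cs(1)[OF s0] continuous_on_cutoff c\<phi>'x simp: cutoff_vanish[OF R])
    let ?err = "cutoff_error D C R (\<alpha> s) (\<zeta> s) \<theta>"
    have errb: "\<bar>?err x\<bar> \<le> c / R" for x
      by (rule c[OF R \<alpha>1[OF st] Z]) (use s in auto)
    have errm: "?err \<in> borel_measurable borel"
      unfolding cutoff_error_def[abs_def]
      by (intro continuous_on_borel_measurable continuous_intros continuous_on_cutoff)
    have ie: "integrable lborel (\<lambda>x. f s x * ?err x)"
    proof (rule Bochner_Integration.integrable_bound)
      show "integrable lborel (\<lambda>x. \<bar>f s x\<bar> * (c / R))" using int[of s] s0 by simp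
      show "AE x in lborel. norm (f s x * ?err x) \<le> norm (\<bar>f s x\<bar> * (c / R))"
        using errb c0 R by (intro AE_I2) (simp only: real_norm_def abs_mult abs_abs, intro mult_left_mono; simp)
      show "(\<lambda>x. f s x * ?err x) \<in> borel_measurable lborel" using int[of s] s0 errm by simp
    qed
    have "(\<integral>x. ft s x * (cutoff R x * \<phi> s x) \<partial>lborel)
       = (\<integral>x. divergence (\<lambda>y. D *v grad (f s) y + f s y *\<^sub>R (C *v y)) x * (cutoff R x * (\<alpha> s * cos (\<zeta> s \<bullet> x + \<theta>))) \<partial>lborel)"
      unfolding ft_eq[OF s0] \<phi>_def ..
    also have "\<dots> = (\<integral>x. f s x * (cutoff R x * (\<alpha> s * (- (\<zeta> s \<bullet> (D *v \<zeta> s)) * cos (\<zeta> s \<bullet> x + \<theta>) + (\<zeta> s \<bullet> (C *v x)) * sin (\<zeta> s \<bullet> x + \<theta>)))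
          + ?err x) \<partial>lborel)"
      by (rule fp_weak_form_cos[OF df1[OF s0] df2[OF s0] cs(1)[OF s0] cs(2)[OF s0] cs(3)[OF s0] R])
    also have "\<dots> = (\<integral>x. f s x * ?err x - f s x * (cutoff R x * \<phi>' s x) \<partial>lborel)"
      by (intro Bochner_Integration.integral_cong refl) (simp add: \<phi>'_def algebra_simps)
    also have "\<dots> = (\<integral>x. f s x * ?err x \<partial>lborel) - (\<integral>x. f s x * (cutoff R x * \<phi>' s x) \<partial>lborel)"
      by (rule Bochner_Integration.integral_diff[OF ie i2])
    finally have "(\<integral>x. ?g' s x \<partial>lborel) = (\<integral>x. f s x * ?err x \<partial>lborel)" using i1 i2 by simp
    moreover have "\<bar>\<integral>x. f s x * ?err x \<partial>lborel\<bar> \<le> c * M / R"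
    proof -
      have "\<bar>\<integral>x. f s x * ?err x \<partial>lborel\<bar> \<le> (\<integral>x. \<bar>f s x * ?err x\<bar> \<partial>lborel)" by (rule integral_abs_bound)
      also have "\<dots> \<le> (\<integral>x. \<bar>f s x\<bar> * (c / R) \<partial>lborel)"
      proof (rule integral_mono)
        show "integrable lborel (\<lambda>x. \<bar>f s x * ?err x\<bar>)" by (rule integrable_abs[OF ie])
        show "integrable lborel (\<lambda>x. \<bar>f s x\<bar> * (c / R))" using int[of s] s0 by simp
        show "\<bar>f s x * ?err x\<bar> \<le> \<bar>f s x\<bar> * (c / R)" for x
          unfolding abs_mult by (rule mult_left_mono[OF errb abs_ge_zero])
      qed
      also have "\<dots> = (\<integral>x. \<bar>f s x\<bar> \<partial>lborel) * (c / R)" by simp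
      also have "\<dots> \<le> M * (c / R)" using M[of s] s c0 R by (intro mult_right_mono) auto
      finally show ?thesis by (simp add: mult.commute)
    qed
    ultimately show ?thesis using D1 by auto
  qed
  \<comment> \<open>The equation holds for positive times only. Time r = 0 is reached through the
    L^1 continuity of the solution, and the mean value theorem then needs the derivative only inside
    the interval.\<close>
  have cJ: "continuous_on {r..t} (J R)" if R: "R \<ge> 1" for R
    unfolding J_def
  proof (rule L1_pairing_continuous[OF int L1 r])
    show "(\<lambda>x. cutoff R x * \<phi> s x) \<in> borel_measurable borel" for s
      by (intro continuous_on_borel_measurable continuous_intros continuous_on_cutoff c\<phi>x)
    show "\<bar>cutoff R x * \<phi> s x\<bar> \<le> 1" if "s \<in> {r..t}" for s x
      unfolding abs_mult using mult_mono[OF cutoff_bounds(1)[OF R] \<phi>1] that by fastforce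
    show "continuous_on {r..t} (\<lambda>s. cutoff R x * \<phi> s x)" for x
      unfolding \<phi>_def by (intro continuous_intros c\<zeta>r c\<alpha>r)
  qed
  have diff: "\<bar>J R t - J R r\<bar> \<le> (t - r) * (c * M / R)" if R: "R \<ge> 1" for R
  proof -
    from dJ[OF R] obtain J' where J': "\<And>s. s \<in> {r<..<t} \<Longrightarrow> (J R has_real_derivative J' s) (at s)"
        "\<And>s. s \<in> {r<..<t} \<Longrightarrow> \<bar>J' s\<bar> \<le> c * M / R" by metis
    obtain z where z: "r < z" "z < t" "J R t - J R r = J' z * (t - r)"
      using mvt[OF rt cJ[OF R], of "\<lambda>s h. J' s * h"] J'(1) by (auto simp: has_field_derivative_def)
    have "\<bar>J' z\<bar> * (t - r) \<le> (c * M / R) * (t - r)" using J'(2)[of z] z rt by (intro mult_right_mono) auto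
    then show ?thesis unfolding z(3) abs_mult using rt by (simp add: mult.commute)
  qed
  have limJ: "(\<lambda>n. J (real (Suc n)) s) \<longlonglongrightarrow> (\<integral>x. f s x * \<phi> s x \<partial>lborel)" if s: "s \<in> {r..t}" for s
    unfolding J_def
  proof (rule integral_dominated_convergence[where w = "\<lambda>x. \<bar>f s x\<bar>"])
    have iis: "integrable lborel (f s)" using int s r by auto
    show "integrable lborel (\<lambda>x. \<bar>f s x\<bar>)" using iis by simp
    have [measurable]: "f s \<in> borel_measurable borel" using iis by (auto dest: borel_measurable_integrable)
    have [measurable]: "\<phi> s \<in> borel_measurable borel" by (rule continuous_on_borel_measurable[OF c\<phi>x])
    have [measurable]: "cutoff R \<in> borel_measurable borel" for R :: real by (rule continuous_on_borel_measurable[OF continuous_on_cutoff(1)])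
    show "(\<lambda>x. f s x * \<phi> s x) \<in> borel_measurable lborel" by simp
    show "(\<lambda>x. f s x * (cutoff (real (Suc n)) x * \<phi> s x)) \<in> borel_measurable lborel" for n by simp
    show "AE x in lborel. (\<lambda>n. f s x * (cutoff (real (Suc n)) x * \<phi> s x)) \<longlonglongrightarrow> f s x * \<phi> s x"
    proof (rule AE_I2)
      fix x
      have "(\<lambda>n. f s x * (cutoff (real (Suc n)) x * \<phi> s x)) \<longlonglongrightarrow> f s x * (1 * \<phi> s x)"
        by (intro tendsto_intros cutoff_tendsto_1)
      then show "(\<lambda>n. f s x * (cutoff (real (Suc n)) x * \<phi> s x)) \<longlonglongrightarrow> f s x * \<phi> s x" by simp
    qed
    show "AE x in lborel. norm (f s x * (cutoff (real (Suc n)) x * \<phi> s x)) \<le> \<bar>f s x\<bar>" for n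
    proof (rule AE_I2)
      fix x
      have "\<bar>cutoff (real (Suc n)) x\<bar> * \<bar>\<phi> s x\<bar> \<le> 1 * 1"
        using s by (intro mult_mono cutoff_bounds \<phi>1) auto
      then have "\<bar>f s x\<bar> * (\<bar>cutoff (real (Suc n)) x\<bar> * \<bar>\<phi> s x\<bar>) \<le> \<bar>f s x\<bar> * 1" by (intro mult_left_mono) auto
      then show "norm (f s x * (cutoff (real (Suc n)) x * \<phi> s x)) \<le> \<bar>f s x\<bar>" by (simp add: abs_mult)
    qed
  qed
  have "(\<lambda>n. J (real (Suc n)) t - J (real (Suc n)) r) \<longlonglongrightarrow> 0"
  proof (rule Lim_null_comparison)
    show "\<forall>\<^sub>F n in sequentially. norm (J (real (Suc n)) t - J (real (Suc n)) r) \<le> (t - r) * (c * M) * (1 / real (Suc n))"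
      using diff[of "real (Suc n)" for n] by (intro always_eventually allI) simp
    have "(\<lambda>n. (t - r) * (c * M) * (1 / real (Suc n))) \<longlonglongrightarrow> (t - r) * (c * M) * 0"
      by (intro tendsto_intros LIMSEQ_inverse_real_of_nat[unfolded inverse_eq_divide])
    then show "(\<lambda>n. (t - r) * (c * M) * (1 / real (Suc n))) \<longlonglongrightarrow> 0" by simp
  qed
  moreover have "(\<lambda>n. J (real (Suc n)) t - J (real (Suc n)) r) \<longlonglongrightarrow> (\<integral>x. f t x * \<phi> t x \<partial>lborel) - (\<integral>x. f r x * \<phi> r x \<partial>lborel)"
    using rt by (intro tendsto_diff limJ) auto
  ultimately have eq: "(\<integral>x. f t x * \<phi> t x \<partial>lborel) = (\<integral>x. f r x * \<phi> r x \<partial>lborel)"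
    using LIMSEQ_unique by fastforce
  have x0: "x v* E 0 = x" for x
    by (simp add: E0 vec_eq_iff vector_matrix_mult_def mat_def if_distrib if_distribR cong: if_cong)
  have "\<phi> t x = cos (\<xi> \<bullet> x + \<theta>)" for x unfolding \<phi>_def \<alpha>_def q_def \<zeta>_def by (simp add: x0)
  moreover have "(\<integral>x. f r x * \<phi> r x \<partial>lborel) = \<alpha> r * (\<integral>x. f r x * cos (\<zeta> r \<bullet> x + \<theta>) \<partial>lborel)"
    unfolding \<phi>_def by (simp add: mult.left_commute)
  ultimately show ?thesis using eq unfolding \<alpha>_def q_def \<zeta>_def by simp
qed

section \<open>Transport to the Gaussian\<close>

text \<open>The dual form of the Mehler semigroup; \<open>a\<close> bounds the contraction over a
  time span. The entropy estimates use this property alone and no longer the differential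
  equation.\<close>

definition mehler_evolution :: "(real \<Rightarrow> real) \<Rightarrow> (real \<Rightarrow> real^'d \<Rightarrow> real) \<Rightarrow> bool" where
  "mehler_evolution a u \<longleftrightarrow> (\<forall>t\<ge>0. integrable gauss (u t)) \<and>
     (\<forall>r t. 0 \<le> r \<longrightarrow> r < t \<longrightarrow> (\<exists>A B :: real^'d^'d. A ** transpose A + B ** transpose B = mat 1 \<and>
        (\<forall>\<eta>. norm (\<eta> v* A) \<le> a (t - r) * norm \<eta>) \<and>
        (\<forall>G. continuous_on UNIV G \<longrightarrow> (\<exists>b. \<forall>x. \<bar>G x\<bar> \<le> b) \<longrightarrow>
           (\<integral>x. u t x * G x \<partial>gauss) = (\<integral>x. u r x * mehler A B G x \<partial>gauss))))"

section \<open>The equilibrium and the passage to Gaussian variables\<close>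

lemma AE_gauss_iff: "(AE x in gauss. Q x) \<longleftrightarrow> (AE x in lborel. Q x)"
  unfolding gauss_def by (subst AE_density) (auto simp: gauss_density_pos)

text \<open>The exceptional set in z lies in the image under T of a null set, and a linear image of
  a null set in the same dimension is null.\<close>

lemma AE_lborel_linear:
  fixes S T :: "real^'d^'d"
  assumes TS: "T ** S = mat 1" and Q: "AE x in lborel. Q x"
  shows "AE z in lborel. Q (S *v z)"
proof -
  obtain N where N: "{x \<in> space lborel. \<not> Q x} \<subseteq> N" "emeasure lborel N = 0" "N \<in> sets lborel"
    using AE_E[OF Q] by blast
  then have "N \<in> null_sets lebesgue" by (auto intro: null_sets_completionI)
  then have "negligible N" by (simp add: negligible_iff_null_sets)
  then have neg: "negligible ((*v) T ` N)" 
    by (intro negligible_differentiable_image_negligible) (auto intro!: linear_imp_differentiable_on)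
  have "AE z in completion lborel. z \<notin> (*v) T ` N"
    using neg by (intro AE_not_in) (simp add: negligible_iff_null_sets)
  then have "AE z in lborel. z \<notin> (*v) T ` N" by (simp add: AE_completion_iff)
  then show ?thesis
  proof eventually_elim
    case (elim z)
    have "T *v (S *v z) = z" using TS by (simp add: matrix_vector_mul_assoc)
    then have "S *v z \<notin> N" using elim by (metis imageI)
    then show ?case using N(1) by auto
  qed
qed

lemma flow_tendsto_0:
  fixes E :: "real \<Rightarrow> real^'n^'n"
  assumes "\<mu> > 0" and E: "\<And>t x. t \<ge> 0 \<Longrightarrow> norm (x v* E t) \<le> K * (1 + t ^ n) * exp (- \<mu> * t) * norm x"
  shows "((\<lambda>t. x v* E t) \<longlongrightarrow> 0) at_top"
proof (rule Lim_null_comparison)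
  show "\<forall>\<^sub>F t in at_top. norm (x v* E t) \<le> K * ((1 + t ^ n) * exp (- \<mu> * t)) * norm x"
    using eventually_ge_at_top[of "0::real"] by eventually_elim (use E in \<open>simp add: mult.assoc\<close>)
  show "((\<lambda>t. K * ((1 + t ^ n) * exp (- \<mu> * t)) * norm x) \<longlongrightarrow> 0) at_top"
    by (rule tendsto_eq_intros poly_mult_exp_tendsto_0[OF assms(1)] refl | simp)+
qed

lemma norm_square_via_factor:
  fixes S P :: "real^'d^'d"
  assumes "P = S ** transpose S"
  shows "x \<bullet> (P *v x) = (norm (x v* S))\<^sup>2"
  unfolding assms by (simp add: power2_norm_eq_inner dot_lmul_matrix matrix_vector_mul_assoc[symmetric])

text \<open>An equilibrium is a constant solution, so its cosine integrals can be followed to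
  infinite time: the frequency tends to 0, unit mass fixes the limit, and the characteristic
  function of the Gaussian with covariance P remains. Positivity of g is a consequence of this
  identification.\<close>

lemma equilibrium_gaussian:
  fixes D C P S T :: "real^'d^'d" and g :: "real^'d \<Rightarrow> real"
  assumes eq: "fp_equilibrium D C g" and m1: "mass g = 1"
    and E0: "E 0 = mat 1"
    and dE: "\<And>t x. t \<ge> 0 \<Longrightarrow> ((\<lambda>t. x v* E t) has_vector_derivative - ((x v* E t) v* C)) (at t)"
    and lim: "\<And>x. ((\<lambda>t. x v* E t) \<longlongrightarrow> 0) at_top"
    and lyap: "C ** P + P ** transpose C = 2 *\<^sub>R D"
    and mono: "\<And>t x. t \<ge> 0 \<Longrightarrow> (x v* E t) \<bullet> (P *v (x v* E t)) \<le> x \<bullet> (P *v x)"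
    and P: "P = S ** transpose S" and ST: "S ** T = mat 1" "T ** S = mat 1"
  shows "integrable lborel g" and "AE x in lborel. g x > 0"
    and "density lborel (\<lambda>x. ennreal (g x)) = distr gauss borel ((*v) S)"
proof -
  have sol: "fp_solution D C g (\<lambda>t. g)" using eq unfolding fp_equilibrium_def .
  have gi: "integrable lborel g" using sol unfolding fp_solution_def by auto
  then show "integrable lborel g" .
  have gm [measurable]: "g \<in> borel_measurable borel" using gi by (auto dest: borel_measurable_integrable)
  have g1: "(\<integral>x. g x \<partial>lborel) = 1" using m1 unfolding mass_def .
  have cosg: "(\<integral>x. g x * cos (\<xi> \<bullet> x + \<theta>) \<partial>lborel) = exp (- (\<xi> \<bullet> (P *v \<xi>)) / 2) * cos \<theta>" for \<xi> \<theta>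
  proof -
    \<comment> \<open>\<open>Suc n\<close> keeps the time positive, as
      \<open>fp_cos_evolution\<close> compares two distinct times.\<close>
    define z where "z n = \<xi> v* E (real (Suc n))" for n
    have z0: "z \<longlonglongrightarrow> 0" unfolding z_def
      by (rule filterlim_compose[OF lim]) (rule filterlim_compose[OF filterlim_real_sequentially filterlim_Suc])
    have ev: "(\<integral>x. g x * cos (\<xi> \<bullet> x + \<theta>) \<partial>lborel)
       = exp (- (\<xi> \<bullet> (P *v \<xi>) - z n \<bullet> (P *v z n)) / 2) * (\<integral>x. g x * cos (z n \<bullet> x + \<theta>) \<partial>lborel)" for n
      using fp_cos_evolution[OF sol E0 dE lyap mono order.refl, of "real (Suc n)" \<xi> \<theta>] unfolding z_def by simp
    have "(\<lambda>n. \<integral>x. g x * cos (z n \<bullet> x + \<theta>) \<partial>lborel) \<longlonglongrightarrow> (\<integral>x. g x * cos (0 \<bullet> x + \<theta>) \<partial>lborel)"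
    proof (rule integral_dominated_convergence[where w = "\<lambda>x. \<bar>g x\<bar>"])
      show "AE x in lborel. (\<lambda>n. g x * cos (z n \<bullet> x + \<theta>)) \<longlonglongrightarrow> g x * cos (0 \<bullet> x + \<theta>)"
        by (intro AE_I2 tendsto_intros z0)
      show "AE x in lborel. norm (g x * cos (z n \<bullet> x + \<theta>)) \<le> \<bar>g x\<bar>" for n
        by (intro AE_I2) (simp add: abs_mult mult_left_le)
    qed (use gi in auto)
    then have i: "(\<lambda>n. \<integral>x. g x * cos (z n \<bullet> x + \<theta>) \<partial>lborel) \<longlonglongrightarrow> cos \<theta>" using g1 by simp
    have q: "(\<lambda>n. z n \<bullet> (P *v z n)) \<longlonglongrightarrow> 0 \<bullet> (P *v 0)"
      by (intro tendsto_inner z0 bounded_linear.tendsto[OF matrix_vector_mul_bounded_linear z0])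
    have e: "(\<lambda>n. exp (- (\<xi> \<bullet> (P *v \<xi>) - z n \<bullet> (P *v z n)) / 2)) \<longlonglongrightarrow> exp (- (\<xi> \<bullet> (P *v \<xi>) - 0 \<bullet> (P *v 0)) / 2)"
      by (intro tendsto_intros q) simp
    have "(\<lambda>n::nat. \<integral>x. g x * cos (\<xi> \<bullet> x + \<theta>) \<partial>lborel) \<longlonglongrightarrow> exp (- (\<xi> \<bullet> (P *v \<xi>) - 0 \<bullet> (P *v 0)) / 2) * cos \<theta>"
      using tendsto_mult[OF e i] unfolding ev[symmetric] .
    then show ?thesis by (simp add: LIMSEQ_const_iff)
  qed
  have cosS: "(\<integral>z. 1 * cos (\<xi> \<bullet> (S *v z) + \<theta>) \<partial>gauss) = exp (- (\<xi> \<bullet> (P *v \<xi>)) / 2) * cos \<theta>" for \<xi> \<theta>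
    using gauss_cos[of "\<xi> v* S" \<theta>] unfolding norm_square_via_factor[OF P] by (simp add: dot_lmul_matrix)
  have cont: "(\<integral>x. g x * h x \<partial>lborel) = (\<integral>z. h (S *v z) \<partial>gauss)" if h: "continuous_on UNIV h" "\<And>x. \<bar>h x\<bar> \<le> b" for h b
  proof -
    have "(\<integral>x. g x * h x \<partial>lborel) = (\<integral>z. 1 * h (S *v z) \<partial>gauss)"
    proof (rule cos_integrals_determine_integrals[OF sigma_finite_lborel _ gi gauss.sigma_finite_measure_axioms _ _ _ h])
      show "(\<integral>x. g x * cos (\<xi> \<bullet> x + \<theta>) \<partial>lborel) = (\<integral>z. 1 * cos (\<xi> \<bullet> (S *v z) + \<theta>) \<partial>gauss)" for \<xi> \<theta>
        unfolding cosg cosS ..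
    qed auto
    then show ?thesis by simp
  qed
  have meas: "(\<integral>x. g x * h x \<partial>lborel) = (\<integral>z. h (S *v z) \<partial>gauss)"
    if h [measurable]: "h \<in> borel_measurable borel" and b: "\<And>x. \<bar>h x\<bar> \<le> b" for h b
  proof -
    obtain k where k: "\<And>n. continuous_on UNIV (k n)" "\<And>n x. \<bar>k n x\<bar> \<le> b" and lim: "AE x in lborel. (\<lambda>n. k n x) \<longlonglongrightarrow> h x"
      using bounded_measurable_approx[OF h b] by blast
    have [measurable]: "k n \<in> borel_measurable borel" for n by (rule continuous_on_borel_measurable[OF k(1)])
    have 1: "(\<lambda>n. \<integral>x. g x * k n x \<partial>lborel) \<longlonglongrightarrow> (\<integral>x. g x * h x \<partial>lborel)"
    proof (rule integral_dominated_convergence[where w = "\<lambda>x. \<bar>g x\<bar> * b"])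
      show "AE x in lborel. (\<lambda>n. g x * k n x) \<longlonglongrightarrow> g x * h x"
        using lim by eventually_elim (intro tendsto_intros)
      show "AE x in lborel. norm (g x * k n x) \<le> \<bar>g x\<bar> * b" for n
        using k(2) by (intro AE_I2) (simp add: abs_mult mult_left_mono)
    qed (use gi in auto)
    have 2: "(\<lambda>n. \<integral>z. k n (S *v z) \<partial>gauss) \<longlonglongrightarrow> (\<integral>z. h (S *v z) \<partial>gauss)"
    proof (rule integral_dominated_convergence[where w = "\<lambda>_. b"])
      show "AE z in gauss. (\<lambda>n. k n (S *v z)) \<longlonglongrightarrow> h (S *v z)"
        unfolding AE_gauss_iff by (rule AE_lborel_linear[OF ST(2) lim])
    qed (use k(2) in auto)
    show ?thesis using 1 2 unfolding cont[OF k] by (rule LIMSEQ_unique)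
  qed
  have ind: "(\<integral>x. g x * indicator A x \<partial>lborel) = (\<integral>z. indicator A (S *v z) \<partial>gauss)" if "A \<in> sets borel" for A
    by (rule meas[where b = 1]) (use that in \<open>auto simp: indicator_def\<close>)
  \<comment> \<open>Over this set g integrates to at most 0, while the Gaussian side is a
    probability, so both vanish.\<close>
  let ?A = "{x. g x \<le> 0}"
  have Am [measurable]: "?A \<in> sets borel" by measurable
  have "(\<integral>z. indicator ?A (S *v z) \<partial>gauss) \<le> (0::real)"
  proof -
    have "0 \<le> (\<integral>x. - (g x * indicator ?A x) \<partial>lborel)"
      by (rule Bochner_Integration.integral_nonneg) (auto simp: indicator_def)
    then show ?thesis unfolding ind[OF Am, symmetric] by simp
  qed
  moreover have ii: "integrable gauss (\<lambda>z. indicator ?A (S *v z) :: real)"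
    by (rule integrable_gauss_bounded[where b = 1]) (auto simp: indicator_def)
  moreover have "0 \<le> (\<integral>z. indicator ?A (S *v z) \<partial>gauss :: real)" by simp
  ultimately have "(\<integral>z. indicator ?A (S *v z) \<partial>gauss) = (0::real)" by linarith
  then have "AE z in gauss. indicator ?A (S *v z) = (0::real)"
    using ii by (subst (asm) integral_nonneg_eq_0_iff_AE) auto
  then have "AE z in lborel. g (S *v z) > 0"
    unfolding AE_gauss_iff by eventually_elim (auto simp: indicator_def split: if_splits)
  from AE_lborel_linear[OF ST(1) this]
  show pos: "AE x in lborel. g x > 0" by (simp add: matrix_vector_mul_assoc ST(1))
  show "density lborel (\<lambda>x. ennreal (g x)) = distr gauss borel ((*v) S)"
  proof (rule measure_eqI)
    fix A assume "A \<in> sets (density lborel (\<lambda>x. ennreal (g x)))"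
    then have A [measurable]: "A \<in> sets borel" by simp
    have "emeasure (density lborel (\<lambda>x. ennreal (g x))) A = (\<integral>\<^sup>+x. ennreal (g x * indicator A x) \<partial>lborel)"
      by (subst emeasure_density) (auto intro!: nn_integral_cong simp: indicator_def)
    also have "\<dots> = ennreal (\<integral>x. g x * indicator A x \<partial>lborel)"
    proof (rule nn_integral_eq_integral)
      show "integrable lborel (\<lambda>x. g x * indicator A x)"
        by (rule Bochner_Integration.integrable_bound[OF gi]) (auto simp: indicator_def)
      show "AE x in lborel. 0 \<le> g x * indicator A x" using pos by eventually_elim (auto simp: indicator_def)
    qed
    also have "\<dots> = ennreal (\<integral>z. indicator A (S *v z) \<partial>gauss)" unfolding ind[OF A] ..
    also have "\<dots> = (\<integral>\<^sup>+z. ennreal (indicator A (S *v z)) \<partial>gauss)"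
      by (rule nn_integral_eq_integral[symmetric]) (auto intro!: integrable_gauss_bounded[where b = 1] simp: indicator_def)
    also have "\<dots> = (\<integral>\<^sup>+x. indicator A x \<partial>distr gauss borel ((*v) S))"
      by (subst nn_integral_distr) (auto simp: ennreal_indicator)
    also have "\<dots> = emeasure (distr gauss borel ((*v) S)) A" by (rule nn_integral_indicator) simp
    finally show "emeasure (density lborel (\<lambda>x. ennreal (g x))) A = emeasure (distr gauss borel ((*v) S)) A" .
  qed simp
qed

text \<open>Change of variables x = S z, which carries the Gaussian to the law of g. Division by g
  is harmless because g is positive almost everywhere.\<close>

lemma transport_to_gauss:
  fixes S T :: "real^'d^'d" and g f :: "real^'d \<Rightarrow> real"
  assumes gi: "integrable lborel g" and pos: "AE x in lborel. g x > 0"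
    and law: "density lborel (\<lambda>x. ennreal (g x)) = distr gauss borel ((*v) S)"
    and TS: "T ** S = mat 1" and f: "integrable lborel f"
  shows "integrable gauss (\<lambda>z. f (S *v z) / g (S *v z))"
    and "\<And>G. G \<in> borel_measurable borel \<Longrightarrow>
       (\<integral>z. f (S *v z) / g (S *v z) * G z \<partial>gauss) = (\<integral>x. f x * G (T *v x) \<partial>lborel)"
    and "rel_entropy p f g = (\<integral>\<^sup>+z. ennreal (psi p (f (S *v z) / g (S *v z))) \<partial>gauss)"
proof -
  have gm [measurable]: "g \<in> borel_measurable borel" using gi by (auto dest: borel_measurable_integrable)
  have fm [measurable]: "f \<in> borel_measurable borel" using f by (auto dest: borel_measurable_integrable)
  have nn: "AE x in lborel. 0 \<le> g x" using pos by eventually_elim simp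
  have [simp]: "T *v (S *v z) = z" for z using TS by (simp add: matrix_vector_mul_assoc)
  have canc: "AE x in lborel. g x * (f x / g x) = f x" using pos by eventually_elim simp
  have "integrable lborel (\<lambda>x. g x * (f x / g x))"
    using f canc by (subst integrable_cong_AE[where g = f]) auto
  then have "integrable (density lborel (\<lambda>x. ennreal (g x))) (\<lambda>x. f x / g x)"
    by (subst integrable_density) (use nn in auto)
  then show "integrable gauss (\<lambda>z. f (S *v z) / g (S *v z))"
    unfolding law by (subst (asm) integrable_distr_eq) auto
  show "(\<integral>z. f (S *v z) / g (S *v z) * G z \<partial>gauss) = (\<integral>x. f x * G (T *v x) \<partial>lborel)"
    if [measurable]: "G \<in> borel_measurable borel" for G
  proof -
    have "(\<integral>z. f (S *v z) / g (S *v z) * G z \<partial>gauss) = (\<integral>x. f x / g x * G (T *v x) \<partial>distr gauss borel ((*v) S))"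
      by (subst integral_distr) auto
    also have "\<dots> = (\<integral>x. g x *\<^sub>R (f x / g x * G (T *v x)) \<partial>lborel)"
      unfolding law[symmetric] by (subst integral_density) (use nn in auto)
    also have "\<dots> = (\<integral>x. f x * G (T *v x) \<partial>lborel)"
      by (rule integral_cong_AE) (use pos in auto)
    finally show ?thesis .
  qed
  have psim [measurable]: "psi p \<in> borel_measurable borel" unfolding psi_def[abs_def] by measurable
  have "rel_entropy p f g = (\<integral>\<^sup>+x. ennreal (g x) * ennreal (psi p (f x / g x)) \<partial>lborel)"
    unfolding rel_entropy_def
    by (rule nn_integral_cong_AE) (use nn in eventually_elim, simp add: ennreal_mult'[symmetric] mult.commute)
  also have "\<dots> = (\<integral>\<^sup>+x. ennreal (psi p (f x / g x)) \<partial>density lborel (\<lambda>x. ennreal (g x)))"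
    by (rule nn_integral_density[symmetric]) auto
  also have "\<dots> = (\<integral>\<^sup>+z. ennreal (psi p (f (S *v z) / g (S *v z))) \<partial>gauss)"
    unfolding law by (subst nn_integral_distr) auto
  finally show "rel_entropy p f g = (\<integral>\<^sup>+z. ennreal (psi p (f (S *v z) / g (S *v z))) \<partial>gauss)" .
qed

text \<open>In the variable z the form of P is the Euclidean norm, so \<open>mono\<close> says A A^T
  \<le> 1 for A = T E S, and B exists. The damping exponent of a plane wave is then (|\<eta>|^2 -
  |A^T \<eta>|^2)/2 = |B^T \<eta>|^2/2, that of the Mehler operator; cosines determine the
  rest.\<close>

lemma fp_mehler_evolution:
  fixes D C P S T :: "real^'d^'d" and g :: "real^'d \<Rightarrow> real" and f :: "real \<Rightarrow> real^'d \<Rightarrow> real"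
  assumes sol: "fp_solution D C f0 f"
    and E0: "E 0 = mat 1"
    and dE: "\<And>t x. t \<ge> 0 \<Longrightarrow> ((\<lambda>t. x v* E t) has_vector_derivative - ((x v* E t) v* C)) (at t)"
    and lyap: "C ** P + P ** transpose C = 2 *\<^sub>R D"
    and mono: "\<And>t x. t \<ge> 0 \<Longrightarrow> (x v* E t) \<bullet> (P *v (x v* E t)) \<le> x \<bullet> (P *v x)"
    and P: "P = S ** transpose S" and ST: "S ** T = mat 1" "T ** S = mat 1"
    and gi: "integrable lborel g" and pos: "AE x in lborel. g x > 0"
    and law: "density lborel (\<lambda>x. ennreal (g x)) = distr gauss borel ((*v) S)"
    and a: "\<And>\<tau> \<eta>. \<tau> \<ge> 0 \<Longrightarrow> norm (\<eta> v* (T ** E \<tau> ** S)) \<le> a \<tau> * norm \<eta>"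
  shows "mehler_evolution a (\<lambda>t z. f t (S *v z) / g (S *v z))"
proof -
  have int: "integrable lborel (f t)" if "t \<ge> 0" for t using sol that unfolding fp_solution_def by blast
  define u where "u t z = f t (S *v z) / g (S *v z)" for t z
  have ui: "integrable gauss (u t)" if "t \<ge> 0" for t
    unfolding u_def by (rule transport_to_gauss(1)[OF gi pos law ST(2) int[OF that]])
  have pair: "(\<integral>z. u t z * G z \<partial>gauss) = (\<integral>x. f t x * G (T *v x) \<partial>lborel)" if "t \<ge> 0" "G \<in> borel_measurable borel" for t G
    unfolding u_def by (rule transport_to_gauss(2)[OF gi pos law ST(2) int[OF that(1)] that(2)])
  have "\<exists>A B :: real^'d^'d. A ** transpose A + B ** transpose B = mat 1 \<and>
        (\<forall>\<eta>. norm (\<eta> v* A) \<le> a (t - r) * norm \<eta>) \<and>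
        (\<forall>G. continuous_on UNIV G \<longrightarrow> (\<exists>b. \<forall>x. \<bar>G x\<bar> \<le> b) \<longrightarrow>
           (\<integral>x. u t x * G x \<partial>gauss) = (\<integral>x. u r x * mehler A B G x \<partial>gauss))" if r: "0 \<le> r" "r < t" for r t
  proof -
    define A where "A = T ** E (t - r) ** S"
    have t0: "t \<ge> 0" "t - r \<ge> 0" using r by auto
    have nP: "(\<eta> v* T) \<bullet> (P *v (\<eta> v* T)) = (norm \<eta>)\<^sup>2" for \<eta>
      unfolding norm_square_via_factor[OF P] by (simp add: vector_matrix_mul_assoc ST(2))
    have nA: "((\<eta> v* T) v* E (t - r)) \<bullet> (P *v ((\<eta> v* T) v* E (t - r))) = (norm (\<eta> v* A))\<^sup>2" for \<eta>
      unfolding norm_square_via_factor[OF P] A_def by (simp add: vector_matrix_mul_assoc)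
    have A1: "(norm (\<eta> v* A))\<^sup>2 \<le> (norm \<eta>)\<^sup>2" for \<eta>
      using mono[OF t0(2), of "\<eta> v* T"] unfolding nP nA .
    have 1: "transpose (mat 1 - A ** transpose A) = mat 1 - A ** transpose A"
    proof -
      have "transpose (X - Y) = transpose X - transpose Y" for X Y :: "real^'d^'d" by (simp add: transpose_def vec_eq_iff)
      then show ?thesis by (simp add: matrix_transpose_mul)
    qed
    have 2: "0 \<le> x \<bullet> ((mat 1 - A ** transpose A) *v x)" for x
    proof -
      have "x \<bullet> ((mat 1 - A ** transpose A) *v x) = x \<bullet> x - (x v* A) \<bullet> (x v* A)"
        by (simp add: matrix_vector_mult_diff_rdistrib inner_diff_right dot_lmul_matrix matrix_vector_mul_assoc[symmetric])
      then show ?thesis using A1[of x] by (simp add: power2_norm_eq_inner)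
    qed
    obtain B :: "real^'d^'d" where "mat 1 - A ** transpose A = B ** transpose B" using psd_factor[OF 1 2] .
    then have "mat 1 = B ** transpose B + A ** transpose A" by (simp only: diff_eq_eq)
    then have AB: "A ** transpose A + B ** transpose B = mat 1" by (simp only: add.commute)
    have nB: "(norm (\<eta> v* B))\<^sup>2 = (norm \<eta>)\<^sup>2 - (norm (\<eta> v* A))\<^sup>2" for \<eta>
      using norm_vector_matrix_split[OF AB, of \<eta> \<eta>] by (simp add: power2_norm_eq_inner)
    have [measurable]: "u r \<in> borel_measurable borel" using ui[OF r(1)] by (auto dest: borel_measurable_integrable)
    let ?g = "gauss :: (real^'d) measure"
    interpret PP: pair_prob_space ?g ?g ..
    have it: "(\<integral>p. u r (fst p) * G (A *v fst p + B *v snd p) \<partial>(?g \<Otimes>\<^sub>M ?g)) = (\<integral>x. u r x * mehler A B G x \<partial>?g)"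
      if [measurable]: "G \<in> borel_measurable borel" and b: "\<And>x. \<bar>G x\<bar> \<le> b" for G b
    proof -
      have gb: "integrable ?g (\<lambda>z. G (A *v x + B *v z))" for x
        by (rule integrable_gauss_bounded[where b = b]) (auto simp: b)
      have "integrable (?g \<Otimes>\<^sub>M ?g) (\<lambda>p. u r (fst p) * G (A *v fst p + B *v snd p))"
      proof (rule integrable_pair_dominated[OF gauss.sigma_finite_measure_axioms gauss.sigma_finite_measure_axioms _ ui[OF r(1)], where b = b])
        show i: "integrable ?g (\<lambda>y. u r (fst (x, y)) * G (A *v fst (x, y) + B *v snd (x, y)))" for x
          using gb[of x] by simp
        show "(\<integral>y. \<bar>u r (fst (x, y)) * G (A *v fst (x, y) + B *v snd (x, y))\<bar> \<partial>?g) \<le> b * \<bar>u r x\<bar>" for x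
        proof -
          have "(\<integral>y. \<bar>u r (fst (x, y)) * G (A *v fst (x, y) + B *v snd (x, y))\<bar> \<partial>?g) \<le> (\<integral>y. b * \<bar>u r x\<bar> \<partial>?g)"
            using i[of x] b by (intro integral_mono integrable_abs) (auto simp: abs_mult mult.commute[of "\<bar>u r x\<bar>"] intro!: mult_right_mono)
          then show ?thesis by (simp add: gauss.prob_space[simplified])
        qed
      qed measurable
      from PP.integral_fst'[OF this] show ?thesis using gb by (simp add: mehler_def)
    qed
    have fin: "(\<integral>x. u t x * G x \<partial>?g) = (\<integral>x. u r x * mehler A B G x \<partial>?g)"
      if G: "continuous_on UNIV G" and b: "\<And>x. \<bar>G x\<bar> \<le> b" for G b
    proof -
      have cosr: "(\<integral>p. u r (fst p) * cos (\<eta> \<bullet> (A *v fst p + B *v snd p) + \<theta>) \<partial>(?g \<Otimes>\<^sub>M ?g))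
         = exp (- (norm (\<eta> v* B))\<^sup>2 / 2) * (\<integral>x. u r x * cos ((\<eta> v* A) \<bullet> x + \<theta>) \<partial>?g)" for \<eta> \<theta>
      proof -
        have m: "mehler A B (\<lambda>y. cos (\<eta> \<bullet> y + \<theta>)) x = exp (- (norm (\<eta> v* B))\<^sup>2 / 2) * cos ((\<eta> v* A) \<bullet> x + \<theta>)" for x
        proof -
          have "mehler A B (\<lambda>y. cos (\<eta> \<bullet> y + \<theta>)) x = (\<integral>z. cos ((\<eta> v* B) \<bullet> z + ((\<eta> v* A) \<bullet> x + \<theta>)) \<partial>?g)"
            unfolding mehler_def by (simp add: dot_lmul_matrix inner_add_right add_ac)
          then show ?thesis unfolding gauss_cos .
        qed
        have "(\<integral>p. u r (fst p) * cos (\<eta> \<bullet> (A *v fst p + B *v snd p) + \<theta>) \<partial>(?g \<Otimes>\<^sub>M ?g))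
           = (\<integral>x. u r x * mehler A B (\<lambda>y. cos (\<eta> \<bullet> y + \<theta>)) x \<partial>?g)"
          by (rule it[of "\<lambda>y. cos (\<eta> \<bullet> y + \<theta>)" 1]) auto
        also have "\<dots> = (\<integral>x. exp (- (norm (\<eta> v* B))\<^sup>2 / 2) * (u r x * cos ((\<eta> v* A) \<bullet> x + \<theta>)) \<partial>?g)"
          unfolding m by (simp only: mult.left_commute)
        also have "\<dots> = exp (- (norm (\<eta> v* B))\<^sup>2 / 2) * (\<integral>x. u r x * cos ((\<eta> v* A) \<bullet> x + \<theta>) \<partial>?g)"
          by (rule integral_mult_right_zero)
        finally show ?thesis .
      qed
      have "(\<integral>x. u t x * G x \<partial>?g) = (\<integral>p. u r (fst p) * G (A *v fst p + B *v snd p) \<partial>(?g \<Otimes>\<^sub>M ?g))"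
      proof (rule cos_integrals_determine_integrals[OF gauss.sigma_finite_measure_axioms _ ui[OF t0(1)] PP.P.sigma_finite_measure_axioms _ _ _ G b])
        show "integrable (?g \<Otimes>\<^sub>M ?g) (\<lambda>p. u r (fst p))"
          by (rule integrable_pair_dominated[OF gauss.sigma_finite_measure_axioms gauss.sigma_finite_measure_axioms _ ui[OF r(1)], where b = 1])
            (auto simp: gauss.prob_space[simplified])
        show "(\<integral>x. u t x * cos (\<eta> \<bullet> x + \<theta>) \<partial>?g) = (\<integral>p. u r (fst p) * cos (\<eta> \<bullet> (A *v fst p + B *v snd p) + \<theta>) \<partial>(?g \<Otimes>\<^sub>M ?g))" for \<eta> \<theta>
        proof -
          have "(\<integral>x. u t x * cos (\<eta> \<bullet> x + \<theta>) \<partial>?g) = (\<integral>x. f t x * cos ((\<eta> v* T) \<bullet> x + \<theta>) \<partial>lborel)"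
            by (subst pair[OF t0(1)]) (auto simp: dot_lmul_matrix)
          also have "\<dots> = exp (- ((norm \<eta>)\<^sup>2 - (norm (\<eta> v* A))\<^sup>2) / 2) * (\<integral>x. f r x * cos (((\<eta> v* T) v* E (t - r)) \<bullet> x + \<theta>) \<partial>lborel)"
            using fp_cos_evolution[OF sol E0 dE lyap mono r, of "\<eta> v* T" \<theta>] unfolding nP nA .
          also have "(\<integral>x. f r x * cos (((\<eta> v* T) v* E (t - r)) \<bullet> x + \<theta>) \<partial>lborel) = (\<integral>x. u r x * cos ((\<eta> v* A) \<bullet> x + \<theta>) \<partial>?g)"
          proof -
            have "(\<eta> v* A) \<bullet> (T *v x) = ((\<eta> v* T) v* E (t - r)) \<bullet> x" for x
            proof -
              have "(\<eta> v* A) \<bullet> (T *v x) = (((\<eta> v* T) v* E (t - r)) v* S) \<bullet> (T *v x)"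
                unfolding A_def by (simp add: vector_matrix_mul_assoc)
              also have "\<dots> = ((\<eta> v* T) v* E (t - r)) \<bullet> (S *v (T *v x))" by (rule dot_lmul_matrix)
              finally show ?thesis by (simp add: matrix_vector_mul_assoc ST(1))
            qed
            then show ?thesis by (subst pair[OF r(1)]) auto
          qed
          finally show ?thesis unfolding cosr nB .
        qed
      qed auto
      then show ?thesis using it[OF continuous_on_borel_measurable[OF G] b] by simp
    qed
    have nA: "\<forall>\<eta>. norm (\<eta> v* A) \<le> a (t - r) * norm \<eta>" unfolding A_def using a[OF t0(2)] by blast
    have "\<forall>G. continuous_on UNIV G \<longrightarrow> (\<exists>b. \<forall>x. \<bar>G x\<bar> \<le> b) \<longrightarrow>
       (\<integral>x. u t x * G x \<partial>gauss) = (\<integral>x. u r x * mehler A B G x \<partial>gauss)"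
      using fin by blast
    then show ?thesis using AB nA by blast
  qed
  then have "mehler_evolution a u" unfolding mehler_evolution_def using ui by blast
  then show ?thesis unfolding u_def[abs_def] .
qed

section \<open>Norm estimates for a Mehler evolution\<close>

lemma mehler_evolutionD:
  fixes u :: "real \<Rightarrow> real^'d \<Rightarrow> real"
  assumes "mehler_evolution a u" "0 \<le> r" "r < t"
  shows "\<exists>A B :: real^'d^'d. A ** transpose A + B ** transpose B = mat 1 \<and>
     (\<forall>\<eta>. norm (\<eta> v* A) \<le> a (t - r) * norm \<eta>) \<and>
     (\<forall>G. continuous_on UNIV G \<longrightarrow> (\<exists>b. \<forall>x. \<bar>G x\<bar> \<le> b) \<longrightarrow>
       (\<integral>x. u t x * G x \<partial>gauss) = (\<integral>x. u r x * mehler A B G x \<partial>gauss))"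
  by (rule conjunct2[OF assms(1)[unfolded mehler_evolution_def], THEN spec, THEN spec, THEN mp, THEN mp, OF assms(2,3)])

lemma mehler_evolution_integrable:
  "mehler_evolution a u \<Longrightarrow> t \<ge> 0 \<Longrightarrow> integrable gauss (u t)"
  unfolding mehler_evolution_def by blast

lemma mehler_evolution_mass:
  fixes u :: "real \<Rightarrow> real^'d \<Rightarrow> real"
  assumes ev: "mehler_evolution a u" and t: "0 \<le> t"
  shows "(\<integral>x. u t x \<partial>gauss) = (\<integral>x. u 0 x \<partial>gauss)"
proof (cases "t = 0")
  case False
  with t have "0 < t" by simp
  obtain A B :: "real^'d^'d" where AB: "A ** transpose A + B ** transpose B = mat 1"
    and "\<forall>\<eta>. norm (\<eta> v* A) \<le> a (t - 0) * norm \<eta>"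
    and dual_all: "\<forall>G. continuous_on UNIV G \<longrightarrow> (\<exists>b. \<forall>x. \<bar>G x\<bar> \<le> b) \<longrightarrow>
       (\<integral>x. u t x * G x \<partial>gauss) = (\<integral>x. u 0 x * mehler A B G x \<partial>gauss)"
    using mehler_evolutionD[OF ev order.refl \<open>0 < t\<close>] by (elim exE conjE) (rule that; assumption)
  have dual: "(\<integral>x. u t x * G x \<partial>gauss) = (\<integral>x. u 0 x * mehler A B G x \<partial>gauss)"
    if "continuous_on UNIV G" "\<And>x. \<bar>G x\<bar> \<le> b" for G b
    by (rule dual_all[rule_format, OF that(1)]) (use that(2) in blast)
  from dual[of "\<lambda>_. 1" 1] show ?thesis by (simp add: mehler_def gauss.prob_space[simplified])
qed simp

text \<open>Test with continuous approximants of the indicator of the set where u < 0, clipped below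
  at 0. In this way the sign of the datum reaches later times without a maximum principle.\<close>

lemma AE_nonneg_of_pairing:
  fixes u :: "'a::euclidean_space \<Rightarrow> real"
  assumes u: "integrable gauss u"
    and pos: "\<And>G b. continuous_on UNIV G \<Longrightarrow> (\<And>x. \<bar>G x\<bar> \<le> b) \<Longrightarrow> (\<And>x. 0 \<le> G x) \<Longrightarrow> 0 \<le> (\<integral>x. u x * G x \<partial>gauss)"
  shows "AE x in gauss. 0 \<le> u x"
proof -
  have um [measurable]: "u \<in> borel_measurable borel" using u by (auto dest: borel_measurable_integrable)
  define g :: "'a \<Rightarrow> real" where "g = indicator {x. u x < 0}"
  have gm: "g \<in> borel_measurable borel" unfolding g_def by measurable
  have gb: "\<bar>g x\<bar> \<le> 1" for x by (auto simp: g_def indicator_def)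
  obtain h where h: "\<And>n. continuous_on UNIV (h n)" "\<And>n x. \<bar>h n x\<bar> \<le> 1" and lim: "AE x in lborel. (\<lambda>n. h n x) \<longlonglongrightarrow> g x"
    using bounded_measurable_approx[OF gm gb] by blast
  define k where "k n x = max 0 (h n x)" for n x
  have kc: "continuous_on UNIV (k n)" for n unfolding k_def by (intro continuous_intros h)
  have kb: "\<bar>k n x\<bar> \<le> 1" "0 \<le> k n x" for n x using h(2)[of n x] by (auto simp: k_def abs_le_iff)
  have [measurable]: "k n \<in> borel_measurable borel" for n by (rule continuous_on_borel_measurable[OF kc])
  have "(\<lambda>n. \<integral>x. u x * k n x \<partial>gauss) \<longlonglongrightarrow> (\<integral>x. u x * g x \<partial>gauss)"
  proof (rule integral_dominated_convergence[where w = "\<lambda>x. \<bar>u x\<bar>"])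
    have "AE x in lborel. (\<lambda>n. u x * k n x) \<longlonglongrightarrow> u x * g x"
      using lim
    proof eventually_elim
      case (elim x)
      have "(\<lambda>n. u x * k n x) \<longlonglongrightarrow> u x * max 0 (g x)" unfolding k_def by (intro tendsto_intros elim)
      moreover have "max 0 (g x) = g x" by (simp add: g_def)
      ultimately show ?case by simp
    qed
    then show "AE x in gauss. (\<lambda>n. u x * k n x) \<longlonglongrightarrow> u x * g x" unfolding AE_gauss_iff .
    show "AE x in gauss. norm (u x * k n x) \<le> \<bar>u x\<bar>" for n
      using kb by (intro AE_I2) (simp add: abs_mult mult_left_le)
  qed (use u gm in auto)
  then have "0 \<le> (\<integral>x. u x * g x \<partial>gauss)"
    by (rule LIMSEQ_le_const) (use pos[OF kc kb] in blast)
  moreover have i: "integrable gauss (\<lambda>x. - (u x * g x))"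
    by (rule Bochner_Integration.integrable_bound[OF u]) (use gm in \<open>auto simp: g_def indicator_def\<close>)
  have nn: "AE x in gauss. 0 \<le> - (u x * g x)" by (auto simp: g_def indicator_def)
  ultimately have "(\<integral>x. - (u x * g x) \<partial>gauss) = 0"
    using integral_nonneg_AE[OF nn] by simp
  then have "AE x in gauss. - (u x * g x) = 0" using i nn by (subst (asm) integral_nonneg_eq_0_iff_AE) auto
  then show ?thesis by eventually_elim (auto simp: g_def indicator_def split: if_splits)
qed

lemma mehler_evolution_nonneg:
  fixes u :: "real \<Rightarrow> real^'d \<Rightarrow> real"
  assumes ev: "mehler_evolution a u" and t: "0 \<le> t" and u0: "AE x in gauss. 0 \<le> u 0 x"
  shows "AE x in gauss. 0 \<le> u t x"
proof (cases "t = 0")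
  case False
  with t have "0 < t" by simp
  obtain A B :: "real^'d^'d" where AB: "A ** transpose A + B ** transpose B = mat 1"
    and "\<forall>\<eta>. norm (\<eta> v* A) \<le> a (t - 0) * norm \<eta>"
    and dual_all: "\<forall>G. continuous_on UNIV G \<longrightarrow> (\<exists>b. \<forall>x. \<bar>G x\<bar> \<le> b) \<longrightarrow>
       (\<integral>x. u t x * G x \<partial>gauss) = (\<integral>x. u 0 x * mehler A B G x \<partial>gauss)"
    using mehler_evolutionD[OF ev order.refl \<open>0 < t\<close>] by (elim exE conjE) (rule that; assumption)
  have dual: "(\<integral>x. u t x * G x \<partial>gauss) = (\<integral>x. u 0 x * mehler A B G x \<partial>gauss)"
    if "continuous_on UNIV G" "\<And>x. \<bar>G x\<bar> \<le> b" for G b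
    by (rule dual_all[rule_format, OF that(1)]) (use that(2) in blast)
  show ?thesis
  proof (rule AE_nonneg_of_pairing[OF mehler_evolution_integrable[OF ev t]])
    fix G :: "real^'d \<Rightarrow> real" and b assume G: "continuous_on UNIV G" "\<And>x. \<bar>G x\<bar> \<le> b" "\<And>x. 0 \<le> G x"
    have "0 \<le> mehler A B G x" for x unfolding mehler_def using G(3) by simp
    then show "0 \<le> (\<integral>x. u t x * G x \<partial>gauss)"
      unfolding dual[OF G(1,2)] by (intro integral_nonneg_AE) (use u0 in eventually_elim, simp)
  qed
qed (use u0 in simp)

lemma abs_powr_2: "\<bar>y\<bar> powr 2 = y\<^sup>2" for y :: real
  by (simp add: powr_numeral)

text \<open>Pair u(t) - 1 with a test function, move to time r by duality, and apply Cauchy-Schwarz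
  and \<open>mehler_contraction\<close> there. Subtracting 1 at both times is possible because the
  mass is 1 and the Mehler operator preserves the Gaussian mean.\<close>

lemma mehler_evolution_L2_decay:
  fixes u :: "real \<Rightarrow> real^'d \<Rightarrow> real"
  assumes ev: "mehler_evolution a u" and r: "0 \<le> r" "r < t" and a: "a (t - r) > 0"
    and mass: "(\<integral>x. u 0 x \<partial>gauss) = 1" and L2: "integrable gauss (\<lambda>x. (u r x - 1)\<^sup>2)"
  shows "integrable gauss (\<lambda>x. (u t x - 1)\<^sup>2)"
    and "(\<integral>x. (u t x - 1)\<^sup>2 \<partial>gauss) \<le> (a (t - r))\<^sup>2 * (\<integral>x. (u r x - 1)\<^sup>2 \<partial>gauss)"
proof -
  have t0: "0 \<le> t" using r by simp
  obtain A B :: "real^'d^'d" where AB: "A ** transpose A + B ** transpose B = mat 1"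
    and "\<forall>\<eta>. norm (\<eta> v* A) \<le> a (t - r) * norm \<eta>"
    and dual_all: "\<forall>G. continuous_on UNIV G \<longrightarrow> (\<exists>b. \<forall>x. \<bar>G x\<bar> \<le> b) \<longrightarrow>
       (\<integral>x. u t x * G x \<partial>gauss) = (\<integral>x. u r x * mehler A B G x \<partial>gauss)"
    using mehler_evolutionD[OF ev r] by (elim exE conjE) (rule that; assumption)
  then have A: "norm (\<eta> v* A) \<le> a (t - r) * norm \<eta>" for \<eta> by blast
  have dual: "(\<integral>x. u t x * G x \<partial>gauss) = (\<integral>x. u r x * mehler A B G x \<partial>gauss)"
    if "continuous_on UNIV G" "\<And>x. \<bar>G x\<bar> \<le> b" for G b
    by (rule dual_all[rule_format, OF that(1)]) (use that(2) in blast)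
  have ui: "integrable gauss (u t)" "integrable gauss (u r)" using mehler_evolution_integrable[OF ev] r by auto
  have [measurable]: "u t \<in> borel_measurable borel" "u r \<in> borel_measurable borel"
    using ui by (auto dest: borel_measurable_integrable)
  have mt: "(\<integral>x. u t x \<partial>gauss) = 1" using mehler_evolution_mass[OF ev t0] mass by simp
  have w: "integrable gauss (\<lambda>x. u t x - 1)" using ui by simp
  define N where "N = a (t - r) * sqrt (\<integral>x. (u r x - 1)\<^sup>2 \<partial>gauss)"
  have N0: "N \<ge> 0" unfolding N_def using a by simp
  have bound: "(\<integral>x. (u t x - 1) * G x \<partial>gauss) \<le> N * (\<integral>x. \<bar>G x\<bar> powr 2 \<partial>gauss) powr (1 / 2)"
    if b: "\<And>x. \<bar>G x\<bar> \<le> b" and L: "\<And>x y. \<bar>G x - G y\<bar> \<le> L * norm (x - y)" "L \<ge> 0" for G b L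
  proof -
    have G: "continuous_on UNIV G"
      by (rule lipschitz_on_continuous_on[where L = L]) (use L in \<open>auto simp: lipschitz_on_def dist_norm\<close>)
    have [measurable]: "G \<in> borel_measurable borel" using G by (rule continuous_on_borel_measurable)
    have Gi: "integrable gauss G" by (rule integrable_gauss_bounded[where b = b]) (auto simp: b)
    define m where "m = (\<integral>x. G x \<partial>gauss)"
    \<comment> \<open>\<open>mehler_contraction\<close> asks for mean zero. Centring is free: u(t) -
      1 has mean zero, and removing the mean of G does not increase its L^2 norm.\<close>
    define H where "H x = G x - m" for x
    have Hc: "continuous_on UNIV H" unfolding H_def using G by (intro continuous_intros)
    have [measurable]: "H \<in> borel_measurable borel" using Hc by (rule continuous_on_borel_measurable)
    have Hb: "\<bar>H x\<bar> \<le> b + \<bar>m\<bar>" for x using b[of x] unfolding H_def by linarith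
    have Hm: "(\<integral>x. H x \<partial>gauss) = 0" unfolding H_def using Gi by (simp add: m_def gauss.prob_space[simplified])
    have sq: "\<bar>y\<^sup>2\<bar> \<le> c\<^sup>2" if "\<bar>y\<bar> \<le> c" for y c :: real using power_mono[OF that abs_ge_zero, of 2] by simp
    have H2: "integrable gauss (\<lambda>x. (H x)\<^sup>2)"
      by (rule integrable_gauss_bounded[where b = "(b + \<bar>m\<bar>)\<^sup>2"], measurable, rule sq, rule Hb)
    have G2: "integrable gauss (\<lambda>x. (G x)\<^sup>2)"
      by (rule integrable_gauss_bounded[where b = "b\<^sup>2"], measurable, rule sq, rule b)
    have mH2: "integrable gauss (\<lambda>x. (mehler A B H x)\<^sup>2)"
      by (rule integrable_gauss_bounded[where b = "(b + \<bar>m\<bar>)\<^sup>2"], measurable, rule sq, rule mehler_bound, measurable, rule Hb)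
    have mHi: "integrable gauss (mehler A B H)"
      by (rule integrable_gauss_bounded[where b = "b + \<bar>m\<bar>"], measurable, rule mehler_bound, measurable, rule Hb)
    have umi: "integrable gauss (\<lambda>x. v x * k x)" if "integrable gauss v" "k \<in> borel_measurable borel" "\<And>x. \<bar>k x\<bar> \<le> c" for v k :: "real^'d \<Rightarrow> real" and c
    proof (rule Bochner_Integration.integrable_bound)
      show "integrable gauss (\<lambda>x. \<bar>v x\<bar> * c)" using that(1) by simp
      show "AE x in gauss. norm (v x * k x) \<le> norm (\<bar>v x\<bar> * c)"
      proof (rule AE_I2)
        fix x
        have "\<bar>v x\<bar> * \<bar>k x\<bar> \<le> \<bar>v x\<bar> * c" using that(3) by (intro mult_left_mono) auto
        then show "norm (v x * k x) \<le> norm (\<bar>v x\<bar> * c)" using abs_ge_self order_trans unfolding real_norm_def abs_mult[of "v x"] by blast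
      qed
      show "(\<lambda>x. v x * k x) \<in> borel_measurable gauss"
        using that(1,2) by (auto dest: borel_measurable_integrable)
    qed
    have "(\<integral>x. (u t x - 1) * G x \<partial>gauss) = (\<integral>x. u t x * G x \<partial>gauss) - m"
      unfolding m_def using umi[OF ui(1) \<open>G \<in> _\<close> b] Gi by (simp add: left_diff_distrib)
    also have "\<dots> = (\<integral>x. u t x * H x \<partial>gauss)"
      unfolding H_def using umi[OF ui(1) \<open>G \<in> _\<close> b] ui mt by (simp add: right_diff_distrib)
    also have "\<dots> = (\<integral>x. u r x * mehler A B H x \<partial>gauss)" by (rule dual[OF Hc Hb])
    also have "\<dots> = (\<integral>x. (u r x - 1) * mehler A B H x \<partial>gauss)"
      using umi[OF ui(2) mehler_measurable[OF \<open>H \<in> _\<close>] mehler_bound[OF \<open>H \<in> _\<close> Hb]] mHi mehler_invariant[OF AB Hc Hb] Hm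
      by (simp add: left_diff_distrib)
    also have "\<dots> \<le> sqrt (\<integral>x. (u r x - 1)\<^sup>2 \<partial>gauss) * sqrt (\<integral>x. (mehler A B H x)\<^sup>2 \<partial>gauss)"
      by (rule order_trans[OF abs_ge_self Cauchy_Schwarz_integral[OF _ _ L2 mH2]]) measurable
    also have "\<dots> \<le> sqrt (\<integral>x. (u r x - 1)\<^sup>2 \<partial>gauss) * (a (t - r) * sqrt (\<integral>x. (G x)\<^sup>2 \<partial>gauss))"
    proof (rule mult_left_mono)
      have HL: "\<bar>H x - H y\<bar> \<le> L * norm (x - y)" for x y using L(1)[of x y] unfolding H_def by simp
      have "(\<integral>x. (mehler A B H x)\<^sup>2 \<partial>gauss) \<le> (a (t - r))\<^sup>2 * (\<integral>x. (H x)\<^sup>2 \<partial>gauss)"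
        by (rule mehler_contraction[OF AB A a HL L(2) Hb Hm])
      also have "(\<integral>x. (H x)\<^sup>2 \<partial>gauss) \<le> (\<integral>x. (G x)\<^sup>2 \<partial>gauss)"
      proof -
        have "(\<integral>x. (H x)\<^sup>2 \<partial>gauss) = (\<integral>x. (G x)\<^sup>2 - 2 * m * G x + m\<^sup>2 \<partial>gauss)"
          unfolding H_def by (intro Bochner_Integration.integral_cong refl) (simp add: power2_eq_square algebra_simps)
        also have "\<dots> = (\<integral>x. (G x)\<^sup>2 \<partial>gauss) - m\<^sup>2"
          using G2 Gi by (simp add: gauss.prob_space[simplified] m_def[symmetric]) (simp add: power2_eq_square)
        finally show ?thesis by simp
      qed
      finally have "(\<integral>x. (mehler A B H x)\<^sup>2 \<partial>gauss) \<le> (a (t - r))\<^sup>2 * (\<integral>x. (G x)\<^sup>2 \<partial>gauss)" by (simp add: mult_left_mono)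
      then have "sqrt (\<integral>x. (mehler A B H x)\<^sup>2 \<partial>gauss) \<le> sqrt ((a (t - r))\<^sup>2 * (\<integral>x. (G x)\<^sup>2 \<partial>gauss))" by (rule real_sqrt_le_mono)
      then show "sqrt (\<integral>x. (mehler A B H x)\<^sup>2 \<partial>gauss) \<le> a (t - r) * sqrt (\<integral>x. (G x)\<^sup>2 \<partial>gauss)"
        using a by (simp add: real_sqrt_mult)
    qed simp
    also have "\<dots> = N * (\<integral>x. \<bar>G x\<bar> powr 2 \<partial>gauss) powr (1 / 2)"
      unfolding N_def abs_powr_2 by (simp add: powr_half_sqrt)
    finally show ?thesis .
  qed
  have 2: "(2::real) > 1" "1 / 2 + 1 / 2 = (1::real)" by auto
  have "integrable gauss (\<lambda>x. \<bar>u t x - 1\<bar> powr 2)"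
    by (rule Lp_bound_by_duality(1)[OF w 2(1) 2(1) 2(2) N0]) (rule bound; assumption)
  then show "integrable gauss (\<lambda>x. (u t x - 1)\<^sup>2)" unfolding abs_powr_2 .
  have "(\<integral>x. \<bar>u t x - 1\<bar> powr 2 \<partial>gauss) \<le> N powr 2"
    by (rule Lp_bound_by_duality(2)[OF w 2(1) 2(1) 2(2) N0]) (rule bound; assumption)
  then have "(\<integral>x. (u t x - 1)\<^sup>2 \<partial>gauss) \<le> N\<^sup>2" using N0 unfolding abs_powr_2 by (simp add: powr_numeral)
  also have "N\<^sup>2 = (a (t - r))\<^sup>2 * (\<integral>x. (u r x - 1)\<^sup>2 \<partial>gauss)" unfolding N_def by (simp add: power_mult_distrib)
  finally show "(\<integral>x. (u t x - 1)\<^sup>2 \<partial>gauss) \<le> (a (t - r))\<^sup>2 * (\<integral>x. (u r x - 1)\<^sup>2 \<partial>gauss)" .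
qed

text \<open>Dual of \<open>mehler_Lq_contraction\<close>. It controls the times before smoothing
  sets in.\<close>

lemma mehler_evolution_Lp:
  fixes u :: "real \<Rightarrow> real^'d \<Rightarrow> real"
  assumes ev: "mehler_evolution a u" and t: "0 < t" and p: "p > 1" "q > 1" "1 / p + 1 / q = 1"
    and Lp: "integrable gauss (\<lambda>x. \<bar>u 0 x\<bar> powr p)"
  shows "integrable gauss (\<lambda>x. \<bar>u t x\<bar> powr p)"
    and "(\<integral>x. \<bar>u t x\<bar> powr p \<partial>gauss) \<le> (\<integral>x. \<bar>u 0 x\<bar> powr p \<partial>gauss)"
proof -
  obtain A B :: "real^'d^'d" where AB: "A ** transpose A + B ** transpose B = mat 1"
    and "\<forall>\<eta>. norm (\<eta> v* A) \<le> a (t - 0) * norm \<eta>"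
    and dual_all: "\<forall>G. continuous_on UNIV G \<longrightarrow> (\<exists>b. \<forall>x. \<bar>G x\<bar> \<le> b) \<longrightarrow>
       (\<integral>x. u t x * G x \<partial>gauss) = (\<integral>x. u 0 x * mehler A B G x \<partial>gauss)"
    using mehler_evolutionD[OF ev order.refl t] by (elim exE conjE) (rule that; assumption)
  have dual: "(\<integral>x. u t x * G x \<partial>gauss) = (\<integral>x. u 0 x * mehler A B G x \<partial>gauss)"
    if "continuous_on UNIV G" "\<And>x. \<bar>G x\<bar> \<le> b" for G b
    by (rule dual_all[rule_format, OF that(1)]) (use that(2) in blast)
  have ui: "integrable gauss (u t)" "integrable gauss (u 0)" using mehler_evolution_integrable[OF ev] t by auto
  have [measurable]: "u 0 \<in> borel_measurable borel" using ui by (auto dest: borel_measurable_integrable)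
  define N where "N = (\<integral>x. \<bar>u 0 x\<bar> powr p \<partial>gauss) powr (1 / p)"
  have N0: "N \<ge> 0" unfolding N_def by simp
  have bound: "(\<integral>x. u t x * G x \<partial>gauss) \<le> N * (\<integral>x. \<bar>G x\<bar> powr q \<partial>gauss) powr (1 / q)"
    if b: "\<And>x. \<bar>G x\<bar> \<le> b" and L: "\<And>x y. \<bar>G x - G y\<bar> \<le> L * norm (x - y)" "L \<ge> 0" for G b L
  proof -
    have G: "continuous_on UNIV G"
      by (rule lipschitz_on_continuous_on[where L = L]) (use L in \<open>auto simp: lipschitz_on_def dist_norm\<close>)
    have [measurable]: "G \<in> borel_measurable borel" using G by (rule continuous_on_borel_measurable)
    have mq: "integrable gauss (\<lambda>x. \<bar>mehler A B G x\<bar> powr q)"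
      by (rule integrable_gauss_bounded[where b = "b powr q"]) (use p in \<open>auto intro!: powr_mono2 mehler_bound b\<close>)
    have "(\<integral>x. u t x * G x \<partial>gauss) = (\<integral>x. u 0 x * mehler A B G x \<partial>gauss)" by (rule dual[OF G b])
    also have "\<dots> \<le> N * (\<integral>x. \<bar>mehler A B G x\<bar> powr q \<partial>gauss) powr (1 / q)"
      unfolding N_def by (rule order_trans[OF abs_ge_self Holder_inequality(2)[OF p _ _ Lp mq]]) measurable
    also have "\<dots> \<le> N * (\<integral>x. \<bar>G x\<bar> powr q \<partial>gauss) powr (1 / q)"
      using p N0 by (intro mult_left_mono powr_mono2 mehler_Lq_contraction[OF AB p(2) G b]) auto
    finally show ?thesis .
  qed
  show "integrable gauss (\<lambda>x. \<bar>u t x\<bar> powr p)"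
    by (rule Lp_bound_by_duality(1)[OF ui(1) p N0]) (rule bound; assumption)
  have "(\<integral>x. \<bar>u t x\<bar> powr p \<partial>gauss) \<le> N powr p"
    by (rule Lp_bound_by_duality(2)[OF ui(1) p N0]) (rule bound; assumption)
  also have "\<dots> = (\<integral>x. \<bar>u 0 x\<bar> powr p \<partial>gauss)" unfolding N_def using p by (simp add: powr_powr)
  finally show "(\<integral>x. \<bar>u t x\<bar> powr p \<partial>gauss) \<le> (\<integral>x. \<bar>u 0 x\<bar> powr p \<partial>gauss)" .
qed

text \<open>Dual of the bound from L^2 to L^q, hence a bound from L^p to L^2. The constant is fixed
  before u, so it does not depend on the datum.\<close>

lemma mehler_evolution_hypercontractive:
  assumes a: "0 \<le> a t" "a t < 1" and t: "0 < t" and p: "p > 1" "q > 1" "1 / p + 1 / q = 1"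
    and small: "q * ((a t)\<^sup>2 / (1 - (a t)\<^sup>2)) < 1 / 2"
  shows "\<exists>K>0. \<forall>u :: real \<Rightarrow> real^'d \<Rightarrow> real. mehler_evolution a u \<longrightarrow> integrable gauss (\<lambda>x. \<bar>u 0 x\<bar> powr p) \<longrightarrow>
     integrable gauss (\<lambda>x. (u t x)\<^sup>2) \<and> (\<integral>x. (u t x)\<^sup>2 \<partial>gauss) \<le> K * (\<integral>x. \<bar>u 0 x\<bar> powr p \<partial>gauss) powr (2 / p)"
proof -
  have q0: "q > 0" using p by simp
  obtain K where K: "K > 0" and hyp: "\<And>(A :: real^'d^'d) B G b. A ** transpose A + B ** transpose B = mat 1 \<Longrightarrow>
     (\<And>\<xi>. norm (\<xi> v* A) \<le> a t * norm \<xi>) \<Longrightarrow> continuous_on UNIV G \<Longrightarrow> (\<And>x. \<bar>G x\<bar> \<le> b) \<Longrightarrow>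
     (\<integral>x. \<bar>mehler A B G x\<bar> powr q \<partial>gauss) powr (1 / q) \<le> K * sqrt (\<integral>x. (G x)\<^sup>2 \<partial>gauss)"
    using mehler_hypercontractive[OF a q0 small, where ?'d = 'd] by blast
  show ?thesis
  proof (intro exI[of _ "K\<^sup>2"] conjI allI impI)
    show "K\<^sup>2 > 0" using K by simp
    fix u :: "real \<Rightarrow> real^'d \<Rightarrow> real" assume ev: "mehler_evolution a u" and Lp: "integrable gauss (\<lambda>x. \<bar>u 0 x\<bar> powr p)"
    obtain A B :: "real^'d^'d" where AB: "A ** transpose A + B ** transpose B = mat 1"
      and "\<forall>\<eta>. norm (\<eta> v* A) \<le> a (t - 0) * norm \<eta>"
      and dual_all: "\<forall>G. continuous_on UNIV G \<longrightarrow> (\<exists>b. \<forall>x. \<bar>G x\<bar> \<le> b) \<longrightarrow>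
         (\<integral>x. u t x * G x \<partial>gauss) = (\<integral>x. u 0 x * mehler A B G x \<partial>gauss)"
      using mehler_evolutionD[OF ev order.refl t] by (elim exE conjE) (rule that; assumption)
    then have A: "norm (\<eta> v* A) \<le> a (t - 0) * norm \<eta>" for \<eta> by blast
    have dual: "(\<integral>x. u t x * G x \<partial>gauss) = (\<integral>x. u 0 x * mehler A B G x \<partial>gauss)"
      if "continuous_on UNIV G" "\<And>x. \<bar>G x\<bar> \<le> b" for G b
      by (rule dual_all[rule_format, OF that(1)]) (use that(2) in blast)
    have A': "norm (\<eta> v* A) \<le> a t * norm \<eta>" for \<eta> using A[of \<eta>] by simp
    have ui: "integrable gauss (u t)" "integrable gauss (u 0)" using mehler_evolution_integrable[OF ev] t by auto
    have [measurable]: "u 0 \<in> borel_measurable borel" using ui by (auto dest: borel_measurable_integrable)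
    define X where "X = (\<integral>x. \<bar>u 0 x\<bar> powr p \<partial>gauss)"
    define N where "N = X powr (1 / p) * K"
    have N0: "N \<ge> 0" unfolding N_def using K by simp
    have bound: "(\<integral>x. u t x * G x \<partial>gauss) \<le> N * (\<integral>x. \<bar>G x\<bar> powr 2 \<partial>gauss) powr (1 / 2)"
      if b: "\<And>x. \<bar>G x\<bar> \<le> b" and L: "\<And>x y. \<bar>G x - G y\<bar> \<le> L * norm (x - y)" "L \<ge> 0" for G b L
    proof -
      have G: "continuous_on UNIV G"
        by (rule lipschitz_on_continuous_on[where L = L]) (use L in \<open>auto simp: lipschitz_on_def dist_norm\<close>)
      have [measurable]: "G \<in> borel_measurable borel" using G by (rule continuous_on_borel_measurable)
      have mq: "integrable gauss (\<lambda>x. \<bar>mehler A B G x\<bar> powr q)"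
        by (rule integrable_gauss_bounded[where b = "b powr q"]) (use p in \<open>auto intro!: powr_mono2 mehler_bound b\<close>)
      have "(\<integral>x. u t x * G x \<partial>gauss) = (\<integral>x. u 0 x * mehler A B G x \<partial>gauss)" by (rule dual[OF G b])
      also have "\<dots> \<le> X powr (1 / p) * (\<integral>x. \<bar>mehler A B G x\<bar> powr q \<partial>gauss) powr (1 / q)"
        unfolding X_def by (rule order_trans[OF abs_ge_self Holder_inequality(2)[OF p _ _ Lp mq]]) measurable
      also have "\<dots> \<le> X powr (1 / p) * (K * sqrt (\<integral>x. (G x)\<^sup>2 \<partial>gauss))"
        by (intro mult_left_mono hyp[OF AB A' G b]) auto
      also have "\<dots> = N * (\<integral>x. \<bar>G x\<bar> powr 2 \<partial>gauss) powr (1 / 2)"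
        unfolding N_def abs_powr_2 by (simp add: powr_half_sqrt)
      finally show ?thesis .
    qed
    have 2: "(2::real) > 1" "1 / 2 + 1 / 2 = (1::real)" by auto
    have "integrable gauss (\<lambda>x. \<bar>u t x\<bar> powr 2)"
      by (rule Lp_bound_by_duality(1)[OF ui(1) 2(1) 2(1) 2(2) N0]) (rule bound; assumption)
    then show "integrable gauss (\<lambda>x. (u t x)\<^sup>2)" unfolding abs_powr_2 .
    have "(\<integral>x. \<bar>u t x\<bar> powr 2 \<partial>gauss) \<le> N powr 2"
      by (rule Lp_bound_by_duality(2)[OF ui(1) 2(1) 2(1) 2(2) N0]) (rule bound; assumption)
    then have "(\<integral>x. (u t x)\<^sup>2 \<partial>gauss) \<le> N\<^sup>2" using N0 unfolding abs_powr_2 by (simp add: powr_numeral)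
    also have "N\<^sup>2 = K\<^sup>2 * X powr (2 / p)"
    proof -
      have "(X powr (1 / p))\<^sup>2 = X powr (2 / p)" by (simp add: power2_eq_square powr_add[symmetric])
      then show ?thesis unfolding N_def by (simp add: power_mult_distrib)
    qed
    finally show "(\<integral>x. (u t x)\<^sup>2 \<partial>gauss) \<le> K\<^sup>2 * (\<integral>x. \<bar>u 0 x\<bar> powr p \<partial>gauss) powr (2 / p)" unfolding X_def .
  qed
qed

section \<open>Entropy decay\<close>

text \<open>The graph of y^p lies above its tangent at 1; Young's inequality with second factor 1
  expresses this without derivatives.\<close>

lemma psi_nonneg:
  assumes "p > 1" "y \<ge> 0" shows "psi p y \<ge> 0"
proof -
  define q where "q = p / (p - 1)"
  have q: "q > 1" "1 / p + 1 / q = 1" using assms by (auto simp: q_def field_simps)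
  have "y * 1 \<le> y powr p / p + 1 powr q / q" using assms by (intro Youngs_inequality q) auto
  then have "p * y \<le> p * (y powr p / p + 1 / q)" using assms by (intro mult_left_mono) auto
  also have "\<dots> = y powr p + p * (1 / q)" using assms by (simp add: distrib_left)
  also have "1 / q = 1 - 1 / p" using q(2) by linarith
  also have "p * (1 - 1 / p) = p - 1" using assms by (simp add: right_diff_distrib)
  finally have "0 \<le> y powr p - p * (y - 1) - 1" by (simp add: algebra_simps)
  then show ?thesis unfolding psi_def using assms by simp
qed

text \<open>The interpolation y^(p-1) \<le> (p-1) y + (2-p), multiplied by y, gives y^p - p (y-1) -
  1 \<le> (p-1) (y-1)^2. Thus an L^2 estimate controls every entropy with p \<le> 2.\<close>

lemma psi_le_square:
  assumes p: "1 < p" "p \<le> 2" and y: "y \<ge> 0" shows "psi p y \<le> (y - 1)\<^sup>2"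
proof -
  have "y powr p \<le> (p - 1) * y\<^sup>2 + (2 - p) * y"
  proof (cases "y = 0")
    case False
    with y have y0: "y > 0" by simp
    have "y powr (p - 1) * 1 powr (2 - p) \<le> (p - 1) * y + (2 - p) * 1"
      using p y0 by (intro Youngs_inequality_0) auto
    then have "y * y powr (p - 1) \<le> y * ((p - 1) * y + (2 - p))" using y by (intro mult_left_mono) auto
    moreover have "y * y powr (p - 1) = y powr p" using y0 by (simp add: powr_mult_base)
    ultimately show ?thesis by (simp add: power2_eq_square algebra_simps)
  qed (use p in simp)
  then have "y powr p - p * (y - 1) - 1 \<le> (p - 1) * (y - 1)\<^sup>2" by (simp add: power2_eq_square algebra_simps)
  then have "psi p y \<le> (p - 1) * (y - 1)\<^sup>2 / (p * (p - 1))" unfolding psi_def using p by (intro divide_right_mono) auto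
  also have "\<dots> = (y - 1)\<^sup>2 / p" using p by simp
  also have "\<dots> \<le> (y - 1)\<^sup>2 / 1" using p by (intro divide_left_mono) auto
  finally show ?thesis by simp
qed

lemma psi_2: "y \<ge> 0 \<Longrightarrow> psi 2 y = (y - 1)\<^sup>2 / 2"
  by (simp add: psi_def powr_numeral power2_eq_square algebra_simps)

lemma psi_measurable [measurable]: "psi p \<in> borel_measurable borel"
  unfolding psi_def[abs_def] by measurable

context
  fixes u :: "'a::euclidean_space \<Rightarrow> real" and p :: real
  assumes u: "integrable gauss u" and nn: "AE x in gauss. 0 \<le> u x" and mass: "(\<integral>x. u x \<partial>gauss) = 1" and p: "p > 1"
begin

text \<open>Unit mass removes the linear term of \<open>psi\<close>, so the entropy is an affine
  function of the p-th moment. Its nonnegativity forces the moment to be at least 1.\<close>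

lemma entropy_integral_from_Lp:
  assumes Lp: "integrable gauss (\<lambda>x. \<bar>u x\<bar> powr p)"
  shows "(\<integral>\<^sup>+x. ennreal (psi p (u x)) \<partial>gauss) = ennreal (((\<integral>x. \<bar>u x\<bar> powr p \<partial>gauss) - 1) / (p * (p - 1)))"
    and "(\<integral>x. \<bar>u x\<bar> powr p \<partial>gauss) \<ge> 1"
proof -
  have [measurable]: "u \<in> borel_measurable borel" using u by (auto dest: borel_measurable_integrable)
  let ?f = "\<lambda>x. (\<bar>u x\<bar> powr p - p * (u x - 1) - 1) / (p * (p - 1))"
  have eq: "AE x in gauss. psi p (u x) = ?f x" using nn by eventually_elim (simp add: psi_def)
  have fi: "integrable gauss ?f" using Lp u by simp
  have pos: "AE x in gauss. 0 \<le> ?f x" using nn eq by eventually_elim (use psi_nonneg[OF p] in metis)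
  have fint: "(\<integral>x. ?f x \<partial>gauss) = ((\<integral>x. \<bar>u x\<bar> powr p \<partial>gauss) - 1) / (p * (p - 1))"
    using Lp u mass by (simp add: gauss.prob_space[simplified])
  have "(\<integral>\<^sup>+x. ennreal (psi p (u x)) \<partial>gauss) = (\<integral>\<^sup>+x. ennreal (?f x) \<partial>gauss)"
    by (rule nn_integral_cong_AE) (use eq in eventually_elim, simp)
  also have "\<dots> = ennreal (\<integral>x. ?f x \<partial>gauss)" by (rule nn_integral_eq_integral[OF fi pos])
  finally show "(\<integral>\<^sup>+x. ennreal (psi p (u x)) \<partial>gauss) = ennreal (((\<integral>x. \<bar>u x\<bar> powr p \<partial>gauss) - 1) / (p * (p - 1)))"
    unfolding fint .
  have "0 \<le> ((\<integral>x. \<bar>u x\<bar> powr p \<partial>gauss) - 1) / (p * (p - 1))" unfolding fint[symmetric] by (rule integral_nonneg_AE[OF pos])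
  moreover have "0 < p * (p - 1)" using p by simp
  ultimately show "(\<integral>x. \<bar>u x\<bar> powr p \<partial>gauss) \<ge> 1" by (simp add: zero_le_divide_iff)
qed

lemma Lp_from_entropy:
  assumes fin: "(\<integral>\<^sup>+x. ennreal (psi p (u x)) \<partial>gauss) < \<infinity>"
  shows "integrable gauss (\<lambda>x. \<bar>u x\<bar> powr p)"
    and "p * (p - 1) * enn2real (\<integral>\<^sup>+x. ennreal (psi p (u x)) \<partial>gauss) + 1 = (\<integral>x. \<bar>u x\<bar> powr p \<partial>gauss)"
proof -
  have [measurable]: "u \<in> borel_measurable borel" using u by (auto dest: borel_measurable_integrable)
  have "AE x in gauss. 0 \<le> psi p (u x)" using nn by eventually_elim (rule psi_nonneg[OF p])
  then have "integrable gauss (\<lambda>x. psi p (u x))" using fin by (intro integrableI_nonneg) auto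
  then have i: "integrable gauss (\<lambda>x. p * (p - 1) * psi p (u x) + p * (u x - 1) + 1)" using u by simp
  have eq: "AE x in gauss. \<bar>u x\<bar> powr p = p * (p - 1) * psi p (u x) + p * (u x - 1) + 1"
    using nn by eventually_elim (use p in \<open>simp add: psi_def\<close>)
  show Lp: "integrable gauss (\<lambda>x. \<bar>u x\<bar> powr p)"
    by (subst integrable_cong_AE[OF _ _ eq]) (use i in auto)
  show "p * (p - 1) * enn2real (\<integral>\<^sup>+x. ennreal (psi p (u x)) \<partial>gauss) + 1 = (\<integral>x. \<bar>u x\<bar> powr p \<partial>gauss)"
    unfolding entropy_integral_from_Lp(1)[OF Lp] using entropy_integral_from_Lp(2)[OF Lp] p by simp
qed

end

lemma one_plus_power_square_le:
  fixes t :: real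
  shows "(1 + t ^ n)\<^sup>2 \<le> 2 * (1 + t ^ (2 * n))"
proof -
  have "0 \<le> (1 - t ^ n)\<^sup>2" by simp
  then have "(1 + t ^ n)\<^sup>2 \<le> 2 * (1 + (t ^ n)\<^sup>2)" by (simp add: power2_eq_square algebra_simps)
  then show ?thesis by (simp add: power_mult[symmetric] mult.commute)
qed

text \<open>The factor 2 in the constant comes from (1 + t^n)^2 \<le> 2 (1 + t^(2n)). The summand 1
  covers t = 0, a case in which \<open>mehler_evolution\<close> supplies no operator.\<close>

lemma mehler_evolution_entropy_decay_2:
  fixes u :: "real \<Rightarrow> real^'d \<Rightarrow> real"
  assumes K: "K > 0" and ev: "mehler_evolution (\<lambda>t. K * (1 + t ^ n) * exp (- \<mu> * t)) u"
    and u0: "AE x in gauss. 0 \<le> u 0 x" and mass: "(\<integral>x. u 0 x \<partial>gauss) = 1"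
    and fin: "(\<integral>\<^sup>+x. ennreal (psi 2 (u 0 x)) \<partial>gauss) < \<infinity>" and t: "t \<ge> 0"
  shows "(\<integral>\<^sup>+x. ennreal (psi 2 (u t x)) \<partial>gauss) \<le> ennreal ((2 * K\<^sup>2 + 1) *
     enn2real (\<integral>\<^sup>+x. ennreal (psi 2 (u 0 x)) \<partial>gauss) * (1 + t ^ (2 * n)) * exp (- 2 * \<mu> * t))"
proof -
  define e where "e = enn2real (\<integral>\<^sup>+x. ennreal (psi 2 (u 0 x)) \<partial>gauss)"
  have e0: "e \<ge> 0" unfolding e_def by simp
  have ee: "(\<integral>\<^sup>+x. ennreal (psi 2 (u 0 x)) \<partial>gauss) = ennreal e" unfolding e_def using fin by simp
  show ?thesis
  proof (cases "t = 0")
    case True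
    have "e \<le> (2 * K\<^sup>2 + 1) * e * (1 + 0 ^ (2 * n))"
    proof -
      have "1 * e * 1 \<le> (2 * K\<^sup>2 + 1) * e * (1 + 0 ^ (2 * n))" using e0 by (intro mult_mono) auto
      then show ?thesis by simp
    qed
    then show ?thesis unfolding True e_def[symmetric] ee using e0 by (simp add: ennreal_leI)
  next
    case False
    with t have tp: "0 < t" by simp
    have ui: "integrable gauss (u 0)" "integrable gauss (u t)" using mehler_evolution_integrable[OF ev] t by auto
    have sq: "\<bar>y\<bar> powr 2 = y\<^sup>2" for y :: real by (rule abs_powr_2)
    have X: "integrable gauss (\<lambda>x. (u 0 x)\<^sup>2)" "2 * e + 1 = (\<integral>x. (u 0 x)\<^sup>2 \<partial>gauss)"
      using Lp_from_entropy[OF ui(1) u0 mass _ fin] unfolding sq e_def by simp_all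
    have expand: "(u 0 x - 1)\<^sup>2 = (u 0 x)\<^sup>2 - 2 * u 0 x + 1" for x by (simp add: power2_eq_square algebra_simps)
    have L2: "integrable gauss (\<lambda>x. (u 0 x - 1)\<^sup>2)" unfolding expand using X(1) ui(1) by simp
    have i2: "(\<integral>x. (u 0 x - 1)\<^sup>2 \<partial>gauss) = 2 * e"
      unfolding expand using X ui(1) mass by (simp add: gauss.prob_space[simplified])
    let ?a = "\<lambda>t. K * (1 + t ^ n) * exp (- \<mu> * t)"
    have "0 < 1 + t ^ n" using tp by (simp add: add_pos_nonneg)
    then have ap: "?a (t - 0) > 0" using K by simp
    note dec = mehler_evolution_L2_decay[OF ev order.refl tp ap mass L2]
    have nn: "AE x in gauss. 0 \<le> u t x" by (rule mehler_evolution_nonneg[OF ev t u0])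
    have "(\<integral>\<^sup>+x. ennreal (psi 2 (u t x)) \<partial>gauss) = (\<integral>\<^sup>+x. ennreal ((u t x - 1)\<^sup>2 / 2) \<partial>gauss)"
      by (rule nn_integral_cong_AE) (use nn in eventually_elim, simp add: psi_2)
    also have "\<dots> = ennreal (\<integral>x. (u t x - 1)\<^sup>2 / 2 \<partial>gauss)" using dec(1) by (intro nn_integral_eq_integral) auto
    also have "\<dots> \<le> ennreal ((2 * K\<^sup>2 + 1) * e * (1 + t ^ (2 * n)) * exp (- 2 * \<mu> * t))"
    proof (rule ennreal_leI)
      have "(\<integral>x. (u t x - 1)\<^sup>2 / 2 \<partial>gauss) \<le> (?a (t - 0))\<^sup>2 * (2 * e) / 2"
        using dec(2) unfolding i2 by simp
      also have "\<dots> = K\<^sup>2 * (1 + t ^ n)\<^sup>2 * exp (- 2 * \<mu> * t) * e"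
        by (simp add: power_mult_distrib exp_double[symmetric] mult_ac)
      also have "\<dots> \<le> K\<^sup>2 * (2 * (1 + t ^ (2 * n))) * exp (- 2 * \<mu> * t) * e"
        using e0 by (intro mult_right_mono mult_left_mono one_plus_power_square_le) auto
      also have "\<dots> \<le> (2 * K\<^sup>2 + 1) * e * (1 + t ^ (2 * n)) * exp (- 2 * \<mu> * t)"
      proof -
        have "0 \<le> e * (1 + t ^ (2 * n)) * exp (- 2 * \<mu> * t)" using e0 by simp
        then show ?thesis by (simp add: algebra_simps)
      qed
      finally show "(\<integral>x. (u t x - 1)\<^sup>2 / 2 \<partial>gauss) \<le> (2 * K\<^sup>2 + 1) * e * (1 + t ^ (2 * n)) * exp (- 2 * \<mu> * t)" .
    qed
    finally show ?thesis unfolding e_def .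
  qed
qed

text \<open>For t > t0 the solution is smoothed into L^2 during [0, t0] and decays afterwards, at
  the price of e^(2\<mu> t0) for the lost time. For t \<le> t0 the p-th moment does not increase,
  and the decay factor is bounded below.\<close>

lemma mehler_evolution_entropy_decay_p:
  assumes K: "K > 0" and \<mu>: "\<mu> > 0" and p: "1 < p" "p \<le> 2"
  shows "\<exists>c>0. \<forall>(u :: real \<Rightarrow> real^'d \<Rightarrow> real) t. mehler_evolution (\<lambda>t. K * (1 + t ^ n) * exp (- \<mu> * t)) u \<longrightarrow>
    (AE x in gauss. 0 \<le> u 0 x) \<longrightarrow> (\<integral>x. u 0 x \<partial>gauss) = 1 \<longrightarrow>
    (\<integral>\<^sup>+x. ennreal (psi p (u 0 x)) \<partial>gauss) < \<infinity> \<longrightarrow> t \<ge> 0 \<longrightarrow>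
    (\<integral>\<^sup>+x. ennreal (psi p (u t x)) \<partial>gauss) \<le> ennreal (c *
      (p * (p - 1) * enn2real (\<integral>\<^sup>+x. ennreal (psi p (u 0 x)) \<partial>gauss) + 1) powr (2 / p) * (1 + t ^ (2 * n)) * exp (- 2 * \<mu> * t))"
proof -
  define q where "q = p / (p - 1)"
  have q: "q > 1" "1 / p + 1 / q = 1" using p by (auto simp: q_def field_simps)
  let ?a = "\<lambda>t. K * (1 + t ^ n) * exp (- \<mu> * t)"
  have a_pos: "?a t > 0" if "t \<ge> 0" for t
  proof -
    have "0 < 1 + t ^ n" using that by (simp add: add_pos_nonneg)
    then show ?thesis using K by simp
  qed
  have "((\<lambda>t. (?a t)\<^sup>2) \<longlongrightarrow> (K * 0)\<^sup>2) at_top"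
    unfolding mult.assoc by (intro tendsto_intros poly_mult_exp_tendsto_0[OF \<mu>])
  then have "((\<lambda>t. (?a t)\<^sup>2) \<longlongrightarrow> 0) at_top" by simp
  moreover have "0 < 1 / (2 * q + 1)" using q by simp
  ultimately have "\<forall>\<^sub>F t in at_top. (?a t)\<^sup>2 < 1 / (2 * q + 1)" by (rule order_tendstoD(2))
  then have "\<forall>\<^sub>F t in at_top. (?a t)\<^sup>2 < 1 / (2 * q + 1) \<and> 1 \<le> t"
    by (rule eventually_conj[OF _ eventually_ge_at_top])
  \<comment> \<open>For x the square of the contraction bound at t0, x < 1/(2q + 1) amounts to q
    x/(1 - x) < 1/2, the threshold of the smoothing estimate.\<close>
  then obtain t0 where t0: "(?a t0)\<^sup>2 < 1 / (2 * q + 1)" "1 \<le> t0"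
    using eventually_happens trivial_limit_at_top_linorder by blast
  have t0p: "0 < t0" using t0 by simp
  define x where "x = (?a t0)\<^sup>2"
  have x: "0 \<le> x" "x * (2 * q + 1) < 1" using t0(1) q unfolding x_def by (auto simp: pos_less_divide_eq)
  have "x < 1"
  proof -
    have "x * 1 \<le> x * (2 * q + 1)" using x(1) q by (intro mult_left_mono) auto
    then show ?thesis using x(2) by simp
  qed
  have a1: "?a t0 < 1"
  proof -
    have "\<bar>?a t0\<bar> < 1" using \<open>x < 1\<close> unfolding x_def abs_square_less_1 .
    then show ?thesis by simp
  qed
  have small: "q * (x / (1 - x)) < 1 / 2"
  proof -
    have "2 * (q * x) < 1 - x" using x(2) by (simp add: algebra_simps)
    then show ?thesis using \<open>x < 1\<close> by (simp add: field_simps)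
  qed
  have a0: "0 \<le> ?a t0" using a_pos[of t0] t0p by simp
  obtain Kh where Kh: "Kh > 0" and hyp_all: "\<forall>u :: real \<Rightarrow> real^'d \<Rightarrow> real. mehler_evolution ?a u \<longrightarrow> integrable gauss (\<lambda>x. \<bar>u 0 x\<bar> powr p) \<longrightarrow>
     integrable gauss (\<lambda>x. (u t0 x)\<^sup>2) \<and> (\<integral>x. (u t0 x)\<^sup>2 \<partial>gauss) \<le> Kh * (\<integral>x. \<bar>u 0 x\<bar> powr p \<partial>gauss) powr (2 / p)"
    using mehler_evolution_hypercontractive[where a = ?a and t = t0 and 'd = 'd, OF a0 a1 t0p p(1) q small[unfolded x_def]]
    by (elim exE conjE) (rule that; assumption)
  note hyp = hyp_all[rule_format]
  \<comment> \<open>The first summand serves the times after t0, the second those up to t0.\<close>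
  define c where "c = (2 * K\<^sup>2 * Kh + 1 / (p * (p - 1))) * exp (2 * \<mu> * t0)"
  have pp: "0 < p * (p - 1)" using p by simp
  have c: "c > 0" unfolding c_def using K Kh pp by (intro mult_pos_pos add_pos_pos) auto
  show ?thesis
  proof (intro exI[of _ c] conjI c allI impI)
    fix u :: "real \<Rightarrow> real^'d \<Rightarrow> real" and t :: real
    assume ev: "mehler_evolution ?a u" and u0: "AE x in gauss. 0 \<le> u 0 x" and mass: "(\<integral>x. u 0 x \<partial>gauss) = 1"
      and fin: "(\<integral>\<^sup>+x. ennreal (psi p (u 0 x)) \<partial>gauss) < \<infinity>" and t: "t \<ge> 0"
    have ui: "integrable gauss (u t)" if "t \<ge> 0" for t using mehler_evolution_integrable[OF ev that] .
    have nn: "AE x in gauss. 0 \<le> u t x" if "t \<ge> 0" for t by (rule mehler_evolution_nonneg[OF ev that u0])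
    have ms: "(\<integral>x. u t x \<partial>gauss) = 1" if "t \<ge> 0" for t using mehler_evolution_mass[OF ev that] mass by simp
    define X where "X = (\<integral>x. \<bar>u 0 x\<bar> powr p \<partial>gauss)"
    note Lp0 = Lp_from_entropy[OF ui[OF order.refl] u0 mass p(1) fin]
    have X1: "X \<ge> 1" unfolding X_def by (rule entropy_integral_from_Lp(2)[OF ui[OF order.refl] u0 mass p(1) Lp0(1)])
    \<comment> \<open>The moment X is at least 1 and 2/p \<ge> 1, so the early times fit under the
      power that smoothing produces.\<close>
    have XX: "X \<le> X powr (2 / p)"
    proof -
      have "X powr 1 \<le> X powr (2 / p)" using X1 p by (intro powr_mono) auto
      then show ?thesis using X1 by simp
    qed
    have Xp: "0 \<le> X powr (2 / p)" by simp
    let ?r = "(1 + t ^ (2 * n)) * exp (- 2 * \<mu> * t)"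
    have r1: "exp (- 2 * \<mu> * t) \<le> ?r" using t by simp
    have r0: "0 \<le> ?r" using t by simp
    have "(\<integral>\<^sup>+x. ennreal (psi p (u t x)) \<partial>gauss) \<le> ennreal (c * X powr (2 / p) * ?r)"
    proof (cases "t \<le> t0")
      case True
      have Lpt: "integrable gauss (\<lambda>x. \<bar>u t x\<bar> powr p) \<and> (\<integral>x. \<bar>u t x\<bar> powr p \<partial>gauss) \<le> X"
      proof (cases "t = 0")
        case True
        then show ?thesis using Lp0(1) unfolding X_def by simp
      next
        case False
        with t have "0 < t" by simp
        from mehler_evolution_Lp[OF ev this p(1) q Lp0(1)] show ?thesis unfolding X_def by blast
      qed
      have "(\<integral>\<^sup>+x. ennreal (psi p (u t x)) \<partial>gauss) = ennreal (((\<integral>x. \<bar>u t x\<bar> powr p \<partial>gauss) - 1) / (p * (p - 1)))"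
        using entropy_integral_from_Lp(1)[OF ui[OF t] nn[OF t] ms[OF t] p(1)] Lpt by blast
      also have "\<dots> \<le> ennreal (c * X powr (2 / p) * ?r)"
      proof (rule ennreal_leI)
        have "((\<integral>x. \<bar>u t x\<bar> powr p \<partial>gauss) - 1) / (p * (p - 1)) \<le> X powr (2 / p) / (p * (p - 1))"
          using Lpt XX pp by (intro divide_right_mono) auto
        also have "\<dots> = 1 / (p * (p - 1)) * X powr (2 / p) * 1" by simp
        also have "\<dots> \<le> 1 / (p * (p - 1)) * X powr (2 / p) * (exp (2 * \<mu> * t0) * ?r)"
        proof (rule mult_left_mono)
          have "1 \<le> exp (2 * \<mu> * t0) * exp (- 2 * \<mu> * t)"
            using True \<mu> by (simp add: exp_add[symmetric] right_diff_distrib[symmetric])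
          also have "\<dots> \<le> exp (2 * \<mu> * t0) * ?r" using r1 by (intro mult_left_mono) auto
          finally show "1 \<le> exp (2 * \<mu> * t0) * ?r" .
        qed (use pp in simp)
        also have "\<dots> = (1 / (p * (p - 1)) * exp (2 * \<mu> * t0)) * X powr (2 / p) * ?r" by (simp only: mult_ac)
        also have "\<dots> \<le> c * X powr (2 / p) * ?r"
          unfolding c_def using Kh r0 by (intro mult_right_mono) auto
        finally show "((\<integral>x. \<bar>u t x\<bar> powr p \<partial>gauss) - 1) / (p * (p - 1)) \<le> c * X powr (2 / p) * ?r" .
      qed
      finally show ?thesis .
    next
      case False
      then have tt: "t0 < t" by simp
      have t00: "0 \<le> t0" using t0p by simp
      have u2: "integrable gauss (\<lambda>x. (u t0 x)\<^sup>2)" "(\<integral>x. (u t0 x)\<^sup>2 \<partial>gauss) \<le> Kh * X powr (2 / p)"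
        using hyp[OF ev Lp0(1)] unfolding X_def by auto
      have expand: "(u t0 x - 1)\<^sup>2 = (u t0 x)\<^sup>2 - 2 * u t0 x + 1" for x by (simp add: power2_eq_square algebra_simps)
      have L2: "integrable gauss (\<lambda>x. (u t0 x - 1)\<^sup>2)" unfolding expand using u2(1) ui[OF t00] by simp
      have "(\<integral>x. (u t0 x - 1)\<^sup>2 \<partial>gauss) = (\<integral>x. (u t0 x)\<^sup>2 \<partial>gauss) - 1"
        unfolding expand using u2(1) ui[OF t00] ms[OF t00] by (simp add: gauss.prob_space[simplified])
      then have i2: "(\<integral>x. (u t0 x - 1)\<^sup>2 \<partial>gauss) \<le> Kh * X powr (2 / p)" using u2(2) by simp
      have ap: "?a (t - t0) > 0" by (rule a_pos) (use tt in simp)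
      note dec = mehler_evolution_L2_decay[OF ev t00 tt ap mass L2]
      have "(\<integral>\<^sup>+x. ennreal (psi p (u t x)) \<partial>gauss) \<le> (\<integral>\<^sup>+x. ennreal ((u t x - 1)\<^sup>2) \<partial>gauss)"
        by (rule nn_integral_mono_AE) (use nn[OF t] in eventually_elim, intro ennreal_leI psi_le_square p)
      also have "\<dots> = ennreal (\<integral>x. (u t x - 1)\<^sup>2 \<partial>gauss)" using dec(1) by (intro nn_integral_eq_integral) auto
      also have "\<dots> \<le> ennreal (c * X powr (2 / p) * ?r)"
      proof (rule ennreal_leI)
        have "(\<integral>x. (u t x - 1)\<^sup>2 \<partial>gauss) \<le> (?a (t - t0))\<^sup>2 * (Kh * X powr (2 / p))"
          by (rule order_trans[OF dec(2) mult_left_mono[OF i2]]) simp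
        also have "(?a (t - t0))\<^sup>2 = K\<^sup>2 * (1 + (t - t0) ^ n)\<^sup>2 * exp (2 * \<mu> * t0) * exp (- 2 * \<mu> * t)"
        proof -
          have "exp (- \<mu> * (t - t0)) ^ 2 = exp (2 * \<mu> * t0) * exp (- 2 * \<mu> * t)"
            by (simp add: exp_double[symmetric] exp_add[symmetric] algebra_simps)
          then show ?thesis by (simp add: power_mult_distrib)
        qed
        also have "\<dots> \<le> K\<^sup>2 * (2 * (1 + t ^ (2 * n))) * exp (2 * \<mu> * t0) * exp (- 2 * \<mu> * t)"
        proof -
          have "(t - t0) ^ n \<le> t ^ n" using tt t0p by (intro power_mono) auto
          then have "(1 + (t - t0) ^ n)\<^sup>2 \<le> (1 + t ^ n)\<^sup>2" using tt by (intro power_mono) auto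
          also have "\<dots> \<le> 2 * (1 + t ^ (2 * n))" by (rule one_plus_power_square_le)
          finally show ?thesis by (intro mult_right_mono mult_left_mono) auto
        qed
        finally have "(\<integral>x. (u t x - 1)\<^sup>2 \<partial>gauss) \<le> K\<^sup>2 * (2 * (1 + t ^ (2 * n))) * exp (2 * \<mu> * t0) * exp (- 2 * \<mu> * t) * (Kh * X powr (2 / p))"
          using Kh by (simp add: mult_right_mono)
        also have "\<dots> = (2 * K\<^sup>2 * Kh * exp (2 * \<mu> * t0)) * X powr (2 / p) * ?r" by (simp only: mult_ac)
        also have "\<dots> \<le> c * X powr (2 / p) * ?r"
          unfolding c_def using pp r0 by (intro mult_right_mono) auto
        finally show "(\<integral>x. (u t x - 1)\<^sup>2 \<partial>gauss) \<le> c * X powr (2 / p) * ?r" .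
      qed
      finally show ?thesis .
    qed
    then show "(\<integral>\<^sup>+x. ennreal (psi p (u t x)) \<partial>gauss) \<le> ennreal (c *
      (p * (p - 1) * enn2real (\<integral>\<^sup>+x. ennreal (psi p (u 0 x)) \<partial>gauss) + 1) powr (2 / p) * (1 + t ^ (2 * n)) * exp (- 2 * \<mu> * t))"
      unfolding Lp0(2) X_def[symmetric] by (simp only: mult.assoc)
  qed
qed

text \<open>The flow bound, S and T are obtained from D and C before any datum is introduced, and
  the constants are built from them, from \<mu>, n and p. The equilibrium enters only through its
  identification as the image of the Gaussian under S.\<close>

theorem theorem1p4:
  fixes D C :: "real^'d^'d" and finf :: "real^'d \<Rightarrow> real" and \<mu> :: real and n :: nat
  assumes "condition_A D" and "condition_B C" and "condition_C D C"
    and "\<mu> = Min {Re l | l. l \<in> eigenvalues C}"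
    and "\<exists>l\<in>eigenvalues C. Re l = \<mu> \<and> defective C l"
    and "n = Max {defect C l | l. l \<in> eigenvalues C \<and> Re l = \<mu>}"
    and "fp_equilibrium D C finf" and "mass finf = 1"
  shows "\<forall>p. 1 < p \<and> p \<le> 2 \<longrightarrow>
    (\<exists>c>0. \<forall>f0 f.
      f0 \<in> L1_plus \<and> mass f0 = 1 \<and> rel_entropy p f0 finf < \<infinity> \<and> fp_solution D C f0 f \<longrightarrow>
      (\<forall>t\<ge>0. rel_entropy p (f t) finf \<le> ennreal
        (if p = 2
         then c * enn2real (rel_entropy 2 f0 finf) * (1 + t ^ (2 * n)) * exp (- 2 * \<mu> * t)
         else c * (p * (p - 1) * enn2real (rel_entropy p f0 finf) + 1) powr (2 / p)
                * (1 + t ^ (2 * n)) * exp (- 2 * \<mu> * t))))"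
proof -
  \<comment> \<open>The defective eigenvalue shows that \<mu> is the real part of an actual
    eigenvalue, to which Condition (B) applies.\<close>
  have \<mu>: "\<mu> > 0"
    using assms(2,5) unfolding condition_B_def by auto
  note decay = has_decaying_orbit_complexify[OF assms(4,6)]
  show ?thesis
  proof (rule lyapunov_solution[OF decay \<mu> assms(1,3)])
    fix E :: "real \<Rightarrow> real^'d^'d" and P S T :: "real^'d^'d" and K :: real
    assume E0: "E 0 = mat 1"
      and dE: "\<And>t x. t \<ge> 0 \<Longrightarrow> ((\<lambda>t. x v* E t) has_vector_derivative - ((x v* E t) v* C)) (at t)"
      and K: "K > 0" and bd: "\<And>t x. t \<ge> 0 \<Longrightarrow> norm (x v* E t) \<le> K * (1 + t ^ n) * exp (- \<mu> * t) * norm x"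
      and lyap: "C ** P + P ** transpose C = 2 *\<^sub>R D"
      and PS: "P = S ** transpose S" and ST: "S ** T = mat 1" and TS: "T ** S = mat 1"
      and mono: "\<And>t x. t \<ge> 0 \<Longrightarrow> (x v* E t) \<bullet> (P *v (x v* E t)) \<le> x \<bullet> (P *v x)"
    have lim: "((\<lambda>t. x v* E t) \<longlongrightarrow> 0) at_top" for x by (rule flow_tendsto_0[OF \<mu> bd])
    have eq: "integrable lborel finf" "AE x in lborel. finf x > 0"
      "density lborel (\<lambda>x. ennreal (finf x)) = distr gauss borel ((*v) S)"
      by (rule equilibrium_gaussian[OF assms(7,8) E0 dE lim lyap mono PS ST TS]; assumption)+
    obtain MS where MS: "MS > 0" "\<And>x. norm (x v* S) \<le> norm x * MS"
      using bounded_linear.pos_bounded[OF matrix_vector_mul_bounded_linear[of "transpose S"]] by auto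
    obtain MT where MT: "MT > 0" "\<And>x. norm (x v* T) \<le> norm x * MT"
      using bounded_linear.pos_bounded[OF matrix_vector_mul_bounded_linear[of "transpose T"]] by auto
    \<comment> \<open>Conjugating the flow by S costs the norm bounds of S and T and leaves the rate
      unchanged.\<close>
    define L where "L = K * MT * MS"
    have L: "L > 0" unfolding L_def using K MT MS by simp
    have a: "norm (\<eta> v* (T ** E \<tau> ** S)) \<le> (L * (1 + \<tau> ^ n) * exp (- \<mu> * \<tau>)) * norm \<eta>" if "\<tau> \<ge> 0" for \<tau> \<eta>
    proof -
      have r: "0 \<le> K * (1 + \<tau> ^ n) * exp (- \<mu> * \<tau>)" using K that by simp
      have "norm (\<eta> v* (T ** E \<tau> ** S)) = norm (((\<eta> v* T) v* E \<tau>) v* S)" by (simp add: vector_matrix_mul_assoc)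
      also have "\<dots> \<le> norm ((\<eta> v* T) v* E \<tau>) * MS" by (rule MS)
      also have "\<dots> \<le> (K * (1 + \<tau> ^ n) * exp (- \<mu> * \<tau>) * norm (\<eta> v* T)) * MS" using bd[OF that] MS(1) by (intro mult_right_mono) auto
      also have "\<dots> \<le> (K * (1 + \<tau> ^ n) * exp (- \<mu> * \<tau>) * (norm \<eta> * MT)) * MS"
        using MT(2) MS(1) r by (intro mult_right_mono mult_left_mono) auto
      finally show ?thesis unfolding L_def by (simp only: mult_ac)
    qed
    \<comment> \<open>Replaces the solution by its density relative to the equilibrium in Gaussian
      variables. \<open>f 0\<close> and \<open>f0\<close> agree only almost everywhere, a difference
      that mass, sign and entropy do not see.\<close>
    have red: "\<exists>u :: real \<Rightarrow> real^'d \<Rightarrow> real. mehler_evolution (\<lambda>t. L * (1 + t ^ n) * exp (- \<mu> * t)) u \<and> (AE x in gauss. 0 \<le> u 0 x) \<and> (\<integral>x. u 0 x \<partial>gauss) = 1 \<and>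
        (\<forall>t\<ge>0. rel_entropy p (f t) finf = (\<integral>\<^sup>+x. ennreal (psi p (u t x)) \<partial>gauss)) \<and>
        rel_entropy p f0 finf = (\<integral>\<^sup>+x. ennreal (psi p (u 0 x)) \<partial>gauss)"
      if f0: "f0 \<in> L1_plus" "mass f0 = 1" and sol: "fp_solution D C f0 f" for f0 f p
    proof -
      define u where "u t z = f t (S *v z) / finf (S *v z)" for t z
      have int: "integrable lborel (f t)" if "t \<ge> 0" for t using sol that unfolding fp_solution_def by blast
      have init: "AE x in lborel. f 0 x = f0 x" using sol unfolding fp_solution_def by blast
      have f0m: "f0 \<in> borel_measurable borel" using f0(1) unfolding L1_plus_def by (auto dest: borel_measurable_integrable)
      have f0nn: "AE x in lborel. 0 \<le> f0 x" using f0(1) unfolding L1_plus_def by blast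
      have ev: "mehler_evolution (\<lambda>t. L * (1 + t ^ n) * exp (- \<mu> * t)) u"
        unfolding u_def[abs_def] by (rule fp_mehler_evolution[OF sol E0 dE lyap mono PS ST TS eq a])
      have "AE x in lborel. 0 \<le> f 0 x / finf x" using init f0nn eq(2) by eventually_elim simp
      from AE_lborel_linear[OF TS this] have nn: "AE x in gauss. 0 \<le> u 0 x" unfolding AE_gauss_iff u_def .
      have "(\<integral>x. u 0 x \<partial>gauss) = (\<integral>x. f 0 x \<partial>lborel)"
        using transport_to_gauss(2)[OF eq TS int[OF order.refl], of "\<lambda>_. 1"] unfolding u_def by simp
      also have "\<dots> = (\<integral>x. f0 x \<partial>lborel)" by (rule integral_cong_AE) (use int[OF order.refl] f0m init in auto)
      finally have ms: "(\<integral>x. u 0 x \<partial>gauss) = 1" using f0(2) unfolding mass_def by simp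
      have ent: "rel_entropy p (f t) finf = (\<integral>\<^sup>+x. ennreal (psi p (u t x)) \<partial>gauss)" if "t \<ge> 0" for t
        unfolding u_def by (rule transport_to_gauss(3)[OF eq TS int[OF that]])
      have "rel_entropy p f0 finf = rel_entropy p (f 0) finf"
        unfolding rel_entropy_def by (rule nn_integral_cong_AE) (use init in eventually_elim, simp)
      then have e0: "rel_entropy p f0 finf = (\<integral>\<^sup>+x. ennreal (psi p (u 0 x)) \<partial>gauss)"
        unfolding ent[OF order.refl] .
      show ?thesis by (intro exI[of _ u] conjI allI impI ev nn ms ent e0)
    qed
    show ?thesis
    proof (intro allI impI, elim conjE)
      fix p :: real assume p: "1 < p" "p \<le> 2"
      show "\<exists>c>0. \<forall>f0 f.
        f0 \<in> L1_plus \<and> mass f0 = 1 \<and> rel_entropy p f0 finf < \<infinity> \<and> fp_solution D C f0 f \<longrightarrow>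
        (\<forall>t\<ge>0. rel_entropy p (f t) finf \<le> ennreal
          (if p = 2
           then c * enn2real (rel_entropy 2 f0 finf) * (1 + t ^ (2 * n)) * exp (- 2 * \<mu> * t)
           else c * (p * (p - 1) * enn2real (rel_entropy p f0 finf) + 1) powr (2 / p)
                  * (1 + t ^ (2 * n)) * exp (- 2 * \<mu> * t)))"
      proof (cases "p = 2")
        case True
        show ?thesis unfolding True
        proof (intro exI[of _ "2 * L\<^sup>2 + 1"] conjI allI impI, goal_cases)
          case 1
          have "0 \<le> 2 * L\<^sup>2" by simp
          then show ?case by linarith
        next
          case (2 f0 f t)
          then have A: "f0 \<in> L1_plus" "mass f0 = 1" "fp_solution D C f0 f" and fin: "rel_entropy 2 f0 finf < \<infinity>" and t: "t \<ge> 0"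
            by auto
          from red[OF A, of 2] obtain u :: "real \<Rightarrow> real^'d \<Rightarrow> real" where u: "mehler_evolution (\<lambda>t. L * (1 + t ^ n) * exp (- \<mu> * t)) u" "AE x in gauss. 0 \<le> u 0 x" "(\<integral>x. u 0 x \<partial>gauss) = 1"
            and e: "\<forall>t\<ge>0. rel_entropy 2 (f t) finf = (\<integral>\<^sup>+x. ennreal (psi 2 (u t x)) \<partial>gauss)"
            and e0: "rel_entropy 2 f0 finf = (\<integral>\<^sup>+x. ennreal (psi 2 (u 0 x)) \<partial>gauss)"
            by (elim exE conjE) (rule that; assumption)
          show ?case unfolding e[rule_format, OF t] e0 if_P[OF refl]
            by (rule mehler_evolution_entropy_decay_2[OF L u fin[unfolded e0] t])
        qed
      next
        case False
        obtain c where c: "c > 0" and dec: "\<forall>(u :: real \<Rightarrow> real^'d \<Rightarrow> real) t. mehler_evolution (\<lambda>t. L * (1 + t ^ n) * exp (- \<mu> * t)) u \<longrightarrow>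
          (AE x in gauss. 0 \<le> u 0 x) \<longrightarrow> (\<integral>x. u 0 x \<partial>gauss) = 1 \<longrightarrow>
          (\<integral>\<^sup>+x. ennreal (psi p (u 0 x)) \<partial>gauss) < \<infinity> \<longrightarrow> t \<ge> 0 \<longrightarrow>
          (\<integral>\<^sup>+x. ennreal (psi p (u t x)) \<partial>gauss) \<le> ennreal (c *
            (p * (p - 1) * enn2real (\<integral>\<^sup>+x. ennreal (psi p (u 0 x)) \<partial>gauss) + 1) powr (2 / p) * (1 + t ^ (2 * n)) * exp (- 2 * \<mu> * t))"
          using mehler_evolution_entropy_decay_p[OF L \<mu> p, of n] by (elim exE conjE) (rule that; assumption)
        show ?thesis unfolding if_not_P[OF False]
        proof (intro exI[of _ c] conjI c allI impI, goal_cases)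
          case (1 f0 f t)
          then have A: "f0 \<in> L1_plus" "mass f0 = 1" "fp_solution D C f0 f" and fin: "rel_entropy p f0 finf < \<infinity>" and t: "t \<ge> 0"
            by auto
          from red[OF A, of p] obtain u :: "real \<Rightarrow> real^'d \<Rightarrow> real" where u: "mehler_evolution (\<lambda>t. L * (1 + t ^ n) * exp (- \<mu> * t)) u" "AE x in gauss. 0 \<le> u 0 x" "(\<integral>x. u 0 x \<partial>gauss) = 1"
            and e: "\<forall>t\<ge>0. rel_entropy p (f t) finf = (\<integral>\<^sup>+x. ennreal (psi p (u t x)) \<partial>gauss)"
            and e0: "rel_entropy p f0 finf = (\<integral>\<^sup>+x. ennreal (psi p (u 0 x)) \<partial>gauss)"
            by (elim exE conjE) (rule that; assumption)
          show ?case unfolding e[rule_format, OF t] e0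
            by (rule dec[rule_format, OF u fin[unfolded e0] t])
        qed
      qed
    qed
  qed
qed

end
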